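(* Let $\Omega\subset\mathbb{R}^d$ be convex and compact with non-empty interior, and let $\mathcal{H}$ be equal to the (fractional) Sobolev space $H^m=H^m(\Omega)$ with equivalent norms. Let $\alpha\in\mathbb{N}^d$ be a multi-index and suppose $m>d/2+|\alpha|$. Suppose the design satisfies the norm-comparison property and $n^{-2m/d}\lesssim\lambda\le1$. In addition, suppose the random error follows a normal distribution, $e_1\sim N(0,\sigma^2)$ with $\sigma^2>0$. Then there are constants $B_1>0$, $B_2>1$ independent of $\sigma^2$, $\lambda$ and $n$ such that, for all sufficiently large $n$, $$\mathbb{P}\left(\sup_{x\in\Omega}\big|D^\alpha\hat f(x)-\mathbb{E}_ED^\alpha\hat f(x)\big|\ge B_1\,\sigma\,n^{-\frac12}\lambda^{-\frac{d+2|\alpha|}{4m}}\sqrt{\log\Big(\frac{B_2}{\lambda}\Big)}\right)\ge\frac12 .$$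
   Context: Setting: $K$ is a reproducing kernel on $\Omega\subset\mathbb{R}^d$ with reproducing kernel Hilbert space $\mathcal{H}$ (norm $\|\cdot\|_{\mathcal H}$). For each $n$ there are design points $x_1,\dots,x_n\in\Omega$ (deterministic or random, may depend on $n$) and data $y_i=f(x_i)+e_i$, with $f\in\mathcal{H}$ and $e_1,e_2,\dots$ i.i.d. with mean zero and finite variance $\sigma^2$; the errors are independent of the design. Write $X=(x_1,\dots,x_n)^T$, $E=(e_1,\dots,e_n)^T$. The smoothing parameter $\lambda=\lambda_n>0$ is deterministic and may depend on $n$. The theory is asymptotic as $n\to\infty$. The kernel ridge regression (KRR) estimator is $\hat f=\operatorname{argmin}_{v\in\mathcal{H}}\frac1n\sum_{i=1}^n(y_i-v(x_i))^2+\lambda\|v\|_{\mathcal{H}}^2$. $D^\alpha$ is the partial derivative with multi-index $\alpha$, of total order $|\alpha|$. $\mathbb{E}_E$ is expectation with respect to $E$ only ($X$ held fixed). Also $\|v\|_n^2=\frac1n\sum_{i=1}^n v(x_i)^2$, and $\|\cdot\|_{L_2}$ is the $L_2(\Omega)$ norm. $a_n\lesssim b_n$ means $a_n/b_n$ is bounded (in probability). Norm-comparison property of the design: $X$, if random, is independent of $E$; and there is $C_1>0$, and for each $\epsilon>0$ a $C_\epsilon>0$, all independent of $n$ and $X$, such that $\mathbb{P}(\Xi_\epsilon)\ge1-\epsilon$, where $\Xi_\epsilon$ is the event that, for all $v\in\mathcal H$, $\|v\|_{L_2}\le\max\{C_1\|v\|_n,C_\epsilon n^{-m/d}\|v\|_{\mathcal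 H}\}$ and $\|v\|_n\le\max\{C_1\|v\|_{L_2},C_\epsilon n^{-m/d}\|v\|_{\mathcal H}\}$ (for deterministic $X$ these inequalities hold unconditionally). *)

theory Defs
  imports "HOL-Probability.Probability"
begin

section \<open>Partial derivatives and multi-indices\<close>

definition partial :: "'d \<Rightarrow> (real^'d \<Rightarrow> real) \<Rightarrow> real^'d \<Rightarrow> real" where
  "partial i f x = deriv (\<lambda>t. f (x + t *\<^sub>R axis i 1)) 0"

definition partials :: "'d list \<Rightarrow> (real^'d \<Rightarrow> real) \<Rightarrow> real^'d \<Rightarrow> real" where
  "partials is f = foldr partial is f"

definition mi_order :: "nat^'d \<Rightarrow> nat" where
  "mi_order \<alpha> = (\<Sum>i\<in>UNIV. \<alpha> $ i)"

text \<open>The classical derivative \<open>D\<^sup>\<alpha> f\<close>: differentiate \<open>\<alpha> $ i\<close> times in each coordinate \<open>i\<close>. The index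
  type carries no order, so the order of differentiation is an arbitrary one; it is immaterial for
  functions of class \<open>C\<^sup>k\<close> with \<open>k = |\<alpha>|\<close>, the only ones to which this is applied.\<close>

definition mderiv :: "nat^'d \<Rightarrow> (real^'d \<Rightarrow> real) \<Rightarrow> real^'d \<Rightarrow> real" where
  "mderiv \<alpha> f = partials (SOME is. \<forall>i. count_list is i = \<alpha> $ i) f"

text \<open>On the boundary of \<open>\<Omega>\<close> the derivative is the continuous extension from the interior.\<close>

definition mderiv_on :: "(real^'d) set \<Rightarrow> nat^'d \<Rightarrow> (real^'d \<Rightarrow> real) \<Rightarrow> real^'d \<Rightarrow> real" where
  "mderiv_on \<Omega> \<alpha> f x =
     (if x \<in> interior \<Omega> then mderiv \<alpha> f x else Lim (at x within interior \<Omega>) (mderiv \<alpha> f))"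


section \<open>Fractional Sobolev spaces\<close>

text \<open>If all iterated partial derivatives are (totally) differentiable everywhere, they are all
  continuous, so the first condition says that \<open>\<phi>\<close> is \<open>C\<^sup>\<infinity>\<close>.\<close>

definition test_fun :: "(real^'d) set \<Rightarrow> (real^'d \<Rightarrow> real) \<Rightarrow> bool" where
  "test_fun U \<phi> \<longleftrightarrow> (\<forall>is x. partials is \<phi> differentiable (at x)) \<and>
     compact (closure {x. \<phi> x \<noteq> 0}) \<and> closure {x. \<phi> x \<noteq> 0} \<subseteq> U"

definition locally_integrable :: "(real^'d) set \<Rightarrow> (real^'d \<Rightarrow> real) \<Rightarrow> bool" where
  "locally_integrable U f \<longleftrightarrow> (\<forall>C. compact C \<and> C \<subseteq> U \<longrightarrow> set_integrable lborel C f)"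

definition has_weak_deriv ::
  "(real^'d) set \<Rightarrow> nat^'d \<Rightarrow> (real^'d \<Rightarrow> real) \<Rightarrow> (real^'d \<Rightarrow> real) \<Rightarrow> bool" where
  "has_weak_deriv U \<beta> f g \<longleftrightarrow> locally_integrable U f \<and> locally_integrable U g \<and>
     (\<forall>\<phi>. test_fun U \<phi> \<longrightarrow>
        (LINT x:U|lborel. f x * mderiv \<beta> \<phi> x) = (- 1) ^ mi_order \<beta> * (LINT x:U|lborel. g x * \<phi> x))"

text \<open>Weak derivatives are unique almost everywhere, hence the choice below does not affect the
  integrals in which it is used.\<close>

definition weak_deriv :: "(real^'d) set \<Rightarrow> nat^'d \<Rightarrow> (real^'d \<Rightarrow> real) \<Rightarrow> real^'d \<Rightarrow> real" where
  "weak_deriv U \<beta> f = (SOME g. has_weak_deriv U \<beta> f g)"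

text \<open>The squared Sobolev-Slobodeckij norm of real order \<open>m = k + s\<close>, \<open>k\<close> a natural number and
  \<open>0 \<le> s < 1\<close>; the double integral is absent if \<open>m\<close> is an integer.\<close>

definition sobolev_energy :: "(real^'d) set \<Rightarrow> real \<Rightarrow> (real^'d \<Rightarrow> real) \<Rightarrow> ennreal" where
  "sobolev_energy U m f =
     (\<Sum>\<beta>\<in>{\<beta>. mi_order \<beta> \<le> nat \<lfloor>m\<rfloor>}. \<integral>\<^sup>+x\<in>U. ennreal ((weak_deriv U \<beta> f x)\<^sup>2) \<partial>lborel) +
     (if frac m = 0 then 0
      else \<Sum>\<beta>\<in>{\<beta>. mi_order \<beta> = nat \<lfloor>m\<rfloor>}.
        \<integral>\<^sup>+x\<in>U. (\<integral>\<^sup>+y\<in>U. ennreal ((weak_deriv U \<beta> f x - weak_deriv U \<beta> f y)\<^sup>2 /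
           norm (x - y) powr (real CARD('d) + 2 * frac m)) \<partial>lborel) \<partial>lborel)"

text \<open>Functions on a set \<open>\<Omega>\<close> are represented by total functions that vanish outside \<open>\<Omega>\<close>. For
  \<open>m > d/2\<close> each class in \<open>H\<^sup>m\<close> is represented by its member that is continuous on \<open>\<Omega>\<close>.\<close>

definition sobolev_space :: "(real^'d) set \<Rightarrow> real \<Rightarrow> (real^'d \<Rightarrow> real) set" where
  "sobolev_space \<Omega> m = {v. (\<forall>x. x \<notin> \<Omega> \<longrightarrow> v x = 0) \<and> continuous_on \<Omega> v \<and>
     (\<forall>\<beta>. mi_order \<beta> \<le> nat \<lfloor>m\<rfloor> \<longrightarrow> (\<exists>g. has_weak_deriv (interior \<Omega>) \<beta> v g)) \<and>
     sobolev_energy (interior \<Omega>) m v < \<infinity>}"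

definition sobolev_norm :: "(real^'d) set \<Rightarrow> real \<Rightarrow> (real^'d \<Rightarrow> real) \<Rightarrow> real" where
  "sobolev_norm \<Omega> m v = sqrt (enn2real (sobolev_energy (interior \<Omega>) m v))"


section \<open>Reproducing kernel Hilbert spaces and kernel ridge regression\<close>

text \<open>\<open>H\<close> with inner product \<open>ip\<close> is the Hilbert space of functions on \<open>\<Omega>\<close> with reproducing
  kernel \<open>K\<close>.\<close>

locale rkhs =
  fixes \<Omega> :: "'a set" and K :: "'a \<Rightarrow> 'a \<Rightarrow> real"
    and H :: "('a \<Rightarrow> real) set" and ip :: "('a \<Rightarrow> real) \<Rightarrow> ('a \<Rightarrow> real) \<Rightarrow> real"
  assumes zero_outside: "v \<in> H \<Longrightarrow> x \<notin> \<Omega> \<Longrightarrow> v x = 0"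
    and zero_mem: "(\<lambda>_. 0) \<in> H"
    and add_mem: "u \<in> H \<Longrightarrow> v \<in> H \<Longrightarrow> (\<lambda>x. u x + v x) \<in> H"
    and scale_mem: "v \<in> H \<Longrightarrow> (\<lambda>x. c * v x) \<in> H"
    and ip_commute: "u \<in> H \<Longrightarrow> v \<in> H \<Longrightarrow> ip u v = ip v u"
    and ip_add: "u \<in> H \<Longrightarrow> v \<in> H \<Longrightarrow> w \<in> H \<Longrightarrow> ip (\<lambda>x. u x + v x) w = ip u w + ip v w"
    and ip_scale: "u \<in> H \<Longrightarrow> v \<in> H \<Longrightarrow> ip (\<lambda>x. c * u x) v = c * ip u v"
    and ip_nonneg: "v \<in> H \<Longrightarrow> 0 \<le> ip v v"
    and ip_definite: "v \<in> H \<Longrightarrow> ip v v = 0 \<Longrightarrow> v = (\<lambda>_. 0)"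
    and complete: "(\<And>k :: nat. h k \<in> H) \<Longrightarrow>
      (\<forall>\<epsilon>>0. \<exists>N. \<forall>j\<ge>N. \<forall>k\<ge>N. ip (\<lambda>x. h j x - h k x) (\<lambda>x. h j x - h k x) < \<epsilon>) \<Longrightarrow>
      \<exists>v\<in>H. (\<lambda>k. ip (\<lambda>x. h k x - v x) (\<lambda>x. h k x - v x)) \<longlonglongrightarrow> 0"
    and kernel_mem: "x \<in> \<Omega> \<Longrightarrow> (\<lambda>y. if y \<in> \<Omega> then K x y else 0) \<in> H"
    and reproducing: "v \<in> H \<Longrightarrow> x \<in> \<Omega> \<Longrightarrow> ip v (\<lambda>y. if y \<in> \<Omega> then K x y else 0) = v x"

definition ip_norm :: "(('a \<Rightarrow> real) \<Rightarrow> ('a \<Rightarrow> real) \<Rightarrow> real) \<Rightarrow> ('a \<Rightarrow> real) \<Rightarrow> real" where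
  "ip_norm ip v = sqrt (ip v v)"

text \<open>The minimiser is unique if \<open>H\<close>, \<open>ip\<close> form an RKHS and \<open>lam > 0\<close>.\<close>

definition krr :: "('a \<Rightarrow> real) set \<Rightarrow> (('a \<Rightarrow> real) \<Rightarrow> ('a \<Rightarrow> real) \<Rightarrow> real) \<Rightarrow> real \<Rightarrow>
    nat \<Rightarrow> (nat \<Rightarrow> 'a) \<Rightarrow> (nat \<Rightarrow> real) \<Rightarrow> 'a \<Rightarrow> real" where
  "krr H ip lam n xs ys =
     (ARG_MIN (\<lambda>v. (\<Sum>i=1..n. (ys i - v (xs i))\<^sup>2) / real n + lam * (ip_norm ip v)\<^sup>2) v. v \<in> H)"


section \<open>The design\<close>

definition emp_norm :: "nat \<Rightarrow> (nat \<Rightarrow> 'a) \<Rightarrow> ('a \<Rightarrow> real) \<Rightarrow> real" where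
  "emp_norm n xs v = sqrt ((\<Sum>i=1..n. (v (xs i))\<^sup>2) / real n)"

definition L2_norm_on :: "(real^'d) set \<Rightarrow> (real^'d \<Rightarrow> real) \<Rightarrow> real" where
  "L2_norm_on \<Omega> v = sqrt (LINT x:\<Omega>|lborel. (v x)\<^sup>2)"

text \<open>\<open>x n i\<close> is the \<open>i\<close>-th of the \<open>n\<close> design points, as a random variable on \<open>M\<close>. A deterministic
  design is the case where \<open>x n i\<close> is constant: the event is then certain or impossible, so that
  its probability is at least \<open>1 - \<epsilon>\<close> for an \<open>\<epsilon> < 1\<close> only if the inequalities hold.\<close>

definition norm_comparison :: "'w measure \<Rightarrow> (real^'d) set \<Rightarrow> (real^'d \<Rightarrow> real) set \<Rightarrow>
    ((real^'d \<Rightarrow> real) \<Rightarrow> (real^'d \<Rightarrow> real) \<Rightarrow> real) \<Rightarrow> real \<Rightarrow>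
    (nat \<Rightarrow> nat \<Rightarrow> 'w \<Rightarrow> real^'d) \<Rightarrow> bool" where
  "norm_comparison M \<Omega> H ip m x \<longleftrightarrow>
     (\<exists>C1>0. \<forall>\<epsilon>>0. \<exists>C>0. \<forall>n\<ge>1.
        \<P>(w in M. \<forall>v\<in>H.
          L2_norm_on \<Omega> v \<le> max (C1 * emp_norm n (\<lambda>i. x n i w) v)
            (C * real n powr (- m / real CARD('d)) * ip_norm ip v) \<and>
          emp_norm n (\<lambda>i. x n i w) v \<le> max (C1 * L2_norm_on \<Omega> v)
            (C * real n powr (- m / real CARD('d)) * ip_norm ip v))
        \<ge> 1 - \<epsilon>)"

text \<open>\<open>prob_space.indep_var\<close> requires both variables to have the same type, hence the formulation
  by the generated \<open>\<sigma>\<close>-algebras.\<close>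

definition indep_of_design ::
  "'w measure \<Rightarrow> (nat \<Rightarrow> nat \<Rightarrow> 'w \<Rightarrow> real^'d) \<Rightarrow> (nat \<Rightarrow> 'w \<Rightarrow> real) \<Rightarrow> bool" where
  "indep_of_design M x e \<longleftrightarrow>
     (\<forall>n. prob_space.indep_set M
        (sets (vimage_algebra (space M) (\<lambda>w. \<lambda>i\<in>{1..n}. x n i w) (\<Pi>\<^sub>M i\<in>{1..n}. borel)))
        (sets (vimage_algebra (space M) (\<lambda>w. \<lambda>i\<in>{1..n}. e i w) (\<Pi>\<^sub>M i\<in>{1..n}. borel))))"

definition gaussian_errors :: "'w measure \<Rightarrow> real \<Rightarrow> (nat \<Rightarrow> 'w \<Rightarrow> real) \<Rightarrow> bool" where
  "gaussian_errors M \<sigma> e \<longleftrightarrow>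
     prob_space.indep_vars M (\<lambda>_. borel) e {1..} \<and>
     (\<forall>i\<ge>1. distributed M lborel (e i) (normal_density 0 \<sigma>))"

text \<open>\<open>D\<^sup>\<alpha>\<close> of the KRR estimator, at the point \<open>t\<close>, for the design drawn at \<open>w\<close> and the errors drawn
  at \<open>w'\<close>. The estimator is the case \<open>w' = w\<close>; its expectation with respect to the errors only, with
  the design held fixed, is the integral over \<open>w'\<close>.\<close>

definition krr_deriv :: "(real^'d) set \<Rightarrow> (real^'d \<Rightarrow> real) set \<Rightarrow>
    ((real^'d \<Rightarrow> real) \<Rightarrow> (real^'d \<Rightarrow> real) \<Rightarrow> real) \<Rightarrow> nat^'d \<Rightarrow> (real^'d \<Rightarrow> real) \<Rightarrow>
    (nat \<Rightarrow> nat \<Rightarrow> 'w \<Rightarrow> real^'d) \<Rightarrow> (nat \<Rightarrow> 'w \<Rightarrow> real) \<Rightarrow> real \<Rightarrow> nat \<Rightarrow> 'w \<Rightarrow> 'w \<Rightarrow> real^'d \<Rightarrow> real"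
  where
  "krr_deriv \<Omega> H ip \<alpha> f x e lam n w w' t =
     mderiv_on \<Omega> \<alpha> (krr H ip lam n (\<lambda>i. x n i w) (\<lambda>i. f (x n i w) + e i w')) t"

end

theory Submission
  imports Defs
begin

text \<open>
  The estimator is linear in the data, so \<open>D\<^sup>\<alpha>\<close> of the centred estimator is \<open>D\<^sup>\<alpha>\<close> of the fit to the pure
  noise \<open>E\<close> (\<open>krr_deriv_centred\<close>), a Gaussian process indexed by \<open>\<Omega>\<close>. On cells of side of order
  \<open>\<rho> = \<lambda> powr (1 / (2 m))\<close> this process is nearly independent. There are about \<open>\<rho> powr (- d)\<close> cells, and the
  standard deviation at a point is of order \<open>\<sigma> n powr (- 1/2) \<rho> powr (- d / 2 - |\<alpha>|)\<close>. The maximum of so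
  many Gaussian variables contributes the factor \<open>sqrt (log (1 / \<lambda>))\<close>.

  To make this precise without computing covariances, the fit is tested against the functions
  \<open>\<beta>\<^sub>j = D\<^sup>\<alpha> \<psi>\<^sub>j\<close> for bumps \<open>\<psi>\<^sub>j\<close> in disjoint cells: by partial integration, the supremum of the derivative
  dominates a multiple of each \<open>\<bar>l\<^sub>j E\<bar>\<close>, where \<open>l\<^sub>j E\<close> is the integral of the fit against \<open>\<beta>\<^sub>j\<close>
  (\<open>integral_against_derived_bump_le\<close>). Let \<open>S\<close> be the event that all \<open>\<bar>l\<^sub>j E\<bar>\<close> are below a level \<open>\<kappa>\<close>. The
  values of \<open>\<beta>\<^sub>j\<close> at the design points form a vector whose fit is close to \<open>\<beta>\<^sub>j\<close>, by the bias bound of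
  least squares and the comparison of norms; so a suitable multiple \<open>\<mu>\<^sub>j\<close> of it makes \<open>l\<^sub>j \<mu>\<^sub>j \<ge> 3 \<kappa>\<close>
  and \<open>\<bar>l\<^sub>k \<mu>\<^sub>j\<bar> \<le> \<kappa> / 2\<close> for \<open>k \<noteq> j\<close>. Therefore the translates of \<open>S\<close> by \<open>\<plusminus> \<mu>\<^sub>j\<close> are disjoint. A translation of
  the Gaussian law costs a factor \<open>exp (- |\<mu>\<^sub>j|\<^sup>2 / (2 \<sigma>\<^sup>2))\<close> for the pair of opposite signs, and with \<open>\<kappa>\<close>
  chosen such that this is comparable to the reciprocal of the number of cells, \<open>S\<close> has probability at
  most \<open>1/4\<close> (\<open>small_maximum_probability\<close>, \<open>lower_bound_fixed_design\<close>). For a random design the bound holds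
  conditionally on the event of norm comparison (\<open>probability_for_random_design\<close>).

  Three analytic facts support this. Rescaled bumps have Sobolev norm at most of order
  \<open>\<rho> powr (d / 2 - m)\<close>, also for fractional \<open>m\<close> (\<open>bump_in_sobolev_space\<close>). Functions in \<open>H\<^sup>m\<close> have continuous
  classical derivatives of order up to \<open>|\<alpha>|\<close> with limits at the boundary (\<open>sobolev_embedding\<close>); this is
  shown with averages over small cubes \<open>t + \<rho> Q\<close>, whose derivative in \<open>\<rho>\<close> consists of averages of the next
  higher order. Finally, the estimator depends measurably on design and noise (\<open>krr_measurable\<close>), being a
  limit of gradient descent iterates.\<close>

section \<open>Smooth functions of one real variable\<close>

text \<open>The derivative is a witness here, not \<open>deriv\<close>, so that closure properties follow by induction on
  the order without first knowing differentiability of \<open>deriv f\<close>.\<close>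

primrec times_differentiable :: "nat \<Rightarrow> (real \<Rightarrow> real) \<Rightarrow> bool" where
  "times_differentiable 0 f \<longleftrightarrow> True"
| "times_differentiable (Suc n) f \<longleftrightarrow>
     (\<exists>f'. (\<forall>x. (f has_real_derivative f' x) (at x)) \<and> times_differentiable n f')"

definition smooth :: "(real \<Rightarrow> real) \<Rightarrow> bool" where
  "smooth f \<longleftrightarrow> (\<forall>n. times_differentiable n f)"

lemma times_differentiable_SucD: "times_differentiable (Suc n) f \<Longrightarrow> times_differentiable n f"
proof (induction n arbitrary: f)
  case (Suc n)
  then obtain f' where "\<forall>x. (f has_real_derivative f' x) (at x)" "times_differentiable (Suc n) f'"
    by auto
  with Suc.IH[of f'] show ?case by auto
qed simp

lemma times_differentiable_add:
  "times_differentiable n f \<Longrightarrow> times_differentiable n g \<Longrightarrow> times_differentiable n (\<lambda>x. f x + g x)"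
proof (induction n arbitrary: f g)
  case (Suc n)
  then obtain f' g' where
    "\<forall>x. (f has_real_derivative f' x) (at x)" "times_differentiable n f'"
    "\<forall>x. (g has_real_derivative g' x) (at x)" "times_differentiable n g'" by auto
  with Suc.IH[of f' g'] show ?case
    by (auto intro!: exI[of _ "\<lambda>x. f' x + g' x"] derivative_eq_intros)
qed simp

lemma times_differentiable_mult:
  "times_differentiable n f \<Longrightarrow> times_differentiable n g \<Longrightarrow> times_differentiable n (\<lambda>x. f x * g x)"
proof (induction n arbitrary: f g)
  case (Suc n)
  then obtain f' g' where d:
    "\<forall>x. (f has_real_derivative f' x) (at x)" "times_differentiable n f'"
    "\<forall>x. (g has_real_derivative g' x) (at x)" "times_differentiable n g'" by auto
  have "times_differentiable n (\<lambda>x. f' x * g x + f x * g' x)"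
    using Suc d by (intro times_differentiable_add Suc.IH) (auto dest: times_differentiable_SucD simp del: times_differentiable.simps(2))
  with d show ?case
    by (auto intro!: exI[of _ "\<lambda>x. f' x * g x + f x * g' x"] derivative_eq_intros)
qed simp

lemma times_differentiable_affine:
  "times_differentiable n f \<Longrightarrow> times_differentiable n (\<lambda>x. c * f (a * x + b))"
proof (induction n arbitrary: f c)
  case (Suc n)
  then obtain f' where d: "\<And>x. (f has_real_derivative f' x) (at x)" "times_differentiable n f'" by auto
  have "((\<lambda>x. c * f (a * x + b)) has_real_derivative c * a * f' (a * x + b)) (at x)" for x
    by (rule derivative_eq_intros DERIV_chain'[OF _ d(1)] | simp)+
  then show ?case
    using Suc.IH[OF d(2), of "c * a"] by (auto intro!: exI[of _ "\<lambda>x. c * a * f' (a * x + b)"])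
qed simp

lemma times_differentiable_const: "times_differentiable n (\<lambda>_. c)"
  by (induction n arbitrary: c) (auto intro!: exI[of _ "\<lambda>_. 0"])

lemma times_differentiable_ident: "times_differentiable n (\<lambda>x. x)"
  by (cases n) (auto intro!: exI[of _ "\<lambda>_. 1"] times_differentiable_const)

lemma smooth_mult: "smooth f \<Longrightarrow> smooth g \<Longrightarrow> smooth (\<lambda>x. f x * g x)"
  by (auto simp: smooth_def intro: times_differentiable_mult)

lemma smooth_ident: "smooth (\<lambda>x. x)"
  by (simp add: smooth_def times_differentiable_ident)

lemma smooth_affine: "smooth f \<Longrightarrow> smooth (\<lambda>x. c * f (a * x + b))"
  by (simp add: smooth_def times_differentiable_affine)

lemma smooth_rescale: "smooth f \<Longrightarrow> smooth (\<lambda>x. f ((x - b) / a))"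
  using smooth_affine[of f 1 "1/a" "- b/a"] by (simp add: diff_divide_distrib)

lemma smooth_deriv:
  assumes "smooth f"
  shows "(f has_real_derivative deriv f x) (at x)" and "smooth (deriv f)"
proof -
  have *: "\<exists>f'. (\<forall>x. (f has_real_derivative f' x) (at x)) \<and> times_differentiable n f'" for n
    using assms times_differentiable.simps(2) unfolding smooth_def by blast
  show "(f has_real_derivative deriv f x) (at x)"
    using *[of 0] DERIV_imp_deriv by metis
  have "times_differentiable n (deriv f)" for n
  proof -
    obtain f' where f': "\<forall>x. (f has_real_derivative f' x) (at x)" "times_differentiable n f'"
      using * by blast
    then have "deriv f = f'" by (auto intro!: ext DERIV_imp_deriv)
    with f' show ?thesis by simp
  qed
  then show "smooth (deriv f)" by (simp add: smooth_def)
qed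

lemma smooth_funpow_deriv: "smooth f \<Longrightarrow> smooth ((deriv ^^ n) f)"
  by (induction n) (auto intro: smooth_deriv(2))

subsection \<open>A flat function and a bump\<close>

text \<open>With all polynomials \<open>p\<close> at once the class is closed under differentiation: at zero the
  exponential beats every power of \<open>1/x\<close>. This gives smoothness by a one-line induction.\<close>

definition flat :: "real poly \<Rightarrow> real \<Rightarrow> real" where
  "flat p x = (if x > 0 then poly p (1 / x) * exp (- (1 / x)) else 0)"

lemma poly_exp_tendsto_0: "((\<lambda>x. poly p x * exp (- x)) \<longlongrightarrow> 0) (at_top :: real filter)"
proof (induction p)
  case (pCons a p)
  have 1: "((\<lambda>x. a * exp (- x)) \<longlongrightarrow> 0) (at_top :: real filter)"
    by (intro tendsto_mult_right_zero) (simp add: filterlim_compose[OF exp_at_bot] filterlim_uminus_at_bot_at_top)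
  have "((\<lambda>x. x ^ k * exp (- x)) \<longlongrightarrow> 0) (at_top :: real filter)" for k
    using tendsto_power_div_exp_0[of k] by (simp add: exp_minus field_simps)
  then have "((\<lambda>x. \<Sum>i\<le>degree (pCons 0 p). coeff (pCons 0 p) i * (x ^ i * exp (- x))) \<longlongrightarrow> 0) (at_top :: real filter)"
    by (intro tendsto_null_sum tendsto_mult_right_zero)
  then have "((\<lambda>x. poly (pCons 0 p) x * exp (- x)) \<longlongrightarrow> 0) (at_top :: real filter)"
    by (simp add: poly_altdef sum_distrib_right mult.assoc)
  from tendsto_add[OF 1 this] show ?case by (simp add: algebra_simps)
qed simp

lemma flat_deriv: "(flat p has_real_derivative flat ([:0, 0, 1:] * (p - pderiv p)) x) (at x)"
proof -
  consider "x > 0" | "x < 0" | "x = 0" by linarith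
  then show ?thesis
  proof cases
    case 1
    have "((\<lambda>x. poly p (1 / x) * exp (- (1 / x))) has_real_derivative flat ([:0, 0, 1:] * (p - pderiv p)) x) (at x)"
      using 1 by (auto intro!: derivative_eq_intros DERIV_chain'[OF _ poly_DERIV] simp: flat_def field_simps power2_eq_square)
    moreover have "eventually (\<lambda>y. flat p y = poly p (1 / y) * exp (- (1 / y))) (nhds x)"
      using eventually_nhds_in_open[of "{0<..}" x] 1 by (auto simp: flat_def elim!: eventually_mono)
    ultimately show ?thesis by (subst DERIV_cong_ev) auto
  next
    case 2
    have "eventually (\<lambda>y. flat p y = 0) (nhds x)"
      using eventually_nhds_in_open[of "{..<0}" x] 2 by (auto simp: flat_def elim!: eventually_mono)
    moreover have "((\<lambda>_. 0) has_real_derivative flat ([:0, 0, 1:] * (p - pderiv p)) x) (at x)"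
      using 2 by (simp add: flat_def)
    ultimately show ?thesis by (subst DERIV_cong_ev) auto
  next
    case 3
    have "((\<lambda>h. flat p h / h) \<longlongrightarrow> 0) (at 0)"
    proof (rule filterlim_split_at)
      show "((\<lambda>h. flat p h / h) \<longlongrightarrow> 0) (at_left 0)"
        by (rule tendsto_eventually) (auto simp: flat_def eventually_at_left_field intro: exI[of _ "-1"])
      have "((\<lambda>h. poly (pCons 0 p) (inverse h) * exp (- inverse h)) \<longlongrightarrow> 0) (at_right 0)"
        by (rule filterlim_compose[OF poly_exp_tendsto_0 filterlim_inverse_at_top_right])
      moreover have "eventually (\<lambda>h. flat p h / h = poly (pCons 0 p) (inverse h) * exp (- inverse h)) (at_right 0)"
        by (auto simp: flat_def eventually_at_right_field field_simps intro!: exI[of _ 1])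
      ultimately show "((\<lambda>h. flat p h / h) \<longlongrightarrow> 0) (at_right 0)"
        by (subst tendsto_cong)
    qed
    then show ?thesis using 3 by (simp add: DERIV_def flat_def)
  qed
qed

lemma smooth_flat: "smooth (flat p)"
proof -
  have "times_differentiable n (flat p)" for n
    by (induction n arbitrary: p) (auto intro: flat_deriv)
  then show ?thesis by (simp add: smooth_def)
qed

abbreviation cutoff :: "real \<Rightarrow> real" where "cutoff \<equiv> flat 1"

lemma cutoff_eq: "cutoff x = (if x > 0 then exp (- (1 / x)) else 0)"
  by (simp add: flat_def)

lemma cutoff_range: "0 \<le> cutoff x" "cutoff x \<le> 1"
  by (auto simp: cutoff_eq)

definition bump :: "real \<Rightarrow> real" where
  "bump x = cutoff x * cutoff (1 - x)"

lemma smooth_bump: "smooth bump"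
proof -
  have "smooth (\<lambda>x. cutoff x * cutoff (1 - x))"
    using smooth_affine[OF smooth_flat, of 1 1 "-1" 1] smooth_flat by (intro smooth_mult) auto
  then show ?thesis by (simp add: bump_def[abs_def])
qed

lemma bump_range: "0 \<le> bump x" "bump x \<le> 1"
  unfolding bump_def by (auto intro!: mult_le_one mult_nonneg_nonneg cutoff_range)

lemma bump_pos_iff: "bump x > 0 \<longleftrightarrow> 0 < x \<and> x < 1"
  by (auto simp: bump_def cutoff_eq zero_less_mult_iff)

lemma bump_outside: "x \<notin> {0<..<1} \<Longrightarrow> bump x = 0"
  using bump_pos_iff[of x] bump_range(1)[of x] by auto

lemma deriv_zero_on_open:
  assumes "open S" "\<And>x. x \<in> S \<Longrightarrow> f x = (0::real)" "x \<in> S"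
  shows "deriv f x = 0"
proof -
  have "eventually (\<lambda>y. f y = 0) (nhds x)"
    using eventually_nhds_in_open[OF assms(1,3)] assms(2) by (auto elim: eventually_mono)
  then have "(f has_real_derivative 0) (at x)" by (subst DERIV_cong_ev[where g = "\<lambda>_. 0"]) auto
  then show ?thesis by (rule DERIV_imp_deriv)
qed

lemma deriv_zero_outside:
  assumes "\<And>x. x \<notin> {l..u} \<Longrightarrow> f x = (0::real)" "x \<notin> {l..u}"
  shows "deriv f x = 0"
  using assms by (intro deriv_zero_on_open[of "- {l..u}"]) (auto intro: open_Compl)

lemma funpow_deriv_zero_outside:
  assumes "\<And>x. x \<notin> {l..u} \<Longrightarrow> f x = (0::real)" "x \<notin> {l..u}"
  shows "(deriv ^^ n) f x = 0"
  using assms(2)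
proof (induction n arbitrary: x)
  case (Suc n)
  have "deriv ((deriv ^^ n) f) x = 0" by (rule deriv_zero_outside[OF Suc.IH Suc.prems])
  then show ?case by simp
qed (simp add: assms(1))

text \<open>Descending in the order: a derivative whose own derivative vanishes is constant, and it is zero
  outside the support.\<close>

lemma funpow_deriv_eq_zero_imp:
  assumes "smooth f" "\<And>x. x \<notin> {l..u} \<Longrightarrow> f x = (0::real)" "\<And>x. (deriv ^^ n) f x = 0"
  shows "f x = 0"
  using assms(3)
proof (induction n arbitrary: x)
  case (Suc n)
  let ?g = "(deriv ^^ n) f"
  have "\<forall>x. (?g has_real_derivative 0) (at x)"
    using smooth_deriv(1)[OF smooth_funpow_deriv[OF assms(1), of n]] Suc.prems by simp
  then have "?g y = ?g (max u l + 1)" for y by (rule DERIV_isconst_all)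
  moreover have "?g (max u l + 1) = 0"
    by (rule funpow_deriv_zero_outside[of l u, OF assms(2)]) auto
  ultimately have "?g y = 0" for y by metis
  then show ?case by (rule Suc.IH)
qed simp

text \<open>The bump must keep some mass after any number of differentiations: the lower bound tests the
  estimator against derivatives of bumps.\<close>

lemma funpow_deriv_bump_nonzero: "\<exists>x. (deriv ^^ n) bump x \<noteq> 0"
proof (rule ccontr)
  assume "\<nexists>x. (deriv ^^ n) bump x \<noteq> 0"
  then have 1: "(deriv ^^ n) bump x = 0" for x by simp
  have 2: "bump x = 0" if "x \<notin> {0..1}" for x using that by (intro bump_outside) auto
  have "bump (1/2) = 0"
    by (rule funpow_deriv_eq_zero_imp[OF smooth_bump 2 1])
  then show False using bump_pos_iff[of "1/2"] by simp
qed

section \<open>Products of smooth functions of the coordinates\<close>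

text \<open>All test functions used below are products of functions of one coordinate. A partial derivative
  of such a product is again one, and iterated derivatives depend only on how often each coordinate
  occurs in the list of directions. Thus no symmetry of second derivatives is needed to identify
  \<open>D\<^sup>\<alpha>\<close> with any particular order of differentiation.\<close>
definition prodfun :: "('d \<Rightarrow> real \<Rightarrow> real) \<Rightarrow> real^'d \<Rightarrow> real" where
  "prodfun \<eta> x = (\<Prod>i\<in>UNIV. \<eta> i (x $ i))"

definition der :: "'d list \<Rightarrow> ('d \<Rightarrow> real \<Rightarrow> real) \<Rightarrow> 'd \<Rightarrow> real \<Rightarrow> real" where
  "der I \<eta> = (\<lambda>i. (deriv ^^ count_list I i) (\<eta> i))"

text \<open>The chain rule for \<open>\<rho> \<mapsto> \<Phi> ((y - t) / \<rho>)\<close> produces factors \<open>(y - t)\<^sub>i / \<rho>\<close>. They are absorbed into the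
  bump, which changes one member of the family only.\<close>

definition coordmul :: "'d \<Rightarrow> ('d \<Rightarrow> real \<Rightarrow> real) \<Rightarrow> 'd \<Rightarrow> real \<Rightarrow> real" where
  "coordmul i \<eta> = \<eta>(i := \<lambda>x. x * \<eta> i x)"

definition rescale :: "real^'d \<Rightarrow> real \<Rightarrow> ('d \<Rightarrow> real \<Rightarrow> real) \<Rightarrow> 'd \<Rightarrow> real \<Rightarrow> real" where
  "rescale t \<rho> \<eta> = (\<lambda>i x. \<eta> i ((x - t $ i) / \<rho>))"

text \<open>The product of such a family is a smooth function supported in the box \<open>cbox l u\<close>.\<close>

definition bumpfam :: "real^'d \<Rightarrow> real^'d \<Rightarrow> ('d \<Rightarrow> real \<Rightarrow> real) \<Rightarrow> bool" where
  "bumpfam l u \<eta> \<longleftrightarrow> (\<forall>i. smooth (\<eta> i) \<and> (\<forall>x. x \<notin> {l $ i..u $ i} \<longrightarrow> \<eta> i x = 0))"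

lemma der_Nil [simp]: "der [] \<eta> = \<eta>"
  by (simp add: der_def)

lemma der_append: "der (I @ J) \<eta> = der I (der J \<eta>)"
  by (simp add: der_def count_list_append funpow_add fun_eq_iff)

lemma der_cong_count: "(\<And>i. count_list I i = count_list J i) \<Longrightarrow> der I \<eta> = der J \<eta>"
  by (simp add: der_def)

lemma der_Cons: "der (i # I) \<eta> = der [i] (der I \<eta>)"
  using der_append[of "[i]" I] by simp

lemma der_single: "der [i] \<eta> = \<eta>(i := deriv (\<eta> i))"
  by (auto simp: der_def fun_eq_iff)

lemma bumpfam_smooth: "bumpfam l u \<eta> \<Longrightarrow> smooth (\<eta> i)"
  by (simp add: bumpfam_def)

lemma smooth_der: "(\<And>i. smooth (\<eta> i)) \<Longrightarrow> smooth (der I \<eta> i)"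
  by (simp add: der_def smooth_funpow_deriv)

lemma bumpfam_der: "bumpfam l u \<eta> \<Longrightarrow> bumpfam l u (der I \<eta>)"
  unfolding bumpfam_def der_def
  by (metis smooth_funpow_deriv funpow_deriv_zero_outside)

lemma bumpfam_coordmul: "bumpfam l u \<eta> \<Longrightarrow> bumpfam l u (coordmul i \<eta>)"
  by (auto simp: bumpfam_def coordmul_def smooth_mult smooth_ident)

lemma bumpfam_rescale: "bumpfam l u \<eta> \<Longrightarrow> \<rho> > 0 \<Longrightarrow> bumpfam (t + \<rho> *\<^sub>R l) (t + \<rho> *\<^sub>R u) (rescale t \<rho> \<eta>)"
  by (auto simp: bumpfam_def rescale_def smooth_rescale field_simps)

lemma prodfun_zero_outside: "bumpfam l u \<eta> \<Longrightarrow> x \<notin> cbox l u \<Longrightarrow> prodfun \<eta> x = 0"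
  by (auto simp: bumpfam_def prodfun_def mem_box_cart intro!: prod_zero)

lemma prodfun_rescale: "prodfun (rescale t \<rho> \<eta>) x = prodfun \<eta> ((1 / \<rho>) *\<^sub>R (x - t))"
  by (simp add: prodfun_def rescale_def)

lemma prodfun_has_derivative:
  assumes "\<And>i. smooth (\<eta> i)"
  shows "(prodfun \<eta> has_derivative (\<lambda>h. \<Sum>i\<in>UNIV. h $ i * prodfun (der [i] \<eta>) x)) (at x)"
proof -
  have 1: "((\<lambda>x. \<eta> i (x $ i)) has_derivative (\<lambda>h. h $ i * deriv (\<eta> i) (x $ i))) (at x)" for i and x :: "real^'a"
  proof -
    have "(\<eta> i has_derivative (\<lambda>h. h * deriv (\<eta> i) (x $ i))) (at (x $ i))"
      using smooth_deriv(1)[OF assms, of i "x $ i"] by (simp add: has_field_derivative_def mult_commute_abs)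
    from has_derivative_compose[OF bounded_linear_imp_has_derivative[OF bounded_linear_vec_nth] this]
    show ?thesis by simp
  qed
  have "(prodfun \<eta> has_derivative (\<lambda>h. \<Sum>i\<in>UNIV. h $ i * deriv (\<eta> i) (x $ i) * (\<Prod>j\<in>UNIV - {i}. \<eta> j (x $ j)))) (at x)"
    unfolding prodfun_def[abs_def] by (rule has_derivative_prod) (rule 1)
  moreover have "prodfun (der [i] \<eta>) x = deriv (\<eta> i) (x $ i) * (\<Prod>j\<in>UNIV - {i}. \<eta> j (x $ j))" for i
    unfolding prodfun_def by (subst prod.remove[of _ i]) (auto simp: der_single intro!: prod.cong)
  ultimately show ?thesis by (simp add: mult.assoc)
qed

lemma prodfun_differentiable: "(\<And>i. smooth (\<eta> i)) \<Longrightarrow> prodfun \<eta> differentiable (at x)"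
  using prodfun_has_derivative differentiable_def by blast

lemma prodfun_continuous: "(\<And>i. smooth (\<eta> i)) \<Longrightarrow> continuous_on S (prodfun \<eta>)"
  by (meson continuous_at_imp_continuous_on prodfun_has_derivative has_derivative_continuous)

lemma prodfun_has_path_derivative:
  assumes "\<And>i. smooth (\<eta> i)" and "\<And>i. ((\<lambda>s. \<gamma> s $ i) has_real_derivative \<gamma>' $ i) (at s)"
  shows "((\<lambda>s. prodfun \<eta> (\<gamma> s)) has_real_derivative (\<Sum>i\<in>UNIV. \<gamma>' $ i * prodfun (der [i] \<eta>) (\<gamma> s))) (at s)"
proof -
  have "(\<gamma> has_derivative (\<lambda>h. h *\<^sub>R \<gamma>')) (at s)"
    using assms(2) unfolding has_field_derivative_def
    by (subst has_derivative_componentwise_within)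
      (auto simp: Basis_vec_def inner_axis mult_commute_abs)
  from has_derivative_compose[OF this prodfun_has_derivative[OF assms(1)]]
  show ?thesis
    by (simp add: has_field_derivative_def mult.assoc sum_distrib_left[symmetric] mult_commute_abs)
qed

lemma prodfun_has_partial_derivative:
  assumes "\<And>i. smooth (\<eta> i)"
  shows "((\<lambda>t. prodfun \<eta> (x + t *\<^sub>R axis i 1)) has_real_derivative prodfun (der [i] \<eta>) x) (at 0)"
proof -
  have "((\<lambda>s. (x + s *\<^sub>R axis i 1) $ j) has_real_derivative axis i 1 $ j) (at 0)" for j
    by (auto intro!: derivative_eq_intros)
  from prodfun_has_path_derivative[OF assms this]
  have "((\<lambda>t. prodfun \<eta> (x + t *\<^sub>R axis i 1)) has_real_derivative
     (\<Sum>j\<in>UNIV. axis i 1 $ j * prodfun (der [j] \<eta>) (x + 0 *\<^sub>R axis i 1))) (at 0)" .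
  moreover have "(\<Sum>j\<in>UNIV. axis i 1 $ j * prodfun (der [j] \<eta>) (x + 0 *\<^sub>R axis i 1)) = prodfun (der [i] \<eta>) x"
    by (subst sum.remove[of _ i]) (auto simp: axis_def intro!: sum.neutral)
  ultimately show ?thesis by simp
qed

lemma partial_prodfun: "(\<And>i. smooth (\<eta> i)) \<Longrightarrow> partial i (prodfun \<eta>) = prodfun (der [i] \<eta>)"
  by (auto simp: partial_def fun_eq_iff intro!: DERIV_imp_deriv prodfun_has_partial_derivative)

lemma partials_Nil [simp]: "partials [] f = f"
  by (simp add: partials_def)

lemma partials_Cons: "partials (i # I) f = partial i (partials I f)"
  by (simp add: partials_def)

lemma partials_append: "partials (I @ J) f = partials I (partials J f)"
  by (simp add: partials_def)

lemma partials_prodfun: "(\<And>i. smooth (\<eta> i)) \<Longrightarrow> partials I (prodfun \<eta>) = prodfun (der I \<eta>)"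
proof (induction I)
  case (Cons i I)
  have "partial i (prodfun (der I \<eta>)) = prodfun (der [i] (der I \<eta>))"
    using Cons.prems by (intro partial_prodfun smooth_der)
  then show ?case
    using Cons by (simp add: partials_Cons der_Cons[of i I])
qed simp

lemma prodfun_test_fun:
  assumes "bumpfam l u \<eta>" "cbox l u \<subseteq> U"
  shows "test_fun U (prodfun \<eta>)"
proof -
  have sm: "\<And>i. smooth (\<eta> i)" using assms(1) by (rule bumpfam_smooth)
  have "{x. prodfun \<eta> x \<noteq> 0} \<subseteq> cbox l u"
    using prodfun_zero_outside[OF assms(1)] by blast
  then have *: "closure {x. prodfun \<eta> x \<noteq> 0} \<subseteq> cbox l u"
    by (intro closure_minimal closed_cbox)
  then have "compact (closure {x. prodfun \<eta> x \<noteq> 0})"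
    by (meson bounded_cbox bounded_subset closed_closure compact_eq_bounded_closed)
  with * assms(2) show ?thesis
    by (auto simp: test_fun_def partials_prodfun[OF sm] intro!: prodfun_differentiable smooth_der sm)
qed

lemma funpow_deriv_rescale:
  assumes "smooth f"
  shows "(deriv ^^ n) (\<lambda>x. f ((x - b) / a)) = (\<lambda>x. (1 / a) ^ n * (deriv ^^ n) f ((x - b) / a))"
proof (induction n)
  case (Suc n)
  have "((\<lambda>x. (1 / a) ^ n * (deriv ^^ n) f ((x - b) / a)) has_real_derivative
      (1 / a) ^ Suc n * (deriv ^^ Suc n) f ((x - b) / a)) (at x)" for x
  proof -
    have "((\<lambda>x. (x - b) / a) has_real_derivative 1 / a) (at x)"
      unfolding divide_inverse by (auto intro!: derivative_eq_intros)
    from DERIV_chain'[OF this smooth_deriv(1)[OF smooth_funpow_deriv[OF assms, of n]]]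
    have "((\<lambda>x. (deriv ^^ n) f ((x - b) / a)) has_real_derivative (1 / a) * (deriv ^^ Suc n) f ((x - b) / a)) (at x)"
      by (simp add: mult.commute)
    from DERIV_cmult[OF this, of "(1 / a) ^ n"] show ?thesis by (simp add: mult_ac)
  qed
  from DERIV_imp_deriv[OF this] show ?case
    unfolding funpow.simps(2) o_apply Suc by (intro ext) (simp only: funpow.simps(2) o_apply diff_Suc_1)
qed simp

lemma sum_count_list_UNIV: "(\<Sum>i\<in>UNIV. count_list I i) = length (I :: 'd::finite list)"
proof (induction I)
  case (Cons a I)
  have "count_list (a # I) i = count_list I i + (if i = a then 1 else 0)" for i by simp
  then show ?case using Cons by (simp add: sum.distrib del: count_list.simps)
qed simp

lemma prodfun_der_rescale:
  assumes "\<And>i. smooth (\<eta> i)"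
  shows "prodfun (der I (rescale t \<rho> \<eta>)) x = (1 / \<rho>) ^ length I * prodfun (rescale t \<rho> (der I \<eta>)) x"
  unfolding prodfun_def der_def rescale_def
  by (simp add: funpow_deriv_rescale[OF assms] prod.distrib flip: power_sum sum_count_list_UNIV)

lemma funpow_deriv_times_ident:
  assumes "smooth f"
  shows "(deriv ^^ n) (\<lambda>x. x * f x) = (\<lambda>x. x * (deriv ^^ n) f x + real n * (deriv ^^ (n - 1)) f x)"
proof (induction n)
  case (Suc n)
  have "((\<lambda>x. x * (deriv ^^ n) f x + real n * (deriv ^^ (n - 1)) f x) has_real_derivative
      x * (deriv ^^ Suc n) f x + real (Suc n) * (deriv ^^ n) f x) (at x)" for x
  proof (cases n)
    case 0
    then show ?thesis
      using smooth_deriv(1)[OF assms] by (auto intro!: derivative_eq_intros)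
  next
    case (Suc k)
    have "((deriv ^^ j) f has_real_derivative (deriv ^^ Suc j) f x) (at x)" for j
      using smooth_deriv(1)[OF smooth_funpow_deriv[OF assms, of j], of x] by simp
    from DERIV_add[OF DERIV_mult[OF DERIV_ident this[of n]] DERIV_cmult[OF this[of k], of "real n"]]
    show ?thesis using Suc by (simp add: algebra_simps)
  qed
  from DERIV_imp_deriv[OF this] show ?case
    unfolding funpow.simps(2) o_apply Suc by (intro ext) (simp only: funpow.simps(2) o_apply diff_Suc_1)
qed simp

text \<open>Leibniz' rule. The second term accounts for the powers of \<open>1 / \<rho>\<close> in front of a rescaled average
  when the average is differentiated in \<open>\<rho>\<close>.\<close>

lemma prodfun_der_coordmul:
  assumes "\<And>i. smooth (\<eta> i)"
  shows "prodfun (der (i # J) (coordmul i \<eta>)) x =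
    x $ i * prodfun (der (i # J) \<eta>) x + real (Suc (count_list J i)) * prodfun (der J \<eta>) x"
proof -
  let ?r = "\<Prod>j\<in>UNIV - {i}. (deriv ^^ count_list J j) (\<eta> j) (x $ j)"
  have r: "prodfun f x = f i (x $ i) * (\<Prod>j\<in>UNIV - {i}. f j (x $ j))" for f
    unfolding prodfun_def by (subst prod.remove[of _ i]) auto
  have "prodfun (der (i # J) (coordmul i \<eta>)) x =
    (deriv ^^ Suc (count_list J i)) (\<lambda>x. x * \<eta> i x) (x $ i) * ?r"
    unfolding r by (auto simp: der_def coordmul_def simp del: funpow.simps intro!: prod.cong)
  moreover have "prodfun (der (i # J) \<eta>) x = (deriv ^^ Suc (count_list J i)) (\<eta> i) (x $ i) * ?r"
    unfolding r by (auto simp: der_def simp del: funpow.simps intro!: prod.cong)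
  moreover have "prodfun (der J \<eta>) x = (deriv ^^ count_list J i) (\<eta> i) (x $ i) * ?r"
    unfolding r by (auto simp: der_def)
  ultimately show ?thesis
    unfolding funpow_deriv_times_ident[OF assms] by (simp add: algebra_simps del: funpow.simps)
qed

lemma prodfun_bounded:
  assumes "bumpfam l u \<eta>"
  obtains C where "C > 0" "\<And>x. \<bar>prodfun \<eta> x\<bar> \<le> C"
proof -
  have "compact (prodfun \<eta> ` cbox l u)"
    by (intro compact_continuous_image prodfun_continuous bumpfam_smooth[OF assms] compact_cbox)
  then obtain B where B: "\<And>x. x \<in> cbox l u \<Longrightarrow> \<bar>prodfun \<eta> x\<bar> \<le> B"
    by (metis bounded_pos compact_imp_bounded imageI real_norm_def)
  have "\<bar>prodfun \<eta> x\<bar> \<le> \<bar>B\<bar> + 1" for x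
    using B[of x] prodfun_zero_outside[OF assms, of x] by (cases "x \<in> cbox l u") auto
  then show thesis by (intro that[of "\<bar>B\<bar> + 1"]) auto
qed

lemma prodfun_measurable: "(\<And>i. smooth (\<eta> i)) \<Longrightarrow> prodfun \<eta> \<in> borel_measurable borel"
  by (intro borel_measurable_continuous_onI prodfun_continuous)

lemma prodfun_integrable:
  assumes "bumpfam l u \<eta>"
  shows "integrable lborel (prodfun \<eta>)"
proof -
  have "set_integrable lborel (cbox l u) (prodfun \<eta>)"
    unfolding set_integrable_def
    by (intro borel_integrable_compact compact_cbox prodfun_continuous bumpfam_smooth[OF assms])
  moreover have "(\<lambda>x. indicator (cbox l u) x *\<^sub>R prodfun \<eta> x) = prodfun \<eta>"
    using prodfun_zero_outside[OF assms] by (auto simp: fun_eq_iff indicator_def)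
  ultimately show ?thesis by (simp add: set_integrable_def)
qed

subsection \<open>Multi-indices\<close>

lemma ex_list_count: "\<exists>I :: 'd::finite list. \<forall>i. count_list I i = \<alpha> $ i"
proof -
  have "finite A \<Longrightarrow> \<exists>I. \<forall>i. count_list I i = (if i \<in> A then \<alpha> $ i else 0)" for A :: "'d set"
  proof (induction A rule: finite_induct)
    case (insert a A)
    then obtain I where "\<forall>i. count_list I i = (if i \<in> A then \<alpha> $ i else 0)" by blast
    moreover have "count_list (replicate n a) i = (if i = a then n else 0)" for n i
      by (induction n) auto
    ultimately show ?case using insert.hyps
      by (intro exI[of _ "replicate (\<alpha> $ a) a @ I"]) (auto simp: count_list_append)
  qed (auto intro!: exI[of _ "[]"])
  from this[of UNIV] show ?thesis by simp
qed

definition mi_list :: "nat^'d \<Rightarrow> 'd list" where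
  "mi_list \<alpha> = (SOME I. \<forall>i. count_list I i = \<alpha> $ i)"

lemma count_mi_list: "count_list (mi_list \<alpha>) i = \<alpha> $ i"
  unfolding mi_list_def by (rule someI2_ex[OF ex_list_count]) auto

lemma mderiv_eq: "mderiv \<alpha> f = partials (mi_list \<alpha>) f"
  by (simp add: mderiv_def mi_list_def)

lemma length_mi_list: "length (mi_list \<alpha>) = mi_order \<alpha>"
  by (simp add: mi_order_def count_mi_list flip: sum_count_list_UNIV)

lemma mderiv_prodfun:
  assumes "\<And>i. smooth (\<eta> i)" "\<And>i. count_list I i = \<alpha> $ i"
  shows "mderiv \<alpha> (prodfun \<eta>) = prodfun (der I \<eta>)"
  by (simp add: mderiv_eq partials_prodfun[OF assms(1)] assms(2) count_mi_list cong: der_cong_count)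
    (metis assms(2) count_mi_list der_cong_count)

lemma finite_mi_order_le: "finite {\<beta> :: nat^'d::finite. mi_order \<beta> \<le> k}"
proof -
  have "{\<beta> :: nat^'d. mi_order \<beta> \<le> k} \<subseteq> vec_lambda ` (PiE UNIV (\<lambda>_. {..k}))"
  proof
    fix \<beta> :: "nat^'d" assume "\<beta> \<in> {\<beta>. mi_order \<beta> \<le> k}"
    then have "\<beta> $ i \<le> k" for i
      using member_le_sum[of i UNIV "\<lambda>i. \<beta> $ i"] by (auto simp: mi_order_def)
    then show "\<beta> \<in> vec_lambda ` (PiE UNIV (\<lambda>_. {..k}))"
      by (intro image_eqI[of _ _ "vec_nth \<beta>"]) auto
  qed
  then show ?thesis by (rule finite_subset) (auto intro!: finite_imageI finite_PiE)
qed

section \<open>Integration by parts and vanishing integrals\<close>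

subsection \<open>Affine substitutions\<close>

lemma nn_integral_affine_vec:
  fixes f :: "real^'d \<Rightarrow> ennreal"
  assumes [measurable]: "f \<in> borel_measurable borel" and "\<rho> > 0"
  shows "(\<integral>\<^sup>+y. f y \<partial>lborel) = ennreal (\<rho> ^ CARD('d)) * (\<integral>\<^sup>+z. f (t + \<rho> *\<^sub>R z) \<partial>lborel)"
proof -
  have "(\<integral>\<^sup>+y. f y \<partial>lborel) = (\<integral>\<^sup>+y. f y \<partial>density (distr lborel borel (\<lambda>x. t + \<rho> *\<^sub>R x)) (\<lambda>_. \<bar>\<rho>\<bar>^DIM(real^'d)))"
    using assms(2) by (subst lborel_affine[of \<rho> t]) auto
  also have "\<dots> = (\<integral>\<^sup>+z. ennreal (\<bar>\<rho>\<bar>^DIM(real^'d)) * f (t + \<rho> *\<^sub>R z) \<partial>lborel)"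
    by (subst nn_integral_density) (auto simp: nn_integral_distr)
  also have "\<dots> = ennreal (\<rho> ^ CARD('d)) * (\<integral>\<^sup>+z. f (t + \<rho> *\<^sub>R z) \<partial>lborel)"
    using assms(2) by (subst nn_integral_cmult) auto
  finally show ?thesis .
qed

lemma integral_affine_vec:
  fixes f :: "real^'d \<Rightarrow> real"
  assumes [measurable]: "f \<in> borel_measurable borel" and "\<rho> > 0"
  shows "(\<integral>y. f y \<partial>lborel) = \<rho> ^ CARD('d) * (\<integral>z. f (t + \<rho> *\<^sub>R z) \<partial>lborel)"
proof -
  have "(\<integral>y. f y \<partial>lborel) = (\<integral>y. f y \<partial>density (distr lborel borel (\<lambda>x. t + \<rho> *\<^sub>R x)) (\<lambda>_. \<bar>\<rho>\<bar>^DIM(real^'d)))"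
    using assms(2) by (subst lborel_affine[of \<rho> t]) auto
  also have "\<dots> = (\<integral>z. (\<bar>\<rho>\<bar>^DIM(real^'d)) * f (t + \<rho> *\<^sub>R z) \<partial>lborel)"
    by (subst integral_density) (auto simp: integral_distr)
  also have "\<dots> = \<rho> ^ CARD('d) * (\<integral>z. f (t + \<rho> *\<^sub>R z) \<partial>lborel)"
    using assms(2) by simp
  finally show ?thesis .
qed

lemma integral_translate_vec:
  fixes f :: "real^'d \<Rightarrow> real"
  assumes [measurable]: "f \<in> borel_measurable borel"
  shows "(\<integral>z. f (z + t) \<partial>lborel) = (\<integral>y. f y \<partial>lborel)"
  using integral_affine_vec[OF assms, of 1 t] by (simp add: add.commute)

lemma integrable_bounded_cbox:
  fixes f :: "real^'d \<Rightarrow> real"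
  assumes [measurable]: "f \<in> borel_measurable borel"
    and "\<And>x. x \<notin> cbox l u \<Longrightarrow> f x = 0" "\<And>x. \<bar>f x\<bar> \<le> C"
  shows "integrable lborel f"
proof (rule Bochner_Integration.integrable_bound)
  show "integrable lborel (\<lambda>x. indicator (cbox l u) x * C :: real)"
    by (intro integrable_mult_left integrable_real_indicator) (auto simp: emeasure_lborel_cbox_eq)
  show "AE x in lborel. norm (f x) \<le> norm (indicator (cbox l u) x * C)"
    using assms(2,3) by (intro AE_I2) (force simp: indicator_def split: if_splits intro: order_trans[OF assms(3) abs_ge_self])
qed auto

subsection \<open>Integration by parts\<close>

text \<open>By translation invariance the difference quotients of \<open>P\<close> have integral zero, and they converge
  boundedly to \<open>P'\<close>.\<close>

lemma integral_partial_eq_0: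
  fixes P P' :: "real^'d \<Rightarrow> real"
  assumes cP: "continuous_on UNIV P" and cP': "continuous_on UNIV P'"
    and der: "\<And>x. ((\<lambda>s. P (x + s *\<^sub>R axis i 1)) has_real_derivative P' x) (at 0)"
    and out: "\<And>x. x \<notin> cbox l u \<Longrightarrow> P x = 0"
    and bd: "\<And>x. \<bar>P' x\<bar> \<le> C"
  shows "(\<integral>x. P' x \<partial>lborel) = 0"
proof -
  define e :: "real^'d" where "e = axis i 1"
  have [measurable]: "P \<in> borel_measurable borel" "P' \<in> borel_measurable borel"
    using cP cP' by (auto intro: borel_measurable_continuous_onI)
  have C: "C \<ge> 0" using bd[of 0] by linarith
  have lip: "\<bar>P (x + s *\<^sub>R e) - P x\<bar> \<le> C * s" if "s \<ge> 0" for x s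
  proof -
    have d: "((\<lambda>s. P (x + s *\<^sub>R e)) has_real_derivative P' (x + r *\<^sub>R e)) (at r)" for r
      using DERIV_shift[of "\<lambda>s. P (x + s *\<^sub>R e)" "P' (x + r *\<^sub>R e)" 0 r] der[of "x + r *\<^sub>R e"]
      by (simp add: e_def algebra_simps)
    show ?thesis
    proof (cases "s = 0")
      case False
      with that have "0 < s" by simp
      from MVT2[OF this d] obtain z where "P (x + s *\<^sub>R e) - P (x + 0 *\<^sub>R e) = (s - 0) * P' (x + z *\<^sub>R e)" by blast
      then have "\<bar>P (x + s *\<^sub>R e) - P x\<bar> = s * \<bar>P' (x + z *\<^sub>R e)\<bar>" using that by (simp add: abs_mult)
      also have "\<dots> \<le> s * C" by (intro mult_left_mono bd that)
      finally show ?thesis by (simp add: mult.commute)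
    qed simp
  qed
  define l' u' where "l' = l - (\<chi> i. 1)" and "u' = u + (\<chi> i. 1)"
  let ?q = "\<lambda>n x. real (Suc n) * (P (x + (1 / real (Suc n)) *\<^sub>R e) - P x)"
  have int: "integrable lborel P"
  proof -
    have "set_integrable lborel (cbox l u) P"
      unfolding set_integrable_def
      by (intro borel_integrable_compact compact_cbox continuous_on_subset[OF cP]) auto
    moreover have "(\<lambda>x. indicator (cbox l u) x *\<^sub>R P x) = P"
      using out by (auto simp: fun_eq_iff indicator_def)
    ultimately show ?thesis by (simp add: set_integrable_def)
  qed
  have int': "integrable lborel (\<lambda>x. P (x + t))" for t
  proof -
    have "integrable (distr lborel borel ((+) t)) P" using int by (simp add: lborel_distr_plus)
    then show ?thesis by (subst (asm) integrable_distr_eq) (auto simp: add.commute)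
  qed
  have "(\<lambda>n. \<integral>x. ?q n x \<partial>lborel) \<longlonglongrightarrow> (\<integral>x. P' x \<partial>lborel)"
  proof (rule integral_dominated_convergence)
    show "integrable lborel (\<lambda>x. indicator (cbox l' u') x * C :: real)"
      by (intro integrable_mult_left integrable_real_indicator) (auto simp: emeasure_lborel_cbox_eq)
    show "AE x in lborel. (\<lambda>n. ?q n x) \<longlonglongrightarrow> P' x"
    proof (rule AE_I2)
      fix x
      have "((\<lambda>h. (P (x + h *\<^sub>R e) - P x) / h) \<longlongrightarrow> P' x) (at 0)"
        using der[of x] by (simp add: DERIV_def e_def)
      moreover have "filterlim (\<lambda>n. 1 / real (Suc n)) (at 0) sequentially"
        using LIMSEQ_inverse_real_of_nat by (auto simp: filterlim_at inverse_eq_divide)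
      ultimately have "(\<lambda>n. (P (x + (1 / real (Suc n)) *\<^sub>R e) - P x) / (1 / real (Suc n))) \<longlonglongrightarrow> P' x"
        by (rule filterlim_compose)
      then show "(\<lambda>n. ?q n x) \<longlonglongrightarrow> P' x" by (simp add: mult.commute)
    qed
    show "AE x in lborel. norm (?q n x) \<le> indicator (cbox l' u') x * C" for n
    proof (rule AE_I2)
      fix x
      show "norm (?q n x) \<le> indicator (cbox l' u') x * C"
      proof (cases "x \<in> cbox l' u'")
        case True
        have "norm (?q n x) \<le> real (Suc n) * (C * (1 / real (Suc n)))"
          unfolding real_norm_def abs_mult using lip[of "1 / real (Suc n)" x] by (intro mult_mono) auto
        then show ?thesis using True by simp
      next
        case False
        then obtain j where j: "x $ j < l $ j - 1 \<or> x $ j > u $ j + 1"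
          by (auto simp: mem_box_cart l'_def u'_def not_le)
        have "\<bar>((1 / real (Suc n)) *\<^sub>R e) $ j\<bar> \<le> 1" by (auto simp: e_def axis_def)
        with j have "(x + (1 / real (Suc n)) *\<^sub>R e) $ j \<notin> {l $ j..u $ j}" "x $ j \<notin> {l $ j..u $ j}"
          unfolding vector_add_component atLeastAtMost_iff by linarith+
        then have "x + (1 / real (Suc n)) *\<^sub>R e \<notin> cbox l u" "x \<notin> cbox l u"
          unfolding mem_box_cart atLeastAtMost_iff by blast+
        then show ?thesis using False by (simp add: out)
      qed
    qed
  qed auto
  moreover have "(\<integral>x. ?q n x \<partial>lborel) = 0" for n
    using int' int by (simp add: integral_translate_vec del: of_nat_Suc)
  ultimately show ?thesis by (simp add: LIMSEQ_unique)
qed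

text \<open>The class \<open>C\<^sup>k\<close> on \<open>U\<close>, with the lists of directions as they occur in the iterated operator; lists with
  the same multiplicities are not identified.\<close>

definition partials_upto :: "(real^'d) set \<Rightarrow> nat \<Rightarrow> (real^'d \<Rightarrow> real) \<Rightarrow> bool" where
  "partials_upto U k v \<longleftrightarrow>
    (\<forall>I. length I \<le> k \<longrightarrow> continuous_on U (partials I v)) \<and>
    (\<forall>I i t. length I < k \<longrightarrow> t \<in> U \<longrightarrow>
      ((\<lambda>s. partials I v (t + s *\<^sub>R axis i 1)) has_real_derivative partials (i # I) v t) (at 0))"

lemma partials_upto_partials:
  assumes "partials_upto U (k + length J) v"
  shows "partials_upto U k (partials J v)"
  unfolding partials_upto_def partials_append[symmetric]
proof (intro conjI allI impI)
  fix I :: "'a list" and i and t :: "real^'a" assume "length I < k" "t \<in> U"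
  with assms have "((\<lambda>s. partials (I @ J) v (t + s *\<^sub>R axis i 1)) has_real_derivative partials (i # (I @ J)) v t) (at 0)"
    unfolding partials_upto_def by simp
  then show "((\<lambda>s. partials (I @ J) v (t + s *\<^sub>R axis i 1)) has_real_derivative partials ((i # I) @ J) v t) (at 0)"
    by simp
qed (use assms in \<open>simp add: partials_upto_def\<close>)

lemma continuous_zero_extension:
  fixes F :: "'a::topological_space \<Rightarrow> real"
  assumes "open U" "closed S" "S \<subseteq> U" "continuous_on U F" "\<And>x. x \<notin> S \<Longrightarrow> F x = 0"
  shows "continuous_on UNIV F"
proof -
  have "continuous_on (- S) F"
    using assms(5) by (subst continuous_on_cong[of _ "- S" _ "\<lambda>_. 0"]) auto
  then have "continuous_on (U \<union> - S) F"
    using assms by (intro continuous_on_open_Un) auto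
  moreover have "U \<union> - S = UNIV" using assms(3) by auto
  ultimately show ?thesis by simp
qed

lemma set_lebesgue_integral_zero_outside:
  fixes f :: "'a::euclidean_space \<Rightarrow> real"
  assumes "\<And>x. x \<notin> U \<Longrightarrow> f x = 0"
  shows "(LINT x:U|lborel. f x) = (\<integral>x. f x \<partial>lborel)"
  unfolding set_lebesgue_integral_def using assms
  by (intro Bochner_Integration.integral_cong) (auto simp: indicator_def)

lemma eventually_on_line:
  assumes "open T" "t \<in> T"
  shows "eventually (\<lambda>s::real. t + s *\<^sub>R axis i 1 \<in> (T :: (real^'d) set)) (nhds 0)"
proof -
  have "continuous_on UNIV (\<lambda>s. t + s *\<^sub>R axis i 1 :: real^'d)" by (intro continuous_intros)
  then have "open ((\<lambda>s. t + s *\<^sub>R axis i 1) -` T)" using assms(1) by (intro open_vimage)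
  then have "eventually (\<lambda>s. s \<in> (\<lambda>s. t + s *\<^sub>R axis i 1) -` T) (nhds 0)"
    using assms(2) by (intro eventually_nhds_in_open) auto
  then show ?thesis by simp
qed

text \<open>The product \<open>F G\<close> extends by zero to a \<open>C\<^sup>1\<close> function on the whole space, whose partial derivative has
  integral zero.\<close>

lemma integral_by_parts_partial:
  fixes F F' G G' :: "real^'d \<Rightarrow> real"
  assumes "open U" "compact S" "S \<subseteq> U"
    and cF: "continuous_on U F" "continuous_on U F'"
    and cG: "continuous_on UNIV G" "continuous_on UNIV G'"
    and dF: "\<And>x. x \<in> U \<Longrightarrow> ((\<lambda>s. F (x + s *\<^sub>R axis i 1)) has_real_derivative F' x) (at 0)"
    and dG: "\<And>x. ((\<lambda>s. G (x + s *\<^sub>R axis i 1)) has_real_derivative G' x) (at 0)"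
    and out: "\<And>x. x \<notin> S \<Longrightarrow> G x = 0" "\<And>x. x \<notin> S \<Longrightarrow> G' x = 0"
  shows "(LINT x:U|lborel. F x * G' x) = - (LINT x:U|lborel. F' x * G x)"
proof -
  have clS: "closed S" by (rule compact_imp_closed[OF assms(2)])
  obtain l u where lu: "S \<subseteq> cbox l u"
    using bounded_subset_cbox_symmetric[OF compact_imp_bounded[OF assms(2)]] by blast
  have cU: "continuous_on U G" "continuous_on U G'"
    using cG by (auto intro: continuous_on_subset)
  have outU: "\<And>x. x \<notin> U \<Longrightarrow> G x = 0" "\<And>x. x \<notin> U \<Longrightarrow> G' x = 0"
    using out assms(3) by blast+
  have c: "continuous_on UNIV (\<lambda>x. F x * G x)" "continuous_on UNIV (\<lambda>x. F x * G' x)"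
    "continuous_on UNIV (\<lambda>x. F' x * G x)"
    by (rule continuous_zero_extension[OF assms(1) clS assms(3)];
        auto intro!: continuous_intros cF cU simp: out)+
  have bdd: "\<exists>C. \<forall>x. \<bar>Q x\<bar> \<le> C" if "continuous_on UNIV Q" "\<And>x. x \<notin> S \<Longrightarrow> Q x = 0" for Q :: "real^'d \<Rightarrow> real"
  proof -
    have "bounded (Q ` S)"
      using that assms(2) by (intro compact_imp_bounded compact_continuous_image) (auto intro: continuous_on_subset)
    then obtain C where "\<And>x. x \<in> S \<Longrightarrow> \<bar>Q x\<bar> \<le> C" by (auto simp: bounded_iff)
    with that(2) have "\<bar>Q x\<bar> \<le> \<bar>C\<bar>" for x by (cases "x \<in> S") force+
    then show ?thesis by blast
  qed
  have int: "integrable lborel Q" if Q: "continuous_on UNIV Q" "\<And>x. x \<notin> S \<Longrightarrow> Q x = 0" for Q :: "real^'d \<Rightarrow> real"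
  proof -
    obtain C where "\<forall>x. \<bar>Q x\<bar> \<le> C" using bdd[OF Q] by blast
    then show ?thesis
      using Q lu by (intro integrable_bounded_cbox[of Q l u C] borel_measurable_continuous_onI) auto
  qed
  have der: "((\<lambda>s. F (x + s *\<^sub>R axis i 1) * G (x + s *\<^sub>R axis i 1)) has_real_derivative F' x * G x + F x * G' x) (at 0)" for x
  proof (cases "x \<in> S")
    case True
    with assms(3) have "x \<in> U" by auto
    show ?thesis using DERIV_mult[OF dF[OF \<open>x \<in> U\<close>] dG[of x]] by (simp add: algebra_simps)
  next
    case False
    have "eventually (\<lambda>s. x + s *\<^sub>R axis i 1 \<in> - S) (nhds 0)"
      by (rule eventually_on_line) (use clS False in auto)
    then have "eventually (\<lambda>s. F (x + s *\<^sub>R axis i 1) * G (x + s *\<^sub>R axis i 1) = 0) (nhds 0)"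
      by eventually_elim (simp add: out)
    then have "((\<lambda>s. F (x + s *\<^sub>R axis i 1) * G (x + s *\<^sub>R axis i 1)) has_real_derivative 0) (at 0)"
      by (subst DERIV_cong_ev[where g = "\<lambda>_. 0"]) auto
    then show ?thesis using False by (simp add: out)
  qed
  have cc: "continuous_on UNIV (\<lambda>x. F' x * G x + F x * G' x)"
    using c by (intro continuous_on_add)
  obtain C where C: "\<forall>x. \<bar>F' x * G x + F x * G' x\<bar> \<le> C" using bdd[OF cc] out by auto
  have "(\<integral>x. F' x * G x + F x * G' x \<partial>lborel) = 0"
    using der lu out C by (intro integral_partial_eq_0[OF c(1) cc, of i l u C]) auto
  moreover have "(\<integral>x. F' x * G x + F x * G' x \<partial>lborel) = (\<integral>x. F' x * G x \<partial>lborel) + (\<integral>x. F x * G' x \<partial>lborel)"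
    using c out by (intro Bochner_Integration.integral_add int) auto
  moreover have "(LINT x:U|lborel. F x * G' x) = (\<integral>x. F x * G' x \<partial>lborel)"
    "(LINT x:U|lborel. F' x * G x) = (\<integral>x. F' x * G x \<partial>lborel)"
    by (rule set_lebesgue_integral_zero_outside, simp add: outU)+
  ultimately show ?thesis by simp
qed

lemma partial_has_derivative:
  assumes "\<psi> differentiable (at x)"
  shows "((\<lambda>s. \<psi> (x + s *\<^sub>R axis i 1)) has_real_derivative partial i \<psi> x) (at 0)"
proof -
  obtain D where D: "(\<psi> has_derivative D) (at x)" using assms by (auto simp: differentiable_def)
  have "((\<lambda>s::real. x + s *\<^sub>R axis i 1 :: real^'a) has_derivative (\<lambda>s. s *\<^sub>R axis i 1)) (at 0)"
    by (auto intro!: derivative_eq_intros)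
  from has_derivative_compose[OF this, of \<psi> D] D
  have "((\<lambda>s. \<psi> (x + s *\<^sub>R axis i 1)) has_derivative (\<lambda>s. D (s *\<^sub>R axis i 1))) (at 0)" by simp
  moreover have "(\<lambda>s. D (s *\<^sub>R axis i 1)) = (*) (D (axis i 1))"
    using linear_scale[OF has_derivative_linear[OF D]] by (auto simp: fun_eq_iff)
  ultimately have "((\<lambda>s. \<psi> (x + s *\<^sub>R axis i 1)) has_real_derivative D (axis i 1)) (at 0)"
    by (simp add: has_field_derivative_def)
  then show ?thesis by (simp add: partial_def DERIV_imp_deriv)
qed

lemma partials_zero_outside:
  assumes "closed S" "\<And>x. x \<notin> S \<Longrightarrow> \<phi> x = 0" "x \<notin> S"
  shows "partials I \<phi> x = 0"
  using assms(3)
proof (induction I arbitrary: x)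
  case (Cons i I)
  have "eventually (\<lambda>s. x + s *\<^sub>R axis i 1 \<in> - S) (nhds 0)"
    by (rule eventually_on_line) (use assms(1) Cons.prems in auto)
  then have "eventually (\<lambda>s. partials I \<phi> (x + s *\<^sub>R axis i 1) = 0) (nhds 0)"
    by eventually_elim (simp add: Cons.IH)
  then have "((\<lambda>s. partials I \<phi> (x + s *\<^sub>R axis i 1)) has_real_derivative 0) (at 0)"
    by (subst DERIV_cong_ev[where g = "\<lambda>_. 0"]) auto
  then have "deriv (\<lambda>s. partials I \<phi> (x + s *\<^sub>R axis i 1)) 0 = 0" by (rule DERIV_imp_deriv)
  then show ?case by (simp add: partials_Cons partial_def)
qed (simp add: assms)

text \<open>Each step moves the outermost derivative of \<open>\<phi>\<close> to the innermost place on \<open>F\<close>; hence the reversed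
  list.\<close>

lemma integral_by_parts_partials:
  fixes F :: "real^'d \<Rightarrow> real"
  assumes "open U" "test_fun U \<phi>" "partials_upto U (length I) F"
  shows "(LINT x:U|lborel. F x * partials I \<phi> x) = (- 1) ^ length I * (LINT x:U|lborel. partials (rev I) F x * \<phi> x)"
  using assms(3)
proof (induction I arbitrary: F)
  case (Cons i I)
  let ?S = "closure {x. \<phi> x \<noteq> 0}"
  have S: "compact ?S" "?S \<subseteq> U" and diff: "\<And>J x. partials J \<phi> differentiable (at x)"
    using assms(2) by (auto simp: test_fun_def)
  have out: "partials J \<phi> x = 0" if "x \<notin> ?S" for J x
    using that closure_subset[of "{x. \<phi> x \<noteq> 0}"] by (intro partials_zero_outside[of ?S]) auto
  have cont: "continuous_on UNIV (partials J \<phi>)" for J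
    by (meson continuous_at_imp_continuous_on diff differentiable_imp_continuous_within)
  have F: "continuous_on U F" "continuous_on U (partials [i] F)"
    "\<And>x. x \<in> U \<Longrightarrow> ((\<lambda>s. F (x + s *\<^sub>R axis i 1)) has_real_derivative partials [i] F x) (at 0)"
    using Cons.prems unfolding partials_upto_def
    by (metis length_Cons le0 list.size(3) partials_Nil,
        metis length_Cons le0 list.size(3) Suc_le_mono One_nat_def,
        metis length_Cons list.size(3) partials_Nil zero_less_Suc)
  have "(LINT x:U|lborel. F x * partials (i # I) \<phi> x) = - (LINT x:U|lborel. partials [i] F x * partials I \<phi> x)"
    using partial_has_derivative[OF diff, of I]
    by (intro integral_by_parts_partial[OF assms(1) S F(1,2) cont cont F(3)] out)
      (simp_all add: partials_Cons[of i I])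
  also have "(LINT x:U|lborel. partials [i] F x * partials I \<phi> x)
    = (- 1) ^ length I * (LINT x:U|lborel. partials (rev I) (partials [i] F) x * \<phi> x)"
    using Cons.prems by (intro Cons.IH partials_upto_partials) simp
  finally show ?case by (simp add: partials_append)
qed simp

lemma partials_upto_prodfun:
  assumes "\<And>i. smooth (\<eta> i)"
  shows "partials_upto U k (prodfun \<eta>)"
  unfolding partials_upto_def
proof (intro conjI allI impI)
  fix I :: "'a list" and i and t :: "real^'a"
  show "((\<lambda>s. partials I (prodfun \<eta>) (t + s *\<^sub>R axis i 1)) has_real_derivative partials (i # I) (prodfun \<eta>) t) (at 0)"
    using prodfun_has_partial_derivative[OF smooth_der[OF assms, of I]]
    by (simp add: partials_prodfun[OF assms] der_Cons[of i I])
qed (simp add: partials_prodfun[OF assms] prodfun_continuous smooth_der assms)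

subsection \<open>Functions with vanishing integrals\<close>

lemma AE_zero_if_box_integrals_zero:
  fixes w :: "real^'d \<Rightarrow> real"
  assumes int: "integrable lborel w" and tot: "(\<integral>x. w x \<partial>lborel) = 0"
    and box: "\<And>a b. (LINT x:box a b|lborel. w x) = 0"
  shows "AE x in lborel. w x = 0"
proof -
  have si: "set_integrable lborel A w" if "A \<in> sets borel" for A
    unfolding set_integrable_def using that int by (intro integrable_mult_indicator) auto
  have sig: "sets borel = sigma_sets UNIV (range (\<lambda>(a, b). box a b :: (real^'d) set))"
    by (subst borel_eq_box) simp
  have IS: "Int_stable (range (\<lambda>(a, b). box a b :: (real^'d) set))" "range (\<lambda>(a, b). box a b :: (real^'d) set) \<subseteq> Pow UNIV"
    by (auto simp: Int_stable_def box_Int_box)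
  have *: "(LINT x:A|lborel. w x) = 0" if "A \<in> sigma_sets UNIV (range (\<lambda>(a, b). box a b))" for A
    using that
  proof (induction rule: sigma_sets_induct_disjoint[OF IS, consumes 1, case_names basic empty compl union])
    case (union A)
    have A: "A i \<in> sets borel" for i using union(2) by (auto simp: sig)
    have "(LINT x:(\<Union>i. A i)|lborel. w x) = (\<Sum>i. LINT x:A i|lborel. w x)"
      using A union(1) by (intro lebesgue_integral_countable_add si) (auto simp: disjoint_family_on_def)
    then show ?case using union by simp
  next
    case (compl A)
    have A: "A \<in> sets borel" using compl(1) by (simp add: sig)
    have "(LINT x:UNIV|lborel. w x) = (LINT x:A|lborel. w x) + (LINT x:-A|lborel. w x)"
      using A by (subst set_integral_Un[symmetric]) (auto intro: si)
    then show ?case using compl tot by (simp add: Compl_eq_Diff_UNIV set_lebesgue_integral_def)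
  qed (use box in \<open>auto simp: set_lebesgue_integral_def\<close>)
  have "(LINT x:A|lborel. w x) = (LINT x:A|lborel. 0)" if "A \<in> sets lborel" for A
  proof -
    have "A \<in> sigma_sets UNIV (range (\<lambda>(a, b). box a b))"
      using that by (simp add: sig)
    then show ?thesis using * by simp
  qed
  from density_unique_real[OF int _ this] show ?thesis by simp
qed

lemma cutoff_seq_tendsto: "(\<lambda>n. cutoff (real (Suc n) * x)) \<longlonglongrightarrow> (if x > 0 then 1 else 0)"
proof (cases "x > 0")
  case True
  have "(\<lambda>n. exp (- (inverse (real (Suc n)) * (1 / x)))) \<longlonglongrightarrow> exp (- (0 * (1 / x)))"
    by (intro tendsto_intros LIMSEQ_inverse_real_of_nat)
  moreover have "cutoff (real (Suc n) * x) = exp (- (inverse (real (Suc n)) * (1 / x)))" for n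
    using True by (simp add: cutoff_eq field_simps del: of_nat_Suc)
  ultimately show ?thesis using True by simp
next
  case False
  then have "\<not> real (Suc n) * x > 0" for n by (simp add: zero_less_mult_iff)
  then show ?thesis using False by (simp add: cutoff_eq)
qed

text \<open>Products of smooth cutoffs converge boundedly to the indicator of an open box, so \<open>w\<close> integrates to
  zero over every box whose closure lies in \<open>U\<close>. Such boxes generate the Borel subsets of \<open>U\<close>.\<close>

lemma annihilated_imp_AE_zero:
  fixes w :: "real^'d \<Rightarrow> real"
  assumes "open U" and loc: "locally_integrable U w"
    and ann: "\<And>\<eta> l u. bumpfam l u \<eta> \<Longrightarrow> cbox l u \<subseteq> U \<Longrightarrow> (LINT x:U|lborel. w x * prodfun \<eta> x) = 0"
  shows "AE x in lborel. x \<in> U \<longrightarrow> w x = 0"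
proof -
  have box0: "(LINT x:box a b|lborel. w x) = 0" if ab: "cbox a b \<subseteq> U" for a b
  proof -
    define \<eta> where "\<eta> n i x = cutoff (real (Suc n) * (x - a $ i)) * cutoff (real (Suc n) * (b $ i - x))" for n i x
    have fam: "bumpfam a b (\<eta> n)" for n
    proof -
      have "smooth (\<eta> n i)" for i
      proof -
        have "smooth (\<lambda>x. cutoff (real (Suc n) * (x - a $ i)) * cutoff (real (Suc n) * (b $ i - x)))"
          using smooth_affine[OF smooth_flat, of 1 1 "real (Suc n)" "- real (Suc n) * a $ i"]
            smooth_affine[OF smooth_flat, of 1 1 "- real (Suc n)" "real (Suc n) * b $ i"]
          by (intro smooth_mult) (simp_all add: algebra_simps)
        then show ?thesis by (simp add: \<eta>_def[abs_def])
      qed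
      moreover have "\<eta> n i x = 0" if "x \<notin> {a $ i..b $ i}" for i x
        using that by (auto simp: \<eta>_def cutoff_eq zero_less_mult_iff)
      ultimately show ?thesis by (auto simp: bumpfam_def)
    qed
    have sm: "\<And>n i. smooth (\<eta> n i)" using fam by (rule bumpfam_smooth)
    have wint: "set_integrable lborel (cbox a b) w" using loc ab by (auto simp: locally_integrable_def)
    then have wint': "integrable lborel (\<lambda>x. indicator (cbox a b) x * w x)" by (simp add: set_integrable_def)
    have [measurable]: "prodfun (\<eta> n) \<in> borel_measurable borel" for n by (rule prodfun_measurable[OF sm])
    have lim: "(\<lambda>n. \<integral>x. indicator (cbox a b) x * w x * prodfun (\<eta> n) x \<partial>lborel) \<longlonglongrightarrow> (\<integral>x. indicator (box a b) x * w x \<partial>lborel)"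
    proof (rule integral_dominated_convergence[where w = "\<lambda>x. \<bar>indicator (cbox a b) x * w x\<bar>"])
      show "(\<lambda>x. indicator (box a b) x * w x) \<in> borel_measurable lborel"
      proof -
        have "(\<lambda>x. indicator (box a b) x * (indicator (cbox a b) x * w x)) \<in> borel_measurable lborel"
          using borel_measurable_integrable[OF wint'] by measurable
        moreover have "indicator (box a b) x * (indicator (cbox a b) x * w x) = indicator (box a b) x * w x" for x
          using box_subset_cbox[of a b] by (auto simp: indicator_def)
        ultimately show ?thesis by simp
      qed
      show "(\<lambda>x. indicator (cbox a b) x * w x * prodfun (\<eta> n) x) \<in> borel_measurable lborel" for n
        using borel_measurable_integrable[OF wint'] by measurable
      show "integrable lborel (\<lambda>x. \<bar>indicator (cbox a b) x * w x\<bar>)"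
        using wint' by (rule integrable_abs)
      show "AE x in lborel. (\<lambda>n. indicator (cbox a b) x * w x * prodfun (\<eta> n) x) \<longlonglongrightarrow> indicator (box a b) x * w x"
      proof (rule AE_I2)
        fix x
        have "(\<lambda>n. prodfun (\<eta> n) x) \<longlonglongrightarrow> (\<Prod>i\<in>UNIV. (if x $ i - a $ i > 0 then 1 else 0) * (if b $ i - x $ i > 0 then 1 else 0))"
          unfolding prodfun_def \<eta>_def by (intro tendsto_prod tendsto_mult cutoff_seq_tendsto)
        moreover have "(\<Prod>i\<in>UNIV. (if x $ i - a $ i > 0 then 1 else 0) * (if b $ i - x $ i > 0 then 1 else 0)) = (indicator (box a b) x :: real)"
        proof (cases "x \<in> box a b")
          case False
          then obtain j where "\<not> (a $ j < x $ j \<and> x $ j < b $ j)" by (auto simp: mem_box_cart)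
          then show ?thesis using False by (intro trans[OF prod_zero]) (auto intro!: exI[of _ j])
        qed (auto simp: mem_box_cart)
        ultimately have "(\<lambda>n. indicator (cbox a b) x * w x * prodfun (\<eta> n) x) \<longlonglongrightarrow> indicator (cbox a b) x * w x * indicator (box a b) x"
          by (intro tendsto_mult_left) simp
        moreover have "indicator (cbox a b) x * w x * indicator (box a b) x = indicator (box a b) x * w x"
          using box_subset_cbox[of a b] by (auto simp: indicator_def)
        ultimately show "(\<lambda>n. indicator (cbox a b) x * w x * prodfun (\<eta> n) x) \<longlonglongrightarrow> indicator (box a b) x * w x"
          by simp
      qed
      show "AE x in lborel. norm (indicator (cbox a b) x * w x * prodfun (\<eta> n) x) \<le> \<bar>indicator (cbox a b) x * w x\<bar>" for n
      proof (rule AE_I2)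
        fix x
        have "0 \<le> \<eta> n i y" "\<eta> n i y \<le> 1" for i y
          by (auto simp: \<eta>_def intro!: mult_le_one mult_nonneg_nonneg cutoff_range)
        then have "\<bar>prodfun (\<eta> n) x\<bar> \<le> 1"
          unfolding prodfun_def abs_prod by (intro prod_le_1) auto
        then show "norm (indicator (cbox a b) x * w x * prodfun (\<eta> n) x) \<le> \<bar>indicator (cbox a b) x * w x\<bar>"
          by (simp add: abs_mult mult_left_le)
      qed
    qed
    have "(\<integral>x. indicator (cbox a b) x * w x * prodfun (\<eta> n) x \<partial>lborel) = (LINT x:U|lborel. w x * prodfun (\<eta> n) x)" for n
      unfolding set_lebesgue_integral_def using prodfun_zero_outside[OF fam] ab
      by (intro Bochner_Integration.integral_cong) (auto simp: indicator_def)
    then have zero: "(\<integral>x. indicator (cbox a b) x * w x * prodfun (\<eta> n) x \<partial>lborel) = 0" for n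
      by (simp only: ann[OF fam ab])
    have "(\<integral>x. indicator (box a b) x * w x \<partial>lborel) = 0"
      using lim unfolding zero LIMSEQ_const_iff by (rule sym)
    then show ?thesis by (simp add: set_lebesgue_integral_def)
  qed
  have AE_box: "AE x in lborel. x \<in> box a b \<longrightarrow> w x = 0" if ab: "cbox a b \<subseteq> U" for a b
  proof -
    have "set_integrable lborel (box a b) w"
    proof (rule set_integrable_subset)
      show "set_integrable lborel (cbox a b) w"
        using loc ab compact_cbox unfolding locally_integrable_def by blast
    qed (simp_all add: box_subset_cbox)
    then have "integrable lborel (\<lambda>x. indicator (box a b) x * w x)" by (simp add: set_integrable_def)
    moreover have "(LINT x:box a' b'|lborel. indicator (box a b) x * w x) = 0" for a' b'
    proof -
      obtain a'' b'' where eq: "box a' b' \<inter> box a b = box a'' b''" by (auto simp: box_Int_box)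
      have "(LINT x:box a' b'|lborel. indicator (box a b) x * w x) = (LINT x:box a'' b''|lborel. w x)"
        unfolding set_lebesgue_integral_def eq[symmetric]
        by (intro Bochner_Integration.integral_cong) (auto simp: indicator_def)
      also have "\<dots> = 0"
      proof (cases "box a'' b'' = {}")
        case True then show ?thesis by (simp add: set_lebesgue_integral_def)
      next
        case False
        have "cbox a'' b'' = closure (box a'' b'')" using False by simp
        also have "\<dots> \<subseteq> closure (box a b)" unfolding eq[symmetric] by (intro closure_mono) blast
        also have "\<dots> \<subseteq> cbox a b" by (intro closure_minimal box_subset_cbox closed_cbox)
        finally show ?thesis using ab by (intro box0) blast
      qed
      finally show ?thesis .
    qed
    moreover have "(\<integral>x. indicator (box a b) x * w x \<partial>lborel) = 0"
      using box0[OF ab] by (simp add: set_lebesgue_integral_def)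
    ultimately have "AE x in lborel. indicator (box a b) x * w x = 0"
      by (intro AE_zero_if_box_integrals_zero)
    then show ?thesis by eventually_elim (simp add: indicator_def of_bool_def split: if_splits)
  qed
  obtain D where D: "countable D" "D \<subseteq> Pow U" "\<And>X. X \<in> D \<Longrightarrow> \<exists>a b. X = cbox a b" "\<Union>D = U"
    by (rule open_countable_Union_open_cbox[OF assms(1)]) (rule that)
  have null: "cbox a b - box a b \<in> null_sets lborel" for a b :: "real^'d"
  proof -
    have "emeasure lborel (cbox a b - box a b) = emeasure lborel (cbox a b) - emeasure lborel (box a b)"
      by (rule emeasure_Diff) (auto simp: emeasure_lborel_box_eq box_subset_cbox)
    also have "\<dots> = 0" by (simp add: emeasure_lborel_box_eq emeasure_lborel_cbox_eq)
    finally show ?thesis by (auto simp: null_sets_def)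
  qed
  have "AE x in lborel. \<forall>X\<in>D. x \<in> X \<longrightarrow> w x = 0"
  proof (subst AE_ball_countable[OF D(1)], intro ballI)
    fix X assume X: "X \<in> D"
    then obtain a b where ab: "X = cbox a b" using D(3) by blast
    have "AE x in lborel. x \<notin> cbox a b - box a b" by (rule AE_not_in[OF null])
    moreover have "AE x in lborel. x \<in> box a b \<longrightarrow> w x = 0" using D(2) X ab by (intro AE_box) blast
    ultimately show "AE x in lborel. x \<in> X \<longrightarrow> w x = 0"
      unfolding ab by eventually_elim auto
  qed
  then show ?thesis by eventually_elim (use D(4) in blast)
qed

section \<open>Rescaled bumps in the Sobolev space\<close>

subsection \<open>Weak derivatives\<close>

lemma locally_integrable_mult_prodfun:
  assumes loc: "locally_integrable U g" and b: "bumpfam l u \<eta>" and sub: "cbox l u \<subseteq> U"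
  shows "integrable lborel (\<lambda>x. g x * prodfun \<eta> x)"
    and "(LINT x:U|lborel. g x * prodfun \<eta> x) = (\<integral>x. g x * prodfun \<eta> x \<partial>lborel)"
proof -
  have out: "prodfun \<eta> x = 0" if "x \<notin> cbox l u" for x using prodfun_zero_outside[OF b that] .
  obtain C where C: "C > 0" "\<And>x. \<bar>prodfun \<eta> x\<bar> \<le> C" using prodfun_bounded[OF b] by blast
  have int: "integrable lborel (\<lambda>x. indicator (cbox l u) x * g x)"
    using loc sub compact_cbox unfolding locally_integrable_def set_integrable_def real_scaleR_def by blast
  have [measurable]: "prodfun \<eta> \<in> borel_measurable borel"
    by (rule prodfun_measurable[OF bumpfam_smooth[OF b]])
  have meas: "(\<lambda>x. indicator (cbox l u) x * g x * prodfun \<eta> x) \<in> borel_measurable lborel"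
    using borel_measurable_integrable[OF int] by measurable
  have "integrable lborel (\<lambda>x. indicator (cbox l u) x * g x * prodfun \<eta> x)"
  proof (rule Bochner_Integration.integrable_bound)
    show "integrable lborel (\<lambda>x. C * (indicator (cbox l u) x * g x))" using int by simp
    show "AE x in lborel. norm (indicator (cbox l u) x * g x * prodfun \<eta> x) \<le> norm (C * (indicator (cbox l u) x * g x))"
    proof (rule AE_I2)
      fix x
      have "norm (indicator (cbox l u) x * g x * prodfun \<eta> x) = \<bar>prodfun \<eta> x\<bar> * \<bar>indicator (cbox l u) x * g x\<bar>"
        by (simp only: real_norm_def abs_mult mult_ac)
      also have "\<dots> \<le> C * \<bar>indicator (cbox l u) x * g x\<bar>" by (intro mult_right_mono C) simp
      also have "\<dots> = norm (C * (indicator (cbox l u) x * g x))" using C(1) by (simp only: real_norm_def abs_mult abs_of_pos)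
      finally show "norm (indicator (cbox l u) x * g x * prodfun \<eta> x) \<le> norm (C * (indicator (cbox l u) x * g x))" .
    qed
  qed (rule meas)
  moreover have "(\<lambda>x. indicator (cbox l u) x * g x * prodfun \<eta> x) = (\<lambda>x. g x * prodfun \<eta> x)"
    using out by (auto simp: fun_eq_iff indicator_def)
  ultimately show "integrable lborel (\<lambda>x. g x * prodfun \<eta> x)" by simp
  show "(LINT x:U|lborel. g x * prodfun \<eta> x) = (\<integral>x. g x * prodfun \<eta> x \<partial>lborel)"
    using out sub by (intro set_lebesgue_integral_zero_outside) auto
qed

text \<open>Uniqueness almost everywhere lets the chosen representative \<open>weak_deriv\<close> be replaced by any known weak
  derivative inside the Sobolev energy.\<close>

lemma weak_deriv_unique:
  assumes "open U" and g: "has_weak_deriv U \<beta> f g" and h: "has_weak_deriv U \<beta> f h"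
  shows "AE x in lborel. x \<in> U \<longrightarrow> g x = h x"
proof -
  have loc: "locally_integrable U g" "locally_integrable U h" using g h by (auto simp: has_weak_deriv_def)
  then have loc': "locally_integrable U (\<lambda>x. g x - h x)"
    unfolding locally_integrable_def by (auto intro: set_integral_diff(1))
  have "AE x in lborel. x \<in> U \<longrightarrow> g x - h x = 0"
  proof (rule annihilated_imp_AE_zero[OF assms(1) loc'])
    fix \<eta> l u assume b: "bumpfam l u \<eta>" "cbox l u \<subseteq> U"
    have "test_fun U (prodfun \<eta>)" by (rule prodfun_test_fun[OF b])
    with g h have "(- 1) ^ mi_order \<beta> * (LINT x:U|lborel. g x * prodfun \<eta> x) = (- 1) ^ mi_order \<beta> * (LINT x:U|lborel. h x * prodfun \<eta> x)"
      unfolding has_weak_deriv_def by metis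
    then have "(LINT x:U|lborel. g x * prodfun \<eta> x) = (LINT x:U|lborel. h x * prodfun \<eta> x)" by simp
    then show "(LINT x:U|lborel. (g x - h x) * prodfun \<eta> x) = 0"
      using locally_integrable_mult_prodfun[OF loc(1) b] locally_integrable_mult_prodfun[OF loc(2) b]
        locally_integrable_mult_prodfun(2)[OF loc' b]
      by (simp add: left_diff_distrib)
  qed
  then show ?thesis by simp
qed

lemma locally_integrable_continuous: "continuous_on U f \<Longrightarrow> locally_integrable U f"
  unfolding locally_integrable_def set_integrable_def
  by (intro allI impI borel_integrable_compact) (auto intro: continuous_on_subset)

lemma prodfun_has_weak_deriv:
  assumes "open U" "\<And>i. smooth (\<eta> i)"
  shows "has_weak_deriv U \<beta> (prodfun \<eta>) (prodfun (der (mi_list \<beta>) \<eta>))"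
  unfolding has_weak_deriv_def
proof (intro conjI allI impI)
  fix \<phi> assume "test_fun U \<phi>"
  from integral_by_parts_partials[OF assms(1) this partials_upto_prodfun[of \<eta>, OF assms(2)], of "mi_list \<beta>"]
  show "(LINT x:U|lborel. prodfun \<eta> x * mderiv \<beta> \<phi> x) =
    (- 1) ^ mi_order \<beta> * (LINT x:U|lborel. prodfun (der (mi_list \<beta>) \<eta>) x * \<phi> x)"
    using der_cong_count[of "rev (mi_list \<beta>)" "mi_list \<beta>" \<eta>]
    by (simp add: mderiv_eq length_mi_list partials_prodfun[of \<eta>, OF assms(2)] count_list_rev)
qed (intro locally_integrable_continuous prodfun_continuous smooth_der assms(2))+

lemma has_weak_deriv_weak_deriv: "has_weak_deriv U \<beta> f g \<Longrightarrow> has_weak_deriv U \<beta> f (weak_deriv U \<beta> f)"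
  using someI[of "\<lambda>g. has_weak_deriv U \<beta> f g" g] by (simp add: weak_deriv_def)

lemma weak_deriv_prodfun_AE:
  assumes "open U" "\<And>i. smooth (\<eta> i)"
  shows "AE x in lborel. x \<in> U \<longrightarrow> weak_deriv U \<beta> (prodfun \<eta>) x = prodfun (der (mi_list \<beta>) \<eta>) x"
  using weak_deriv_unique[OF assms(1) has_weak_deriv_weak_deriv] prodfun_has_weak_deriv[of U \<eta>, OF assms] by blast

subsection \<open>Finiteness of the fractional seminorm of a bump\<close>

lemma prod_Basis_vec: "(\<Prod>b\<in>Basis. f (x \<bullet> b)) = (\<Prod>i\<in>UNIV. f (x $ i))" for x :: "real^'d"
proof -
  have 1: "(Basis :: (real^'d) set) = (\<lambda>i. axis i 1) ` UNIV" by (auto simp: Basis_vec_def)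
  have 2: "inj (\<lambda>i::'d. axis i (1::real))" by (auto simp: inj_def axis_eq_axis)
  show ?thesis by (subst 1) (simp add: prod.reindex[OF 2] inner_axis)
qed

lemma AE_coordinates_nonzero: "AE z in lborel. \<forall>i. (z :: real^'d) $ i \<noteq> 0"
proof -
  have "AE z in lborel. (z :: real^'d) $ i \<noteq> 0" for i
  proof -
    have "negligible {z :: real^'d. z $ i = 0}" by (rule negligible_standard_hyperplane_cart)
    then have "{z :: real^'d. z $ i = 0} \<in> null_sets lebesgue" by (simp add: negligible_iff_null_sets)
    moreover have "{z :: real^'d. z $ i = 0} \<in> sets lborel" by simp
    ultimately have "{z :: real^'d. z $ i = 0} \<in> null_sets lborel" by (simp add: null_sets_completion_iff)
    from AE_not_in[OF this] show ?thesis by simp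
  qed
  then show ?thesis by (simp add: AE_all_countable)
qed

lemma nn_integral_abs_powr_finite:
  assumes "0 \<le> a" "a < 1" "q > 1"
  shows "(\<integral>\<^sup>+(x::real). ennreal (if \<bar>x\<bar> \<le> 1 then \<bar>x\<bar> powr (- a) else \<bar>x\<bar> powr (- q)) \<partial>lborel) < \<infinity>"
proof -
  let ?f = "\<lambda>x::real. ennreal (if \<bar>x\<bar> \<le> 1 then \<bar>x\<bar> powr (- a) else \<bar>x\<bar> powr (- q))"
  have 1: "(\<integral>\<^sup>+x\<in>{0..1}. ennreal (x powr (- a)) \<partial>lborel) < \<infinity>"
  proof -
    have "((\<lambda>x. x powr (- a)) has_integral 1 powr (- a + 1) / (- a + 1)) {0..1::real}"
      using assms by (intro has_integral_powr_from_0) auto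
    then have "(\<integral>\<^sup>+x\<in>{0..1}. ennreal (x powr (- a)) \<partial>lborel) = ennreal (1 powr (- a + 1) / (- a + 1))"
      by (intro nn_integral_has_integral_lebesgue') auto
    then show ?thesis by simp
  qed
  have 2: "(\<integral>\<^sup>+x\<in>{1..}. ennreal (x powr (- q)) \<partial>lborel) < \<infinity>"
  proof -
    have "((\<lambda>x. x powr (- q)) has_integral - (1 powr (- q + 1)) / (- q + 1)) {1::real..}"
      using assms by (intro has_integral_powr_to_inf) auto
    then have "(\<integral>\<^sup>+x\<in>{1..}. ennreal (x powr (- q)) \<partial>lborel) = ennreal (- (1 powr (- q + 1)) / (- q + 1))"
      by (intro nn_integral_has_integral_lebesgue') auto
    then show ?thesis by simp
  qed
  have half: "(\<integral>\<^sup>+x\<in>{0..}. ?f x \<partial>lborel) < \<infinity>"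
  proof -
    have "(\<integral>\<^sup>+x\<in>{0..}. ?f x \<partial>lborel) \<le> (\<integral>\<^sup>+x. ennreal (x powr (- a)) * indicator {0..1} x + ennreal (x powr (- q)) * indicator {1..} x \<partial>lborel)"
      by (intro nn_integral_mono) (auto simp: indicator_def)
    also have "\<dots> = (\<integral>\<^sup>+x\<in>{0..1}. ennreal (x powr (- a)) \<partial>lborel) + (\<integral>\<^sup>+x\<in>{1..}. ennreal (x powr (- q)) \<partial>lborel)"
      by (intro nn_integral_add) auto
    also have "\<dots> < \<infinity>" using 1 2 by simp
    finally show ?thesis .
  qed
  have "(\<integral>\<^sup>+x. ?f x \<partial>lborel) \<le> (\<integral>\<^sup>+x. ?f x * indicator {0..} x + ?f x * indicator {..0} x \<partial>lborel)"
    by (intro nn_integral_mono) (auto simp: indicator_def)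
  also have "\<dots> = (\<integral>\<^sup>+x\<in>{0..}. ?f x \<partial>lborel) + (\<integral>\<^sup>+x\<in>{..0}. ?f x \<partial>lborel)"
    by (intro nn_integral_add) auto
  also have "(\<integral>\<^sup>+x\<in>{..0}. ?f x \<partial>lborel) = (\<integral>\<^sup>+x\<in>{0..}. ?f x \<partial>lborel)"
    by (subst nn_integral_real_affine[where c = "-1" and t = 0])
      (auto intro!: nn_integral_cong simp: indicator_def)
  finally show ?thesis using half by (auto simp: less_top[symmetric] top_unique)
qed

text \<open>In place of polar coordinates: the kernel is dominated by a product of functions of one coordinate,
  because \<open>|z| \<ge> |z\<^sub>i|\<close> near the origin and \<open>|z| \<ge> max 1 |z\<^sub>i|\<close> away from it. The exponents \<open>a < 1 < q\<close> of
  the factors distribute the total exponent over the \<open>d\<close> coordinates.\<close>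

lemma fractional_kernel_integrable:
  assumes "0 < s" "s < 1"
  shows "(\<integral>\<^sup>+(z::real^'d). ennreal (min 1 ((norm z)\<^sup>2) / norm z powr (real CARD('d) + 2 * s)) \<partial>lborel) < \<infinity>"
proof -
  let ?d = "real CARD('d)"
  define a where "a = max 0 (?d + 2 * s - 2) / ?d"
  define q where "q = 1 + 2 * s / ?d"
  define f where "f x = (if \<bar>x\<bar> \<le> 1 then \<bar>x\<bar> powr (- a) else \<bar>x\<bar> powr (- q))" for x :: real
  have d: "?d > 0" by simp
  have a: "0 \<le> a" "a < 1" and q: "q > 1" "q * ?d = ?d + 2 * s" and ad: "a * ?d \<ge> ?d + 2 * s - 2"
    using assms d by (auto simp: a_def q_def divide_less_eq field_simps)
  have [measurable]: "f \<in> borel_measurable borel" unfolding f_def[abs_def] by measurable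
  have bound: "min 1 ((norm z)\<^sup>2) / norm z powr (?d + 2 * s) \<le> (\<Prod>i\<in>UNIV. f (z $ i))"
    if nz: "\<forall>i. z $ i \<noteq> 0" for z :: "real^'d"
  proof -
    have zp: "norm z > 0" using nz by (auto simp: vec_eq_iff)
    have le: "\<bar>z $ i\<bar> \<le> norm z" for i by (rule component_le_norm_cart)
    have powd: "norm z powr (r * ?d) = (\<Prod>i\<in>(UNIV::'d set). norm z powr r)" for r
      using zp by (simp add: powr_powr[symmetric] powr_realpow)
    show ?thesis
    proof (cases "norm z \<le> 1")
      case True
      have "(norm z)\<^sup>2 \<le> 1" using True by (simp add: power_le_one)
      then have "min 1 ((norm z)\<^sup>2) / norm z powr (?d + 2 * s) = norm z powr 2 / norm z powr (?d + 2 * s)"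
        using zp by (simp add: powr_numeral)
      also have "\<dots> = norm z powr (2 - (?d + 2 * s))" by (simp only: powr_diff)
      also have "\<dots> \<le> norm z powr ((- a) * ?d)" using ad zp True by (intro powr_mono') auto
      also have "\<dots> = (\<Prod>i\<in>(UNIV::'d set). norm z powr (- a))" by (rule powd)
      also have "\<dots> \<le> (\<Prod>i\<in>UNIV. f (z $ i))"
      proof (intro prod_mono conjI)
        fix i :: 'd
        have "norm z powr (- a) \<le> \<bar>z $ i\<bar> powr (- a)" using a nz le[of i] by (intro powr_mono2') auto
        then show "norm z powr (- a) \<le> f (z $ i)" using le[of i] True by (simp add: f_def)
      qed simp
      finally show ?thesis .
    next
      case False
      have "min 1 ((norm z)\<^sup>2) / norm z powr (?d + 2 * s) \<le> 1 / norm z powr (?d + 2 * s)"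
        by (intro divide_right_mono) auto
      also have "\<dots> = norm z powr (- (?d + 2 * s))" by (simp only: powr_minus_divide)
      also have "\<dots> = norm z powr ((- q) * ?d)" using q(2) by simp
      also have "\<dots> = (\<Prod>i\<in>(UNIV::'d set). norm z powr (- q))" by (rule powd)
      also have "\<dots> \<le> (\<Prod>i\<in>UNIV. f (z $ i))"
      proof (intro prod_mono conjI)
        fix i :: 'd
        show "norm z powr (- q) \<le> f (z $ i)"
        proof (cases "\<bar>z $ i\<bar> \<le> 1")
          case True
          have "norm z powr (- q) \<le> 1 powr (- q)" using False q by (intro powr_mono2') auto
          also have "1 powr (- q) = (1::real) powr (- a)" by simp
          also have "\<dots> \<le> \<bar>z $ i\<bar> powr (- a)" using a nz True by (intro powr_mono2') auto
          finally show ?thesis using True by (simp add: f_def)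
        next
          case False
          have "norm z powr (- q) \<le> \<bar>z $ i\<bar> powr (- q)" using q nz le[of i] by (intro powr_mono2') auto
          then show ?thesis using False by (simp add: f_def)
        qed
      qed simp
      finally show ?thesis .
    qed
  qed
  have "(\<integral>\<^sup>+(z::real^'d). ennreal (min 1 ((norm z)\<^sup>2) / norm z powr (?d + 2 * s)) \<partial>lborel)
    \<le> (\<integral>\<^sup>+(z::real^'d). (\<Prod>b\<in>Basis. ennreal (f (z \<bullet> b))) \<partial>lborel)"
  proof (rule nn_integral_mono_AE)
    show "AE (z::real^'d) in lborel. ennreal (min 1 ((norm z)\<^sup>2) / norm z powr (?d + 2 * s)) \<le> (\<Prod>b\<in>Basis. ennreal (f (z \<bullet> b)))"
      using AE_coordinates_nonzero
    proof eventually_elim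
      case (elim z)
      have "(\<Prod>b\<in>Basis. ennreal (f (z \<bullet> b))) = ennreal (\<Prod>i\<in>UNIV. f (z $ i))"
        unfolding prod_Basis_vec[of "\<lambda>x. ennreal (f x)" z] by (intro prod_ennreal) (simp add: f_def)
      with bound[OF elim] show ?case by (simp add: ennreal_leI)
    qed
  qed
  also have "\<dots> = (\<Prod>b\<in>(Basis::(real^'d) set). \<integral>\<^sup>+x. ennreal (f x) \<partial>lborel)"
    by (intro nn_integral_lborel_prod) auto
  also have "\<dots> < \<infinity>"
    using nn_integral_abs_powr_finite[OF a q(1)] by (simp add: f_def power_less_top_ennreal)
  finally show ?thesis .
qed

lemma prodfun_lipschitz:
  assumes "bumpfam l u \<eta>"
  obtains L where "L > 0" "\<And>x y. \<bar>prodfun \<eta> x - prodfun \<eta> y\<bar> \<le> L * norm (x - y)"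
proof -
  have "\<exists>C>0. \<forall>x. \<bar>prodfun (der [i] \<eta>) x\<bar> \<le> C" for i
    using prodfun_bounded[OF bumpfam_der[OF assms]] by metis
  then obtain C where C: "\<And>i. C i > 0" "\<And>i x. \<bar>prodfun (der [i] \<eta>) x\<bar> \<le> C i" by metis
  let ?L = "\<Sum>i\<in>UNIV. C i"
  have "norm (prodfun \<eta> x - prodfun \<eta> y) \<le> ?L * norm (x - y)" for x y
  proof (rule differentiable_bound[where S = UNIV])
    fix x
    show "(prodfun \<eta> has_derivative (\<lambda>h. \<Sum>i\<in>UNIV. h $ i * prodfun (der [i] \<eta>) x)) (at x within UNIV)"
      using prodfun_has_derivative[of \<eta>, OF bumpfam_smooth[OF assms]] by simp
    show "onorm (\<lambda>h. \<Sum>i\<in>UNIV. h $ i * prodfun (der [i] \<eta>) x) \<le> ?L"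
    proof (rule onorm_le)
      fix h :: "real^'a"
      have "norm (\<Sum>i\<in>UNIV. h $ i * prodfun (der [i] \<eta>) x) \<le> (\<Sum>i\<in>UNIV. norm h * C i)"
        unfolding real_norm_def
        by (intro order_trans[OF sum_abs] sum_mono) (auto simp: abs_mult intro!: mult_mono component_le_norm_cart C)
      then show "norm (\<Sum>i\<in>UNIV. h $ i * prodfun (der [i] \<eta>) x) \<le> ?L * norm h"
        by (simp add: sum_distrib_left sum_distrib_right mult.commute)
    qed
  qed auto
  moreover have "?L > 0" by (intro sum_pos C) auto
  ultimately show thesis by (intro that[of ?L]) auto
qed

text \<open>A bump is bounded and Lipschitz, so its squared increments are at most a multiple of
  \<open>min 1 |x - y|\<^sup>2\<close>, which tames the kernel near the diagonal.\<close>

lemma fractional_seminorm_bump_finite: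
  fixes \<eta> :: "'d::finite \<Rightarrow> real \<Rightarrow> real"
  assumes b: "bumpfam l u \<eta>" and s: "0 < s" "s < 1"
  shows "(\<integral>\<^sup>+x. (\<integral>\<^sup>+y. ennreal ((prodfun \<eta> x - prodfun \<eta> y)\<^sup>2 / norm (x - y) powr (real CARD('d) + 2 * s)) \<partial>lborel) \<partial>lborel) < \<infinity>"
proof -
  let ?W = "prodfun \<eta>" and ?p = "real CARD('d) + 2 * s"
  define \<omega> where "\<omega> z = ennreal (min 1 ((norm z)\<^sup>2) / norm z powr ?p)" for z :: "real^'d"
  have [measurable]: "\<omega> \<in> borel_measurable borel" unfolding \<omega>_def by measurable
  have \<omega>fin: "(\<integral>\<^sup>+z. \<omega> z \<partial>lborel) < \<infinity>" unfolding \<omega>_def by (rule fractional_kernel_integrable[OF s])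
  have shift: "(\<integral>\<^sup>+y. \<omega> (x - y) \<partial>lborel) = (\<integral>\<^sup>+z. \<omega> z \<partial>lborel)" for x
  proof -
    have "(\<integral>\<^sup>+y. \<omega> (x - y) \<partial>lborel) = (\<integral>\<^sup>+z. \<omega> (x - (x + 1 *\<^sub>R z)) \<partial>lborel)"
      by (subst nn_integral_affine_vec[of _ 1 x]) auto
    also have "\<dots> = (\<integral>\<^sup>+z. \<omega> z \<partial>lborel)" by (simp add: \<omega>_def)
    finally show ?thesis .
  qed
  obtain L where L: "L > 0" "\<And>x y. \<bar>?W x - ?W y\<bar> \<le> L * norm (x - y)" using prodfun_lipschitz[OF b] by blast
  obtain C where C: "C > 0" "\<And>x. \<bar>?W x\<bar> \<le> C" using prodfun_bounded[OF b] by blast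
  define B where "B = max L (2 * C)"
  let ?i = "\<lambda>x. indicator (cbox l u) x :: ennreal"
  have pt: "ennreal ((?W x - ?W y)\<^sup>2 / norm (x - y) powr ?p) \<le> ennreal (B\<^sup>2) * (?i x * \<omega> (x - y)) + ennreal (B\<^sup>2) * (?i y * \<omega> (x - y))" for x y
  proof (cases "x \<in> cbox l u \<or> y \<in> cbox l u")
    case True
    have "\<bar>?W x - ?W y\<bar> \<le> B * norm (x - y)"
      using L(2)[of x y] by (rule order_trans) (auto simp: B_def intro: mult_right_mono)
    then have 1: "(?W x - ?W y)\<^sup>2 \<le> B\<^sup>2 * (norm (x - y))\<^sup>2"
      using power_mono[of "\<bar>?W x - ?W y\<bar>" "B * norm (x - y)" 2] by (simp add: power_mult_distrib)
    have "\<bar>?W x - ?W y\<bar> \<le> B" using C(2)[of x] C(2)[of y] unfolding B_def by linarith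
    then have 2: "(?W x - ?W y)\<^sup>2 \<le> B\<^sup>2" using power_mono[of "\<bar>?W x - ?W y\<bar>" B 2] by simp
    have "(?W x - ?W y)\<^sup>2 \<le> B\<^sup>2 * min 1 ((norm (x - y))\<^sup>2)" using 1 2 by (simp add: min_def)
    then have "(?W x - ?W y)\<^sup>2 / norm (x - y) powr ?p \<le> B\<^sup>2 * min 1 ((norm (x - y))\<^sup>2) / norm (x - y) powr ?p"
      by (intro divide_right_mono) auto
    then have "ennreal ((?W x - ?W y)\<^sup>2 / norm (x - y) powr ?p) \<le> ennreal (B\<^sup>2) * \<omega> (x - y)"
      unfolding \<omega>_def by (subst ennreal_mult[symmetric]) (auto intro: ennreal_leI)
    also have "\<dots> \<le> ennreal (B\<^sup>2) * (?i x * \<omega> (x - y)) + ennreal (B\<^sup>2) * (?i y * \<omega> (x - y))"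
      using True by (auto simp: indicator_def)
    finally show ?thesis .
  qed (auto simp: prodfun_zero_outside[OF b])
  have "(\<integral>\<^sup>+x. (\<integral>\<^sup>+y. ennreal ((?W x - ?W y)\<^sup>2 / norm (x - y) powr ?p) \<partial>lborel) \<partial>lborel)
    \<le> (\<integral>\<^sup>+x. (\<integral>\<^sup>+y. ennreal (B\<^sup>2) * (?i x * \<omega> (x - y)) + ennreal (B\<^sup>2) * (?i y * \<omega> (x - y)) \<partial>lborel) \<partial>lborel)"
    by (intro nn_integral_mono pt)
  also have "\<dots> = (\<integral>\<^sup>+x. (\<integral>\<^sup>+y. ennreal (B\<^sup>2) * (?i x * \<omega> (x - y)) \<partial>lborel) \<partial>lborel)
      + (\<integral>\<^sup>+x. (\<integral>\<^sup>+y. ennreal (B\<^sup>2) * (?i y * \<omega> (x - y)) \<partial>lborel) \<partial>lborel)"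
    by (subst nn_integral_add[symmetric]) (auto intro!: nn_integral_cong nn_integral_add)
  also have "(\<integral>\<^sup>+x. (\<integral>\<^sup>+y. ennreal (B\<^sup>2) * (?i y * \<omega> (x - y)) \<partial>lborel) \<partial>lborel)
    = (\<integral>\<^sup>+y. (\<integral>\<^sup>+x. ennreal (B\<^sup>2) * (?i y * \<omega> (x - y)) \<partial>lborel) \<partial>lborel)"
    by (rule lborel_pair.Fubini'[of "\<lambda>x y. ennreal (B\<^sup>2) * (?i y * \<omega> (x - y))", symmetric]) measurable
  also have "\<dots> = (\<integral>\<^sup>+x. (\<integral>\<^sup>+y. ennreal (B\<^sup>2) * (?i x * \<omega> (x - y)) \<partial>lborel) \<partial>lborel)"
    by (simp add: \<omega>_def norm_minus_commute)
  also have "(\<integral>\<^sup>+x. (\<integral>\<^sup>+y. ennreal (B\<^sup>2) * (?i x * \<omega> (x - y)) \<partial>lborel) \<partial>lborel)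
     = ennreal (B\<^sup>2) * (emeasure lborel (cbox l u) * (\<integral>\<^sup>+z. \<omega> z \<partial>lborel))"
    by (simp add: nn_integral_cmult nn_integral_multc shift)
  also have "\<dots> + \<dots> < \<infinity>"
    using \<omega>fin by (simp add: ennreal_mult_less_top emeasure_lborel_cbox_eq)
  finally show ?thesis .
qed

subsection \<open>Scaling\<close>

lemma scaled_fractional_seminorm:
  fixes \<eta> :: "'d::finite \<Rightarrow> real \<Rightarrow> real"
  assumes b: "\<And>i. smooth (\<eta> i)" and "\<rho> > 0"
  shows "(\<integral>\<^sup>+x. (\<integral>\<^sup>+y. ennreal ((prodfun (rescale t \<rho> \<eta>) x - prodfun (rescale t \<rho> \<eta>) y)\<^sup>2 / norm (x - y) powr p) \<partial>lborel) \<partial>lborel)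
    = ennreal (\<rho> powr (2 * real CARD('d) - p)) * (\<integral>\<^sup>+x. (\<integral>\<^sup>+y. ennreal ((prodfun \<eta> x - prodfun \<eta> y)\<^sup>2 / norm (x - y) powr p) \<partial>lborel) \<partial>lborel)"
proof -
  have [measurable]: "prodfun \<eta> \<in> borel_measurable borel" "prodfun (rescale t \<rho> \<eta>) \<in> borel_measurable borel"
    using b by (auto intro!: prodfun_measurable smooth_rescale simp: rescale_def)
  let ?D = "\<rho> ^ CARD('d)"
  have val: "prodfun (rescale t \<rho> \<eta>) (t + \<rho> *\<^sub>R z) = prodfun \<eta> z" for z
    using assms(2) by (simp add: prodfun_rescale)
  have nrm: "norm ((t + \<rho> *\<^sub>R x) - (t + \<rho> *\<^sub>R y)) = \<rho> * norm (x - y)" for x y :: "real^'d"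
    using assms(2) by (simp flip: scaleR_diff_right)
  have "(\<integral>\<^sup>+x. (\<integral>\<^sup>+y. ennreal ((prodfun (rescale t \<rho> \<eta>) x - prodfun (rescale t \<rho> \<eta>) y)\<^sup>2 / norm (x - y) powr p) \<partial>lborel) \<partial>lborel)
    = ?D * (\<integral>\<^sup>+x. ?D * (\<integral>\<^sup>+y. ennreal ((prodfun \<eta> x - prodfun \<eta> y)\<^sup>2 / (\<rho> * norm (x - y)) powr p) \<partial>lborel) \<partial>lborel)"
    by (subst nn_integral_affine_vec[OF _ assms(2), where t = t], measurable,
        subst nn_integral_affine_vec[OF _ assms(2), where t = t], measurable)
      (simp only: val nrm)
  also have "\<dots> = ?D * (\<integral>\<^sup>+x. ?D * (\<integral>\<^sup>+y. ennreal (\<rho> powr (- p)) * ennreal ((prodfun \<eta> x - prodfun \<eta> y)\<^sup>2 / norm (x - y) powr p) \<partial>lborel) \<partial>lborel)"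
    using assms(2) by (simp add: ennreal_mult[symmetric] powr_mult powr_minus field_simps)
  also have "\<dots> = (ennreal ?D * ennreal ?D * ennreal (\<rho> powr (- p))) * (\<integral>\<^sup>+x. (\<integral>\<^sup>+y. ennreal ((prodfun \<eta> x - prodfun \<eta> y)\<^sup>2 / norm (x - y) powr p) \<partial>lborel) \<partial>lborel)"
    by (simp add: nn_integral_cmult mult.assoc)
  also have "ennreal ?D * ennreal ?D * ennreal (\<rho> powr (- p)) = ennreal (\<rho> powr (2 * real CARD('d) - p))"
  proof -
    have "\<rho> powr (2 * real CARD('d) - p) = \<rho> powr real CARD('d) * \<rho> powr real CARD('d) * \<rho> powr (- p)"
      by (simp flip: powr_add)
    then show ?thesis using assms(2) by (simp add: powr_realpow ennreal_mult)
  qed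
  finally show ?thesis .
qed

text \<open>The exponent \<open>d/2 - m\<close> comes from the terms of top order, which scale exactly so; the terms of
  lower order scale with a larger exponent and are dominated because \<open>\<rho> \<le> 1\<close>.\<close>

lemma bump_in_sobolev_space:
  fixes \<Omega> :: "(real^'d) set"
  assumes "m > 0" and b: "bumpfam l u \<eta>"
  obtains C where "C > 0"
    "\<And>t \<rho>. 0 < \<rho> \<Longrightarrow> \<rho> \<le> 1 \<Longrightarrow> cbox (t + \<rho> *\<^sub>R l) (t + \<rho> *\<^sub>R u) \<subseteq> interior \<Omega> \<Longrightarrow>
       prodfun (rescale t \<rho> \<eta>) \<in> sobolev_space \<Omega> m \<and>
       sobolev_norm \<Omega> m (prodfun (rescale t \<rho> \<eta>)) \<le> C * \<rho> powr (real CARD('d) / 2 - m)"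
proof -
  let ?d = "real CARD('d)" and ?k = "nat \<lfloor>m\<rfloor>" and ?U = "interior \<Omega>" and ?s = "frac m"
  have sm: "\<And>i. smooth (\<eta> i)" using b by (rule bumpfam_smooth)
  have k: "real ?k \<le> m" "real ?k + ?s = m" using assms(1) by (auto simp: frac_def)
  have s: "0 \<le> ?s" "?s < 1" by (auto simp: frac_lt_1)
  define W where "W \<beta> = prodfun (der (mi_list \<beta>) \<eta>)" for \<beta>
  have [measurable]: "W \<beta> \<in> borel_measurable borel" for \<beta>
    unfolding W_def by (intro prodfun_measurable smooth_der sm)
  define A where "A \<beta> = (\<integral>\<^sup>+x. ennreal ((W \<beta> x)\<^sup>2) \<partial>lborel)" for \<beta>
  define F where "F \<beta> = (\<integral>\<^sup>+x. (\<integral>\<^sup>+y. ennreal ((W \<beta> x - W \<beta> y)\<^sup>2 / norm (x - y) powr (?d + 2 * ?s)) \<partial>lborel) \<partial>lborel)" for \<beta>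
  define E where "E = (\<Sum>\<beta>\<in>{\<beta>. mi_order \<beta> \<le> ?k}. A \<beta>) + (if ?s = 0 then 0 else \<Sum>\<beta>\<in>{\<beta>. mi_order \<beta> = ?k}. F \<beta>)"
  have finA: "A \<beta> < \<infinity>" for \<beta>
  proof -
    have bW: "bumpfam l u (der (mi_list \<beta>) \<eta>)" by (rule bumpfam_der[OF b])
    obtain C where C: "C > 0" "\<And>x. \<bar>W \<beta> x\<bar> \<le> C" unfolding W_def using prodfun_bounded[OF bW] by metis
    have "integrable lborel (\<lambda>x. (W \<beta> x)\<^sup>2)"
      using C(2) prodfun_zero_outside[OF bW]
      by (intro integrable_bounded_cbox[of _ l u "C\<^sup>2"]) (auto simp: W_def[symmetric] abs_le_square_iff[symmetric] C(1) less_imp_le)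
    then have "A \<beta> = ennreal (\<integral>x. (W \<beta> x)\<^sup>2 \<partial>lborel)" unfolding A_def by (intro nn_integral_eq_integral) auto
    then show ?thesis by simp
  qed
  have finF: "F \<beta> < \<infinity>" if "?s \<noteq> 0" for \<beta>
    unfolding F_def W_def using that s by (intro fractional_seminorm_bump_finite[OF bumpfam_der[OF b]]) auto
  have finE: "E < \<infinity>"
  proof -
    have "sum A S < \<infinity>" if "finite S" for S using that finA by (induction S rule: finite_induct) auto
    moreover have "sum F S < \<infinity>" if "finite S" "?s \<noteq> 0" for S using that finF by (induction S rule: finite_induct) auto
    moreover have "finite {\<beta> :: nat^'d. mi_order \<beta> = ?k}"
      by (rule finite_subset[OF _ finite_mi_order_le[of ?k]]) auto
    ultimately have 1: "(\<Sum>\<beta>\<in>{\<beta>. mi_order \<beta> \<le> ?k}. A \<beta>) < \<infinity>"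
      and 2: "?s \<noteq> 0 \<Longrightarrow> (\<Sum>\<beta>\<in>{\<beta>. mi_order \<beta> = ?k}. F \<beta>) < \<infinity>"
      using finite_mi_order_le[of ?k] by blast+
    show ?thesis
    proof (cases "?s = 0")
      case True
      show ?thesis unfolding E_def if_P[OF True] using 1 by (simp only: add_0_right)
    next
      case False
      show ?thesis unfolding E_def if_not_P[OF False] using 1 2[OF False]
        by (simp only: ennreal_add_less_top infinity_ennreal_def)
    qed
  qed
  define C where "C = sqrt (enn2real E) + 1"
  have main: "prodfun (rescale t \<rho> \<eta>) \<in> sobolev_space \<Omega> m \<and>
       sobolev_norm \<Omega> m (prodfun (rescale t \<rho> \<eta>)) \<le> C * \<rho> powr (?d / 2 - m)"
    if \<rho>: "0 < \<rho>" "\<rho> \<le> 1" and sub: "cbox (t + \<rho> *\<^sub>R l) (t + \<rho> *\<^sub>R u) \<subseteq> ?U" for t \<rho>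
  proof -
    let ?b = "prodfun (rescale t \<rho> \<eta>)"
    have smr: "\<And>i. smooth (rescale t \<rho> \<eta> i)" using sm by (simp add: rescale_def smooth_rescale)
    define V where "V \<beta> = prodfun (rescale t \<rho> (der (mi_list \<beta>) \<eta>))" for \<beta>
    have smV: "\<And>i. smooth (rescale t \<rho> (der (mi_list \<beta>) \<eta>) i)" for \<beta>
      using smooth_der[of \<eta>, OF sm] by (simp add: rescale_def smooth_rescale)
    have [measurable]: "V \<beta> \<in> borel_measurable borel" for \<beta>
      unfolding V_def by (intro prodfun_measurable smV)
    have wd: "AE x in lborel. x \<in> ?U \<longrightarrow> weak_deriv ?U \<beta> ?b x = (1 / \<rho>) ^ mi_order \<beta> * V \<beta> x" for \<beta>
      using weak_deriv_prodfun_AE[of ?U "rescale t \<rho> \<eta>" \<beta>, OF open_interior smr]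
      unfolding prodfun_der_rescale[of \<eta>, OF sm] length_mi_list V_def by simp
    have scale: "((1 / \<rho>) ^ j)\<^sup>2 = \<rho> powr (- 2 * real j)" for j
    proof -
      have "((1 / \<rho>) ^ j)\<^sup>2 = 1 / \<rho> ^ (2 * j)" by (simp add: power_mult[symmetric] power_one_over mult.commute)
      also have "\<rho> ^ (2 * j) = \<rho> powr (2 * real j)" using \<rho>(1) by (simp flip: powr_realpow)
      also have "1 / \<rho> powr (2 * real j) = \<rho> powr (- (2 * real j))" by (simp only: powr_minus_divide)
      finally show ?thesis by simp
    qed
    have V2: "(\<integral>\<^sup>+x. ennreal ((V \<beta> x)\<^sup>2) \<partial>lborel) = ennreal (\<rho> powr ?d) * A \<beta>" for \<beta>
    proof -
      have "V \<beta> (t + \<rho> *\<^sub>R z) = W \<beta> z" for z unfolding V_def W_def prodfun_rescale using \<rho> by simp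
      then show ?thesis unfolding A_def using \<rho> by (subst nn_integral_affine_vec[of _ \<rho> t]) (auto simp: powr_realpow)
    qed
    have e1: "(\<integral>\<^sup>+x\<in>?U. ennreal ((weak_deriv ?U \<beta> ?b x)\<^sup>2) \<partial>lborel) \<le> ennreal (\<rho> powr (?d - 2 * m)) * A \<beta>"
      if \<beta>: "mi_order \<beta> \<le> ?k" for \<beta>
    proof -
      have "(\<integral>\<^sup>+x\<in>?U. ennreal ((weak_deriv ?U \<beta> ?b x)\<^sup>2) \<partial>lborel) \<le> (\<integral>\<^sup>+x. ennreal (((1 / \<rho>) ^ mi_order \<beta>)\<^sup>2) * ennreal ((V \<beta> x)\<^sup>2) \<partial>lborel)"
      proof (rule nn_integral_mono_AE)
        show "AE x in lborel. ennreal ((weak_deriv ?U \<beta> ?b x)\<^sup>2) * indicator ?U x \<le> ennreal (((1 / \<rho>) ^ mi_order \<beta>)\<^sup>2) * ennreal ((V \<beta> x)\<^sup>2)"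
          using wd[of \<beta>]
        proof eventually_elim
          case (elim x)
          then show ?case
            by (cases "x \<in> ?U") (simp_all add: power_mult_distrib flip: ennreal_mult)
        qed
      qed
      also have "\<dots> = ennreal (((1 / \<rho>) ^ mi_order \<beta>)\<^sup>2) * (ennreal (\<rho> powr ?d) * A \<beta>)"
        by (simp add: nn_integral_cmult V2)
      also have "\<dots> = ennreal (((1 / \<rho>) ^ mi_order \<beta>)\<^sup>2 * \<rho> powr ?d) * A \<beta>"
        by (simp add: ennreal_mult mult.assoc)
      also have "\<dots> \<le> ennreal (\<rho> powr (?d - 2 * m)) * A \<beta>"
      proof (intro mult_right_mono ennreal_leI)
        have "((1 / \<rho>) ^ mi_order \<beta>)\<^sup>2 * \<rho> powr ?d = \<rho> powr (?d - 2 * real (mi_order \<beta>))"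
          unfolding scale by (simp flip: powr_add)
        also have "\<dots> \<le> \<rho> powr (?d - 2 * m)"
          using \<rho> \<beta> k(1) of_nat_mono[OF \<beta>, where 'a = real] by (intro powr_mono') auto
        finally show "((1 / \<rho>) ^ mi_order \<beta>)\<^sup>2 * \<rho> powr ?d \<le> \<rho> powr (?d - 2 * m)" .
      qed auto
      finally show ?thesis .
    qed
    have e2: "(\<integral>\<^sup>+x\<in>?U. (\<integral>\<^sup>+y\<in>?U. ennreal ((weak_deriv ?U \<beta> ?b x - weak_deriv ?U \<beta> ?b y)\<^sup>2 / norm (x - y) powr (?d + 2 * ?s)) \<partial>lborel) \<partial>lborel)
        \<le> ennreal (\<rho> powr (?d - 2 * m)) * F \<beta>" if \<beta>: "mi_order \<beta> = ?k" for \<beta>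
    proof -
      let ?c = "((1 / \<rho>) ^ mi_order \<beta>)\<^sup>2"
      have inner: "(\<integral>\<^sup>+y\<in>?U. ennreal ((weak_deriv ?U \<beta> ?b x - weak_deriv ?U \<beta> ?b y)\<^sup>2 / norm (x - y) powr (?d + 2 * ?s)) \<partial>lborel)
        \<le> (\<integral>\<^sup>+y. ennreal ?c * ennreal ((V \<beta> x - V \<beta> y)\<^sup>2 / norm (x - y) powr (?d + 2 * ?s)) \<partial>lborel)"
        if x: "weak_deriv ?U \<beta> ?b x = (1 / \<rho>) ^ mi_order \<beta> * V \<beta> x" for x
      proof (rule nn_integral_mono_AE)
        show "AE y in lborel. ennreal ((weak_deriv ?U \<beta> ?b x - weak_deriv ?U \<beta> ?b y)\<^sup>2 / norm (x - y) powr (?d + 2 * ?s)) * indicator ?U y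
          \<le> ennreal ?c * ennreal ((V \<beta> x - V \<beta> y)\<^sup>2 / norm (x - y) powr (?d + 2 * ?s))"
          using wd[of \<beta>]
        proof eventually_elim
          case (elim y)
          show ?case
          proof (cases "y \<in> ?U")
            case True
            then have "weak_deriv ?U \<beta> ?b x - weak_deriv ?U \<beta> ?b y = (1 / \<rho>) ^ mi_order \<beta> * (V \<beta> x - V \<beta> y)"
              using elim x by (simp add: right_diff_distrib)
            then show ?thesis using True by (simp add: power_mult_distrib flip: ennreal_mult)
          qed simp
        qed
      qed
      have "(\<integral>\<^sup>+x\<in>?U. (\<integral>\<^sup>+y\<in>?U. ennreal ((weak_deriv ?U \<beta> ?b x - weak_deriv ?U \<beta> ?b y)\<^sup>2 / norm (x - y) powr (?d + 2 * ?s)) \<partial>lborel) \<partial>lborel)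
        \<le> (\<integral>\<^sup>+x. (\<integral>\<^sup>+y. ennreal ?c * ennreal ((V \<beta> x - V \<beta> y)\<^sup>2 / norm (x - y) powr (?d + 2 * ?s)) \<partial>lborel) \<partial>lborel)"
      proof (rule nn_integral_mono_AE)
        show "AE x in lborel. (\<integral>\<^sup>+y\<in>?U. ennreal ((weak_deriv ?U \<beta> ?b x - weak_deriv ?U \<beta> ?b y)\<^sup>2 / norm (x - y) powr (?d + 2 * ?s)) \<partial>lborel) * indicator ?U x
          \<le> (\<integral>\<^sup>+y. ennreal ?c * ennreal ((V \<beta> x - V \<beta> y)\<^sup>2 / norm (x - y) powr (?d + 2 * ?s)) \<partial>lborel)"
          using wd[of \<beta>]
        proof eventually_elim
          case (elim x)
          then show ?case using inner[of x] by (cases "x \<in> ?U") auto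
        qed
      qed
      also have "\<dots> = ennreal ?c * (\<integral>\<^sup>+x. (\<integral>\<^sup>+y. ennreal ((V \<beta> x - V \<beta> y)\<^sup>2 / norm (x - y) powr (?d + 2 * ?s)) \<partial>lborel) \<partial>lborel)"
        by (simp add: nn_integral_cmult)
      also have "\<dots> = ennreal ?c * (ennreal (\<rho> powr (2 * ?d - (?d + 2 * ?s))) * F \<beta>)"
        unfolding V_def F_def W_def by (subst scaled_fractional_seminorm[of "der (mi_list \<beta>) \<eta>", OF smooth_der[of \<eta>, OF sm] \<rho>(1)]) simp
      also have "\<dots> = ennreal (?c * \<rho> powr (2 * ?d - (?d + 2 * ?s))) * F \<beta>"
        by (simp add: ennreal_mult mult.assoc)
      also have "?c * \<rho> powr (2 * ?d - (?d + 2 * ?s)) = \<rho> powr (?d - 2 * m)"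
      proof -
        have "?c = \<rho> powr (- 2 * real ?k)"
          unfolding \<beta> by (rule scale)
        moreover have "- 2 * real ?k + (2 * ?d - (?d + 2 * ?s)) = ?d - 2 * m" using k(2) by simp
        ultimately show ?thesis by (metis powr_add)
      qed
      finally show ?thesis .
    qed
    have energy: "sobolev_energy ?U m ?b \<le> ennreal (\<rho> powr (?d - 2 * m)) * E"
      unfolding sobolev_energy_def E_def distrib_left
    proof (rule add_mono)
      show "(\<Sum>\<beta>\<in>{\<beta>. mi_order \<beta> \<le> ?k}. \<integral>\<^sup>+x\<in>?U. ennreal ((weak_deriv ?U \<beta> ?b x)\<^sup>2) \<partial>lborel)
        \<le> ennreal (\<rho> powr (?d - 2 * m)) * (\<Sum>\<beta>\<in>{\<beta>. mi_order \<beta> \<le> ?k}. A \<beta>)"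
        unfolding sum_distrib_left by (intro sum_mono e1) auto
      show "(if ?s = 0 then 0 else \<Sum>\<beta>\<in>{\<beta>. mi_order \<beta> = ?k}.
        \<integral>\<^sup>+x\<in>?U. (\<integral>\<^sup>+y\<in>?U. ennreal ((weak_deriv ?U \<beta> ?b x - weak_deriv ?U \<beta> ?b y)\<^sup>2 / norm (x - y) powr (?d + 2 * ?s)) \<partial>lborel) \<partial>lborel)
        \<le> ennreal (\<rho> powr (?d - 2 * m)) * (if ?s = 0 then 0 else \<Sum>\<beta>\<in>{\<beta>. mi_order \<beta> = ?k}. F \<beta>)"
      proof (cases "?s = 0")
        case False
        show ?thesis unfolding if_not_P[OF False] sum_distrib_left by (intro sum_mono e2) auto
      qed simp
    qed
    have rhs: "ennreal (\<rho> powr (?d - 2 * m)) * E = ennreal (\<rho> powr (?d - 2 * m) * enn2real E)"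
      using finE by (simp add: ennreal_mult ennreal_enn2real)
    have "sobolev_energy ?U m ?b < \<infinity>"
      using energy unfolding rhs by (rule le_less_trans) simp
    moreover have "?b x = 0" if "x \<notin> \<Omega>" for x
      using that sub interior_subset[of \<Omega>]
      by (intro prodfun_zero_outside[OF bumpfam_rescale[OF b \<rho>(1)]]) blast
    moreover have "\<exists>g. has_weak_deriv ?U \<beta> ?b g" for \<beta>
      using prodfun_has_weak_deriv[of ?U "rescale t \<rho> \<eta>", OF open_interior smr] by blast
    ultimately have mem: "?b \<in> sobolev_space \<Omega> m"
      unfolding sobolev_space_def using prodfun_continuous[of "rescale t \<rho> \<eta>", OF smr] by simp
    have "enn2real (sobolev_energy ?U m ?b) \<le> \<rho> powr (?d - 2 * m) * enn2real E"
      using energy unfolding rhs by (intro enn2real_leI) auto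
    then have "sobolev_norm \<Omega> m ?b \<le> sqrt (\<rho> powr (?d - 2 * m)) * sqrt (enn2real E)"
      unfolding sobolev_norm_def by (simp flip: real_sqrt_mult)
    also have "sqrt (\<rho> powr (?d - 2 * m)) = \<rho> powr (?d / 2 - m)"
      using \<rho> by (simp add: powr_half_sqrt[symmetric] powr_powr diff_divide_distrib)
    also have "\<rho> powr (?d / 2 - m) * sqrt (enn2real E) \<le> \<rho> powr (?d / 2 - m) * C"
      unfolding C_def by (intro mult_left_mono) auto
    finally show ?thesis using mem by (simp add: mult.commute)
  qed
  have "C > 0" unfolding C_def using real_sqrt_ge_zero[OF enn2real_nonneg[of E]] by linarith
  from that[OF this main] show thesis .
qed

section \<open>The Sobolev embedding\<close>

subsection \<open>Rescaled averages and their derivatives\<close>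

text \<open>Differentiation under the integral sign, by dominated convergence of the difference quotients.\<close>

lemma has_real_derivative_integral:
  fixes k k' :: "real \<Rightarrow> 'a \<Rightarrow> real" and w :: "'a \<Rightarrow> real"
  assumes w: "integrable M w" and "\<delta> > 0"
    and meas: "\<And>\<tau>. k \<tau> \<in> borel_measurable M" "k' \<tau>0 \<in> borel_measurable M"
    and der: "\<And>\<tau> y. \<bar>\<tau> - \<tau>0\<bar> < \<delta> \<Longrightarrow> ((\<lambda>\<tau>. k \<tau> y) has_real_derivative k' \<tau> y) (at \<tau>)"
    and bd: "\<And>\<tau> y. \<bar>\<tau> - \<tau>0\<bar> < \<delta> \<Longrightarrow> \<bar>k \<tau> y\<bar> \<le> C"
    and bd': "\<And>\<tau> y. \<bar>\<tau> - \<tau>0\<bar> < \<delta> \<Longrightarrow> \<bar>k' \<tau> y\<bar> \<le> C"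
  shows "((\<lambda>\<tau>. \<integral>y. w y * k \<tau> y \<partial>M) has_real_derivative (\<integral>y. w y * k' \<tau>0 y \<partial>M)) (at \<tau>0)"
proof -
  have [measurable]: "w \<in> borel_measurable M" using w by auto
  note meas[measurable]
  have int: "integrable M (\<lambda>y. w y * k \<tau> y)" if "\<bar>\<tau> - \<tau>0\<bar> < \<delta>" for \<tau>
  proof (rule Bochner_Integration.integrable_bound)
    show "integrable M (\<lambda>y. C * w y)" using w by simp
    show "AE y in M. norm (w y * k \<tau> y) \<le> norm (C * w y)"
    proof (rule AE_I2)
      fix y
      have "\<bar>k \<tau> y\<bar> \<le> \<bar>C\<bar>" using bd[OF that, of y] by linarith
      then have "\<bar>k \<tau> y\<bar> * \<bar>w y\<bar> \<le> \<bar>C\<bar> * \<bar>w y\<bar>" by (intro mult_right_mono) auto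
      then show "norm (w y * k \<tau> y) \<le> norm (C * w y)" by (simp add: abs_mult mult.commute)
    qed
  qed measurable
  have lip: "\<bar>k (\<tau>0 + h) y - k \<tau>0 y\<bar> \<le> C * \<bar>h\<bar>" if h: "\<bar>h\<bar> < \<delta>" for h y
  proof -
    have "norm (k (\<tau>0 + h) y - k \<tau>0 y) \<le> C * norm (\<tau>0 + h - \<tau>0)"
    proof (rule field_differentiable_bound[where S = "{\<tau>0 - \<bar>h\<bar>..\<tau>0 + \<bar>h\<bar>}"])
      fix \<tau> assume "\<tau> \<in> {\<tau>0 - \<bar>h\<bar>..\<tau>0 + \<bar>h\<bar>}"
      then have \<tau>: "\<bar>\<tau> - \<tau>0\<bar> < \<delta>" using h by auto
      show "((\<lambda>\<tau>. k \<tau> y) has_real_derivative k' \<tau> y) (at \<tau> within {\<tau>0 - \<bar>h\<bar>..\<tau>0 + \<bar>h\<bar>})"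
        by (rule has_field_derivative_at_within[OF der[OF \<tau>]])
      show "norm (k' \<tau> y) \<le> C" using bd'[OF \<tau>, of y] by simp
    qed auto
    then show ?thesis by simp
  qed
  have "((\<lambda>h. ((\<integral>y. w y * k (\<tau>0 + h) y \<partial>M) - (\<integral>y. w y * k \<tau>0 y \<partial>M)) / h) \<longlongrightarrow> (\<integral>y. w y * k' \<tau>0 y \<partial>M)) (at 0)"
    unfolding tendsto_at_iff_sequentially comp_def
  proof (intro allI impI)
    fix X :: "nat \<Rightarrow> real" assume X0: "\<forall>i. X i \<in> UNIV - {0}" and X: "X \<longlonglongrightarrow> 0"
    obtain N where N: "\<And>n. n \<ge> N \<Longrightarrow> \<bar>X n\<bar> < \<delta>"
      using tendstoD[OF X \<open>\<delta> > 0\<close>] by (auto simp: eventually_sequentially dist_real_def)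
    have "(\<lambda>n. \<integral>y. w y * ((k (\<tau>0 + X (n + N)) y - k \<tau>0 y) / X (n + N)) \<partial>M) \<longlonglongrightarrow> (\<integral>y. w y * k' \<tau>0 y \<partial>M)"
    proof (rule integral_dominated_convergence[where w = "\<lambda>y. \<bar>C * w y\<bar>"])
      show "integrable M (\<lambda>y. \<bar>C * w y\<bar>)" using w by simp
      show "AE y in M. (\<lambda>n. w y * ((k (\<tau>0 + X (n + N)) y - k \<tau>0 y) / X (n + N))) \<longlonglongrightarrow> w y * k' \<tau>0 y"
      proof (intro AE_I2 tendsto_mult_left)
        fix y
        have "((\<lambda>h. (k (\<tau>0 + h) y - k \<tau>0 y) / h) \<longlongrightarrow> k' \<tau>0 y) (at 0)"
          using der[of \<tau>0 y] \<open>\<delta> > 0\<close> by (simp add: DERIV_def)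
        moreover have "filterlim (\<lambda>n. X (n + N)) (at 0) sequentially"
          using X0 LIMSEQ_ignore_initial_segment[OF X, of N] by (auto simp: filterlim_at)
        ultimately show "(\<lambda>n. (k (\<tau>0 + X (n + N)) y - k \<tau>0 y) / X (n + N)) \<longlonglongrightarrow> k' \<tau>0 y"
          by (rule filterlim_compose)
      qed
      show "AE y in M. norm (w y * ((k (\<tau>0 + X (n + N)) y - k \<tau>0 y) / X (n + N))) \<le> \<bar>C * w y\<bar>" for n
      proof (rule AE_I2)
        fix y
        have "X (n + N) \<noteq> 0" using X0 by simp
        then have "\<bar>(k (\<tau>0 + X (n + N)) y - k \<tau>0 y) / X (n + N)\<bar> \<le> C"
          using lip[OF N[of "n + N"], of y] by (simp add: divide_le_eq)
        then have "\<bar>(k (\<tau>0 + X (n + N)) y - k \<tau>0 y) / X (n + N)\<bar> \<le> \<bar>C\<bar>" by linarith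
        then show "norm (w y * ((k (\<tau>0 + X (n + N)) y - k \<tau>0 y) / X (n + N))) \<le> \<bar>C * w y\<bar>"
          unfolding real_norm_def abs_mult by (simp only: mult.commute[of "\<bar>C\<bar>"]) (intro mult_left_mono abs_ge_zero)
      qed
    qed measurable
    moreover have "(\<integral>y. w y * ((k (\<tau>0 + X (n + N)) y - k \<tau>0 y) / X (n + N)) \<partial>M)
      = ((\<integral>y. w y * k (\<tau>0 + X (n + N)) y \<partial>M) - (\<integral>y. w y * k \<tau>0 y \<partial>M)) / X (n + N)" for n
    proof -
      have "(\<integral>y. w y * ((k (\<tau>0 + X (n + N)) y - k \<tau>0 y) / X (n + N)) \<partial>M)
        = (\<integral>y. (w y * k (\<tau>0 + X (n + N)) y - w y * k \<tau>0 y) / X (n + N) \<partial>M)"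
        by (simp add: right_diff_distrib)
      also have "\<dots> = (\<integral>y. (w y * k (\<tau>0 + X (n + N)) y - w y * k \<tau>0 y) \<partial>M) / X (n + N)"
        by (rule integral_divide_zero)
      also have "(\<integral>y. (w y * k (\<tau>0 + X (n + N)) y - w y * k \<tau>0 y) \<partial>M)
         = (\<integral>y. w y * k (\<tau>0 + X (n + N)) y \<partial>M) - (\<integral>y. w y * k \<tau>0 y \<partial>M)"
        using N[of "n + N"] \<open>\<delta> > 0\<close> by (intro Bochner_Integration.integral_diff int) auto
      finally show ?thesis .
    qed
    ultimately have "(\<lambda>n. ((\<integral>y. w y * k (\<tau>0 + X (n + N)) y \<partial>M) - (\<integral>y. w y * k \<tau>0 y \<partial>M)) / X (n + N)) \<longlonglongrightarrow> (\<integral>y. w y * k' \<tau>0 y \<partial>M)"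
      by (simp only:)
    then show "(\<lambda>n. ((\<integral>y. w y * k (\<tau>0 + X n) y \<partial>M) - (\<integral>y. w y * k \<tau>0 y \<partial>M)) / X n) \<longlonglongrightarrow> (\<integral>y. w y * k' \<tau>0 y \<partial>M)"
      by (rule LIMSEQ_offset)
  qed
  then show ?thesis by (simp add: DERIV_def)
qed

text \<open>Up to the sign \<open>(-1)\<^bsup>|I|\<^esup>\<close> this is \<open>\<integral> D\<^sup>I v (t + \<rho> z) \<Phi> z dz\<close> with \<open>\<Phi> = prodfun \<eta>\<close>, all derivatives being
  moved to \<open>\<Phi>\<close>.\<close>

definition avg :: "(real^'d \<Rightarrow> real) \<Rightarrow> ('d \<Rightarrow> real \<Rightarrow> real) \<Rightarrow> 'd list \<Rightarrow> real^'d \<Rightarrow> real \<Rightarrow> real" where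
  "avg v \<eta> I t \<rho> = (1 / \<rho>) ^ (CARD('d) + length I) * (\<integral>y. v y * prodfun (der I \<eta>) ((1 / \<rho>) *\<^sub>R (y - t)) \<partial>lborel)"

lemma integrable_mult_bounded_fun:
  fixes w g :: "'a \<Rightarrow> real"
  assumes "integrable M w" "g \<in> borel_measurable M" "\<And>y. \<bar>g y\<bar> \<le> C"
  shows "integrable M (\<lambda>y. w y * g y)"
proof (rule Bochner_Integration.integrable_bound)
  show "integrable M (\<lambda>y. C * w y)" using assms(1) by simp
  show "AE y in M. norm (w y * g y) \<le> norm (C * w y)"
  proof (rule AE_I2)
    fix y
    have "\<bar>g y\<bar> \<le> \<bar>C\<bar>" using assms(3)[of y] by linarith
    then have "\<bar>g y\<bar> * \<bar>w y\<bar> \<le> \<bar>C\<bar> * \<bar>w y\<bar>" by (intro mult_right_mono) auto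
    then show "norm (w y * g y) \<le> norm (C * w y)" by (simp add: abs_mult mult.commute)
  qed
qed (use assms in measurable)

lemma avg_integrable:
  assumes "integrable lborel v" "bumpfam l u \<eta>"
  shows "integrable lborel (\<lambda>y. v y * prodfun \<eta> (a *\<^sub>R (y - t)))"
proof -
  obtain C where "C > 0" "\<And>x. \<bar>prodfun \<eta> x\<bar> \<le> C" using prodfun_bounded[OF assms(2)] by blast
  moreover have [measurable]: "prodfun \<eta> \<in> borel_measurable borel"
    by (rule prodfun_measurable[OF bumpfam_smooth[OF assms(2)]])
  ultimately show ?thesis by (intro integrable_mult_bounded_fun[OF assms(1), of _ C]) auto
qed

lemma avg_deriv_t:
  assumes v: "integrable lborel v" and b: "bumpfam l u \<eta>"
  shows "((\<lambda>s. avg v \<eta> I (t + s *\<^sub>R axis i 1) \<rho>) has_real_derivative - avg v \<eta> (i # I) (t + s0 *\<^sub>R axis i 1) \<rho>) (at s0)"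
proof -
  let ?W = "der I \<eta>"
  have bW: "bumpfam l u ?W" "bumpfam l u (der (i # I) \<eta>)" by (rule bumpfam_der[OF b])+
  have sm: "\<And>i. smooth (?W i)" by (rule bumpfam_smooth[OF bW(1)])
  obtain C where C: "C > 0" "\<And>x. \<bar>prodfun ?W x\<bar> \<le> C" using prodfun_bounded[OF bW(1)] by blast
  obtain C' where C': "C' > 0" "\<And>x. \<bar>prodfun (der (i # I) \<eta>) x\<bar> \<le> C'" using prodfun_bounded[OF bW(2)] by blast
  have [measurable]: "prodfun ?W \<in> borel_measurable borel" "prodfun (der (i # I) \<eta>) \<in> borel_measurable borel"
    by (intro prodfun_measurable bumpfam_smooth[OF bW(1)] bumpfam_smooth[OF bW(2)])+
  define \<gamma> where "\<gamma> y s = (1 / \<rho>) *\<^sub>R (y - (t + s *\<^sub>R axis i 1))" for y s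
  have "((\<lambda>s. \<integral>y. v y * prodfun ?W (\<gamma> y s) \<partial>lborel) has_real_derivative
     (\<integral>y. v y * ((- 1 / \<rho>) * prodfun (der (i # I) \<eta>) (\<gamma> y s0)) \<partial>lborel)) (at s0)"
  proof (rule has_real_derivative_integral[OF v zero_less_one, where C = "max C (\<bar>1 / \<rho>\<bar> * C')"])
    fix s y
    have "((\<lambda>s. \<gamma> y s $ j) has_real_derivative ((- 1 / \<rho>) *\<^sub>R axis i 1) $ j) (at s)" for j
    proof -
      have "((\<lambda>s. c * (y $ j - (t $ j + s * a))) has_real_derivative - c * a) (at s)" for c a :: real
        by (auto intro!: derivative_eq_intros)
      from this[of "1 / \<rho>" "axis i 1 $ j"] show ?thesis by (simp add: \<gamma>_def)
    qed
    from prodfun_has_path_derivative[of ?W "\<gamma> y", OF sm this]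
    have "((\<lambda>s. prodfun ?W (\<gamma> y s)) has_real_derivative (\<Sum>j\<in>UNIV. ((- 1 / \<rho>) *\<^sub>R axis i 1) $ j * prodfun (der [j] ?W) (\<gamma> y s))) (at s)" .
    moreover have "(\<Sum>j\<in>UNIV. ((- 1 / \<rho>) *\<^sub>R axis i 1) $ j * prodfun (der [j] ?W) (\<gamma> y s)) = (- 1 / \<rho>) * prodfun (der (i # I) \<eta>) (\<gamma> y s)"
      unfolding der_Cons[of i I] by (subst sum.remove[of _ i]) (auto simp: axis_def intro!: sum.neutral)
    ultimately show "((\<lambda>s. prodfun ?W (\<gamma> y s)) has_real_derivative (- 1 / \<rho>) * prodfun (der (i # I) \<eta>) (\<gamma> y s)) (at s)"
      by simp
    show "\<bar>prodfun ?W (\<gamma> y s)\<bar> \<le> max C (\<bar>1 / \<rho>\<bar> * C')" using C(2)[of "\<gamma> y s"] by simp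
    have "\<bar>(- 1 / \<rho>) * prodfun (der (i # I) \<eta>) (\<gamma> y s)\<bar> = \<bar>1 / \<rho>\<bar> * \<bar>prodfun (der (i # I) \<eta>) (\<gamma> y s)\<bar>"
      by (simp add: abs_mult)
    also have "\<dots> \<le> \<bar>1 / \<rho>\<bar> * C'" by (intro mult_left_mono C') simp
    finally show "\<bar>(- 1 / \<rho>) * prodfun (der (i # I) \<eta>) (\<gamma> y s)\<bar> \<le> max C (\<bar>1 / \<rho>\<bar> * C')" by simp
  qed (simp_all add: \<gamma>_def)
  moreover have "(\<integral>y. v y * ((- 1 / \<rho>) * prodfun (der (i # I) \<eta>) (\<gamma> y s0)) \<partial>lborel) =
     (- 1 / \<rho>) * (\<integral>y. v y * prodfun (der (i # I) \<eta>) (\<gamma> y s0) \<partial>lborel)"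
    by (subst integral_mult_right_zero[symmetric]) (simp only: mult_ac)
  ultimately have "((\<lambda>s. \<integral>y. v y * prodfun ?W (\<gamma> y s) \<partial>lborel) has_real_derivative
     (- 1 / \<rho>) * (\<integral>y. v y * prodfun (der (i # I) \<eta>) (\<gamma> y s0) \<partial>lborel)) (at s0)" by simp
  from DERIV_cmult[OF this, of "(1 / \<rho>) ^ (CARD('a) + length I)"]
  have "((\<lambda>s. (1 / \<rho>) ^ (CARD('a) + length I) * (\<integral>y. v y * prodfun ?W (\<gamma> y s) \<partial>lborel)) has_real_derivative
     - ((1 / \<rho>) ^ Suc (CARD('a) + length I) * (\<integral>y. v y * prodfun (der (i # I) \<eta>) (\<gamma> y s0) \<partial>lborel))) (at s0)"
    by (rule DERIV_cong) simp
  then show ?thesis by (simp only: avg_def \<gamma>_def list.size add_Suc_right add_0_right One_nat_def)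
qed

text \<open>The key to the embedding: the derivative of an average in the scale is a sum of averages of the next
  higher order. All powers of \<open>1 / \<rho>\<close> and the terms without an additional derivative cancel.\<close>

lemma avg_deriv_rho:
  fixes v :: "real^'d \<Rightarrow> real"
  assumes v: "integrable lborel v" and b: "bumpfam l u \<eta>" and "\<rho> > 0"
  shows "((\<lambda>r. avg v \<eta> I t r) has_real_derivative - (\<Sum>i\<in>UNIV. avg v (coordmul i \<eta>) (i # I) t \<rho>)) (at \<rho>)"
proof -
  let ?W = "der I \<eta>" and ?N = "CARD('d) + length I"
  let ?M = "\<lambda>i. der (i # I) (coordmul i \<eta>)"
  have bW: "bumpfam l u ?W" by (rule bumpfam_der[OF b])
  have bM: "bumpfam l u (?M i)" for i by (rule bumpfam_der[OF bumpfam_coordmul[OF b]])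
  have sm: "\<And>i. smooth (?W i)" by (rule bumpfam_smooth[OF bW])
  have sm0: "\<And>i. smooth (\<eta> i)" by (rule bumpfam_smooth[OF b])
  obtain C where C: "C > 0" "\<And>x. \<bar>prodfun ?W x\<bar> \<le> C" using prodfun_bounded[OF bW] by blast
  have "\<exists>C>0. \<forall>x. \<bar>prodfun (?M i) x\<bar> \<le> C" for i using prodfun_bounded[OF bM] by metis
  then obtain D where D: "\<And>i. D i > 0" "\<And>i x. \<bar>prodfun (?M i) x\<bar> \<le> D i" by metis
  have [measurable]: "prodfun ?W \<in> borel_measurable borel" "\<And>i. prodfun (?M i) \<in> borel_measurable borel"
    by (intro prodfun_measurable bumpfam_smooth[OF bW] bumpfam_smooth[OF bM])+
  define \<gamma> where "\<gamma> y r = (1 / r) *\<^sub>R (y - t)" for y :: "real^'d" and r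
  define k' where "k' r y = - (1 / r) * ((\<Sum>i\<in>UNIV. prodfun (?M i) (\<gamma> y r)) - real ?N * prodfun ?W (\<gamma> y r))" for r y
  let ?S = "(\<Sum>i\<in>UNIV. D i) + real ?N * C"
  have kb: "\<bar>(\<Sum>i\<in>UNIV. prodfun (?M i) x) - real ?N * prodfun ?W x\<bar> \<le> ?S" for x
  proof -
    have 1: "\<bar>\<Sum>i\<in>UNIV. prodfun (?M i) x\<bar> \<le> (\<Sum>i\<in>UNIV. D i)"
      by (intro order_trans[OF sum_abs] sum_mono D)
    have 2: "\<bar>real ?N * prodfun ?W x\<bar> \<le> real ?N * C" unfolding abs_mult using C(2)[of x] by (simp add: mult_left_mono)
    show ?thesis using abs_triangle_ineq4[of "\<Sum>i\<in>UNIV. prodfun (?M i) x" "real ?N * prodfun ?W x"] 1 2 by linarith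
  qed
  have S0: "?S \<ge> 0" using order_trans[OF abs_ge_zero kb] .
  have der: "((\<lambda>r. prodfun ?W (\<gamma> y r)) has_real_derivative k' r y) (at r)" if r: "r > 0" for r y
  proof -
    have "((\<lambda>r. \<gamma> y r $ j) has_real_derivative (- (1 / r) *\<^sub>R \<gamma> y r) $ j) (at r)" for j
      unfolding \<gamma>_def using r by (auto intro!: derivative_eq_intros simp: field_simps)
    from prodfun_has_path_derivative[of ?W "\<gamma> y", OF sm this]
    have "((\<lambda>r. prodfun ?W (\<gamma> y r)) has_real_derivative (\<Sum>j\<in>UNIV. (- (1 / r) *\<^sub>R \<gamma> y r) $ j * prodfun (der [j] ?W) (\<gamma> y r))) (at r)" .
    also have "(\<Sum>j\<in>UNIV. (- (1 / r) *\<^sub>R \<gamma> y r) $ j * prodfun (der [j] ?W) (\<gamma> y r)) =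
      - (1 / r) * (\<Sum>j\<in>UNIV. prodfun (?M j) (\<gamma> y r) - real (Suc (count_list I j)) * prodfun ?W (\<gamma> y r))"
      unfolding sum_distrib_left
      by (intro sum.cong refl) (simp add: prodfun_der_coordmul[of \<eta>, OF sm0] der_Cons[of _ I, symmetric] algebra_simps)
    also have "(\<Sum>j\<in>UNIV. prodfun (?M j) (\<gamma> y r) - real (Suc (count_list I j)) * prodfun ?W (\<gamma> y r))
      = (\<Sum>j\<in>UNIV. prodfun (?M j) (\<gamma> y r)) - real ?N * prodfun ?W (\<gamma> y r)"
    proof -
      have "(\<Sum>j\<in>(UNIV::'d set). real (Suc (count_list I j))) = real ?N"
        unfolding of_nat_sum[symmetric] by (simp add: sum.distrib sum_count_list_UNIV sum_Suc)
      then show ?thesis by (simp only: sum_subtractf sum_distrib_right[symmetric])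
    qed
    finally show ?thesis by (simp add: k'_def)
  qed
  have G: "((\<lambda>r. \<integral>y. v y * prodfun ?W (\<gamma> y r) \<partial>lborel) has_real_derivative (\<integral>y. v y * k' \<rho> y \<partial>lborel)) (at \<rho>)"
  proof (rule has_real_derivative_integral[OF v, where \<delta> = "\<rho> / 2" and C = "max C ((2 / \<rho>) * ?S)"])
    show "\<rho> / 2 > 0" using assms(3) by simp
    show "k' \<rho> \<in> borel_measurable lborel" unfolding k'_def \<gamma>_def by measurable
    show "(\<lambda>y. prodfun ?W (\<gamma> y r)) \<in> borel_measurable lborel" for r unfolding \<gamma>_def by measurable
    fix r y assume "\<bar>r - \<rho>\<bar> < \<rho> / 2"
    then have r: "r > \<rho> / 2" by linarith
    then have "r > 0" using assms(3) by simp
    then show "((\<lambda>r. prodfun ?W (\<gamma> y r)) has_real_derivative k' r y) (at r)" by (rule der)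
    show "\<bar>prodfun ?W (\<gamma> y r)\<bar> \<le> max C ((2 / \<rho>) * ?S)" using C(2)[of "\<gamma> y r"] by simp
    have "\<bar>k' r y\<bar> = (1 / r) * \<bar>(\<Sum>i\<in>UNIV. prodfun (?M i) (\<gamma> y r)) - real ?N * prodfun ?W (\<gamma> y r)\<bar>"
      using \<open>r > 0\<close> unfolding k'_def abs_mult by simp
    also have "\<dots> \<le> (2 / \<rho>) * ?S"
      using r \<open>r > 0\<close> assms(3) by (intro mult_mono kb) (auto simp: field_simps)
    finally show "\<bar>k' r y\<bar> \<le> max C ((2 / \<rho>) * ?S)" by simp
  qed
  have Gk: "(\<integral>y. v y * k' \<rho> y \<partial>lborel) = - (1 / \<rho>) * ((\<Sum>i\<in>UNIV. \<integral>y. v y * prodfun (?M i) (\<gamma> y \<rho>) \<partial>lborel) - real ?N * (\<integral>y. v y * prodfun ?W (\<gamma> y \<rho>) \<partial>lborel))"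
  proof -
    have i1: "integrable lborel (\<lambda>y. v y * prodfun (?M i) (\<gamma> y \<rho>))" for i unfolding \<gamma>_def by (rule avg_integrable[OF v bM])
    have i2: "integrable lborel (\<lambda>y. v y * prodfun ?W (\<gamma> y \<rho>))" unfolding \<gamma>_def by (rule avg_integrable[OF v bW])
    have "(\<integral>y. v y * k' \<rho> y \<partial>lborel) = (\<integral>y. - (1 / \<rho>) * ((\<Sum>i\<in>UNIV. v y * prodfun (?M i) (\<gamma> y \<rho>)) - real ?N * (v y * prodfun ?W (\<gamma> y \<rho>))) \<partial>lborel)"
      unfolding k'_def by (intro Bochner_Integration.integral_cong refl) (simp only: sum_distrib_left[symmetric] right_diff_distrib mult_ac)
    also have "\<dots> = - (1 / \<rho>) * ((\<integral>y. (\<Sum>i\<in>UNIV. v y * prodfun (?M i) (\<gamma> y \<rho>)) \<partial>lborel) - (\<integral>y. real ?N * (v y * prodfun ?W (\<gamma> y \<rho>)) \<partial>lborel))"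
      using i1 i2 by (subst integral_mult_right_zero, subst Bochner_Integration.integral_diff) auto
    also have "(\<integral>y. (\<Sum>i\<in>UNIV. v y * prodfun (?M i) (\<gamma> y \<rho>)) \<partial>lborel) = (\<Sum>i\<in>UNIV. \<integral>y. v y * prodfun (?M i) (\<gamma> y \<rho>) \<partial>lborel)"
      by (intro Bochner_Integration.integral_sum i1)
    also have "(\<integral>y. real ?N * (v y * prodfun ?W (\<gamma> y \<rho>)) \<partial>lborel) = real ?N * (\<integral>y. v y * prodfun ?W (\<gamma> y \<rho>) \<partial>lborel)"
      by (rule integral_mult_right_zero)
    finally show ?thesis .
  qed
  have pw: "((\<lambda>r. (1 / r) ^ ?N) has_real_derivative - real ?N * (1 / \<rho>) ^ Suc ?N) (at \<rho>)"
  proof -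
    have d: "((\<lambda>r. 1 / r) has_real_derivative - (1 / \<rho>) * (1 / \<rho>)) (at \<rho>)"
      using assms(3) by (auto intro!: derivative_eq_intros simp: field_simps)
    have alg: "real N * (- x * x * x ^ (N - Suc 0)) = - real N * x ^ Suc N" for N and x :: real
      by (cases N) (simp_all add: algebra_simps)
    show ?thesis by (rule DERIV_cong[OF DERIV_power[OF d] alg])
  qed
  have alg: "- N * (x * p) * A + (- x * (S - N * A)) * p = - ((x * p) * S)" for N x p A S :: real
    by (simp add: algebra_simps)
  have "((\<lambda>r. (1 / r) ^ ?N * (\<integral>y. v y * prodfun ?W (\<gamma> y r) \<partial>lborel)) has_real_derivative
     - real ?N * (1 / \<rho>) ^ Suc ?N * (\<integral>y. v y * prodfun ?W (\<gamma> y \<rho>) \<partial>lborel) +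
     (- (1 / \<rho>) * ((\<Sum>i\<in>UNIV. \<integral>y. v y * prodfun (?M i) (\<gamma> y \<rho>) \<partial>lborel) - real ?N * (\<integral>y. v y * prodfun ?W (\<gamma> y \<rho>) \<partial>lborel))) * (1 / \<rho>) ^ ?N) (at \<rho>)"
    using DERIV_mult[OF pw G] unfolding Gk .
  then have "((\<lambda>r. (1 / r) ^ ?N * (\<integral>y. v y * prodfun ?W (\<gamma> y r) \<partial>lborel)) has_real_derivative
      - ((1 / \<rho>) ^ Suc ?N * (\<Sum>i\<in>UNIV. \<integral>y. v y * prodfun (?M i) (\<gamma> y \<rho>) \<partial>lborel))) (at \<rho>)"
    by (rule DERIV_cong) (simp only: power_Suc alg)
  then show ?thesis by (simp only: avg_def[abs_def] \<gamma>_def sum_distrib_left list.size add_Suc_right add_0_right One_nat_def)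
qed

lemma increment_bound_of_deriv_bound:
  fixes f f' :: "real \<Rightarrow> real"
  assumes "0 < \<rho>'" "\<rho>' \<le> \<rho>" "e \<noteq> 0"
    and der: "\<And>r. \<rho>' \<le> r \<Longrightarrow> r \<le> \<rho> \<Longrightarrow> (f has_real_derivative f' r) (at r)"
    and bd: "\<And>r. \<rho>' \<le> r \<Longrightarrow> r \<le> \<rho> \<Longrightarrow> \<bar>f' r\<bar> \<le> C * r powr (e - 1)"
  shows "\<bar>f \<rho> - f \<rho>'\<bar> \<le> (C / e) * (\<rho> powr e - \<rho>' powr e)"
proof -
  have g: "((\<lambda>r. (C / e) * r powr e) has_real_derivative C * r powr (e - 1)) (at r)" if "r \<ge> \<rho>'" for r
    using that assms(1,3) by (auto intro!: derivative_eq_intros)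
  have "(C / e) * \<rho>' powr e - f \<rho>' \<le> (C / e) * \<rho> powr e - f \<rho>"
  proof (rule DERIV_nonneg_imp_nondecreasing[OF assms(2), of "\<lambda>r. (C / e) * r powr e - f r"])
    fix r assume r: "\<rho>' \<le> r" "r \<le> \<rho>"
    show "\<exists>y. ((\<lambda>r. (C / e) * r powr e - f r) has_real_derivative y) (at r) \<and> 0 \<le> y"
      using DERIV_diff[OF g[OF r(1)] der[OF r]] bd[OF r] by (intro exI[of _ "C * r powr (e - 1) - f' r"]) auto
  qed
  moreover have "(C / e) * \<rho>' powr e + f \<rho>' \<le> (C / e) * \<rho> powr e + f \<rho>"
  proof (rule DERIV_nonneg_imp_nondecreasing[OF assms(2), of "\<lambda>r. (C / e) * r powr e + f r"])
    fix r assume r: "\<rho>' \<le> r" "r \<le> \<rho>"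
    show "\<exists>y. ((\<lambda>r. (C / e) * r powr e + f r) has_real_derivative y) (at r) \<and> 0 \<le> y"
      using DERIV_add[OF g[OF r(1)] der[OF r]] bd[OF r] by (intro exI[of _ "C * r powr (e - 1) + f' r"]) auto
  qed
  ultimately show ?thesis by (simp add: abs_le_iff right_diff_distrib)
qed

lemma avg_bounded_at:
  assumes v: "integrable lborel v" and b: "bumpfam l u \<eta>"
  obtains C where "C > 0" "\<And>t. \<bar>avg v \<eta> I t \<rho>\<bar> \<le> C"
proof -
  have bW: "bumpfam l u (der I \<eta>)" by (rule bumpfam_der[OF b])
  obtain C where C: "C > 0" "\<And>x. \<bar>prodfun (der I \<eta>) x\<bar> \<le> C" using prodfun_bounded[OF bW] by blast
  let ?B = "\<bar>(1 / \<rho>) ^ (CARD('a) + length I)\<bar> * (\<integral>y. \<bar>v y\<bar> * C \<partial>lborel)"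
  have B: "\<bar>avg v \<eta> I t \<rho>\<bar> \<le> ?B" for t
    unfolding avg_def abs_mult
  proof (rule mult_left_mono)
    show "\<bar>\<integral>y. v y * prodfun (der I \<eta>) ((1 / \<rho>) *\<^sub>R (y - t)) \<partial>lborel\<bar> \<le> (\<integral>y. \<bar>v y\<bar> * C \<partial>lborel)"
      using v by (intro order_trans[OF integral_abs_bound] integral_mono avg_integrable[OF v bW] integrable_abs)
        (auto simp: abs_mult intro!: mult_left_mono C)
  qed simp
  show thesis
  proof (rule that)
    show "\<bar>?B\<bar> + 1 > 0" by linarith
    show "\<bar>avg v \<eta> I t \<rho>\<bar> \<le> \<bar>?B\<bar> + 1" for t using B[of t] by linarith
  qed
qed

lemma avg_continuous:
  assumes v: "integrable lborel v" and b: "bumpfam l u \<eta>"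
  shows "isCont (\<lambda>t. avg v \<eta> I t \<rho>) t0"
proof -
  have bW: "bumpfam l u (der I \<eta>)" by (rule bumpfam_der[OF b])
  obtain C where C: "C > 0" "\<And>x. \<bar>prodfun (der I \<eta>) x\<bar> \<le> C" using prodfun_bounded[OF bW] by blast
  have cont: "isCont (prodfun (der I \<eta>)) x" for x
    using prodfun_has_derivative[of "der I \<eta>", OF bumpfam_smooth[OF bW]] has_derivative_continuous by blast
  have [measurable]: "prodfun (der I \<eta>) \<in> borel_measurable borel"
    by (rule prodfun_measurable[OF bumpfam_smooth[OF bW]])
  have [measurable]: "v \<in> borel_measurable borel" using borel_measurable_integrable[OF v] by simp
  have "isCont (\<lambda>t. \<integral>y. v y * prodfun (der I \<eta>) ((1 / \<rho>) *\<^sub>R (y - t)) \<partial>lborel) t0"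
    unfolding continuous_at_sequentially comp_def
  proof (intro allI impI)
    fix X assume X: "X \<longlonglongrightarrow> t0"
    show "(\<lambda>n. \<integral>y. v y * prodfun (der I \<eta>) ((1 / \<rho>) *\<^sub>R (y - X n)) \<partial>lborel) \<longlonglongrightarrow> (\<integral>y. v y * prodfun (der I \<eta>) ((1 / \<rho>) *\<^sub>R (y - t0)) \<partial>lborel)"
    proof (rule integral_dominated_convergence[where w = "\<lambda>y. \<bar>v y\<bar> * C"])
      show "integrable lborel (\<lambda>y. \<bar>v y\<bar> * C)" using v by simp
      show "AE y in lborel. (\<lambda>n. v y * prodfun (der I \<eta>) ((1 / \<rho>) *\<^sub>R (y - X n))) \<longlonglongrightarrow> v y * prodfun (der I \<eta>) ((1 / \<rho>) *\<^sub>R (y - t0))"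
        by (intro AE_I2 tendsto_mult_left isCont_tendsto_compose[OF cont] tendsto_intros X)
      show "AE y in lborel. norm (v y * prodfun (der I \<eta>) ((1 / \<rho>) *\<^sub>R (y - X n))) \<le> \<bar>v y\<bar> * C" for n
        by (intro AE_I2) (auto simp: abs_mult intro!: mult_left_mono C)
    qed measurable
  qed
  then show ?thesis unfolding avg_def by (intro continuous_mult continuous_const)
qed

lemma avg_tendsto:
  fixes v :: "real^'d \<Rightarrow> real"
  assumes [measurable]: "v \<in> borel_measurable borel" and vb: "\<And>x. \<bar>v x\<bar> \<le> V"
    and b: "bumpfam l u \<eta>" and r: "r \<longlonglongrightarrow> 0" "\<And>n. r n > 0"
    and cont: "\<And>z. z \<in> cbox l u \<Longrightarrow> (\<lambda>n. v (t + r n *\<^sub>R z)) \<longlonglongrightarrow> v t"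
  shows "(\<lambda>n. avg v \<eta> [] t (r n)) \<longlonglongrightarrow> v t * (\<integral>z. prodfun \<eta> z \<partial>lborel)"
proof -
  have [measurable]: "prodfun \<eta> \<in> borel_measurable borel"
    by (rule prodfun_measurable[OF bumpfam_smooth[OF b]])
  have eq: "avg v \<eta> [] t \<rho> = (\<integral>z. v (t + \<rho> *\<^sub>R z) * prodfun \<eta> z \<partial>lborel)" if "\<rho> > 0" for \<rho>
    unfolding avg_def using that
    by (subst integral_affine_vec[OF _ that, where t = t]) (auto simp: power_divide)
  have "(\<lambda>n. \<integral>z. v (t + r n *\<^sub>R z) * prodfun \<eta> z \<partial>lborel) \<longlonglongrightarrow> (\<integral>z. v t * prodfun \<eta> z \<partial>lborel)"
  proof (rule integral_dominated_convergence[where w = "\<lambda>z. V * \<bar>prodfun \<eta> z\<bar>"])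
    show "integrable lborel (\<lambda>z. V * \<bar>prodfun \<eta> z\<bar>)"
      using prodfun_integrable[OF b] by simp
    show "AE z in lborel. (\<lambda>n. v (t + r n *\<^sub>R z) * prodfun \<eta> z) \<longlonglongrightarrow> v t * prodfun \<eta> z"
    proof (rule AE_I2)
      fix z show "(\<lambda>n. v (t + r n *\<^sub>R z) * prodfun \<eta> z) \<longlonglongrightarrow> v t * prodfun \<eta> z"
        using prodfun_zero_outside[OF b, of z] cont[of z] by (cases "z \<in> cbox l u") (auto intro: tendsto_mult_right)
    qed
    show "AE z in lborel. norm (v (t + r n *\<^sub>R z) * prodfun \<eta> z) \<le> V * \<bar>prodfun \<eta> z\<bar>" for n
      by (intro AE_I2) (auto simp: abs_mult intro!: mult_right_mono vb)
  qed measurable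
  then show ?thesis by (simp add: eq[OF r(2)])
qed

subsection \<open>Weak derivatives against rescaled bumps\<close>

lemma sobolev_spaceD:
  assumes "v \<in> sobolev_space \<Omega> m"
  shows "\<And>x. x \<notin> \<Omega> \<Longrightarrow> v x = 0" "continuous_on \<Omega> v"
    "\<And>\<beta>. mi_order \<beta> \<le> nat \<lfloor>m\<rfloor> \<Longrightarrow> has_weak_deriv (interior \<Omega>) \<beta> v (weak_deriv (interior \<Omega>) \<beta> v)"
    "sobolev_energy (interior \<Omega>) m v < \<infinity>"
  using assms has_weak_deriv_weak_deriv unfolding sobolev_space_def by blast+

lemma sobolev_energy_finite_parts:
  assumes "sobolev_energy U m f < \<infinity>"
  shows "mi_order \<beta> \<le> nat \<lfloor>m\<rfloor> \<Longrightarrow> (\<integral>\<^sup>+x\<in>U. ennreal ((weak_deriv U \<beta> f x)\<^sup>2) \<partial>lborel) < \<infinity>"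
    and "mi_order (\<beta> :: nat^'d) = nat \<lfloor>m\<rfloor> \<Longrightarrow> frac m \<noteq> 0 \<Longrightarrow>
      (\<integral>\<^sup>+x\<in>U. (\<integral>\<^sup>+y\<in>U. ennreal ((weak_deriv U \<beta> f x - weak_deriv U \<beta> f y)\<^sup>2 /
           norm (x - y) powr (real CARD('d) + 2 * frac m)) \<partial>lborel) \<partial>lborel) < \<infinity>"
proof -
  let ?A = "\<lambda>\<beta>. \<integral>\<^sup>+x\<in>U. ennreal ((weak_deriv U \<beta> f x)\<^sup>2) \<partial>lborel"
  let ?F = "\<lambda>\<beta>. (\<integral>\<^sup>+x\<in>U. (\<integral>\<^sup>+y\<in>U. ennreal ((weak_deriv U \<beta> f x - weak_deriv U \<beta> f y)\<^sup>2 /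
           norm (x - y) powr (real CARD('d) + 2 * frac m)) \<partial>lborel) \<partial>lborel)"
  have fin: "finite {\<beta> :: nat^'d. mi_order \<beta> = nat \<lfloor>m\<rfloor>}"
    by (rule finite_subset[OF _ finite_mi_order_le[of "nat \<lfloor>m\<rfloor>"]]) auto
  have sum: "(\<Sum>\<beta>\<in>{\<beta>. mi_order \<beta> \<le> nat \<lfloor>m\<rfloor>}. ?A \<beta>) + (if frac m = 0 then 0 else \<Sum>\<beta>\<in>{\<beta>. mi_order \<beta> = nat \<lfloor>m\<rfloor>}. ?F \<beta>) < \<infinity>"
    using assms unfolding sobolev_energy_def .
  show "?A \<beta> < \<infinity>" if "mi_order \<beta> \<le> nat \<lfloor>m\<rfloor>" for \<beta>
  proof -
    have "?A \<beta> \<le> (\<Sum>\<beta>\<in>{\<beta>. mi_order \<beta> \<le> nat \<lfloor>m\<rfloor>}. ?A \<beta>)"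
      using that by (intro member_le_sum finite_mi_order_le) auto
    also have "\<dots> \<le> (\<Sum>\<beta>\<in>{\<beta>. mi_order \<beta> \<le> nat \<lfloor>m\<rfloor>}. ?A \<beta>) + (if frac m = 0 then 0 else \<Sum>\<beta>\<in>{\<beta>. mi_order \<beta> = nat \<lfloor>m\<rfloor>}. ?F \<beta>)"
      by (rule add_increasing2) simp_all
    also note sum
    finally show ?thesis .
  qed
  show "?F \<beta> < \<infinity>" if "mi_order \<beta> = nat \<lfloor>m\<rfloor>" "frac m \<noteq> 0" for \<beta>
  proof -
    have "?F \<beta> \<le> (\<Sum>\<beta>\<in>{\<beta>. mi_order \<beta> = nat \<lfloor>m\<rfloor>}. ?F \<beta>)"
      using that by (intro member_le_sum fin) auto
    also have "\<dots> \<le> (\<Sum>\<beta>\<in>{\<beta>. mi_order \<beta> \<le> nat \<lfloor>m\<rfloor>}. ?A \<beta>) + (if frac m = 0 then 0 else \<Sum>\<beta>\<in>{\<beta>. mi_order \<beta> = nat \<lfloor>m\<rfloor>}. ?F \<beta>)"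
      unfolding if_not_P[OF that(2)] by (rule add_increasing) simp_all
    also note sum
    finally show ?thesis .
  qed
qed

definition mi_of :: "'d list \<Rightarrow> nat^'d" where
  "mi_of I = (\<chi> i. count_list I i)"

lemma mi_order_mi_of: "mi_order (mi_of I) = length I"
  by (simp add: mi_order_def mi_of_def sum_count_list_UNIV)

text \<open>The rescaled bump is a test function, so the definition of the weak derivative applies; each of the
  derivatives costs a factor \<open>1 / \<rho>\<close>.\<close>

lemma avg_eq_weak_deriv:
  fixes v :: "real^'d \<Rightarrow> real"
  assumes wd: "has_weak_deriv U (mi_of J) v g" and b: "bumpfam l u \<eta>" and "\<rho> > 0"
    and sub: "cbox (t + \<rho> *\<^sub>R l) (t + \<rho> *\<^sub>R u) \<subseteq> U"
  shows "(\<integral>y. v y * prodfun (der J \<eta>) ((1 / \<rho>) *\<^sub>R (y - t)) \<partial>lborel)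
    = \<rho> ^ length J * (- 1) ^ length J * (\<integral>y. g y * prodfun (rescale t \<rho> \<eta>) y \<partial>lborel)"
proof -
  have sm: "\<And>i. smooth (\<eta> i)" by (rule bumpfam_smooth[OF b])
  have bR: "bumpfam (t + \<rho> *\<^sub>R l) (t + \<rho> *\<^sub>R u) (rescale t \<rho> \<eta>)" by (rule bumpfam_rescale[OF b assms(3)])
  have smR: "\<And>i. smooth (rescale t \<rho> \<eta> i)" by (rule bumpfam_smooth[OF bR])
  have bD: "bumpfam (t + \<rho> *\<^sub>R l) (t + \<rho> *\<^sub>R u) (der J (rescale t \<rho> \<eta>))" by (rule bumpfam_der[OF bR])
  have m: "mderiv (mi_of J) (prodfun (rescale t \<rho> \<eta>)) = prodfun (der J (rescale t \<rho> \<eta>))"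
    by (rule mderiv_prodfun[OF smR]) (simp add: mi_of_def)
  have lv: "locally_integrable U v" and lg: "locally_integrable U g" using wd by (auto simp: has_weak_deriv_def)
  have "(\<integral>y. v y * prodfun (der J \<eta>) ((1 / \<rho>) *\<^sub>R (y - t)) \<partial>lborel)
     = (\<integral>y. \<rho> ^ length J * (v y * prodfun (der J (rescale t \<rho> \<eta>)) y) \<partial>lborel)"
    using assms(3) by (intro Bochner_Integration.integral_cong refl)
      (simp add: prodfun_der_rescale[of \<eta>, OF sm] prodfun_rescale power_one_over)
  also have "\<dots> = \<rho> ^ length J * (\<integral>y. v y * prodfun (der J (rescale t \<rho> \<eta>)) y \<partial>lborel)"
    by (rule integral_mult_right_zero)
  also have "(\<integral>y. v y * prodfun (der J (rescale t \<rho> \<eta>)) y \<partial>lborel) = (LINT y:U|lborel. v y * mderiv (mi_of J) (prodfun (rescale t \<rho> \<eta>)) y)"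
    unfolding m by (rule locally_integrable_mult_prodfun(2)[OF lv bD sub, symmetric])
  also have "\<dots> = (- 1) ^ mi_order (mi_of J) * (LINT y:U|lborel. g y * prodfun (rescale t \<rho> \<eta>) y)"
    using wd prodfun_test_fun[OF bR sub] unfolding has_weak_deriv_def by blast
  also have "(LINT y:U|lborel. g y * prodfun (rescale t \<rho> \<eta>) y) = (\<integral>y. g y * prodfun (rescale t \<rho> \<eta>) y \<partial>lborel)"
    by (rule locally_integrable_mult_prodfun(2)[OF lg bR sub])
  finally show ?thesis by (simp only: mi_order_mi_of mult.assoc)
qed

lemma weighted_AM_GM: "\<epsilon> > 0 \<Longrightarrow> \<bar>a * b\<bar> \<le> (\<epsilon> * a\<^sup>2 + b\<^sup>2 / \<epsilon>) / 2" for a b \<epsilon> :: real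
proof -
  assume e: "\<epsilon> > 0"
  have "0 \<le> (\<epsilon> * \<bar>a\<bar> - \<bar>b\<bar>)\<^sup>2 / \<epsilon>" using e by simp
  also have "\<dots> = \<epsilon> * a\<^sup>2 - 2 * \<bar>a * b\<bar> + b\<^sup>2 / \<epsilon>"
    using e by (simp add: power2_eq_square field_simps abs_mult)
  finally show ?thesis by simp
qed

lemma integral_rescaled_bump_squared:
  fixes \<eta> :: "'d::finite \<Rightarrow> real \<Rightarrow> real"
  assumes b: "bumpfam l u \<eta>" and "\<rho> > 0"
  shows "(\<integral>\<^sup>+y. ennreal ((prodfun (rescale t \<rho> \<eta>) y)\<^sup>2) \<partial>lborel) = ennreal (\<rho> ^ CARD('d) * (\<integral>z. (prodfun \<eta> z)\<^sup>2 \<partial>lborel))"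
    and "integrable lborel (\<lambda>z. (prodfun \<eta> z)\<^sup>2)"
proof -
  have [measurable]: "prodfun \<eta> \<in> borel_measurable borel" "prodfun (rescale t \<rho> \<eta>) \<in> borel_measurable borel"
    by (intro prodfun_measurable bumpfam_smooth[OF b] bumpfam_smooth[OF bumpfam_rescale[OF b assms(2)]])+
  obtain C where C: "C > 0" "\<And>x. \<bar>prodfun \<eta> x\<bar> \<le> C" using prodfun_bounded[OF b] by metis
  show i: "integrable lborel (\<lambda>z. (prodfun \<eta> z)\<^sup>2)"
  proof (rule integrable_bounded_cbox[of _ l u "C\<^sup>2"])
    show "\<bar>(prodfun \<eta> x)\<^sup>2\<bar> \<le> C\<^sup>2" for x using power_mono[OF C(2)[of x], of 2] by simp
  qed (simp_all add: prodfun_zero_outside[OF b])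
  have "(\<integral>\<^sup>+y. ennreal ((prodfun (rescale t \<rho> \<eta>) y)\<^sup>2) \<partial>lborel) = ennreal (\<rho> ^ CARD('d)) * (\<integral>\<^sup>+z. ennreal ((prodfun \<eta> z)\<^sup>2) \<partial>lborel)"
    using assms(2) by (subst nn_integral_affine_vec[OF _ assms(2), where t = t]) (auto simp: prodfun_rescale)
  also have "(\<integral>\<^sup>+z. ennreal ((prodfun \<eta> z)\<^sup>2) \<partial>lborel) = ennreal (\<integral>z. (prodfun \<eta> z)\<^sup>2 \<partial>lborel)"
    by (rule nn_integral_eq_integral[OF i]) simp
  finally show "(\<integral>\<^sup>+y. ennreal ((prodfun (rescale t \<rho> \<eta>) y)\<^sup>2) \<partial>lborel) = ennreal (\<rho> ^ CARD('d) * (\<integral>z. (prodfun \<eta> z)\<^sup>2 \<partial>lborel))"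
    using assms(2) by (simp add: ennreal_mult)
qed

lemma locally_integrable_measurable:
  fixes g :: "real^'d \<Rightarrow> real"
  assumes "locally_integrable U g" "cbox l u \<subseteq> U"
  shows "(\<lambda>x. indicator (cbox l u) x * g x) \<in> borel_measurable borel"
    and "integrable lborel (\<lambda>x. indicator (cbox l u) x * g x)"
proof -
  show i: "integrable lborel (\<lambda>x. indicator (cbox l u) x * g x)"
    using assms compact_cbox unfolding locally_integrable_def set_integrable_def real_scaleR_def by blast
  then show "(\<lambda>x. indicator (cbox l u) x * g x) \<in> borel_measurable borel" by (auto dest: borel_measurable_integrable)
qed

lemma L2_against_rescaled_bump:
  fixes g :: "real^'d \<Rightarrow> real"
  assumes loc: "locally_integrable U g" and fin: "(\<integral>\<^sup>+x\<in>U. ennreal ((g x)\<^sup>2) \<partial>lborel) < \<infinity>"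
    and b: "bumpfam l u \<eta>"
  obtains C where "C > 0" "\<And>t \<rho>. 0 < \<rho> \<Longrightarrow> cbox (t + \<rho> *\<^sub>R l) (t + \<rho> *\<^sub>R u) \<subseteq> U \<Longrightarrow>
    \<bar>\<integral>y. g y * prodfun (rescale t \<rho> \<eta>) y \<partial>lborel\<bar> \<le> C * \<rho> powr (real CARD('d) / 2)"
proof -
  let ?d = "real CARD('d)"
  define A where "A = enn2real (\<integral>\<^sup>+x\<in>U. ennreal ((g x)\<^sup>2) \<partial>lborel)"
  have A: "(\<integral>\<^sup>+x\<in>U. ennreal ((g x)\<^sup>2) \<partial>lborel) = ennreal A" "A \<ge> 0" using fin by (auto simp: A_def)
  define N where "N = (\<integral>z. (prodfun \<eta> z)\<^sup>2 \<partial>lborel)"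
  have N: "N \<ge> 0" by (simp add: N_def)
  have "\<bar>\<integral>y. g y * prodfun (rescale t \<rho> \<eta>) y \<partial>lborel\<bar> \<le> (A + N + 1) * \<rho> powr (?d / 2)"
    if \<rho>: "0 < \<rho>" and sub: "cbox (t + \<rho> *\<^sub>R l) (t + \<rho> *\<^sub>R u) \<subseteq> U" for t \<rho>
  proof -
    let ?Q = "cbox (t + \<rho> *\<^sub>R l) (t + \<rho> *\<^sub>R u)" and ?\<phi> = "prodfun (rescale t \<rho> \<eta>)"
    define h where "h x = indicator ?Q x * g x" for x
    have bR: "bumpfam (t + \<rho> *\<^sub>R l) (t + \<rho> *\<^sub>R u) (rescale t \<rho> \<eta>)" by (rule bumpfam_rescale[OF b \<rho>])
    have [measurable]: "h \<in> borel_measurable borel" "?\<phi> \<in> borel_measurable borel"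
      using locally_integrable_measurable(1)[OF loc sub] by (auto simp: h_def[abs_def] intro: prodfun_measurable bumpfam_smooth[OF bR])
    define \<epsilon> where "\<epsilon> = \<rho> powr (?d / 2)"
    have \<epsilon>: "\<epsilon> > 0" "\<rho> ^ CARD('d) = \<epsilon> * \<epsilon>" using \<rho> by (auto simp: \<epsilon>_def simp flip: powr_add powr_realpow)
    have "ennreal \<bar>\<integral>y. g y * ?\<phi> y \<partial>lborel\<bar> \<le> (\<integral>\<^sup>+y. ennreal \<bar>g y * ?\<phi> y\<bar> \<partial>lborel)"
      using integral_norm_bound_ennreal[OF locally_integrable_mult_prodfun(1)[OF loc bR sub]] by simp
    also have "\<dots> \<le> (\<integral>\<^sup>+y. ennreal (\<epsilon> / 2) * ennreal ((h y)\<^sup>2) + ennreal (1 / (2 * \<epsilon>)) * ennreal ((?\<phi> y)\<^sup>2) \<partial>lborel)"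
    proof (rule nn_integral_mono)
      fix y
      have "\<bar>g y * ?\<phi> y\<bar> = \<bar>h y * ?\<phi> y\<bar>" using prodfun_zero_outside[OF bR, of y] by (cases "y \<in> ?Q") (auto simp: h_def)
      also have "\<dots> \<le> \<epsilon> / 2 * (h y)\<^sup>2 + 1 / (2 * \<epsilon>) * (?\<phi> y)\<^sup>2"
        using weighted_AM_GM[OF \<epsilon>(1), of "h y" "?\<phi> y"] by (simp add: add_divide_distrib)
      finally show "ennreal \<bar>g y * ?\<phi> y\<bar> \<le> ennreal (\<epsilon> / 2) * ennreal ((h y)\<^sup>2) + ennreal (1 / (2 * \<epsilon>)) * ennreal ((?\<phi> y)\<^sup>2)"
        using \<epsilon>(1) by (simp add: ennreal_leI flip: ennreal_mult ennreal_plus)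
    qed
    also have "\<dots> = ennreal (\<epsilon> / 2) * (\<integral>\<^sup>+y. ennreal ((h y)\<^sup>2) \<partial>lborel) + ennreal (1 / (2 * \<epsilon>)) * (\<integral>\<^sup>+y. ennreal ((?\<phi> y)\<^sup>2) \<partial>lborel)"
      by (simp add: nn_integral_add nn_integral_cmult)
    also have "\<dots> \<le> ennreal (\<epsilon> / 2) * ennreal A + ennreal (1 / (2 * \<epsilon>)) * ennreal (\<rho> ^ CARD('d) * N)"
    proof (intro add_mono mult_left_mono)
      have "(\<integral>\<^sup>+y. ennreal ((h y)\<^sup>2) \<partial>lborel) \<le> (\<integral>\<^sup>+x\<in>U. ennreal ((g x)\<^sup>2) \<partial>lborel)"
        using sub by (intro nn_integral_mono) (auto simp: h_def indicator_def)
      then show "(\<integral>\<^sup>+y. ennreal ((h y)\<^sup>2) \<partial>lborel) \<le> ennreal A" by (simp add: A)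
      show "(\<integral>\<^sup>+y. ennreal ((?\<phi> y)\<^sup>2) \<partial>lborel) \<le> ennreal (\<rho> ^ CARD('d) * N)"
        using integral_rescaled_bump_squared(1)[OF b \<rho>, of t] by (simp add: N_def)
    qed auto
    also have "\<dots> = ennreal (\<epsilon> / 2 * A + 1 / (2 * \<epsilon>) * (\<rho> ^ CARD('d) * N))"
      using \<epsilon>(1) A(2) N \<rho> by (simp flip: ennreal_mult ennreal_plus)
    also have "\<epsilon> / 2 * A + 1 / (2 * \<epsilon>) * (\<rho> ^ CARD('d) * N) = \<epsilon> / 2 * (A + N)"
      unfolding \<epsilon>(2) using \<epsilon>(1) by (simp add: field_simps)
    finally have "\<bar>\<integral>y. g y * ?\<phi> y \<partial>lborel\<bar> \<le> \<epsilon> / 2 * (A + N)"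
      using \<epsilon>(1) A(2) N by (subst (asm) ennreal_le_iff) auto
    also have "\<dots> \<le> (A + N + 1) * \<epsilon>" using \<epsilon>(1) A(2) N by (simp add: field_simps)
    finally show ?thesis by (simp add: \<epsilon>_def)
  qed
  moreover have "A + N + 1 > 0" using A(2) N by linarith
  ultimately show thesis using that by blast
qed

lemma integral_der_bump:
  assumes b: "bumpfam l u \<eta>"
  shows "(\<integral>z. prodfun (der [i] \<eta>) z \<partial>lborel) = 0"
proof -
  have sm: "\<And>i. smooth (\<eta> i)" by (rule bumpfam_smooth[OF b])
  obtain C where "C > 0" "\<And>x. \<bar>prodfun (der [i] \<eta>) x\<bar> \<le> C" using prodfun_bounded[OF bumpfam_der[OF b]] by metis
  then show ?thesis
    by (intro integral_partial_eq_0[of "prodfun \<eta>" _ i l u C] prodfun_continuous smooth_der sm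
        prodfun_has_partial_derivative prodfun_zero_outside[OF b])
qed

text \<open>A kernel of mean zero sees only differences of \<open>g\<close>. On a cube of side \<open>\<rho>\<close> these are controlled by the
  fractional seminorm, which gains the factor \<open>\<rho> powr s\<close> over the bound for a square integrable \<open>g\<close>.\<close>

lemma fractional_against_rescaled_bump:
  fixes g :: "real^'d \<Rightarrow> real"
  assumes loc: "locally_integrable U g" and s: "0 < s"
    and fin: "(\<integral>\<^sup>+x\<in>U. (\<integral>\<^sup>+y\<in>U. ennreal ((g x - g y)\<^sup>2 / norm (x - y) powr (real CARD('d) + 2 * s)) \<partial>lborel) \<partial>lborel) < \<infinity>"
    and b: "bumpfam l u \<eta>" and mean: "(\<integral>z. prodfun \<eta> z \<partial>lborel) = 0" and lu: "\<And>i. l $ i < u $ i"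
  obtains C where "C > 0" "\<And>t \<rho>. 0 < \<rho> \<Longrightarrow> cbox (t + \<rho> *\<^sub>R l) (t + \<rho> *\<^sub>R u) \<subseteq> U \<Longrightarrow>
    \<bar>\<integral>y. g y * prodfun (rescale t \<rho> \<eta>) y \<partial>lborel\<bar> \<le> C * \<rho> powr (real CARD('d) / 2 + s)"
proof -
  let ?d = "real CARD('d)" and ?p = "real CARD('d) + 2 * s"
  let ?S = "(\<integral>\<^sup>+x\<in>U. (\<integral>\<^sup>+y\<in>U. ennreal ((g x - g y)\<^sup>2 / norm (x - y) powr ?p) \<partial>lborel) \<partial>lborel)"
  define A where "A = enn2real ?S"
  have A: "?S = ennreal A" "A \<ge> 0" using fin by (auto simp: A_def)
  obtain B where B: "B > 0" "\<And>x. \<bar>prodfun \<eta> x\<bar> \<le> B" using prodfun_bounded[OF b] by metis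
  define V where "V = (\<Prod>i\<in>UNIV. u $ i - l $ i)"
  have V: "V > 0" unfolding V_def using lu by (intro prod_pos) auto
  define D where "D = norm (u - l) + 1"
  have D: "D > 0" by (simp add: D_def add_nonneg_pos)
  define C where "C = (A + D powr ?p * B\<^sup>2 * V\<^sup>2) / (2 * V) + 1"
  have C: "C > 0" unfolding C_def using A(2) V by (intro add_nonneg_pos divide_nonneg_pos) auto
  have "\<bar>\<integral>y. g y * prodfun (rescale t \<rho> \<eta>) y \<partial>lborel\<bar> \<le> C * \<rho> powr (?d / 2 + s)"
    if \<rho>: "0 < \<rho>" and sub: "cbox (t + \<rho> *\<^sub>R l) (t + \<rho> *\<^sub>R u) \<subseteq> U" for t \<rho>
  proof -
    let ?Q = "cbox (t + \<rho> *\<^sub>R l) (t + \<rho> *\<^sub>R u)" and ?\<phi> = "prodfun (rescale t \<rho> \<eta>)"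
    let ?i = "\<lambda>x. indicator ?Q x :: real"
    have bR: "bumpfam (t + \<rho> *\<^sub>R l) (t + \<rho> *\<^sub>R u) (rescale t \<rho> \<eta>)" by (rule bumpfam_rescale[OF b \<rho>])
    define h where "h x = ?i x * g x" for x
    have hint: "integrable lborel h" unfolding h_def[abs_def] by (rule locally_integrable_measurable(2)[OF loc sub])
    have [measurable]: "h \<in> borel_measurable borel" "?\<phi> \<in> borel_measurable borel" "prodfun \<eta> \<in> borel_measurable borel"
      using locally_integrable_measurable(1)[OF loc sub]
      by (auto simp: h_def[abs_def] intro: prodfun_measurable bumpfam_smooth[OF bR] bumpfam_smooth[OF b])
    have hphi: "h x * ?\<phi> x = g x * ?\<phi> x" for x
      using prodfun_zero_outside[OF bR, of x] by (cases "x \<in> ?Q") (auto simp: h_def)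
    have pb: "\<bar>?\<phi> x\<bar> \<le> B" for x unfolding prodfun_rescale by (rule B)
    have iphi: "integrable lborel ?\<phi>" by (rule prodfun_integrable[OF bR])
    have ihphi: "integrable lborel (\<lambda>x. h x * ?\<phi> x)"
      unfolding hphi by (rule locally_integrable_mult_prodfun(1)[OF loc bR sub])
    have zero: "(\<integral>x. ?\<phi> x \<partial>lborel) = 0"
      using \<rho> mean by (subst integral_affine_vec[OF _ \<rho>, where t = t]) (auto simp: prodfun_rescale)
    define q where "q = \<rho> ^ CARD('d) * V"
    have q: "q > 0" using \<rho> V by (simp add: q_def)
    have emQ: "emeasure lborel ?Q = ennreal q"
    proof -
      have "measure lborel ?Q = (\<Prod>i\<in>UNIV. (t + \<rho> *\<^sub>R u) $ i - (t + \<rho> *\<^sub>R l) $ i)"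
        using lu \<rho> by (intro content_cbox_cart) (simp add: interval_ne_empty_cart less_imp_le)
      also have "\<dots> = (\<Prod>i\<in>UNIV. \<rho> * (u $ i - l $ i))" by (simp add: right_diff_distrib)
      also have "\<dots> = q" by (simp add: q_def V_def prod.distrib)
      finally show ?thesis using emeasure_lborel_cbox_finite[of "t + \<rho> *\<^sub>R l" "t + \<rho> *\<^sub>R u"]
        by (simp add: emeasure_eq_ennreal_measure less_top)
    qed
    have iQ: "integrable lborel ?i" "(\<integral>x. ?i x \<partial>lborel) = q"
      using emQ q by (auto simp: measure_def)
    \<comment> \<open>the mean-zero property enters through the identity \<open>|Q| \<integral> g \<phi> = \<integral>\<integral> (g x - g y) \<phi> x dy dx\<close> over \<open>Q \<times> Q\<close>\<close>
    have inner: "(\<integral>y. (h x - h y) * ?\<phi> x * ?i y \<partial>lborel) = q * (h x * ?\<phi> x) - ?\<phi> x * (\<integral>y. h y \<partial>lborel)" for x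
    proof -
      have "(\<integral>y. (h x - h y) * ?\<phi> x * ?i y \<partial>lborel) = (\<integral>y. (h x * ?\<phi> x) * ?i y - ?\<phi> x * h y \<partial>lborel)"
        by (intro Bochner_Integration.integral_cong refl) (auto simp: h_def indicator_def algebra_simps)
      also have "\<dots> = (\<integral>y. (h x * ?\<phi> x) * ?i y \<partial>lborel) - (\<integral>y. ?\<phi> x * h y \<partial>lborel)"
        using iQ(1) hint by (intro Bochner_Integration.integral_diff integrable_mult_right) auto
      finally show ?thesis by (simp only: integral_mult_right_zero iQ(2)) (simp add: algebra_simps)
    qed
    have "(\<integral>x. (\<integral>y. (h x - h y) * ?\<phi> x * ?i y \<partial>lborel) \<partial>lborel) = q * (\<integral>x. h x * ?\<phi> x \<partial>lborel) - (\<integral>x. ?\<phi> x * (\<integral>y. h y \<partial>lborel) \<partial>lborel)"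
      unfolding inner using ihphi iphi by (subst Bochner_Integration.integral_diff) auto
    also have "(\<integral>x. ?\<phi> x * (\<integral>y. h y \<partial>lborel) \<partial>lborel) = 0" by (simp add: zero)
    finally have id: "(\<integral>x. (\<integral>y. (h x - h y) * ?\<phi> x * ?i y \<partial>lborel) \<partial>lborel) = q * (\<integral>x. g x * ?\<phi> x \<partial>lborel)" by (simp add: hphi)
    have int_outer: "integrable lborel (\<lambda>x. \<integral>y. (h x - h y) * ?\<phi> x * ?i y \<partial>lborel)"
      unfolding inner using ihphi iphi by auto
    have int_inner: "integrable lborel (\<lambda>y. (h x - h y) * ?\<phi> x * ?i y)" for x
    proof -
      have "integrable lborel (\<lambda>y. (h x * ?\<phi> x) * ?i y - ?\<phi> x * h y)"
        using iQ(1) hint by (intro Bochner_Integration.integrable_diff integrable_mult_right) auto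
      moreover have "(h x - h y) * ?\<phi> x * ?i y = (h x * ?\<phi> x) * ?i y - ?\<phi> x * h y" for y
        by (auto simp: h_def indicator_def algebra_simps)
      ultimately show ?thesis by simp
    qed
    define \<epsilon> where "\<epsilon> = \<rho> powr (?d + ?p / 2)"
    have \<epsilon>: "\<epsilon> > 0" using \<rho> by (simp add: \<epsilon>_def)
    let ?K = "(\<rho> * D) powr ?p * B\<^sup>2 / (2 * \<epsilon>)"
    have K: "?K \<ge> 0" using \<epsilon> by simp
    let ?f = "\<lambda>x y. (h x - h y)\<^sup>2 / norm (x - y) powr ?p * ?i x * ?i y"
    have pt: "\<bar>(h x - h y) * ?\<phi> x * ?i y\<bar> \<le> \<epsilon> / 2 * ?f x y + ?K * (?i x * ?i y)" for x y
    proof (cases "x \<in> ?Q \<and> y \<in> ?Q \<and> x \<noteq> y")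
      case True
      define n where "n = norm (x - y) powr (?p / 2)"
      have n: "n > 0" "n\<^sup>2 = norm (x - y) powr ?p" using True by (auto simp: n_def power2_eq_square simp flip: powr_add)
      have "norm (x - y) \<le> \<rho> * D"
      proof -
        have "norm (x - y) \<le> norm ((t + \<rho> *\<^sub>R u) - (t + \<rho> *\<^sub>R l))"
          using True by (intro norm_le_componentwise_cart) (auto simp: mem_box_cart abs_le_iff; smt (verit))
        also have "\<dots> = \<rho> * norm (u - l)" using \<rho> by (simp flip: scaleR_diff_right)
        also have "\<dots> \<le> \<rho> * D" using \<rho> by (simp add: D_def)
        finally show ?thesis .
      qed
      then have nK: "n\<^sup>2 \<le> (\<rho> * D) powr ?p" unfolding n(2) using s by (intro powr_mono2) auto
      have "\<bar>(h x - h y) * ?\<phi> x\<bar> = \<bar>((h x - h y) / n) * (n * ?\<phi> x)\<bar>" using n(1) by simp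
      also have "\<dots> \<le> (\<epsilon> * ((h x - h y) / n)\<^sup>2 + (n * ?\<phi> x)\<^sup>2 / \<epsilon>) / 2" by (rule weighted_AM_GM[OF \<epsilon>])
      also have "\<dots> \<le> \<epsilon> / 2 * ((h x - h y)\<^sup>2 / norm (x - y) powr ?p) + ?K"
      proof -
        have "(?\<phi> x)\<^sup>2 \<le> B\<^sup>2" using power_mono[OF pb[of x], of 2] by simp
        then have "n\<^sup>2 * (?\<phi> x)\<^sup>2 \<le> (\<rho> * D) powr ?p * B\<^sup>2" using nK by (intro mult_mono) auto
        then have "(n * ?\<phi> x)\<^sup>2 / \<epsilon> \<le> (\<rho> * D) powr ?p * B\<^sup>2 / \<epsilon>" using \<epsilon> by (simp add: power_mult_distrib divide_right_mono)
        then show ?thesis by (simp add: power_divide n(2) field_simps)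
      qed
      finally show ?thesis using True by simp
    next
      case False
      then have z: "(h x - h y) * ?\<phi> x * ?i y = 0" using prodfun_zero_outside[OF bR, of x] by auto
      show ?thesis unfolding z abs_zero
        using \<epsilon> by (intro add_nonneg_nonneg mult_nonneg_nonneg[OF K] mult_nonneg_nonneg divide_nonneg_nonneg) auto
    qed
    have "ennreal (q * \<bar>\<integral>x. g x * ?\<phi> x \<partial>lborel\<bar>) = ennreal \<bar>\<integral>x. (\<integral>y. (h x - h y) * ?\<phi> x * ?i y \<partial>lborel) \<partial>lborel\<bar>"
      unfolding id using q by (simp add: abs_mult)
    also have "\<dots> \<le> (\<integral>\<^sup>+x. ennreal \<bar>\<integral>y. (h x - h y) * ?\<phi> x * ?i y \<partial>lborel\<bar> \<partial>lborel)"
      using integral_norm_bound_ennreal[OF int_outer] by simp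
    also have "\<dots> \<le> (\<integral>\<^sup>+x. (\<integral>\<^sup>+y. ennreal \<bar>(h x - h y) * ?\<phi> x * ?i y\<bar> \<partial>lborel) \<partial>lborel)"
      using integral_norm_bound_ennreal[OF int_inner] by (intro nn_integral_mono) simp
    also have "\<dots> \<le> (\<integral>\<^sup>+x. (\<integral>\<^sup>+y. ennreal (\<epsilon> / 2) * ennreal (?f x y) + ennreal ?K * ennreal (?i x * ?i y) \<partial>lborel) \<partial>lborel)"
    proof (intro nn_integral_mono)
      fix x y
      show "ennreal \<bar>(h x - h y) * ?\<phi> x * ?i y\<bar> \<le> ennreal (\<epsilon> / 2) * ennreal (?f x y) + ennreal ?K * ennreal (?i x * ?i y)"
        using ennreal_leI[OF pt[of x y]] \<epsilon> K
        by (subst ennreal_mult[symmetric], simp, simp, subst ennreal_mult[symmetric], simp, simp, subst ennreal_plus[symmetric]) auto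
    qed
    also have "\<dots> = ennreal (\<epsilon> / 2) * (\<integral>\<^sup>+x. (\<integral>\<^sup>+y. ennreal (?f x y) \<partial>lborel) \<partial>lborel) + ennreal ?K * (\<integral>\<^sup>+x. (\<integral>\<^sup>+y. ennreal (?i x * ?i y) \<partial>lborel) \<partial>lborel)"
    proof -
      have cm: "(\<integral>\<^sup>+x. (\<integral>\<^sup>+y. a * F x y + c * G x y \<partial>lborel) \<partial>lborel)
        = a * (\<integral>\<^sup>+x. (\<integral>\<^sup>+y. F x y \<partial>lborel) \<partial>lborel) + c * (\<integral>\<^sup>+x. (\<integral>\<^sup>+y. G x y \<partial>lborel) \<partial>lborel)"
        if [measurable]: "case_prod F \<in> borel_measurable (lborel \<Otimes>\<^sub>M lborel)" "case_prod G \<in> borel_measurable (lborel \<Otimes>\<^sub>M lborel)"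
        for F G :: "real^'d \<Rightarrow> real^'d \<Rightarrow> ennreal" and a c
        by (simp add: nn_integral_add nn_integral_cmult)
      show ?thesis by (rule cm) measurable
    qed
    also have "(\<integral>\<^sup>+x. (\<integral>\<^sup>+y. ennreal (?i x * ?i y) \<partial>lborel) \<partial>lborel) = ennreal (q * q)"
      using q by (simp add: ennreal_mult ennreal_indicator nn_integral_cmult nn_integral_multc emQ)
    also have "(\<integral>\<^sup>+x. (\<integral>\<^sup>+y. ennreal (?f x y) \<partial>lborel) \<partial>lborel) \<le> ?S"
    proof (rule nn_integral_mono)
      fix x
      show "(\<integral>\<^sup>+y. ennreal (?f x y) \<partial>lborel) \<le> (\<integral>\<^sup>+y\<in>U. ennreal ((g x - g y)\<^sup>2 / norm (x - y) powr ?p) \<partial>lborel) * indicator U x"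
      proof (cases "x \<in> ?Q")
        case True
        then have "x \<in> U" using sub by blast
        moreover have "(\<integral>\<^sup>+y. ennreal (?f x y) \<partial>lborel) \<le> (\<integral>\<^sup>+y\<in>U. ennreal ((g x - g y)\<^sup>2 / norm (x - y) powr ?p) \<partial>lborel)"
          using True sub by (intro nn_integral_mono) (auto simp: h_def indicator_def)
        ultimately show ?thesis by simp
      qed simp
    qed
    finally have "ennreal (q * \<bar>\<integral>x. g x * ?\<phi> x \<partial>lborel\<bar>) \<le> ennreal (\<epsilon> / 2) * ennreal A + ennreal ?K * ennreal (q * q)"
      unfolding A(1) by (simp add: add_mono mult_left_mono)
    also have "\<dots> = ennreal (\<epsilon> / 2 * A + ?K * (q * q))"
      using \<epsilon> A(2) K q by (subst ennreal_mult[symmetric], simp, simp, subst ennreal_mult[symmetric], simp, simp, subst ennreal_plus[symmetric]) auto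
    finally have "q * \<bar>\<integral>x. g x * ?\<phi> x \<partial>lborel\<bar> \<le> \<epsilon> / 2 * A + ?K * (q * q)"
      using \<epsilon> A(2) K q by (subst (asm) ennreal_le_iff) auto
    then have "\<bar>\<integral>x. g x * ?\<phi> x \<partial>lborel\<bar> \<le> (\<epsilon> / 2 * A + ?K * (q * q)) / q"
      using q by (simp add: field_simps)
    also have "\<dots> = (A + D powr ?p * B\<^sup>2 * V\<^sup>2) / (2 * V) * \<rho> powr (?d / 2 + s)"
    proof -
      have e1: "\<epsilon> / q = \<rho> powr (?d / 2 + s) / V"
      proof -
        have "\<epsilon> = \<rho> powr (?d / 2 + s) * \<rho> powr ?d"
          by (simp add: \<epsilon>_def add_divide_distrib flip: powr_add)
        then show ?thesis using \<rho> by (simp add: q_def powr_realpow)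
      qed
      have e2: "?K * q = D powr ?p * B\<^sup>2 * V / 2 * \<rho> powr (?d / 2 + s)"
      proof -
        have e: "?p + ?d - (?d + ?p / 2) = ?d / 2 + s" by (simp add: field_simps)
        have "\<rho> powr ?p * \<rho> powr ?d / \<epsilon> = \<rho> powr (?d / 2 + s)"
          by (simp only: \<epsilon>_def powr_add[symmetric] powr_diff[symmetric] e)
        then have "\<rho> powr (?d / 2 + s) = \<rho> powr ?p * \<rho> ^ CARD('d) / \<epsilon>" using \<rho> by (simp add: powr_realpow)
        then show ?thesis using \<rho> D by (simp add: powr_mult q_def)
      qed
      have "(\<epsilon> / 2 * A + ?K * (q * q)) / q = (\<epsilon> / q) * A / 2 + ?K * q" using q by (simp add: field_simps)
      also have "\<dots> = \<rho> powr (?d / 2 + s) / V * A / 2 + D powr ?p * B\<^sup>2 * V / 2 * \<rho> powr (?d / 2 + s)"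
        by (simp only: e1 e2)
      also have "\<dots> = (A + D powr ?p * B\<^sup>2 * V\<^sup>2) / (2 * V) * \<rho> powr (?d / 2 + s)"
        using V by (simp add: field_simps power2_eq_square)
      finally show ?thesis .
    qed
    also have "\<dots> \<le> C * \<rho> powr (?d / 2 + s)" unfolding C_def by (intro mult_right_mono) auto
    finally show ?thesis .
  qed
  with C show thesis using that by blast
qed

subsection \<open>Bounds on the averages\<close>

text \<open>For integral \<open>m\<close> all derivatives are taken as weak derivatives. For fractional \<open>m\<close> one derivative more than
  available is used: it stays on the bump, whose integral then vanishes.\<close>

lemma avg_top_order_bound:
  fixes v :: "real^'d \<Rightarrow> real"
  assumes v: "v \<in> sobolev_space \<Omega> m" and "m > 0" and b: "bumpfam l u \<eta>" and lu: "\<And>i. l $ i < u $ i"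
    and K: "K = (if frac m = 0 then nat \<lfloor>m\<rfloor> else Suc (nat \<lfloor>m\<rfloor>))" "length I = K"
  obtains C where "C > 0" "\<And>t \<rho>. 0 < \<rho> \<Longrightarrow> cbox (t + \<rho> *\<^sub>R l) (t + \<rho> *\<^sub>R u) \<subseteq> interior \<Omega> \<Longrightarrow>
    \<bar>avg v \<eta> I t \<rho>\<bar> \<le> C * \<rho> powr (m - real CARD('d) / 2 - real K)"
proof -
  let ?U = "interior \<Omega>" and ?d = "real CARD('d)" and ?k = "nat \<lfloor>m\<rfloor>"
  note vD = sobolev_spaceD[OF v]
  have m: "real ?k + frac m = m" using assms(2) by (simp add: frac_def)
  have scale: "(1 / \<rho>) ^ (CARD('d) + a) * \<bar>\<rho> ^ c * (- 1) ^ c * X\<bar> = \<rho> powr (real c - ?d - real a) * \<bar>X\<bar>"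
    if "\<rho> > 0" for \<rho> X :: real and a c
    using that by (simp add: abs_mult power_abs powr_diff powr_realpow power_add power_one_over divide_simps)
  show thesis
  proof (cases "frac m = 0")
    case True
    let ?g = "weak_deriv ?U (mi_of I) v"
    have ord: "mi_order (mi_of I) \<le> ?k" using K True by (simp add: mi_order_mi_of)
    have wd: "has_weak_deriv ?U (mi_of I) v ?g" by (rule vD(3)[OF ord])
    then have loc: "locally_integrable ?U ?g" by (simp add: has_weak_deriv_def)
    obtain C where C: "C > 0" "\<And>t \<rho>. 0 < \<rho> \<Longrightarrow> cbox (t + \<rho> *\<^sub>R l) (t + \<rho> *\<^sub>R u) \<subseteq> ?U \<Longrightarrow>
      \<bar>\<integral>y. ?g y * prodfun (rescale t \<rho> \<eta>) y \<partial>lborel\<bar> \<le> C * \<rho> powr (?d / 2)"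
      using L2_against_rescaled_bump[OF loc sobolev_energy_finite_parts(1)[OF vD(4) ord] b] by blast
    show thesis
    proof (rule that[OF C(1)])
      fix t \<rho> assume \<rho>: "0 < (\<rho>::real)" and sub: "cbox (t + \<rho> *\<^sub>R l) (t + \<rho> *\<^sub>R u) \<subseteq> ?U"
      let ?X = "\<integral>y. ?g y * prodfun (rescale t \<rho> \<eta>) y \<partial>lborel"
      have "\<bar>avg v \<eta> I t \<rho>\<bar> = (1 / \<rho>) ^ (CARD('d) + length I) * \<bar>\<rho> ^ length I * (- 1) ^ length I * ?X\<bar>"
        unfolding avg_def avg_eq_weak_deriv[OF wd b \<rho> sub] using \<rho> by (simp add: abs_mult)
      also have "\<dots> = \<rho> powr (real (length I) - ?d - real (length I)) * \<bar>?X\<bar>" by (rule scale[OF \<rho>])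
      also have "\<dots> \<le> \<rho> powr (real (length I) - ?d - real (length I)) * (C * \<rho> powr (?d / 2))"
        by (intro mult_left_mono C(2) \<rho> sub) simp
      also have "\<dots> = C * \<rho> powr ((real (length I) - ?d - real (length I)) + ?d / 2)" by (simp only: powr_add mult_ac)
      also have "(real (length I) - ?d - real (length I)) + ?d / 2 = m - ?d / 2 - real K"
        using m K True by (simp add: field_simps)
      finally show "\<bar>avg v \<eta> I t \<rho>\<bar> \<le> C * \<rho> powr (m - ?d / 2 - real K)" .
    qed
  next
    case False
    with K obtain i J where I: "I = i # J" "length J = ?k" by (cases I) auto
    let ?g = "weak_deriv ?U (mi_of J) v" and ?\<eta> = "der [i] \<eta>"
    have b': "bumpfam l u ?\<eta>" by (rule bumpfam_der[OF b])
    have derI: "der I \<eta> = der J ?\<eta>"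
      unfolding der_append[symmetric] I by (rule der_cong_count) (simp add: count_list_append)
    have ord: "mi_order (mi_of J) = ?k" using I by (simp add: mi_order_mi_of)
    have wd: "has_weak_deriv ?U (mi_of J) v ?g" by (rule vD(3)) (simp add: ord)
    then have loc: "locally_integrable ?U ?g" by (simp add: has_weak_deriv_def)
    have s: "frac m > 0" using False by (simp add: order_neq_le_trans)
    obtain C where C: "C > 0" "\<And>t \<rho>. 0 < \<rho> \<Longrightarrow> cbox (t + \<rho> *\<^sub>R l) (t + \<rho> *\<^sub>R u) \<subseteq> ?U \<Longrightarrow>
      \<bar>\<integral>y. ?g y * prodfun (rescale t \<rho> ?\<eta>) y \<partial>lborel\<bar> \<le> C * \<rho> powr (?d / 2 + frac m)"
      using fractional_against_rescaled_bump[OF loc s sobolev_energy_finite_parts(2)[OF vD(4) ord False] b' integral_der_bump[OF b] lu]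
      by blast
    show thesis
    proof (rule that[OF C(1)])
      fix t \<rho> assume \<rho>: "0 < (\<rho>::real)" and sub: "cbox (t + \<rho> *\<^sub>R l) (t + \<rho> *\<^sub>R u) \<subseteq> ?U"
      let ?X = "\<integral>y. ?g y * prodfun (rescale t \<rho> ?\<eta>) y \<partial>lborel"
      have "\<bar>avg v \<eta> I t \<rho>\<bar> = (1 / \<rho>) ^ (CARD('d) + length I) * \<bar>\<rho> ^ length J * (- 1) ^ length J * ?X\<bar>"
        unfolding avg_def derI avg_eq_weak_deriv[OF wd b' \<rho> sub] using \<rho> by (simp add: abs_mult)
      also have "\<dots> = \<rho> powr (real (length J) - ?d - real (length I)) * \<bar>?X\<bar>" by (rule scale[OF \<rho>])
      also have "\<dots> \<le> \<rho> powr (real (length J) - ?d - real (length I)) * (C * \<rho> powr (?d / 2 + frac m))"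
        by (intro mult_left_mono C(2) \<rho> sub) simp
      also have "\<dots> = C * \<rho> powr ((real (length J) - ?d - real (length I)) + (?d / 2 + frac m))" by (simp only: powr_add mult_ac)
      also have "(real (length J) - ?d - real (length I)) + (?d / 2 + frac m) = m - ?d / 2 - real K"
        using m K I False by (simp add: field_simps)
      finally show "\<bar>avg v \<eta> I t \<rho>\<bar> \<le> C * \<rho> powr (m - ?d / 2 - real K)" .
    qed
  qed
qed

text \<open>The scale derivative consists of averages of the next higher order, so bounds on these are integrated
  in the scale. This lowers the order by one and raises the exponent of \<open>\<rho>\<close> by one.\<close>

lemma avg_increment_bound:
  fixes v :: "real^'d \<Rightarrow> real"
  assumes v: "integrable lborel v" and b: "bumpfam l u \<eta>" and "e \<noteq> 0"
    and next_order: "\<And>\<eta> i. bumpfam l u \<eta> \<Longrightarrow> \<exists>C. \<forall>t\<in>G. \<forall>\<rho>\<in>{0<..1}. \<bar>avg v \<eta> (i # I) t \<rho>\<bar> \<le> C * \<rho> powr (e - 1)"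
  shows "\<exists>C\<ge>0. \<forall>t\<in>G. \<forall>\<rho>\<in>{0<..1}. \<forall>\<rho>'\<in>{0<..\<rho>}.
    \<bar>avg v \<eta> I t \<rho> - avg v \<eta> I t \<rho>'\<bar> \<le> (C / e) * (\<rho> powr e - \<rho>' powr e)"
proof -
  have "\<forall>i. \<exists>C. \<forall>t\<in>G. \<forall>\<rho>\<in>{0<..1}. \<bar>avg v (coordmul i \<eta>) (i # I) t \<rho>\<bar> \<le> C * \<rho> powr (e - 1)"
    using next_order bumpfam_coordmul[OF b] by blast
  then obtain C where C: "\<And>i t \<rho>. t \<in> G \<Longrightarrow> \<rho> \<in> {0<..1} \<Longrightarrow> \<bar>avg v (coordmul i \<eta>) (i # I) t \<rho>\<bar> \<le> C i * \<rho> powr (e - 1)"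
    by metis
  define S where "S = \<bar>\<Sum>i\<in>UNIV. C i\<bar>"
  have "\<bar>avg v \<eta> I t \<rho> - avg v \<eta> I t \<rho>'\<bar> \<le> (S / e) * (\<rho> powr e - \<rho>' powr e)"
    if t: "t \<in> G" and \<rho>: "\<rho> \<in> {0<..1}" "\<rho>' \<in> {0<..\<rho>}" for t \<rho> \<rho>'
  proof (rule increment_bound_of_deriv_bound[of \<rho>' \<rho> e _ "\<lambda>r. - (\<Sum>i\<in>UNIV. avg v (coordmul i \<eta>) (i # I) t r)"])
    fix r assume r: "\<rho>' \<le> r" "r \<le> \<rho>"
    then have r': "r \<in> {0<..1}" using \<rho> by auto
    show "((\<lambda>r. avg v \<eta> I t r) has_real_derivative - (\<Sum>i\<in>UNIV. avg v (coordmul i \<eta>) (i # I) t r)) (at r)"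
      using r' by (intro avg_deriv_rho[OF v b]) simp
    have "\<bar>\<Sum>i\<in>UNIV. avg v (coordmul i \<eta>) (i # I) t r\<bar> \<le> (\<Sum>i\<in>UNIV. C i * r powr (e - 1))"
      by (intro order_trans[OF sum_abs] sum_mono C t r')
    also have "\<dots> \<le> S * r powr (e - 1)"
      unfolding sum_distrib_right[symmetric] S_def by (intro mult_right_mono) auto
    finally show "\<bar>- (\<Sum>i\<in>UNIV. avg v (coordmul i \<eta>) (i # I) t r)\<bar> \<le> S * r powr (e - 1)" by simp
  qed (use \<rho> assms(3) in auto)
  moreover have "S \<ge> 0" by (simp add: S_def)
  ultimately show ?thesis by blast
qed

text \<open>Descending from the order \<open>K\<close>, each order gains one power of \<open>\<rho>\<close>, so that at the order \<open>k\<close> the exponent is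
  \<open>\<gamma> > 0\<close> and the averages converge as \<open>\<rho> \<rightarrow> 0\<close>. For orders below \<open>k\<close> the averages are bounded and the
  weaker exponent \<open>\<gamma> - 1\<close> is enough to repeat the step. The bounds are uniform on \<open>G\<close>.\<close>

lemma avg_bounds:
  fixes v :: "real^'d \<Rightarrow> real"
  assumes v: "integrable lborel v" and \<gamma>: "0 < \<gamma>" "\<gamma> < 1" and "k < K"
    and top: "\<And>\<eta> I. bumpfam l u \<eta> \<Longrightarrow> length I = K \<Longrightarrow>
      \<exists>C. \<forall>t\<in>G. \<forall>\<rho>\<in>{0<..1}. \<bar>avg v \<eta> I t \<rho>\<bar> \<le> C * \<rho> powr (\<gamma> - (real K - real k))"
    and b: "bumpfam l u \<eta>" and I: "length I \<le> k"
  shows "\<exists>C\<ge>0. \<forall>t\<in>G. \<forall>\<rho>\<in>{0<..1}. \<forall>\<rho>'\<in>{0<..\<rho>}. \<bar>avg v \<eta> I t \<rho> - avg v \<eta> I t \<rho>'\<bar> \<le> C * \<rho> powr \<gamma>"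
proof -
  have high: "\<exists>C. \<forall>t\<in>G. \<forall>\<rho>\<in>{0<..1}. \<bar>avg v \<eta> I t \<rho>\<bar> \<le> C * \<rho> powr (\<gamma> - (real (length I) - real k))"
    if "length I + n = K" "k < length I" "bumpfam l u \<eta>" for n \<eta> I
    using that
  proof (induction n arbitrary: \<eta> I)
    case 0
    then show ?case using top[of \<eta> I] by simp
  next
    case (Suc n)
    define e where "e = \<gamma> - (real (length I) - real k)"
    have "real (length I) \<ge> real k + 1" using Suc.prems(2) by linarith
    then have e: "e < 0" using \<gamma> by (simp add: e_def)
    have "\<exists>C. \<forall>t\<in>G. \<forall>\<rho>\<in>{0<..1}. \<bar>avg v \<eta> (i # I) t \<rho>\<bar> \<le> C * \<rho> powr (e - 1)" if "bumpfam l u \<eta>" for \<eta> i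
    proof -
      have eq: "\<gamma> - (real (length (i # I)) - real k) = e - 1" by (simp add: e_def)
      show ?thesis using Suc.IH[of "i # I" \<eta>, unfolded eq] Suc.prems that by simp
    qed
    from avg_increment_bound[OF v Suc.prems(3) _ this] e
    obtain C where C: "C \<ge> 0" "\<And>t \<rho> \<rho>'. t \<in> G \<Longrightarrow> \<rho> \<in> {0<..1} \<Longrightarrow> \<rho>' \<in> {0<..\<rho>} \<Longrightarrow>
      \<bar>avg v \<eta> I t \<rho> - avg v \<eta> I t \<rho>'\<bar> \<le> (C / e) * (\<rho> powr e - \<rho>' powr e)" by blast
    obtain D where D: "D > 0" "\<And>t. \<bar>avg v \<eta> I t 1\<bar> \<le> D" using avg_bounded_at[OF v Suc.prems(3)] by blast
    have "\<bar>avg v \<eta> I t \<rho>\<bar> \<le> (D + C / - e) * \<rho> powr e" if t: "t \<in> G" "\<rho> \<in> {0<..1}" for t \<rho>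
    proof -
      have "\<bar>avg v \<eta> I t 1 - avg v \<eta> I t \<rho>\<bar> \<le> (C / e) * (1 powr e - \<rho> powr e)" using C(2)[of t 1 \<rho>] t by simp
      also have "\<dots> = (C / - e) * \<rho> powr e - C / - e" by (simp add: algebra_simps)
      also have "\<dots> \<le> (C / - e) * \<rho> powr e" using C(1) e by (simp add: divide_nonneg_neg)
      finally have 1: "\<bar>avg v \<eta> I t 1 - avg v \<eta> I t \<rho>\<bar> \<le> (C / - e) * \<rho> powr e" .
      have "1 powr e \<le> \<rho> powr e" using t e by (intro powr_mono2') auto
      then have "D * 1 \<le> D * \<rho> powr e" using D(1) by (intro mult_left_mono) auto
      then have "\<bar>avg v \<eta> I t 1\<bar> \<le> D * \<rho> powr e" using D(2)[of t] by simp
      with 1 show ?thesis unfolding distrib_right by linarith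
    qed
    then show ?case unfolding e_def[symmetric] by blast
  qed
  have incr: "\<exists>C\<ge>0. \<forall>t\<in>G. \<forall>\<rho>\<in>{0<..1}. \<forall>\<rho>'\<in>{0<..\<rho>}. \<bar>avg v \<eta> I t \<rho> - avg v \<eta> I t \<rho>'\<bar> \<le> C * \<rho> powr \<gamma>"
    if nxt: "\<And>\<eta> i. bumpfam l u \<eta> \<Longrightarrow> \<exists>C. \<forall>t\<in>G. \<forall>\<rho>\<in>{0<..1}. \<bar>avg v \<eta> (i # I) t \<rho>\<bar> \<le> C * \<rho> powr (\<gamma> - 1)"
      and b: "bumpfam l u \<eta>" for \<eta> I
  proof -
    from avg_increment_bound[OF v b _ nxt] \<gamma>
    obtain C where C: "C \<ge> 0" "\<And>t \<rho> \<rho>'. t \<in> G \<Longrightarrow> \<rho> \<in> {0<..1} \<Longrightarrow> \<rho>' \<in> {0<..\<rho>} \<Longrightarrow>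
      \<bar>avg v \<eta> I t \<rho> - avg v \<eta> I t \<rho>'\<bar> \<le> (C / \<gamma>) * (\<rho> powr \<gamma> - \<rho>' powr \<gamma>)" by blast
    have 1: "(C / \<gamma>) * (\<rho> powr \<gamma> - \<rho>' powr \<gamma>) \<le> (C / \<gamma>) * \<rho> powr \<gamma>" for \<rho> \<rho>'
      using C(1) \<gamma> by (intro mult_left_mono) auto
    have "C / \<gamma> \<ge> 0" using C(1) \<gamma> by simp
    then show ?thesis using order_trans[OF C(2) 1] by blast
  qed
  have low: "\<exists>C. \<forall>t\<in>G. \<forall>\<rho>\<in>{0<..1}. \<bar>avg v \<eta> I t \<rho>\<bar> \<le> C * \<rho> powr (\<gamma> - 1)"
    if "length I + n = Suc k" "bumpfam l u \<eta>" for n \<eta> I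
    using that
  proof (induction n arbitrary: \<eta> I)
    case 0
    have "length I + (K - Suc k) = K" "k < length I" using 0 \<open>k < K\<close> by auto
    from high[OF this 0(2)] show ?case using 0 by simp
  next
    case (Suc n)
    have nxt: "\<exists>C. \<forall>t\<in>G. \<forall>\<rho>\<in>{0<..1}. \<bar>avg v \<eta> (i # I) t \<rho>\<bar> \<le> C * \<rho> powr (\<gamma> - 1)" if "bumpfam l u \<eta>" for \<eta> i
      using Suc.IH[of "i # I" \<eta>] Suc.prems that by simp
    obtain C where C: "C \<ge> 0" "\<And>t \<rho> \<rho>'. t \<in> G \<Longrightarrow> \<rho> \<in> {0<..1} \<Longrightarrow> \<rho>' \<in> {0<..\<rho>} \<Longrightarrow>
      \<bar>avg v \<eta> I t \<rho> - avg v \<eta> I t \<rho>'\<bar> \<le> C * \<rho> powr \<gamma>" using incr[OF nxt Suc.prems(2)] by blast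
    obtain D where D: "D > 0" "\<And>t. \<bar>avg v \<eta> I t 1\<bar> \<le> D" using avg_bounded_at[OF v Suc.prems(2)] by blast
    have "\<bar>avg v \<eta> I t \<rho>\<bar> \<le> (D + C) * \<rho> powr (\<gamma> - 1)" if t: "t \<in> G" "\<rho> \<in> {0<..1}" for t \<rho>
    proof -
      have "\<bar>avg v \<eta> I t \<rho>\<bar> \<le> D + C" using C(2)[of t 1 \<rho>] t D(2)[of t] by simp
      also have "\<dots> = (D + C) * 1 powr (\<gamma> - 1)" by simp
      also have "\<dots> \<le> (D + C) * \<rho> powr (\<gamma> - 1)"
        using t \<gamma> C(1) D(1) by (intro mult_left_mono powr_mono2') auto
      finally show ?thesis .
    qed
    then show ?case by blast
  qed
  show ?thesis
  proof (rule incr[OF _ b])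
    fix \<eta> i assume "bumpfam l u \<eta>"
    then show "\<exists>C. \<forall>t\<in>G. \<forall>\<rho>\<in>{0<..1}. \<bar>avg v \<eta> (i # I) t \<rho>\<bar> \<le> C * \<rho> powr (\<gamma> - 1)"
      using low[of "i # I" "k - length I" \<eta>] I by simp
  qed
qed

subsection \<open>The embedding theorem\<close>

lemma integral_pos_of_continuous:
  fixes f :: "real^'d \<Rightarrow> real"
  assumes "continuous_on UNIV f" "integrable lborel f" "\<And>x. f x \<ge> 0" "f x0 > 0"
  shows "(\<integral>x. f x \<partial>lborel) > 0"
proof (rule ccontr)
  assume "\<not> (\<integral>x. f x \<partial>lborel) > 0"
  moreover have "(\<integral>x. f x \<partial>lborel) \<ge> 0" by (simp add: assms(3))
  ultimately have "(\<integral>x. f x \<partial>lborel) = 0" by simp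
  then have "AE x in lborel. f x = 0" using assms(2,3) by (subst (asm) integral_nonneg_eq_0_iff_AE) auto
  moreover have op: "open {x. f x > 0}"
    using open_vimage[OF open_greaterThan[of 0] assms(1)] by (simp add: vimage_def)
  ultimately have "{x. f x > 0} \<in> null_sets lborel"
    by (subst AE_iff_null_sets) (auto elim!: eventually_mono)
  then have "negligible {x. f x > 0}"
    by (simp add: negligible_iff_null_sets null_sets_completionI)
  with op have "{x. f x > 0} = {}" using open_not_negligible by blast
  then show False using assms(4) by auto
qed

definition boxbump :: "real^'d \<Rightarrow> real^'d \<Rightarrow> 'd \<Rightarrow> real \<Rightarrow> real" where
  "boxbump l u = (\<lambda>i x. bump ((x - l $ i) / (u $ i - l $ i)))"

lemma boxbump:
  assumes lu: "\<And>i. l $ i < u $ i"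
  shows "bumpfam l u (boxbump l u)" "(\<integral>z. prodfun (boxbump l u) z \<partial>lborel) > 0"
proof -
  have "boxbump l u i x = 0" if "x \<notin> {l $ i..u $ i}" for i x
    unfolding boxbump_def using that lu[of i] by (intro bump_outside) (auto simp: divide_less_eq zero_less_divide_iff)
  then show b: "bumpfam l u (boxbump l u)"
    by (auto simp: bumpfam_def boxbump_def intro: smooth_rescale smooth_bump)
  have "boxbump l u i (((1/2) *\<^sub>R (l + u)) $ i) > 0" for i
    unfolding boxbump_def bump_pos_iff using lu[of i] by (auto simp: field_simps)
  then have "prodfun (boxbump l u) ((1/2) *\<^sub>R (l + u)) > 0"
    unfolding prodfun_def by (intro prod_pos) auto
  moreover have "prodfun (boxbump l u) x \<ge> 0" for x
    unfolding prodfun_def boxbump_def by (intro prod_nonneg) (auto intro: bump_range)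
  ultimately show "(\<integral>z. prodfun (boxbump l u) z \<partial>lborel) > 0"
    by (intro integral_pos_of_continuous[OF prodfun_continuous prodfun_integrable[OF b]] bumpfam_smooth[OF b])
qed

lemma cube_in_ball:
  fixes q :: "real^'d"
  assumes "r > 0"
  obtains l u where "\<And>i. l $ i < u $ i" "cbox l u \<subseteq> ball q r"
proof -
  let ?\<delta> = "r / (2 * real CARD('d))"
  have \<delta>: "?\<delta> > 0" using assms by simp
  let ?l = "\<chi> i. q $ i - ?\<delta>" and ?u = "\<chi> i. q $ i + ?\<delta>"
  have "cbox ?l ?u \<subseteq> ball q r"
  proof
    fix z assume "z \<in> cbox ?l ?u"
    then have "\<bar>(z - q) $ i\<bar> \<le> ?\<delta>" for i by (auto simp: mem_box_cart abs_le_iff algebra_simps)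
    then have "norm (z - q) \<le> (\<Sum>i\<in>(UNIV::'d set). ?\<delta>)"
      by (intro order_trans[OF norm_le_l1_cart] sum_mono) auto
    also have "\<dots> < r" using assms by simp
    finally show "z \<in> ball q r" by (simp add: dist_norm norm_minus_commute)
  qed
  moreover have "?l $ i < ?u $ i" for i using \<delta> by simp
  ultimately show thesis using that by blast
qed

lemma sobolev_space_integrable:
  assumes "compact \<Omega>" "v \<in> sobolev_space \<Omega> m"
  shows "integrable lborel v" "\<exists>V. \<forall>x. \<bar>v x\<bar> \<le> V"
proof -
  note vD = sobolev_spaceD[OF assms(2)]
  have "set_integrable lborel \<Omega> v" unfolding set_integrable_def by (rule borel_integrable_compact[OF assms(1) vD(2)])
  moreover have "(\<lambda>x. indicator \<Omega> x *\<^sub>R v x) = v" using vD(1) by (auto simp: fun_eq_iff indicator_def)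
  ultimately show "integrable lborel v" by (simp add: set_integrable_def)
  have "bounded (v ` \<Omega>)" using assms(1) vD(2) by (intro compact_imp_bounded compact_continuous_image)
  then obtain V where "\<And>x. x \<in> \<Omega> \<Longrightarrow> \<bar>v x\<bar> \<le> V" by (auto simp: bounded_iff)
  then have "\<bar>v x\<bar> \<le> \<bar>V\<bar>" for x using vD(1)[of x] by (cases "x \<in> \<Omega>") force+
  then show "\<exists>V. \<forall>x. \<bar>v x\<bar> \<le> V" by blast
qed

text \<open>By convexity, there is a cube \<open>Q\<close> of directions that point from all points of \<open>\<Omega>\<close> near \<open>p\<close> into the
  interior. Averages over the cubes \<open>t + \<rho> Q\<close> are therefore defined for boundary points \<open>t\<close> as well, and
  the averages of the derivatives of \<open>v\<close> up to the order \<open>k\<close> converge uniformly as \<open>\<rho> \<rightarrow> 0\<close>. The limits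
  are continuous up to the boundary and are the classical derivatives of \<open>v\<close>.\<close>

lemma sobolev_embedding_local:
  fixes \<Omega> :: "(real^'d) set"
  assumes "convex \<Omega>" "compact \<Omega>" "interior \<Omega> \<noteq> {}" and v: "v \<in> sobolev_space \<Omega> m"
    and m: "m > real CARD('d) / 2 + real k" and p: "p \<in> \<Omega>"
  obtains e where "e > 0"
    "\<And>I. length I \<le> k \<Longrightarrow> continuous_on (interior \<Omega> \<inter> ball p e) (partials I v)"
    "\<And>I i t. length I < k \<Longrightarrow> t \<in> interior \<Omega> \<inter> ball p e \<Longrightarrow>
      ((\<lambda>s. partials I v (t + s *\<^sub>R axis i 1)) has_real_derivative partials (i # I) v t) (at 0)"
    "\<And>I. length I \<le> k \<Longrightarrow> \<exists>L. (partials I v \<longlongrightarrow> L) (at p within interior \<Omega>)"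
proof -
  let ?U = "interior \<Omega>" and ?d = "real CARD('d)"
  note vD = sobolev_spaceD[OF v]
  have vint: "integrable lborel v" by (rule sobolev_space_integrable[OF assms(2) v])
  obtain V where V: "\<And>x. \<bar>v x\<bar> \<le> V" using sobolev_space_integrable(2)[OF assms(2) v] by blast
  have mpos: "m > 0" using m by (smt (verit) divide_nonneg_nonneg of_nat_0_le_iff)
  obtain x0 where "x0 \<in> ?U" using assms(3) by blast
  then obtain r0 where r0: "r0 > 0" "ball x0 r0 \<subseteq> ?U" using open_contains_ball[of ?U] by auto
  define e where "e = r0 / 2"
  have e: "e > 0" using r0 by (simp add: e_def)
  obtain l u where lu: "\<And>i. l $ i < u $ i" "cbox l u \<subseteq> ball (x0 - p) e" using cube_in_ball[OF e] by metis
  define G where "G = \<Omega> \<inter> ball p e"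
  have inU: "t + \<rho> *\<^sub>R z \<in> ?U" if "t \<in> G" "0 < \<rho>" "\<rho> \<le> 1" "z \<in> cbox l u" for t \<rho> z
  proof -
    have "norm (z - (x0 - p)) < e" using lu(2) that(4) by (auto simp: dist_norm norm_minus_commute)
    moreover have "norm (t - p) < e" using that(1) by (auto simp: G_def dist_norm norm_minus_commute)
    ultimately have "norm ((t - p) + (z - (x0 - p))) < r0"
      using norm_triangle_ineq[of "t - p" "z - (x0 - p)"] by (simp add: e_def)
    then have "t + z \<in> ball x0 r0" by (simp add: dist_norm norm_minus_commute algebra_simps)
    then have tz: "t + z \<in> ?U" using r0 by blast
    have "t - \<rho> *\<^sub>R (t - (t + z)) \<in> ?U"
      using that by (intro mem_interior_convex_shrink[OF assms(1) tz]) (auto simp: G_def)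
    then show ?thesis by simp
  qed
  have sub: "cbox (t + \<rho> *\<^sub>R l) (t + \<rho> *\<^sub>R u) \<subseteq> ?U" if "t \<in> G" "\<rho> \<in> {0<..1}" for t \<rho>
  proof
    fix y assume y: "y \<in> cbox (t + \<rho> *\<^sub>R l) (t + \<rho> *\<^sub>R u)"
    have "(1 / \<rho>) *\<^sub>R (y - t) \<in> cbox l u" using y that(2) by (auto simp: mem_box_cart field_simps)
    from inU[OF that(1) _ _ this, of \<rho>] show "y \<in> ?U" using that(2) by simp
  qed
  \<comment> \<open>an order beyond \<open>k\<close> at which the Sobolev norm bounds the averages\<close>
  define K where "K = (if frac m = 0 then nat \<lfloor>m\<rfloor> else Suc (nat \<lfloor>m\<rfloor>))"
  have mK: "m \<le> real K"
  proof (cases "frac m = 0")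
    case True then show ?thesis using mpos by (simp add: K_def frac_def)
  next
    case False then show ?thesis using mpos by (simp add: K_def) linarith
  qed
  have "0 \<le> ?d / 2" by simp
  then have kK: "k < K" using m mK by linarith
  \<comment> \<open>the excess smoothness, reduced below 1\<close>
  define \<gamma> where "\<gamma> = min (1/2) (m - ?d / 2 - real k)"
  have \<gamma>: "0 < \<gamma>" "\<gamma> < 1" "\<gamma> \<le> m - ?d / 2 - real k" using m by (auto simp: \<gamma>_def)
  have top: "\<exists>C. \<forall>t\<in>G. \<forall>\<rho>\<in>{0<..1}. \<bar>avg v \<eta> I t \<rho>\<bar> \<le> C * \<rho> powr (\<gamma> - (real K - real k))"
    if b: "bumpfam l u \<eta>" and I: "length I = K" for \<eta> I
  proof -
    obtain C where C: "C > 0" "\<And>t \<rho>. 0 < \<rho> \<Longrightarrow> cbox (t + \<rho> *\<^sub>R l) (t + \<rho> *\<^sub>R u) \<subseteq> ?U \<Longrightarrow>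
      \<bar>avg v \<eta> I t \<rho>\<bar> \<le> C * \<rho> powr (m - ?d / 2 - real K)"
      using avg_top_order_bound[OF v mpos b lu(1) K_def I] by blast
    have "\<bar>avg v \<eta> I t \<rho>\<bar> \<le> C * \<rho> powr (\<gamma> - (real K - real k))" if "t \<in> G" "\<rho> \<in> {0<..1}" for t \<rho>
    proof -
      have "\<bar>avg v \<eta> I t \<rho>\<bar> \<le> C * \<rho> powr (m - ?d / 2 - real K)" using that sub by (intro C) auto
      also have "\<dots> \<le> C * \<rho> powr (\<gamma> - (real K - real k))"
        using C(1) that(2) \<gamma>(3) by (intro mult_left_mono powr_mono') auto
      finally show ?thesis .
    qed
    then show ?thesis by blast
  qed
  define \<eta> where "\<eta> = boxbump l u"
  have b: "bumpfam l u \<eta>" and J0: "(\<integral>z. prodfun \<eta> z \<partial>lborel) > 0" unfolding \<eta>_def using boxbump[OF lu(1)] by auto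
  define J where "J = (\<integral>z. prodfun \<eta> z \<partial>lborel)"
  have J: "J > 0" using J0 by (simp add: J_def)
  define r where "r n = 1 / real (Suc n)" for n
  have r: "r \<longlonglongrightarrow> 0" "\<And>n. r n \<in> {0<..1}" "\<And>m n. m \<le> n \<Longrightarrow> r n \<le> r m"
  proof -
    have "r = (\<lambda>n. inverse (real (Suc n)))" by (simp add: r_def inverse_eq_divide fun_eq_iff)
    then show "r \<longlonglongrightarrow> 0" using LIMSEQ_inverse_real_of_nat by simp
  qed (auto simp: r_def field_simps)
  define f where "f n I t = (- 1) ^ length I * avg v \<eta> I t (r n) / J" for n I t
  define F where "F I t = lim (\<lambda>n. f n I t)" for I t
  have unif: "uniform_limit G (\<lambda>n. f n I) (F I) sequentially" if I: "length I \<le> k" for I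
  proof -
    obtain C where C: "C \<ge> 0" "\<And>t \<rho> \<rho>'. t \<in> G \<Longrightarrow> \<rho> \<in> {0<..1} \<Longrightarrow> \<rho>' \<in> {0<..\<rho>} \<Longrightarrow>
      \<bar>avg v \<eta> I t \<rho> - avg v \<eta> I t \<rho>'\<bar> \<le> C * \<rho> powr \<gamma>"
      using avg_bounds[OF vint \<gamma>(1,2) kK top b I] by blast
    have "uniformly_Cauchy_on G (\<lambda>n. f n I)"
    proof (rule uniformly_Cauchy_onI')
      fix \<epsilon> :: real assume "\<epsilon> > 0"
      have "(\<lambda>n. C * r n powr \<gamma> / J) \<longlonglongrightarrow> C * 0 powr \<gamma> / J"
        using J by (intro tendsto_intros tendsto_powr'[OF r(1)]) (use \<gamma> r(2) in \<open>auto intro!: always_eventually less_imp_le\<close>)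
      then have "(\<lambda>n. C * r n powr \<gamma> / J) \<longlonglongrightarrow> 0" by simp
      then have "eventually (\<lambda>n. C * r n powr \<gamma> / J < \<epsilon>) sequentially" using \<open>\<epsilon> > 0\<close> by (rule order_tendstoD(2))
      then obtain N where N: "\<And>n. n \<ge> N \<Longrightarrow> C * r n powr \<gamma> / J < \<epsilon>" by (auto simp: eventually_sequentially)
      have "dist (f a I t) (f b I t) < \<epsilon>" if t: "t \<in> G" and ab: "a \<ge> N" "b > a" for t a b
      proof -
        have "dist (f a I t) (f b I t) = \<bar>avg v \<eta> I t (r a) - avg v \<eta> I t (r b)\<bar> / J"
          using J by (simp add: f_def dist_real_def abs_mult power_abs abs_divide flip: diff_divide_distrib right_diff_distrib)
        also have "\<dots> \<le> C * r a powr \<gamma> / J"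
          using J r(2)[of a] r(2)[of b] r(3)[of a b] ab by (intro divide_right_mono C t) auto
        also have "\<dots> < \<epsilon>" by (rule N[OF ab(1)])
        finally show ?thesis .
      qed
      then show "\<exists>M. \<forall>x\<in>G. \<forall>m\<ge>M. \<forall>n>m. dist (f m I x) (f n I x) < \<epsilon>" by blast
    qed
    then have "uniformly_convergent_on G (\<lambda>n. f n I)" by (rule Cauchy_uniformly_convergent)
    then show ?thesis unfolding F_def uniformly_convergent_uniform_limit_iff .
  qed
  have lim: "(\<lambda>n. f n I t) \<longlonglongrightarrow> F I t" if "length I \<le> k" "t \<in> G" for I t
    by (rule tendsto_uniform_limitI[OF unif[OF that(1)] that(2)])
  have cont: "isCont (f n I) t" for n I t
    unfolding f_def using J by (intro continuous_intros avg_continuous[OF vint b]) auto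
  define T where "T = ?U \<inter> ball p e"
  have TG: "T \<subseteq> G" using interior_subset by (auto simp: T_def G_def)
  have opT: "open T" by (simp add: T_def open_Int)
  have F0: "F [] t = v t" if "t \<in> T" for t
  proof -
    have "(\<lambda>n. avg v \<eta> [] t (r n)) \<longlonglongrightarrow> v t * J"
      unfolding J_def
    proof (rule avg_tendsto[OF _ V b r(1)])
      show "v \<in> borel_measurable borel" using borel_measurable_integrable[OF vint] by simp
      show "0 < r n" for n using r(2)[of n] by simp
      fix z assume z: "z \<in> cbox l u"
      have "isCont v t" using that by (intro continuous_on_interior[OF vD(2)]) (simp add: T_def)
      moreover have "(\<lambda>n. t + r n *\<^sub>R z) \<longlonglongrightarrow> t + 0 *\<^sub>R z" by (intro tendsto_intros r)
      ultimately show "(\<lambda>n. v (t + r n *\<^sub>R z)) \<longlonglongrightarrow> v t"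
        using isCont_tendsto_compose[of t v "\<lambda>n. t + r n *\<^sub>R z" sequentially] by simp
    qed
    then have "(\<lambda>n. f n [] t) \<longlonglongrightarrow> v t * J / J" unfolding f_def using J by (intro tendsto_divide) auto
    moreover have "(\<lambda>n. f n [] t) \<longlonglongrightarrow> F [] t" using that TG by (intro lim) auto
    ultimately show ?thesis using J by (simp add: LIMSEQ_unique)
  qed
  have derF: "((\<lambda>s. F I (t + s *\<^sub>R axis i 1)) has_real_derivative F (i # I) t) (at 0)"
    if I: "length I < k" and t: "t \<in> T" for I i t
  proof -
    obtain \<delta> where \<delta>: "\<delta> > 0" "ball t \<delta> \<subseteq> T" using opT t open_contains_ball by blast
    define S where "S = {- \<delta><..<\<delta>}"
    have line: "t + s *\<^sub>R axis i 1 \<in> T" if "s \<in> S" for s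
      using that \<delta>(2) by (intro subsetD[OF \<delta>(2)]) (auto simp: S_def dist_norm)
    have "\<exists>g. \<forall>s\<in>S. (\<lambda>n. f n I (t + s *\<^sub>R axis i 1)) \<longlonglongrightarrow> g s \<and>
      (g has_derivative (\<lambda>h. F (i # I) (t + s *\<^sub>R axis i 1) * h)) (at s within S)"
    proof (rule has_derivative_sequence)
      show "convex S" by (simp add: S_def)
      show "0 \<in> S" using \<delta> by (simp add: S_def)
      show "(\<lambda>n. f n I (t + 0 *\<^sub>R axis i 1)) \<longlonglongrightarrow> F I t" using I t TG by (simp add: lim subsetD)
      fix n s assume "s \<in> S"
      have "((\<lambda>s. f n I (t + s *\<^sub>R axis i 1)) has_real_derivative
        (- 1) ^ length I * (- avg v \<eta> (i # I) (t + s *\<^sub>R axis i 1) (r n)) / J) (at s)"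
        unfolding f_def by (intro DERIV_cdivide DERIV_cmult avg_deriv_t[OF vint b])
      then have "((\<lambda>s. f n I (t + s *\<^sub>R axis i 1)) has_real_derivative f n (i # I) (t + s *\<^sub>R axis i 1)) (at s)"
        by (simp add: f_def)
      then show "((\<lambda>s. f n I (t + s *\<^sub>R axis i 1)) has_derivative (\<lambda>h. f n (i # I) (t + s *\<^sub>R axis i 1) * h)) (at s within S)"
        unfolding has_field_derivative_def by (rule has_derivative_at_withinI)
    next
      fix \<epsilon> :: real assume "\<epsilon> > 0"
      have "length (i # I) \<le> k" using I by simp
      from uniform_limitD[OF unif[OF this] \<open>\<epsilon> > 0\<close>]
      show "\<forall>\<^sub>F n in sequentially. \<forall>s\<in>S. \<forall>h. norm (f n (i # I) (t + s *\<^sub>R axis i 1) * h - F (i # I) (t + s *\<^sub>R axis i 1) * h) \<le> \<epsilon> * norm h"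
      proof eventually_elim
        case (elim n)
        show ?case
        proof (intro ballI allI)
          fix s h assume "s \<in> S"
          then have "dist (f n (i # I) (t + s *\<^sub>R axis i 1)) (F (i # I) (t + s *\<^sub>R axis i 1)) < \<epsilon>"
            using elim line TG by blast
          then show "norm (f n (i # I) (t + s *\<^sub>R axis i 1) * h - F (i # I) (t + s *\<^sub>R axis i 1) * h) \<le> \<epsilon> * norm h"
            by (simp add: dist_real_def abs_mult mult_right_mono flip: left_diff_distrib)
        qed
      qed
    qed
    then obtain g where g: "\<And>s. s \<in> S \<Longrightarrow> (\<lambda>n. f n I (t + s *\<^sub>R axis i 1)) \<longlonglongrightarrow> g s"
      "\<And>s. s \<in> S \<Longrightarrow> (g has_derivative (\<lambda>h. F (i # I) (t + s *\<^sub>R axis i 1) * h)) (at s within S)" by blast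
    have gF: "g s = F I (t + s *\<^sub>R axis i 1)" if "s \<in> S" for s
    proof (rule LIMSEQ_unique[OF g(1)[OF that]])
      show "(\<lambda>n. f n I (t + s *\<^sub>R axis i 1)) \<longlonglongrightarrow> F I (t + s *\<^sub>R axis i 1)"
        using I line[OF that] TG by (intro lim) auto
    qed
    have S0: "open S" "0 \<in> S" using \<delta> by (auto simp: S_def)
    have "(g has_derivative (\<lambda>h. F (i # I) (t + 0 *\<^sub>R axis i 1) * h)) (at 0)"
      using g(2)[OF S0(2)] at_within_open[OF S0(2,1)] by simp
    then have "(g has_real_derivative F (i # I) t) (at 0)" by (simp add: has_field_derivative_def)
    moreover have "eventually (\<lambda>s. F I (t + s *\<^sub>R axis i 1) = g s) (nhds 0)"
      using eventually_nhds_in_open[OF S0] by eventually_elim (simp add: gF)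
    ultimately show ?thesis by (subst DERIV_cong_ev[OF refl _ refl]) auto
  qed
  have pF: "\<forall>t\<in>T. partials I v t = F I t" if "length I \<le> k" for I
    using that
  proof (induction I)
    case (Cons i I)
    show ?case
    proof
      fix t assume t: "t \<in> T"
      have ev: "eventually (\<lambda>s. partials I v (t + s *\<^sub>R axis i 1) = F I (t + s *\<^sub>R axis i 1)) (nhds 0)"
        using eventually_on_line[OF opT t, of i] by eventually_elim (use Cons in auto)
      have "((\<lambda>s. partials I v (t + s *\<^sub>R axis i 1)) has_real_derivative F (i # I) t) (at 0)"
        using derF[of I t i] Cons.prems t by (subst DERIV_cong_ev[OF refl ev refl]) auto
      then show "partials (i # I) v t = F (i # I) t" by (simp add: partials_Cons partial_def DERIV_imp_deriv)
    qed
  qed (simp add: F0)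
  show thesis
  proof (rule that[OF e])
    fix I :: "'d list" assume I: "length I \<le> k"
    have "continuous_on T (F I)"
    proof (rule uniform_limit_theorem[OF _ uniform_limit_on_subset[OF unif[OF I] TG]])
      show "\<forall>\<^sub>F n in sequentially. continuous_on T (f n I)"
        by (intro always_eventually allI continuous_at_imp_continuous_on ballI cont)
    qed simp
    then show "continuous_on (?U \<inter> ball p e) (partials I v)"
      unfolding T_def[symmetric] by (subst continuous_on_cong[OF refl]) (use pF[OF I] in auto)
    have "(F I \<longlongrightarrow> F I p) (at p within ?U)"
    proof (rule swap_uniform_limit'[of "\<lambda>n. f n I" "\<lambda>n. f n I p" "at p within ?U" sequentially "F I p" G])
      show "\<forall>\<^sub>F n in sequentially. (f n I \<longlongrightarrow> f n I p) (at p within ?U)"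
        by (intro always_eventually allI) (rule tendsto_mono[OF at_le[OF subset_UNIV] isContD[OF cont]])
      show "(\<lambda>n. f n I p) \<longlonglongrightarrow> F I p" using p e by (intro lim I) (auto simp: G_def)
      show "\<forall>\<^sub>F x in at p within ?U. x \<in> G"
        using e interior_subset[of \<Omega>] by (auto simp: eventually_at G_def dist_commute intro!: exI[of _ e])
    qed (use unif[OF I] in auto)
    moreover have "\<forall>\<^sub>F x in at p within ?U. F I x = partials I v x"
      using e pF[OF I] by (auto simp: eventually_at T_def dist_commute intro!: exI[of _ e])
    ultimately have "(partials I v \<longlongrightarrow> F I p) (at p within ?U)" by (rule Lim_transform_eventually)
    then show "\<exists>L. (partials I v \<longlongrightarrow> L) (at p within ?U)" by blast
  next
    fix I :: "'d list" and i t assume I: "length I < k" and t: "t \<in> ?U \<inter> ball p e"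
    then have t': "t \<in> T" by (simp add: T_def)
    have ev: "eventually (\<lambda>s. partials I v (t + s *\<^sub>R axis i 1) = F I (t + s *\<^sub>R axis i 1)) (nhds 0)"
      using eventually_on_line[OF opT t', of i] by eventually_elim (use pF[of I] I in auto)
    have eq: "partials (i # I) v t = F (i # I) t" using pF[of "i # I"] I t' by simp
    show "((\<lambda>s. partials I v (t + s *\<^sub>R axis i 1)) has_real_derivative partials (i # I) v t) (at 0)"
      unfolding eq using derF[OF I t', of i] by (subst DERIV_cong_ev[OF refl ev refl]) auto
  qed
qed

theorem sobolev_embedding:
  fixes \<Omega> :: "(real^'d) set"
  assumes "convex \<Omega>" "compact \<Omega>" "interior \<Omega> \<noteq> {}" "v \<in> sobolev_space \<Omega> m"
    and "m > real CARD('d) / 2 + real k"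
  shows "partials_upto (interior \<Omega>) k v"
    and "length I \<le> k \<Longrightarrow> p \<in> \<Omega> \<Longrightarrow> \<exists>L. (partials I v \<longlongrightarrow> L) (at p within interior \<Omega>)"
proof -
  show "partials_upto (interior \<Omega>) k v"
    unfolding partials_upto_def
  proof (intro conjI allI impI)
    fix I :: "'d list" assume I: "length I \<le> k"
    show "continuous_on (interior \<Omega>) (partials I v)"
    proof (rule continuous_at_imp_continuous_on, rule ballI)
      fix t assume t: "t \<in> interior \<Omega>"
      have "t \<in> \<Omega>" using t interior_subset by blast
      from sobolev_embedding_local[OF assms this] obtain e where e: "e > 0"
        "continuous_on (interior \<Omega> \<inter> ball t e) (partials I v)" using I by metis
      show "isCont (partials I v) t"
        using e t by (intro continuous_on_interior[OF e(2)]) (simp add: interior_open open_Int)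
    qed
  next
    fix I :: "'d list" and i t
    show "length I < k \<Longrightarrow> t \<in> interior \<Omega> \<Longrightarrow> ((\<lambda>s. partials I v (t + s *\<^sub>R axis i 1)) has_real_derivative partials (i # I) v t) (at 0)"
    proof -
      assume I: "length I < k" and t: "t \<in> interior \<Omega>"
      have "t \<in> \<Omega>" using t interior_subset by blast
      from sobolev_embedding_local[OF assms this] obtain e where e: "e > 0"
        "\<And>I i s. length I < k \<Longrightarrow> s \<in> interior \<Omega> \<inter> ball t e \<Longrightarrow>
          ((\<lambda>h. partials I v (s + h *\<^sub>R axis i 1)) has_real_derivative partials (i # I) v s) (at 0)" by metis
      show ?thesis by (rule e(2)[OF I]) (use t e(1) in simp)
    qed
  qed
  show "\<exists>L. (partials I v \<longlongrightarrow> L) (at p within interior \<Omega>)" if "length I \<le> k" "p \<in> \<Omega>"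
    using sobolev_embedding_local[OF assms that(2)] that(1) by metis
qed

section \<open>Kernel ridge regression in a reproducing kernel Hilbert space\<close>

context rkhs
begin

abbreviation kfun :: "'a \<Rightarrow> 'a \<Rightarrow> real" where
  "kfun x \<equiv> \<lambda>y. if y \<in> \<Omega> then K x y else 0"

lemma diff_mem: "u \<in> H \<Longrightarrow> v \<in> H \<Longrightarrow> (\<lambda>x. u x - v x) \<in> H"
  using add_mem[of u "\<lambda>x. (- 1) * v x"] scale_mem[of v "- 1"] by simp

lemma ip_zero_left: "v \<in> H \<Longrightarrow> ip (\<lambda>_. 0) v = 0"
  using ip_scale[of v v 0] by simp

lemma ip_diff_left: "u \<in> H \<Longrightarrow> v \<in> H \<Longrightarrow> w \<in> H \<Longrightarrow> ip (\<lambda>x. u x - v x) w = ip u w - ip v w"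
  using ip_add[of u "\<lambda>x. (- 1) * v x" w] scale_mem[of v "- 1"] ip_scale[of v w "- 1"] by simp

lemma ip_add_right: "u \<in> H \<Longrightarrow> v \<in> H \<Longrightarrow> w \<in> H \<Longrightarrow> ip w (\<lambda>x. u x + v x) = ip w u + ip w v"
  using ip_add[of u v w] ip_commute[of w u] ip_commute[of w v] ip_commute[of w "\<lambda>x. u x + v x"] add_mem by simp

lemma ip_diff_right: "u \<in> H \<Longrightarrow> v \<in> H \<Longrightarrow> w \<in> H \<Longrightarrow> ip w (\<lambda>x. u x - v x) = ip w u - ip w v"
  using ip_diff_left[of u v w] ip_commute[of w u] ip_commute[of w v] ip_commute[of w "\<lambda>x. u x - v x"] diff_mem by simp

lemma ip_scale_right: "u \<in> H \<Longrightarrow> v \<in> H \<Longrightarrow> ip u (\<lambda>x. c * v x) = c * ip u v"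
  using ip_scale[of v u c] ip_commute[of u v] ip_commute[of u "\<lambda>x. c * v x"] scale_mem by simp

lemma sum_mem: "finite S \<Longrightarrow> (\<And>i. i \<in> S \<Longrightarrow> u i \<in> H) \<Longrightarrow> (\<lambda>x. \<Sum>i\<in>S. c i * u i x) \<in> H"
proof (induction S rule: finite_induct)
  case (insert a S)
  then show ?case using add_mem[OF scale_mem[of "u a" "c a"], of "\<lambda>x. \<Sum>i\<in>S. c i * u i x"] by simp
qed (simp add: zero_mem)

lemma ip_sum_left:
  "finite S \<Longrightarrow> (\<And>i. i \<in> S \<Longrightarrow> u i \<in> H) \<Longrightarrow> v \<in> H \<Longrightarrow> ip (\<lambda>x. \<Sum>i\<in>S. c i * u i x) v = (\<Sum>i\<in>S. c i * ip (u i) v)"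
proof (induction S rule: finite_induct)
  case (insert a S)
  have "(\<lambda>x. \<Sum>i\<in>S. c i * u i x) \<in> H" using insert by (intro sum_mem) auto
  then show ?case using insert ip_add[OF scale_mem[of "u a" "c a"], of "\<lambda>x. \<Sum>i\<in>S. c i * u i x" v] ip_scale[of "u a" v "c a"]
    by simp
qed (simp add: ip_zero_left)

lemma ip_Cauchy_Schwarz:
  assumes "u \<in> H" "v \<in> H"
  shows "(ip u v)\<^sup>2 \<le> ip u u * ip v v"
proof (cases "ip v v = 0")
  case True
  then have "v = (\<lambda>_. 0)" using ip_definite[OF assms(2)] by simp
  then have "ip u v = 0" using ip_zero_left[OF assms(1)] ip_commute[OF assms] by simp
  then show ?thesis using True by simp
next
  case False
  then have vv: "ip v v > 0" using ip_nonneg[OF assms(2)] by simp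
  let ?t = "ip u v / ip v v"
  have expand: "0 \<le> ip u u - c * ip u v - (c * ip v u - c * (c * ip v v))" for c
  proof -
    have m: "(\<lambda>x. c * v x) \<in> H" by (rule scale_mem[OF assms(2)])
    have "0 \<le> ip (\<lambda>x. u x - c * v x) (\<lambda>x. u x - c * v x)" by (rule ip_nonneg[OF diff_mem[OF assms(1) m]])
    also have "\<dots> = ip u u - c * ip u v - (c * ip v u - c * (c * ip v v))"
      using assms m diff_mem[OF assms(1) m] by (simp add: ip_diff_left ip_diff_right ip_scale ip_scale_right)
    finally show ?thesis .
  qed
  have "0 \<le> ip u u - ?t * ip u v - (?t * ip v u - ?t * (?t * ip v v))" by (rule expand)
  also have "\<dots> = ip u u - (ip u v)\<^sup>2 / ip v v"
    using vv ip_commute[OF assms(2,1)] by (simp add: power2_eq_square field_simps)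
  finally show ?thesis using vv by (simp add: divide_le_eq)
qed

lemma ip_norm_nonneg: "v \<in> H \<Longrightarrow> 0 \<le> ip_norm ip v"
  by (simp add: ip_norm_def ip_nonneg)

lemma ip_norm_square: "v \<in> H \<Longrightarrow> (ip_norm ip v)\<^sup>2 = ip v v"
  by (simp add: ip_norm_def ip_nonneg)

lemma ip_norm_triangle:
  assumes "u \<in> H" "v \<in> H"
  shows "ip_norm ip (\<lambda>x. u x + v x) \<le> ip_norm ip u + ip_norm ip v"
proof (rule power2_le_imp_le)
  have "ip u v \<le> \<bar>ip u v\<bar>" by simp
  also have "\<dots> = sqrt ((ip u v)\<^sup>2)" by simp
  also have "\<dots> \<le> sqrt (ip u u * ip v v)" by (intro real_sqrt_le_mono ip_Cauchy_Schwarz assms)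
  finally have "ip u v \<le> ip_norm ip u * ip_norm ip v" by (simp add: ip_norm_def real_sqrt_mult)
  then have "ip u u + 2 * ip u v + ip v v \<le> (ip_norm ip u + ip_norm ip v)\<^sup>2"
    by (simp add: power2_sum ip_norm_square assms)
  then show "(ip_norm ip (\<lambda>x. u x + v x))\<^sup>2 \<le> (ip_norm ip u + ip_norm ip v)\<^sup>2"
    using ip_commute[OF assms] by (simp add: ip_norm_square ip_add ip_add_right add_mem assms)
  show "0 \<le> ip_norm ip u + ip_norm ip v" by (intro add_nonneg_nonneg ip_norm_nonneg assms)
qed

lemma ip_norm_triangle_diff:
  assumes "u \<in> H" "v \<in> H" "w \<in> H"
  shows "ip_norm ip (\<lambda>x. u x - w x) \<le> ip_norm ip (\<lambda>x. u x - v x) + ip_norm ip (\<lambda>x. v x - w x)"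
  using ip_norm_triangle[OF diff_mem[OF assms(1,2)] diff_mem[OF assms(2,3)]] by simp

lemma ip_kfun: "v \<in> H \<Longrightarrow> x \<in> \<Omega> \<Longrightarrow> ip (kfun x) v = v x"
  using reproducing[of v x] ip_commute[OF kernel_mem] by simp

lemma kernel_symmetric: "x \<in> \<Omega> \<Longrightarrow> y \<in> \<Omega> \<Longrightarrow> K x y = K y x"
  using reproducing[OF kernel_mem, of y x] ip_kfun[OF kernel_mem, of x y] by simp

lemma kernel_diag_nonneg: "x \<in> \<Omega> \<Longrightarrow> 0 \<le> K x x"
  using ip_kfun[OF kernel_mem, of x x] ip_nonneg[OF kernel_mem, of x] by simp

lemma value_bound: "v \<in> H \<Longrightarrow> x \<in> \<Omega> \<Longrightarrow> (v x)\<^sup>2 \<le> ip v v * K x x"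
  using ip_Cauchy_Schwarz[OF kernel_mem, of x v] ip_kfun[of v x] ip_kfun[OF kernel_mem, of x x] by (simp add: mult.commute)

subsection \<open>The normal equation\<close>

text \<open>The derivative of the least squares objective vanishes in every direction.\<close>

definition normal_eq :: "real \<Rightarrow> nat \<Rightarrow> (nat \<Rightarrow> 'a) \<Rightarrow> (nat \<Rightarrow> real) \<Rightarrow> ('a \<Rightarrow> real) \<Rightarrow> bool" where
  "normal_eq lam n xs ys g \<longleftrightarrow> g \<in> H \<and>
     (\<forall>v\<in>H. (\<Sum>i=1..n. (ys i - g (xs i)) * v (xs i)) / real n = lam * ip g v)"

lemma objective_expansion:
  assumes g: "normal_eq lam n xs ys g" and v: "v \<in> H"
  shows "(\<Sum>i=1..n. (ys i - v (xs i))\<^sup>2) / real n + lam * (ip_norm ip v)\<^sup>2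
    = (\<Sum>i=1..n. (ys i - g (xs i))\<^sup>2) / real n + lam * (ip_norm ip g)\<^sup>2
      + ((\<Sum>i=1..n. (v (xs i) - g (xs i))\<^sup>2) / real n + lam * (ip_norm ip (\<lambda>x. v x - g x))\<^sup>2)"
proof -
  have gH: "g \<in> H" using g by (simp add: normal_eq_def)
  have dH: "(\<lambda>x. v x - g x) \<in> H" by (rule diff_mem[OF v gH])
  have "(\<Sum>i=1..n. (ys i - g (xs i)) * (v (xs i) - g (xs i))) / real n = lam * ip g (\<lambda>x. v x - g x)"
    using g dH by (auto simp: normal_eq_def)
  also have "\<dots> = lam * (ip g v - ip g g)" using ip_diff_right[OF v gH gH] by simp
  finally have ne: "(\<Sum>i=1..n. (ys i - g (xs i)) * (v (xs i) - g (xs i))) / real n = lam * (ip g v - ip g g)" .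
  have s1: "(\<Sum>i=1..n. (ys i - v (xs i))\<^sup>2) = (\<Sum>i=1..n. (ys i - g (xs i))\<^sup>2 + (v (xs i) - g (xs i))\<^sup>2 - 2 * ((ys i - g (xs i)) * (v (xs i) - g (xs i))))"
    by (intro sum.cong refl) (simp add: power2_eq_square algebra_simps)
  have s2: "(\<Sum>i=1..n. (ys i - g (xs i))\<^sup>2 + (v (xs i) - g (xs i))\<^sup>2 - 2 * ((ys i - g (xs i)) * (v (xs i) - g (xs i)))) / real n
    = (\<Sum>i=1..n. (ys i - g (xs i))\<^sup>2) / real n + (\<Sum>i=1..n. (v (xs i) - g (xs i))\<^sup>2) / real n
     - 2 * ((\<Sum>i=1..n. (ys i - g (xs i)) * (v (xs i) - g (xs i))) / real n)"
    by (simp only: sum.distrib sum_subtractf sum_distrib_left[symmetric] add_divide_distrib diff_divide_distrib times_divide_eq_right)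
  have S: "(\<Sum>i=1..n. (ys i - v (xs i))\<^sup>2) / real n = (\<Sum>i=1..n. (ys i - g (xs i))\<^sup>2) / real n
     + (\<Sum>i=1..n. (v (xs i) - g (xs i))\<^sup>2) / real n - 2 * (lam * (ip g v - ip g g))" unfolding s1 s2 ne ..
  have dd: "ip (\<lambda>x. v x - g x) (\<lambda>x. v x - g x) = ip v v - 2 * ip g v + ip g g"
    by (subst ip_diff_left[OF v gH dH], subst ip_diff_right[OF v gH v], subst ip_diff_right[OF v gH gH], subst ip_commute[OF v gH]) simp
  have alg: "S = A + B - 2 * (l * (gv - gg)) \<Longrightarrow> S + l * vv = A + l * gg + (B + l * (vv - 2 * gv + gg))"
    for S A B l gv gg vv :: real by (simp add: algebra_simps)
  show ?thesis
    unfolding ip_norm_square[OF v] ip_norm_square[OF gH] ip_norm_square[OF dH] dd by (rule alg[OF S])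
qed

lemma krr_eqI:
  assumes "lam > 0" and g: "normal_eq lam n xs ys g"
  shows "krr H ip lam n xs ys = g"
proof -
  let ?J = "\<lambda>v. (\<Sum>i=1..n. (ys i - v (xs i))\<^sup>2) / real n + lam * (ip_norm ip v)\<^sup>2"
  have gH: "g \<in> H" using g by (simp add: normal_eq_def)
  have ex: "?J v \<ge> ?J g + lam * (ip_norm ip (\<lambda>x. v x - g x))\<^sup>2" if "v \<in> H" for v
    unfolding objective_expansion[OF g that] by (simp add: sum_nonneg)
  have "?J v \<ge> ?J g" if "v \<in> H" for v
    using ex[OF that] assms(1) by (smt (verit) mult_nonneg_nonneg zero_le_power2)
  then have "is_arg_min ?J (\<lambda>v. v \<in> H) g" using gH by (auto simp: is_arg_min_def not_less)
  then have am: "is_arg_min ?J (\<lambda>v. v \<in> H) (krr H ip lam n xs ys)"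
    unfolding krr_def arg_min_def by (rule someI[of "is_arg_min ?J (\<lambda>v. v \<in> H)"])
  let ?v = "krr H ip lam n xs ys"
  have vH: "?v \<in> H" using am by (simp add: is_arg_min_def)
  have dH: "(\<lambda>x. ?v x - g x) \<in> H" by (rule diff_mem[OF vH gH])
  have "\<not> ?J g < ?J ?v" using am gH by (simp add: is_arg_min_def)
  with ex[OF vH] have "lam * (ip_norm ip (\<lambda>x. ?v x - g x))\<^sup>2 \<le> 0" by linarith
  then have "lam * ip (\<lambda>x. ?v x - g x) (\<lambda>x. ?v x - g x) \<le> 0" by (simp only: ip_norm_square[OF dH])
  with assms(1) have "ip (\<lambda>x. ?v x - g x) (\<lambda>x. ?v x - g x) \<le> 0" by (simp only: mult_le_0_iff) linarith
  then have "ip (\<lambda>x. ?v x - g x) (\<lambda>x. ?v x - g x) = 0" using ip_nonneg[OF dH] by (rule order_antisym)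
  from ip_definite[OF dH this] have "?v x - g x = 0" for x by metis
  then show ?thesis by (intro ext) simp
qed

subsection \<open>Gradient descent\<close>

text \<open>The minimiser is obtained as the limit of a contracting iteration. Besides existence, this gives
  measurability of the estimator in the design and the data: every iterate is an explicit expression
  in kernel values.\<close>
definition mean_diag :: "nat \<Rightarrow> (nat \<Rightarrow> 'a) \<Rightarrow> real" where
  "mean_diag n xs = (\<Sum>i=1..n. K (xs i) (xs i)) / real n"

definition step_size :: "real \<Rightarrow> nat \<Rightarrow> (nat \<Rightarrow> 'a) \<Rightarrow> real" where
  "step_size lam n xs = 1 / (lam + mean_diag n xs)"

definition gd_step :: "real \<Rightarrow> nat \<Rightarrow> (nat \<Rightarrow> 'a) \<Rightarrow> (nat \<Rightarrow> real) \<Rightarrow> ('a \<Rightarrow> real) \<Rightarrow> 'a \<Rightarrow> real" where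
  "gd_step lam n xs ys v = (\<lambda>t. (1 - step_size lam n xs * lam) * v t
     - step_size lam n xs * (\<Sum>i=1..n. ((v (xs i) - ys i) / real n) * kfun (xs i) t))"

definition gd :: "real \<Rightarrow> nat \<Rightarrow> (nat \<Rightarrow> 'a) \<Rightarrow> (nat \<Rightarrow> real) \<Rightarrow> nat \<Rightarrow> 'a \<Rightarrow> real" where
  "gd lam n xs ys k = (gd_step lam n xs ys ^^ k) (\<lambda>_. 0)"

context
  fixes n :: nat and xs :: "nat \<Rightarrow> 'a"
  assumes xs: "\<And>i. i \<in> {1..n} \<Longrightarrow> xs i \<in> \<Omega>"
begin

lemma mean_diag_nonneg: "mean_diag n xs \<ge> 0"
  unfolding mean_diag_def by (intro divide_nonneg_nonneg sum_nonneg kernel_diag_nonneg xs) auto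

definition samp :: "('a \<Rightarrow> real) \<Rightarrow> 'a \<Rightarrow> real" where
  "samp d = (\<lambda>t. \<Sum>i=1..n. (d (xs i) / real n) * kfun (xs i) t)"

lemma samp_mem: "samp d \<in> H"
  unfolding samp_def by (intro sum_mem kernel_mem xs) auto

lemma ip_samp: "w \<in> H \<Longrightarrow> ip (samp d) w = (\<Sum>i=1..n. d (xs i) * w (xs i)) / real n"
  unfolding samp_def by (subst ip_sum_left) (auto simp: ip_kfun xs kernel_mem sum_divide_distrib intro!: sum.cong)

text \<open>The sampling operator is positive, with norm at most the mean of the kernel on the diagonal.\<close>

lemma samp_norm: "ip (samp d) (samp d) \<le> mean_diag n xs * ((\<Sum>i=1..n. (d (xs i))\<^sup>2) / real n)"
proof -
  let ?T = "samp d" and ?k = "mean_diag n xs"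
  define S where "S = ip ?T ?T"
  have S0: "S \<ge> 0" unfolding S_def by (rule ip_nonneg[OF samp_mem])
  have t0: "(\<Sum>i=1..n. (d (xs i))\<^sup>2) / real n \<ge> 0" by (intro divide_nonneg_nonneg sum_nonneg) auto
  show ?thesis
  proof (cases "S = 0")
    case True
    then show ?thesis using mult_nonneg_nonneg[OF mean_diag_nonneg t0] unfolding S_def by linarith
  next
    case False
    with S0 have Sp: "S > 0" by simp
    have "(\<Sum>i=1..n. d (xs i) * ?T (xs i))\<^sup>2 \<le> (\<Sum>i=1..n. (d (xs i))\<^sup>2) * (\<Sum>i=1..n. (?T (xs i))\<^sup>2)"
      by (rule Cauchy_Schwarz_ineq_sum)
    also have "\<dots> \<le> (\<Sum>i=1..n. (d (xs i))\<^sup>2) * (\<Sum>i=1..n. S * K (xs i) (xs i))"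
      unfolding S_def by (intro mult_left_mono sum_mono value_bound samp_mem xs sum_nonneg) auto
    finally have "(\<Sum>i=1..n. d (xs i) * ?T (xs i))\<^sup>2 / (real n)\<^sup>2
        \<le> ((\<Sum>i=1..n. (d (xs i))\<^sup>2) * (\<Sum>i=1..n. S * K (xs i) (xs i))) / (real n)\<^sup>2"
      by (intro divide_right_mono) auto
    also have "\<dots> = ((\<Sum>i=1..n. (d (xs i))\<^sup>2) / real n) * (S * ?k)"
    proof -
      have "(\<Sum>i=1..n. S * K (xs i) (xs i)) = S * (real n * ?k)"
      proof -
        have "(\<Sum>i=1..n. K (xs i) (xs i)) = real n * ?k" by (cases "n = 0") (simp_all add: mean_diag_def)
        then show ?thesis by (simp only: sum_distrib_left[symmetric])
      qed
      moreover have "(A * (S * (real n * ?k))) / (real n)\<^sup>2 = (A / real n) * (S * ?k)" for A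
        by (cases "n = 0") (simp_all add: power2_eq_square)
      ultimately show ?thesis by (simp only:)
    qed
    finally have "S * S \<le> S * (?k * ((\<Sum>i=1..n. (d (xs i))\<^sup>2) / real n))"
      unfolding S_def ip_samp[OF samp_mem] by (simp add: power2_eq_square mult_ac)
    from mult_left_le_imp_le[OF this Sp] show ?thesis unfolding S_def .
  qed
qed

text \<open>The step shrinks the penalty part by \<open>1 - h lam\<close>, where \<open>h\<close> is the step size, and the sampling operator,
  positive and of norm at most \<open>mean_diag\<close>, cannot increase this because \<open>h\<close> is small enough.\<close>

lemma gd_step_contraction:
  assumes "lam > 0" "u \<in> H" "v \<in> H"
  shows "gd_step lam n xs ys u \<in> H"
    and "ip_norm ip (\<lambda>t. gd_step lam n xs ys u t - gd_step lam n xs ys v t)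
      \<le> mean_diag n xs / (lam + mean_diag n xs) * ip_norm ip (\<lambda>t. u t - v t)"
proof -
  let ?k = "mean_diag n xs" and ?h = "step_size lam n xs"
  have lk: "lam + ?k > 0" using mean_diag_nonneg assms(1) by simp
  have "?h * (lam + ?k) = 1" using lk by (simp add: step_size_def)
  then have h: "?h > 0" "?h * lam + ?h * ?k = 1" "1 - ?h * lam = ?h * ?k"
    using lk by (simp add: step_size_def, simp_all add: distrib_left)
  have eH: "?k / (lam + ?k) = ?h * ?k" by (simp add: step_size_def)
  have "(\<lambda>t. (1 - ?h * lam) * u t - ?h * (\<Sum>i=1..n. ((u (xs i) - ys i) / real n) * kfun (xs i) t)) \<in> H"
    using assms(2) by (intro diff_mem scale_mem sum_mem kernel_mem xs) auto
  then show "gd_step lam n xs ys u \<in> H" by (simp only: gd_step_def)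
  define d where "d = (\<lambda>t. u t - v t)"
  have dH: "d \<in> H" unfolding d_def by (rule diff_mem[OF assms(2,3)])
  let ?e = "?h * ?k"
  have eq: "(\<lambda>t. gd_step lam n xs ys u t - gd_step lam n xs ys v t) = (\<lambda>t. ?e * d t - ?h * samp d t)"
  proof
    fix t
    have "(\<Sum>i=1..n. ((u (xs i) - ys i) / real n) * kfun (xs i) t) - (\<Sum>i=1..n. ((v (xs i) - ys i) / real n) * kfun (xs i) t) = samp d t"
      unfolding samp_def sum_subtractf[symmetric] by (intro sum.cong refl) (simp add: d_def diff_divide_distrib algebra_simps)
    then show "gd_step lam n xs ys u t - gd_step lam n xs ys v t = ?e * d t - ?h * samp d t"
      unfolding gd_step_def h(3) d_def by (simp add: algebra_simps)
  qed
  define \<tau> where "\<tau> = (\<Sum>i=1..n. (d (xs i))\<^sup>2) / real n"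
  have t0: "\<tau> \<ge> 0" unfolding \<tau>_def by (intro divide_nonneg_nonneg sum_nonneg) auto
  have Td: "ip (samp d) d = \<tau>" "ip d (samp d) = \<tau>"
    using ip_samp[OF dH, of d] ip_commute[OF dH samp_mem, of d] by (simp_all add: \<tau>_def power2_eq_square)
  have expand: "ip (\<lambda>t. a * d t - b * samp d t) (\<lambda>t. a * d t - b * samp d t)
      = a\<^sup>2 * ip d d - 2 * a * b * \<tau> + b\<^sup>2 * ip (samp d) (samp d)" for a b
  proof -
    have m: "(\<lambda>t. a * d t) \<in> H" "(\<lambda>t. b * samp d t) \<in> H" by (intro scale_mem dH samp_mem)+
    have "ip (\<lambda>t. a * d t - b * samp d t) (\<lambda>t. a * d t - b * samp d t)
      = a * (a * ip d d - b * \<tau>) - b * (a * \<tau> - b * ip (samp d) (samp d))"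
      using m dH samp_mem[of d] diff_mem[OF m] by (simp add: ip_diff_left ip_diff_right ip_scale ip_scale_right Td) (simp add: algebra_simps)
    then show ?thesis by (simp add: power2_eq_square algebra_simps)
  qed
  have "ip (\<lambda>t. ?e * d t - ?h * samp d t) (\<lambda>t. ?e * d t - ?h * samp d t)
      = ?e\<^sup>2 * ip d d - 2 * ?e * ?h * \<tau> + ?h\<^sup>2 * ip (samp d) (samp d)" by (rule expand)
  also have "\<dots> \<le> ?e\<^sup>2 * ip d d - 2 * ?e * ?h * \<tau> + ?h\<^sup>2 * (?k * \<tau>)"
    using samp_norm[of d] by (intro add_left_mono mult_left_mono) (auto simp: \<tau>_def)
  also have "\<dots> = ?e\<^sup>2 * ip d d - ?h\<^sup>2 * (?k * \<tau>)" by (simp add: power2_eq_square algebra_simps)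
  also have "\<dots> \<le> ?e\<^sup>2 * ip d d" using t0 mean_diag_nonneg by simp
  finally have "sqrt (ip (\<lambda>t. ?e * d t - ?h * samp d t) (\<lambda>t. ?e * d t - ?h * samp d t)) \<le> sqrt (?e\<^sup>2 * ip d d)"
    by (rule real_sqrt_le_mono)
  also have "\<dots> = ?e * sqrt (ip d d)" using h(1) mean_diag_nonneg by (simp add: real_sqrt_mult)
  finally show "ip_norm ip (\<lambda>t. gd_step lam n xs ys u t - gd_step lam n xs ys v t) \<le> ?k / (lam + ?k) * ip_norm ip (\<lambda>t. u t - v t)"
    unfolding eq eH ip_norm_def d_def .
qed

lemma gd_mem: "lam > 0 \<Longrightarrow> gd lam n xs ys k \<in> H"
  unfolding gd_def by (induction k) (auto simp: zero_mem intro: gd_step_contraction(1))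

lemma gd_converges:
  assumes lam: "lam > 0"
  obtains g where "normal_eq lam n xs ys g" "\<And>t. t \<in> \<Omega> \<Longrightarrow> (\<lambda>k. gd lam n xs ys k t) \<longlonglongrightarrow> g t"
proof -
  let ?k = "mean_diag n xs" and ?h = "step_size lam n xs"
  let ?G = "gd lam n xs ys"
  let ?N = "ip_norm ip"
  define q where "q = ?k / (lam + ?k)"
  have lk: "lam + ?k > 0" using mean_diag_nonneg lam by simp
  have q: "0 \<le> q" "q < 1" using mean_diag_nonneg lam lk by (auto simp: q_def)
  have GS: "?G (Suc k) = gd_step lam n xs ys (?G k)" for k by (simp add: gd_def)
  note mem = gd_mem[OF lam]
  have contr: "?N (\<lambda>t. ?G (Suc j) t - ?G (Suc k) t) \<le> q * ?N (\<lambda>t. ?G j t - ?G k t)" for j k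
    unfolding GS q_def by (rule gd_step_contraction(2)[OF lam mem mem])
  define a where "a = ?N (\<lambda>t. ?G 1 t - ?G 0 t)"
  define B where "B = a / (1 - q)"
  have a0: "a \<ge> 0" unfolding a_def by (rule ip_norm_nonneg[OF diff_mem[OF mem mem]])
  have B0: "B \<ge> 0" "q * B + a = B" using a0 q by (auto simp: B_def field_simps)
  have base: "?N (\<lambda>t. ?G p t - ?G 0 t) \<le> B" for p
  proof (induction p)
    case 0
    show ?case using B0(1) ip_zero_left[OF zero_mem] by (simp add: ip_norm_def)
  next
    case (Suc p)
    have "?N (\<lambda>t. ?G (Suc p) t - ?G 0 t) \<le> ?N (\<lambda>t. ?G (Suc p) t - ?G (Suc 0) t) + ?N (\<lambda>t. ?G (Suc 0) t - ?G 0 t)"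
      by (rule ip_norm_triangle_diff[OF mem mem mem])
    also have "\<dots> \<le> q * B + a"
      using contr[of p 0] Suc q(1) mult_left_mono[OF Suc q(1)] by (simp add: a_def)
    finally show ?case using B0(2) by simp
  qed
  have bound: "?N (\<lambda>t. ?G (k + p) t - ?G k t) \<le> q ^ k * B" for k p
  proof (induction k)
    case (Suc k)
    have "?N (\<lambda>t. ?G (Suc k + p) t - ?G (Suc k) t) \<le> q * ?N (\<lambda>t. ?G (k + p) t - ?G k t)" using contr[of "k + p" k] by simp
    also have "\<dots> \<le> q * (q ^ k * B)" by (intro mult_left_mono Suc q)
    finally show ?case by simp
  qed (use base in simp)
  have "\<exists>v\<in>H. (\<lambda>k. ip (\<lambda>x. ?G k x - v x) (\<lambda>x. ?G k x - v x)) \<longlonglongrightarrow> 0"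
  proof (rule complete)
    show "?G k \<in> H" for k by (rule mem)
    show "\<forall>\<epsilon>>0. \<exists>N. \<forall>j\<ge>N. \<forall>k\<ge>N. ip (\<lambda>x. ?G j x - ?G k x) (\<lambda>x. ?G j x - ?G k x) < \<epsilon>"
    proof (intro allI impI)
      fix \<epsilon> :: real assume \<epsilon>: "\<epsilon> > 0"
      have "(\<lambda>N. 2 * (q ^ N * B)) \<longlonglongrightarrow> 2 * (0 * B)" using q by (intro tendsto_intros LIMSEQ_power_zero) auto
      moreover have "sqrt \<epsilon> > 2 * (0 * B)" using \<epsilon> by simp
      ultimately have "eventually (\<lambda>N. 2 * (q ^ N * B) < sqrt \<epsilon>) sequentially" by (rule order_tendstoD(2))
      then obtain N where N: "2 * (q ^ N * B) < sqrt \<epsilon>" by (auto simp: eventually_sequentially)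
      have "ip (\<lambda>x. ?G j x - ?G k x) (\<lambda>x. ?G j x - ?G k x) < \<epsilon>" if "j \<ge> N" "k \<ge> N" for j k
      proof -
        have sym: "?N (\<lambda>t. ?G N t - ?G k t) = ?N (\<lambda>t. ?G k t - ?G N t)"
          unfolding ip_norm_def using mem by (simp add: ip_diff_left ip_diff_right diff_mem algebra_simps)
        have "?N (\<lambda>t. ?G j t - ?G k t) \<le> ?N (\<lambda>t. ?G j t - ?G N t) + ?N (\<lambda>t. ?G N t - ?G k t)"
          by (rule ip_norm_triangle_diff[OF mem mem mem])
        also have "\<dots> \<le> q ^ N * B + q ^ N * B"
          unfolding sym using bound[of N "j - N"] bound[of N "k - N"] that by (intro add_mono) auto
        finally have "?N (\<lambda>t. ?G j t - ?G k t) < sqrt \<epsilon>" using N by linarith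
        then show ?thesis by (simp add: ip_norm_def)
      qed
      then show "\<exists>N. \<forall>j\<ge>N. \<forall>k\<ge>N. ip (\<lambda>x. ?G j x - ?G k x) (\<lambda>x. ?G j x - ?G k x) < \<epsilon>" by blast
    qed
  qed
  then obtain g where gH: "g \<in> H" and g: "(\<lambda>k. ip (\<lambda>x. ?G k x - g x) (\<lambda>x. ?G k x - g x)) \<longlonglongrightarrow> 0" by blast
  have pt: "(\<lambda>k. ?G k t) \<longlonglongrightarrow> g t" if t: "t \<in> \<Omega>" for t
  proof -
    have "(\<lambda>k. ip (\<lambda>x. ?G k x - g x) (\<lambda>x. ?G k x - g x) * K t t) \<longlonglongrightarrow> 0 * K t t" by (rule tendsto_mult_right[OF g])
    then have lim0: "(\<lambda>k. ip (\<lambda>x. ?G k x - g x) (\<lambda>x. ?G k x - g x) * K t t) \<longlonglongrightarrow> 0" by simp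
    have "(\<lambda>k. (?G k t - g t)\<^sup>2) \<longlonglongrightarrow> 0"
    proof (rule tendsto_sandwich[OF _ _ tendsto_const lim0])
      show "\<forall>\<^sub>F k in sequentially. 0 \<le> (?G k t - g t)\<^sup>2" by simp
      show "\<forall>\<^sub>F k in sequentially. (?G k t - g t)\<^sup>2 \<le> ip (\<lambda>x. ?G k x - g x) (\<lambda>x. ?G k x - g x) * K t t"
        by (intro always_eventually allI value_bound[OF diff_mem[OF mem gH] t])
    qed
    then have "(\<lambda>k. sqrt ((?G k t - g t)\<^sup>2)) \<longlonglongrightarrow> sqrt 0" by (rule tendsto_real_sqrt)
    then have "(\<lambda>k. ?G k t - g t) \<longlonglongrightarrow> 0" by (simp add: tendsto_rabs_zero_iff)
    then show ?thesis by (rule LIM_zero_cancel)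
  qed
  have fixed: "lam * g t = (\<Sum>i=1..n. ((ys i - g (xs i)) / real n) * kfun (xs i) t)" for t
  proof (cases "t \<in> \<Omega>")
    case True
    have "(\<lambda>k. ?G (Suc k) t) \<longlonglongrightarrow> (1 - ?h * lam) * g t - ?h * (\<Sum>i=1..n. ((g (xs i) - ys i) / real n) * kfun (xs i) t)"
      unfolding GS gd_step_def divide_inverse
      by (intro tendsto_diff tendsto_mult tendsto_sum tendsto_const pt True xs) assumption
    moreover have "(\<lambda>k. ?G (Suc k) t) \<longlonglongrightarrow> g t" by (rule LIMSEQ_Suc[OF pt[OF True]])
    ultimately have "g t = (1 - ?h * lam) * g t - ?h * (\<Sum>i=1..n. ((g (xs i) - ys i) / real n) * kfun (xs i) t)"
      using LIMSEQ_unique by blast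
    then have "?h * (lam * g t) = ?h * (- (\<Sum>i=1..n. ((g (xs i) - ys i) / real n) * kfun (xs i) t))" by (simp add: algebra_simps)
    moreover have "?h \<noteq> 0" using lk by (simp add: step_size_def)
    ultimately have "lam * g t = - (\<Sum>i=1..n. ((g (xs i) - ys i) / real n) * kfun (xs i) t)"
      by (simp only: mult_cancel_left) blast
    also have "\<dots> = (\<Sum>i=1..n. ((ys i - g (xs i)) / real n) * kfun (xs i) t)"
      unfolding sum_negf[symmetric] by (intro sum.cong refl) (simp add: diff_divide_distrib algebra_simps)
    finally show ?thesis .
  qed (simp add: zero_outside[OF gH])
  have "(\<Sum>i=1..n. (ys i - g (xs i)) * v (xs i)) / real n = lam * ip g v" if v: "v \<in> H" for v
  proof -
    have "lam * ip g v = ip (\<lambda>t. lam * g t) v" by (simp add: ip_scale gH v)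
    also have "\<dots> = ip (\<lambda>t. \<Sum>i=1..n. ((ys i - g (xs i)) / real n) * kfun (xs i) t) v" by (simp only: fixed)
    also have "\<dots> = (\<Sum>i=1..n. ((ys i - g (xs i)) / real n) * ip (kfun (xs i)) v)"
      by (intro ip_sum_left kernel_mem xs v) auto
    also have "\<dots> = (\<Sum>i=1..n. (ys i - g (xs i)) * v (xs i)) / real n"
      unfolding sum_divide_distrib by (intro sum.cong refl) (simp add: ip_kfun v xs)
    finally show ?thesis by simp
  qed
  with gH have "normal_eq lam n xs ys g" by (auto simp: normal_eq_def)
  from that[OF this pt] show thesis .
qed

lemma krr_normal_eq: "lam > 0 \<Longrightarrow> normal_eq lam n xs ys (krr H ip lam n xs ys)"
  using gd_converges krr_eqI by metis

lemma krr_mem: "lam > 0 \<Longrightarrow> krr H ip lam n xs ys \<in> H"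
  using krr_normal_eq by (simp add: normal_eq_def)

lemma gd_tendsto_krr: "lam > 0 \<Longrightarrow> t \<in> \<Omega> \<Longrightarrow> (\<lambda>k. gd lam n xs ys k t) \<longlonglongrightarrow> krr H ip lam n xs ys t"
  using gd_converges krr_eqI by metis

lemma krr_add:
  assumes "lam > 0"
  shows "krr H ip lam n xs (\<lambda>i. ys i + zs i) = (\<lambda>t. krr H ip lam n xs ys t + krr H ip lam n xs zs t)"
proof (rule krr_eqI[OF assms])
  let ?g = "krr H ip lam n xs ys" and ?h = "krr H ip lam n xs zs"
  have ne: "normal_eq lam n xs ys ?g" "normal_eq lam n xs zs ?h" using krr_normal_eq[OF assms] by auto
  then have mem: "?g \<in> H" "?h \<in> H" by (auto simp: normal_eq_def)
  have "(\<Sum>i=1..n. (ys i + zs i - (?g (xs i) + ?h (xs i))) * v (xs i)) / real n = lam * ip (\<lambda>t. ?g t + ?h t) v" if v: "v \<in> H" for v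
  proof -
    have "(\<Sum>i=1..n. (ys i + zs i - (?g (xs i) + ?h (xs i))) * v (xs i)) / real n
      = (\<Sum>i=1..n. (ys i - ?g (xs i)) * v (xs i)) / real n + (\<Sum>i=1..n. (zs i - ?h (xs i)) * v (xs i)) / real n"
      unfolding add_divide_distrib[symmetric] sum.distrib[symmetric] by (simp add: algebra_simps)
    then show ?thesis using ne v by (simp add: normal_eq_def ip_add mem distrib_left)
  qed
  then show "normal_eq lam n xs (\<lambda>i. ys i + zs i) (\<lambda>t. ?g t + ?h t)"
    by (simp add: normal_eq_def add_mem mem)
qed

lemma krr_scale:
  assumes "lam > 0"
  shows "krr H ip lam n xs (\<lambda>i. c * ys i) = (\<lambda>t. c * krr H ip lam n xs ys t)"
proof (rule krr_eqI[OF assms])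
  let ?g = "krr H ip lam n xs ys"
  have ne: "normal_eq lam n xs ys ?g" using krr_normal_eq[OF assms] by auto
  then have mem: "?g \<in> H" by (auto simp: normal_eq_def)
  have "(\<Sum>i=1..n. (c * ys i - c * ?g (xs i)) * v (xs i)) / real n = lam * ip (\<lambda>t. c * ?g t) v" if v: "v \<in> H" for v
  proof -
    have "(\<Sum>i=1..n. (c * ys i - c * ?g (xs i)) * v (xs i)) / real n = c * ((\<Sum>i=1..n. (ys i - ?g (xs i)) * v (xs i)) / real n)"
    proof -
      have "(c * ys i - c * ?g (xs i)) * v (xs i) = c * ((ys i - ?g (xs i)) * v (xs i))" for i
        by (simp add: algebra_simps)
      then show ?thesis by (simp only: sum_distrib_left[symmetric] times_divide_eq_right)
    qed
    also have "\<dots> = c * (lam * ip ?g v)" using ne v by (auto simp: normal_eq_def)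
    finally show ?thesis by (simp add: ip_scale mem v)
  qed
  then show "normal_eq lam n xs (\<lambda>i. c * ys i) (\<lambda>t. c * ?g t)"
    by (simp add: normal_eq_def scale_mem mem)
qed

lemma krr_cong:
  assumes "\<And>i. i \<in> {1..n} \<Longrightarrow> ys i = zs i"
  shows "krr H ip lam n xs ys = krr H ip lam n xs zs"
proof -
  have "(\<Sum>i=1..n. (ys i - v (xs i))\<^sup>2) = (\<Sum>i=1..n. (zs i - v (xs i))\<^sup>2)" for v
    by (intro sum.cong refl) (simp add: assms)
  then show ?thesis unfolding krr_def by (simp only:)
qed

lemma krr_linear_combination:
  assumes "lam > 0"
  shows "krr H ip lam n xs ys = (\<lambda>t. \<Sum>j=1..n. ys j * krr H ip lam n xs (\<lambda>i. if i = j then 1 else 0) t)"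
proof -
  have "krr H ip lam n xs (\<lambda>i. \<Sum>j\<in>S. ys j * (if i = j then 1 else 0)) = (\<lambda>t. \<Sum>j\<in>S. ys j * krr H ip lam n xs (\<lambda>i. if i = j then 1 else 0) t)"
    if "finite S" for S
    using that
  proof (induction S rule: finite_induct)
    case empty
    show ?case using krr_scale[OF assms, of 0 "\<lambda>_. 0"] by simp
  next
    case (insert j S)
    then show ?case
      using krr_add[OF assms, of "\<lambda>i. ys j * (if i = j then 1 else 0)" "\<lambda>i. \<Sum>j\<in>S. ys j * (if i = j then 1 else 0)"]
        krr_scale[OF assms, of "ys j" "\<lambda>i. if i = j then 1 else 0"] by simp
  qed
  from this[of "{1..n}"] show ?thesis
    by (subst krr_cong[of ys "\<lambda>i. \<Sum>j\<in>{1..n}. ys j * (if i = j then 1 else 0)"]) (auto simp: if_distrib cong: if_cong)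
qed

text \<open>The bias bound: the minimum of the objective for the data \<open>h (x\<^sub>i)\<close> is at most its value at \<open>h\<close>, where
  the residuals vanish.\<close>

lemma krr_bias_bound:
  assumes "lam > 0" "h \<in> H"
  shows "(\<Sum>i=1..n. (h (xs i) - krr H ip lam n xs (\<lambda>i. h (xs i)) (xs i))\<^sup>2) / real n
      + lam * (ip_norm ip (krr H ip lam n xs (\<lambda>i. h (xs i))))\<^sup>2 \<le> lam * (ip_norm ip h)\<^sup>2"
proof -
  let ?g = "krr H ip lam n xs (\<lambda>i. h (xs i))"
  have "lam * (ip_norm ip h)\<^sup>2 = (\<Sum>i=1..n. (h (xs i) - h (xs i))\<^sup>2) / real n + lam * (ip_norm ip h)\<^sup>2" by simp
  also have "\<dots> = (\<Sum>i=1..n. (h (xs i) - ?g (xs i))\<^sup>2) / real n + lam * (ip_norm ip ?g)\<^sup>2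
    + ((\<Sum>i=1..n. (h (xs i) - ?g (xs i))\<^sup>2) / real n + lam * (ip_norm ip (\<lambda>x. h x - ?g x))\<^sup>2)"
    by (rule objective_expansion[OF krr_normal_eq[OF assms(1)] assms(2)])
  finally show ?thesis using assms(1) by (smt (verit) divide_nonneg_nonneg mult_nonneg_nonneg of_nat_0_le_iff sum_nonneg zero_le_power2)
qed

text \<open>The fit is determined by the residuals divided by the smoothing parameter, so a change of the latter
  is compensated by amplifying the residuals.\<close>

lemma krr_change_parameter:
  assumes "lam' > 0" "lam > 0"
  shows "krr H ip lam n xs (\<lambda>i. ys i + (lam - lam') / lam' * (ys i - krr H ip lam' n xs ys (xs i))) = krr H ip lam' n xs ys"
proof (rule krr_eqI[OF assms(2)])
  let ?g = "krr H ip lam' n xs ys"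
  have ne: "normal_eq lam' n xs ys ?g" by (rule krr_normal_eq[OF assms(1)])
  have "(\<Sum>i=1..n. (ys i + (lam - lam') / lam' * (ys i - ?g (xs i)) - ?g (xs i)) * v (xs i)) / real n = lam * ip ?g v" if v: "v \<in> H" for v
  proof -
    have "ys i + (lam - lam') / lam' * (ys i - ?g (xs i)) - ?g (xs i) = lam / lam' * (ys i - ?g (xs i))" for i
      using assms by (simp add: field_simps)
    then have "(\<Sum>i=1..n. (ys i + (lam - lam') / lam' * (ys i - ?g (xs i)) - ?g (xs i)) * v (xs i)) / real n
      = lam / lam' * ((\<Sum>i=1..n. (ys i - ?g (xs i)) * v (xs i)) / real n)"
      by (simp only:) (simp add: sum_distrib_left mult.assoc)
    also have "\<dots> = lam / lam' * (lam' * ip ?g v)" using ne v by (auto simp: normal_eq_def)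
    finally show ?thesis using assms by simp
  qed
  then show "normal_eq lam n xs (\<lambda>i. ys i + (lam - lam') / lam' * (ys i - ?g (xs i))) ?g"
    using ne by (simp add: normal_eq_def)
qed

end

end

subsection \<open>Measurable dependence on the design and the data\<close>

text \<open>The induction over the iterates needs their values at the random design points too, hence the set \<open>R\<close>
  of random points.\<close>

lemma (in rkhs) krr_measurable_aux:
  assumes meas: "\<And>i \<tau>. i \<in> {1..n} \<Longrightarrow> \<tau> \<in> R \<Longrightarrow> (\<lambda>w. K (X i w) (\<tau> w)) \<in> borel_measurable N"
    and Y[measurable]: "\<And>i. i \<in> {1..n} \<Longrightarrow> Y i \<in> borel_measurable N"
    and XR: "\<And>i. i \<in> {1..n} \<Longrightarrow> X i \<in> R"
    and R\<Omega>: "\<And>\<tau> w. \<tau> \<in> R \<Longrightarrow> w \<in> space N \<Longrightarrow> \<tau> w \<in> \<Omega>"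
    and "lam > 0" "\<tau> \<in> R"
  shows "(\<lambda>w. krr H ip lam n (\<lambda>i. X i w) (\<lambda>i. Y i w) (\<tau> w)) \<in> borel_measurable N"
proof -
  have md[measurable]: "(\<lambda>w. step_size lam n (\<lambda>i. X i w)) \<in> borel_measurable N"
    unfolding step_size_def mean_diag_def
    by (intro borel_measurable_divide borel_measurable_add borel_measurable_const borel_measurable_sum meas XR)
  have it: "(\<lambda>w. gd lam n (\<lambda>i. X i w) (\<lambda>i. Y i w) k (\<tau> w)) \<in> borel_measurable N" if "\<tau> \<in> R" for k \<tau>
    using that
  proof (induction k arbitrary: \<tau>)
    case 0
    then show ?case by (simp add: gd_def)
  next
    case (Suc k)
    have "(\<lambda>w. (1 - step_size lam n (\<lambda>i. X i w) * lam) * gd lam n (\<lambda>i. X i w) (\<lambda>i. Y i w) k (\<tau> w)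
       - step_size lam n (\<lambda>i. X i w) * (\<Sum>i=1..n. ((gd lam n (\<lambda>i. X i w) (\<lambda>i. Y i w) k (X i w) - Y i w) / real n) * K (X i w) (\<tau> w)))
       \<in> borel_measurable N"
      by (intro borel_measurable_diff borel_measurable_times borel_measurable_sum borel_measurable_divide borel_measurable_const
          md Suc.IH Suc.prems XR Y meas)
    then show ?case
      by (rule measurable_cong[THEN iffD1, rotated])
        (use R\<Omega>[OF Suc.prems] in \<open>simp add: gd_def gd_step_def\<close>)
  qed
  show ?thesis
  proof (rule borel_measurable_LIMSEQ_real)
    show "(\<lambda>w. gd lam n (\<lambda>i. X i w) (\<lambda>i. Y i w) k (\<tau> w)) \<in> borel_measurable N" for k
      by (rule it[OF assms(6)])
    fix w assume w: "w \<in> space N"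
    show "(\<lambda>k. gd lam n (\<lambda>i. X i w) (\<lambda>i. Y i w) k (\<tau> w)) \<longlonglongrightarrow> krr H ip lam n (\<lambda>i. X i w) (\<lambda>i. Y i w) (\<tau> w)"
      using R\<Omega>[OF XR w] R\<Omega>[OF assms(6) w] assms(5) by (intro gd_tendsto_krr)
  qed
qed

text \<open>A kernel that is continuous in each variable is jointly measurable: approximate the second
  argument by the first close point of a countable dense set.\<close>

lemma kernel_measurable:
  fixes \<Omega> :: "'a::{second_countable_topology, metric_space} set"
  assumes "rkhs \<Omega> K H ip" and cl: "closed \<Omega>" and cont: "\<And>v. v \<in> H \<Longrightarrow> continuous_on \<Omega> v"
    and X[measurable]: "X \<in> borel_measurable N" and \<tau>[measurable]: "\<tau> \<in> borel_measurable N"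
    and XO: "\<And>w. w \<in> space N \<Longrightarrow> X w \<in> \<Omega>" and \<tau>O: "\<And>w. w \<in> space N \<Longrightarrow> \<tau> w \<in> \<Omega>"
  shows "(\<lambda>w. K (X w) (\<tau> w)) \<in> borel_measurable N"
proof (cases "space N = {}")
  case True
  then show ?thesis by (simp add: measurable_def)
next
  case False
  interpret rkhs \<Omega> K H ip by fact
  have ne: "\<Omega> \<noteq> {}" using False XO by blast
  obtain T where T: "countable T" "T \<subseteq> \<Omega>" "\<Omega> \<subseteq> closure T" by (rule separable)
  have Tne: "T \<noteq> {}" using T(3) ne by auto
  define q where "q = from_nat_into T"
  have qT: "range q = T" unfolding q_def by (rule range_from_nat_into[OF Tne T(1)])
  have qO: "q k \<in> \<Omega>" for k using qT T(2) by blast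
  have near: "\<exists>k. dist y (q k) < e" if y: "y \<in> \<Omega>" and e: "e > 0" for y e
  proof -
    have "y \<in> closure T" using y T(3) by blast
    then obtain z where "z \<in> T" "dist z y < e" using e closure_approachable by blast
    then show ?thesis using qT by (metis dist_commute rangeE)
  qed
  have km: "(\<lambda>x. kfun a x) \<in> borel_measurable borel" if "a \<in> \<Omega>" for a
  proof -
    have "(\<lambda>x. indicator \<Omega> x *\<^sub>R kfun a x) \<in> borel_measurable borel"
      using cl by (intro borel_measurable_continuous_on_indicator cont kernel_mem that) auto
    moreover have "(\<lambda>x. indicator \<Omega> x *\<^sub>R kfun a x) = kfun a" by (auto simp: fun_eq_iff)
    ultimately show ?thesis by simp
  qed
  define \<kappa> where "\<kappa> j w = (LEAST k. dist (\<tau> w) (q k) < 1 / real (Suc j))" for j w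
  have [measurable]: "\<kappa> j \<in> measurable N (count_space UNIV)" for j
    unfolding \<kappa>_def by (intro measurable_Least) measurable
  have \<kappa>: "dist (\<tau> w) (q (\<kappa> j w)) < 1 / real (Suc j)" if "w \<in> space N" for j w
    unfolding \<kappa>_def by (rule LeastI_ex[OF near]) (use \<tau>O[OF that] in auto)
  show ?thesis
  proof (rule borel_measurable_LIMSEQ_real)
    fix j
    have "(\<lambda>w. K (X w) (q k)) \<in> borel_measurable N" for k
    proof -
      have "(\<lambda>w. kfun (q k) (X w)) \<in> borel_measurable N" by (rule measurable_compose[OF X km[OF qO]])
      then show ?thesis
        by (rule measurable_cong[THEN iffD1, rotated]) (use XO qO kernel_symmetric in auto)
    qed
    then show "(\<lambda>w. K (X w) (q (\<kappa> j w))) \<in> borel_measurable N"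
      by (rule measurable_compose_countable) measurable
  next
    fix w assume w: "w \<in> space N"
    have "(\<lambda>j. q (\<kappa> j w)) \<longlonglongrightarrow> \<tau> w"
    proof (rule metric_tendsto_imp_tendsto[of "\<lambda>j. 1 / real (Suc j)" "0::real"])
      show "(\<lambda>j. 1 / real (Suc j)) \<longlonglongrightarrow> 0" using LIMSEQ_inverse_real_of_nat by (simp add: inverse_eq_divide)
      show "\<forall>\<^sub>F j in sequentially. dist (q (\<kappa> j w)) (\<tau> w) \<le> dist (1 / real (Suc j)) (0::real)"
        using \<kappa>[OF w] by (intro always_eventually allI) (simp add: dist_commute less_imp_le)
    qed
    then have "(\<lambda>j. kfun (X w) (q (\<kappa> j w))) \<longlonglongrightarrow> kfun (X w) (\<tau> w)"
      by (rule continuous_on_tendsto_compose[OF cont[OF kernel_mem[OF XO[OF w]]]]) (auto simp: \<tau>O[OF w] qO)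
    then show "(\<lambda>j. K (X w) (q (\<kappa> j w))) \<longlonglongrightarrow> K (X w) (\<tau> w)" by (simp add: qO \<tau>O[OF w])
  qed
qed

lemma krr_measurable:
  fixes \<Omega> :: "'a::{second_countable_topology, metric_space} set"
  assumes "rkhs \<Omega> K H ip" and "closed \<Omega>" and "\<And>v. v \<in> H \<Longrightarrow> continuous_on \<Omega> v"
    and "\<And>i. i \<in> {1..n} \<Longrightarrow> X i \<in> borel_measurable N" "\<And>i w. i \<in> {1..n} \<Longrightarrow> w \<in> space N \<Longrightarrow> X i w \<in> \<Omega>"
    and "\<And>i. i \<in> {1..n} \<Longrightarrow> Y i \<in> borel_measurable N" and "lam > 0" "t \<in> \<Omega>"
  shows "(\<lambda>w. krr H ip lam n (\<lambda>i. X i w) (\<lambda>i. Y i w) t) \<in> borel_measurable N"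
  by (rule rkhs.krr_measurable_aux[OF assms(1), of n "{\<tau> \<in> borel_measurable N. \<forall>w\<in>space N. \<tau> w \<in> \<Omega>}" X N Y lam "\<lambda>_. t"])
    (use assms in \<open>auto intro!: kernel_measurable[OF assms(1-3)]\<close>)

section \<open>Gaussian noise and its translates\<close>

subsection \<open>Translating a vector of independent normal variables\<close>

definition normal_law :: "real \<Rightarrow> real \<Rightarrow> real measure" where
  "normal_law m \<sigma> = density lborel (normal_density m \<sigma>)"

definition noise_law :: "nat \<Rightarrow> real \<Rightarrow> (nat \<Rightarrow> real) measure" where
  "noise_law n \<sigma> = (\<Pi>\<^sub>M i\<in>{1..n}. normal_law 0 \<sigma>)"

lemma sets_normal_law [simp, measurable_cong]: "sets (normal_law m \<sigma>) = sets borel"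
  by (simp add: normal_law_def)

lemma space_normal_law [simp]: "space (normal_law m \<sigma>) = UNIV"
  by (simp add: normal_law_def)

lemma prob_space_normal_law: "\<sigma> > 0 \<Longrightarrow> prob_space (normal_law m \<sigma>)"
  unfolding normal_law_def by (rule prob_space_normal_density)

lemma sets_noise_law [measurable_cong]: "sets (noise_law n \<sigma>) = sets (\<Pi>\<^sub>M i\<in>{1..n}. borel)"
  unfolding noise_law_def by (intro sets_PiM_cong) auto

lemma space_noise_law: "space (noise_law n \<sigma>) = PiE {1..n} (\<lambda>_. UNIV)"
  by (simp add: noise_law_def space_PiM)

lemma prob_space_noise_law: "\<sigma> > 0 \<Longrightarrow> prob_space (noise_law n \<sigma>)"
  unfolding noise_law_def by (intro prob_space_PiM prob_space_normal_law)

lemma normal_density_shift: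
  assumes "\<sigma> > 0"
  shows "normal_density 0 \<sigma> x * exp (x * m / \<sigma>\<^sup>2 - m\<^sup>2 / (2 * \<sigma>\<^sup>2)) = normal_density m \<sigma> x"
proof -
  have e: "- (x - m)\<^sup>2 / (2 * \<sigma>\<^sup>2) = - x\<^sup>2 / (2 * \<sigma>\<^sup>2) + (x * m / \<sigma>\<^sup>2 - m\<^sup>2 / (2 * \<sigma>\<^sup>2))"
    using assms by (simp add: field_simps power2_eq_square)
  show ?thesis unfolding normal_density_def e exp_add by simp
qed

text \<open>The finite-dimensional Cameron--Martin formula.\<close>

lemma noise_law_shift:
  assumes \<sigma>: "\<sigma> > 0"
  shows "distr (noise_law n \<sigma>) (noise_law n \<sigma>) (\<lambda>E. \<lambda>i\<in>{1..n}. E i + \<mu> i)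
    = density (noise_law n \<sigma>) (\<lambda>E. \<Prod>i\<in>{1..n}. ennreal (exp (E i * \<mu> i / \<sigma>\<^sup>2 - (\<mu> i)\<^sup>2 / (2 * \<sigma>\<^sup>2))))"
proof -
  let ?I = "{1..n}" and ?\<nu> = "noise_law n \<sigma>" and ?N = "normal_law 0 \<sigma>"
  let ?f = "\<lambda>i x. ennreal (exp (x * \<mu> i / \<sigma>\<^sup>2 - (\<mu> i)\<^sup>2 / (2 * \<sigma>\<^sup>2)))"
  interpret N0: product_sigma_finite "\<lambda>i::nat. ?N"
    by (intro product_sigma_finite.intro prob_space_imp_sigma_finite prob_space_normal_law \<sigma>)
  interpret Nm: product_sigma_finite "\<lambda>i. normal_law (\<mu> i) \<sigma>"
    by (intro product_sigma_finite.intro prob_space_imp_sigma_finite prob_space_normal_law \<sigma>)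
  have setsM: "sets (\<Pi>\<^sub>M i\<in>?I. normal_law (\<mu> i) \<sigma>) = sets ?\<nu>"
    unfolding noise_law_def by (intro sets_PiM_cong) auto
  have "distr ?\<nu> ?\<nu> (\<lambda>E. \<lambda>i\<in>?I. E i + \<mu> i) = (\<Pi>\<^sub>M i\<in>?I. normal_law (\<mu> i) \<sigma>)"
  proof (rule Nm.PiM_eqI)
    fix A assume A: "\<And>i. i \<in> ?I \<Longrightarrow> A i \<in> sets (normal_law (\<mu> i) \<sigma>)"
    then have A': "A i \<in> sets borel" if "i \<in> ?I" for i using that by simp
    have m: "(\<lambda>E. \<lambda>i\<in>?I. E i + \<mu> i) \<in> ?\<nu> \<rightarrow>\<^sub>M ?\<nu>"
      unfolding noise_law_def by measurable
    have PA: "Pi\<^sub>E ?I A \<in> sets ?\<nu>" unfolding noise_law_def using A' by (intro sets_PiM_I_finite) auto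
    have "emeasure (distr ?\<nu> ?\<nu> (\<lambda>E. \<lambda>i\<in>?I. E i + \<mu> i)) (Pi\<^sub>E ?I A)
      = emeasure ?\<nu> ((\<lambda>E. \<lambda>i\<in>?I. E i + \<mu> i) -` Pi\<^sub>E ?I A \<inter> space ?\<nu>)" by (rule emeasure_distr[OF m PA])
    also have "(\<lambda>E. \<lambda>i\<in>?I. E i + \<mu> i) -` Pi\<^sub>E ?I A \<inter> space ?\<nu> = Pi\<^sub>E ?I (\<lambda>i. {x. x + \<mu> i \<in> A i})"
      unfolding space_noise_law by (auto simp: PiE_iff extensional_def)
    also have "emeasure ?\<nu> \<dots> = (\<Prod>i\<in>?I. emeasure ?N {x. x + \<mu> i \<in> A i})"
    proof -
      have "{x. x + \<mu> i \<in> A i} \<in> sets borel" if "i \<in> ?I" for i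
        using measurable_sets[of "\<lambda>x. x + \<mu> i" borel borel "A i"] A'[OF that] by (simp add: vimage_def)
      then show ?thesis unfolding noise_law_def by (intro N0.emeasure_PiM) auto
    qed
    also have "\<dots> = (\<Prod>i\<in>?I. emeasure (normal_law (\<mu> i) \<sigma>) (A i))"
    proof (rule prod.cong[OF refl])
      fix i assume i: "i \<in> ?I"
      have [measurable]: "A i \<in> sets borel" "{x. x + \<mu> i \<in> A i} \<in> sets borel"
        using measurable_sets[of "\<lambda>x. x + \<mu> i" borel borel "A i"] A'[OF i] by (simp_all add: vimage_def)
      have "emeasure ?N {x. x + \<mu> i \<in> A i} = (\<integral>\<^sup>+x. ennreal (normal_density 0 \<sigma> x) * indicator {x. x + \<mu> i \<in> A i} x \<partial>lborel)"
        unfolding normal_law_def by (subst emeasure_density) auto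
      also have "\<dots> = (\<integral>\<^sup>+x. ennreal (normal_density 0 \<sigma> (- \<mu> i + 1 * x)) * indicator {x. x + \<mu> i \<in> A i} (- \<mu> i + 1 * x) \<partial>lborel)"
        by (subst nn_integral_real_affine[where c = 1 and t = "- \<mu> i"]) auto
      also have "\<dots> = (\<integral>\<^sup>+x. ennreal (normal_density (\<mu> i) \<sigma> x) * indicator (A i) x \<partial>lborel)"
        by (intro nn_integral_cong) (auto simp: normal_density_def indicator_def)
      also have "\<dots> = emeasure (normal_law (\<mu> i) \<sigma>) (A i)"
        unfolding normal_law_def by (subst emeasure_density) auto
      finally show "emeasure ?N {x. x + \<mu> i \<in> A i} = emeasure (normal_law (\<mu> i) \<sigma>) (A i)" .
    qed
    finally show "emeasure (distr ?\<nu> ?\<nu> (\<lambda>E. \<lambda>i\<in>?I. E i + \<mu> i)) (Pi\<^sub>E ?I A) = (\<Prod>i\<in>?I. emeasure (normal_law (\<mu> i) \<sigma>) (A i))" .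
  qed (simp_all only: sets_distr sets_density setsM finite_atLeastAtMost)
  also have "\<dots> = density ?\<nu> (\<lambda>E. \<Prod>i\<in>?I. ?f i (E i))"
  proof (rule Nm.PiM_eqI[symmetric])
    fix A assume A: "\<And>i. i \<in> ?I \<Longrightarrow> A i \<in> sets (normal_law (\<mu> i) \<sigma>)"
    then have A'[measurable]: "A i \<in> sets borel" if "i \<in> ?I" for i using that by simp
    have PA: "Pi\<^sub>E ?I A \<in> sets ?\<nu>" unfolding noise_law_def using A' by (intro sets_PiM_I_finite) auto
    have mf: "(\<lambda>E. \<Prod>i\<in>?I. ?f i (E i)) \<in> borel_measurable ?\<nu>" unfolding noise_law_def by measurable
    have "emeasure (density ?\<nu> (\<lambda>E. \<Prod>i\<in>?I. ?f i (E i))) (Pi\<^sub>E ?I A) = (\<integral>\<^sup>+E. (\<Prod>i\<in>?I. ?f i (E i)) * indicator (Pi\<^sub>E ?I A) E \<partial>?\<nu>)"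
      by (rule emeasure_density[OF mf PA])
    also have "\<dots> = (\<integral>\<^sup>+E. (\<Prod>i\<in>?I. ?f i (E i) * indicator (A i) (E i)) \<partial>?\<nu>)"
    proof (rule nn_integral_cong)
      fix E assume "E \<in> space ?\<nu>"
      then have "indicator (Pi\<^sub>E ?I A) E = (\<Prod>i\<in>?I. indicator (A i) (E i) :: ennreal)"
        by (cases "E \<in> Pi\<^sub>E ?I A") (auto simp: space_noise_law PiE_iff indicator_def prod_zero_iff)
      then show "(\<Prod>i\<in>?I. ?f i (E i)) * indicator (Pi\<^sub>E ?I A) E = (\<Prod>i\<in>?I. ?f i (E i) * indicator (A i) (E i))"
        by (simp add: prod.distrib)
    qed
    also have "\<dots> = (\<Prod>i\<in>?I. \<integral>\<^sup>+x. ?f i x * indicator (A i) x \<partial>?N)"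
      unfolding noise_law_def by (intro N0.product_nn_integral_prod) auto
    also have "\<dots> = (\<Prod>i\<in>?I. emeasure (normal_law (\<mu> i) \<sigma>) (A i))"
    proof (rule prod.cong[OF refl])
      fix i assume i: "i \<in> ?I"
      have [measurable]: "A i \<in> sets borel" using A'[OF i] .
      have "(\<integral>\<^sup>+x. ?f i x * indicator (A i) x \<partial>?N) = (\<integral>\<^sup>+x. ennreal (normal_density 0 \<sigma> x) * (?f i x * indicator (A i) x) \<partial>lborel)"
        unfolding normal_law_def by (subst nn_integral_density) auto
      also have "\<dots> = (\<integral>\<^sup>+x. ennreal (normal_density (\<mu> i) \<sigma> x) * indicator (A i) x \<partial>lborel)"
      proof (rule nn_integral_cong)
        fix x
        show "ennreal (normal_density 0 \<sigma> x) * (?f i x * indicator (A i) x) = ennreal (normal_density (\<mu> i) \<sigma> x) * indicator (A i) x"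
          by (subst normal_density_shift[OF \<sigma>, of x "\<mu> i", symmetric]) (simp add: ennreal_mult mult.assoc)
      qed
      also have "\<dots> = emeasure (normal_law (\<mu> i) \<sigma>) (A i)"
        unfolding normal_law_def by (subst emeasure_density) auto
      finally show "(\<integral>\<^sup>+x. ?f i x * indicator (A i) x \<partial>?N) = emeasure (normal_law (\<mu> i) \<sigma>) (A i)" .
    qed
    finally show "emeasure (density ?\<nu> (\<lambda>E. \<Prod>i\<in>?I. ?f i (E i))) (Pi\<^sub>E ?I A) = (\<Prod>i\<in>?I. emeasure (normal_law (\<mu> i) \<sigma>) (A i))" .
  qed (simp_all only: sets_distr sets_density setsM finite_atLeastAtMost)
  finally show ?thesis .
qed

definition translate :: "nat \<Rightarrow> (nat \<Rightarrow> real) \<Rightarrow> (nat \<Rightarrow> real) \<Rightarrow> nat \<Rightarrow> real" where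
  "translate n \<mu> E = (\<lambda>i\<in>{1..n}. E i + \<mu> i)"

lemma translate_measurable: "translate n \<mu> \<in> noise_law n \<sigma> \<rightarrow>\<^sub>M noise_law n \<sigma>"
  unfolding noise_law_def translate_def by measurable

text \<open>The two translates have the densities \<open>exp (- W \<plusminus> l)\<close> with \<open>W = |\<mu>|\<^sup>2 / (2 \<sigma>\<^sup>2)\<close> and \<open>l\<close> linear, and
  \<open>exp l + exp (- l) \<ge> 2\<close>. The opposite signs make the exponential of the linear term harmless.\<close>

lemma translates_lower_bound:
  assumes \<sigma>: "\<sigma> > 0" and S: "S \<in> sets (noise_law n \<sigma>)"
    and V: "(\<Sum>i=1..n. (\<mu> i)\<^sup>2) / (2 * \<sigma>\<^sup>2) \<le> V"
  shows "ennreal (2 * exp (- V)) * emeasure (noise_law n \<sigma>) S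
    \<le> emeasure (noise_law n \<sigma>) (translate n \<mu> -` S \<inter> space (noise_law n \<sigma>))
      + emeasure (noise_law n \<sigma>) (translate n (\<lambda>i. - \<mu> i) -` S \<inter> space (noise_law n \<sigma>))"
proof -
  let ?\<nu> = "noise_law n \<sigma>" and ?I = "{1..n}"
  let ?f = "\<lambda>\<mu> E. \<Prod>i\<in>?I. ennreal (exp (E i * \<mu> i / \<sigma>\<^sup>2 - (\<mu> i)\<^sup>2 / (2 * \<sigma>\<^sup>2)))"
  define v where "v = (\<Sum>i=1..n. (\<mu> i)\<^sup>2) / (2 * \<sigma>\<^sup>2)"
  define l where "l E = (\<Sum>i\<in>?I. E i * \<mu> i) / \<sigma>\<^sup>2" for E
  have meas[measurable]: "?f \<mu> \<in> borel_measurable ?\<nu>" for \<mu> unfolding noise_law_def by measurable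
  have em: "emeasure ?\<nu> (translate n \<mu> -` S \<inter> space ?\<nu>) = (\<integral>\<^sup>+E. ?f \<mu> E * indicator S E \<partial>?\<nu>)" for \<mu>
  proof -
    have "emeasure ?\<nu> (translate n \<mu> -` S \<inter> space ?\<nu>) = emeasure (distr ?\<nu> ?\<nu> (translate n \<mu>)) S"
      by (rule emeasure_distr[OF translate_measurable S, symmetric])
    also have "distr ?\<nu> ?\<nu> (translate n \<mu>) = density ?\<nu> (?f \<mu>)"
      unfolding translate_def by (rule noise_law_shift[OF \<sigma>])
    also have "emeasure (density ?\<nu> (?f \<mu>)) S = (\<integral>\<^sup>+E. ?f \<mu> E * indicator S E \<partial>?\<nu>)"
      by (rule emeasure_density[OF meas S])
    finally show ?thesis .
  qed
  have f: "?f \<mu> E = ennreal (exp (l E - v))" "?f (\<lambda>i. - \<mu> i) E = ennreal (exp (- l E - v))" for E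
  proof -
    have "(\<Sum>i\<in>?I. E i * \<mu> i / \<sigma>\<^sup>2 - (\<mu> i)\<^sup>2 / (2 * \<sigma>\<^sup>2)) = l E - v"
      by (simp only: sum_subtractf sum_divide_distrib[symmetric] l_def v_def)
    then show "?f \<mu> E = ennreal (exp (l E - v))" by (simp add: prod_ennreal flip: exp_sum)
    have "(\<Sum>i\<in>?I. E i * - \<mu> i / \<sigma>\<^sup>2 - (- \<mu> i)\<^sup>2 / (2 * \<sigma>\<^sup>2)) = - l E - v"
      by (simp only: sum_subtractf sum_divide_distrib[symmetric] l_def v_def mult_minus_right sum_negf power2_minus minus_divide_left)
    then show "?f (\<lambda>i. - \<mu> i) E = ennreal (exp (- l E - v))" by (simp add: prod_ennreal flip: exp_sum)
  qed
  have pt: "ennreal (2 * exp (- V)) \<le> ?f \<mu> E + ?f (\<lambda>i. - \<mu> i) E" for E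
  proof -
    have "2 * exp (- V) \<le> 2 * exp (- v)" using V by (simp add: v_def)
    also have "2 * exp (- v) \<le> (exp (l E) + exp (- l E)) * exp (- v)"
    proof (rule mult_right_mono)
      have "1 + l E \<le> exp (l E)" "1 + - l E \<le> exp (- l E)" by (rule exp_ge_add_one_self)+
      then show "2 \<le> exp (l E) + exp (- l E)" by linarith
    qed simp
    also have "\<dots> = exp (l E - v) + exp (- l E - v)" by (simp add: distrib_right flip: exp_add)
    finally show ?thesis unfolding f by (simp add: ennreal_leI flip: ennreal_plus)
  qed
  have "ennreal (2 * exp (- V)) * emeasure ?\<nu> S = (\<integral>\<^sup>+E. ennreal (2 * exp (- V)) * indicator S E \<partial>?\<nu>)"
    using S by (simp add: nn_integral_cmult_indicator)
  also have "\<dots> \<le> (\<integral>\<^sup>+E. ?f \<mu> E * indicator S E + ?f (\<lambda>i. - \<mu> i) E * indicator S E \<partial>?\<nu>)"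
    by (intro nn_integral_mono) (simp only: distrib_right[symmetric], intro mult_right_mono pt, simp)
  also have "\<dots> = (\<integral>\<^sup>+E. ?f \<mu> E * indicator S E \<partial>?\<nu>) + (\<integral>\<^sup>+E. ?f (\<lambda>i. - \<mu> i) E * indicator S E \<partial>?\<nu>)"
    using S by (intro nn_integral_add borel_measurable_times_ennreal meas borel_measurable_indicator)
  finally show ?thesis unfolding em .
qed

subsection \<open>The maximum of linear functionals of the noise\<close>

definition lin :: "nat \<Rightarrow> (nat \<Rightarrow> real) \<Rightarrow> (nat \<Rightarrow> real) \<Rightarrow> real" where
  "lin n a E = (\<Sum>i=1..n. E i * a i)"

lemma lin_translate: "lin n a (translate n \<mu> E) = lin n a E + lin n a \<mu>"
  by (simp add: lin_def translate_def distrib_right sum.distrib)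

lemma lin_uminus: "lin n a (\<lambda>i. - \<mu> i) = - lin n a \<mu>"
  by (simp add: lin_def sum_negf)

lemma lin_measurable: "lin n a \<in> borel_measurable (noise_law n \<sigma>)"
  unfolding lin_def[abs_def] noise_law_def by measurable

text \<open>The translates by \<open>\<plusminus> \<mu>\<^sub>j\<close> of the set \<open>S\<close> where all functionals are small are disjoint: on the one that
  belongs to \<open>\<plusminus> \<mu>\<^sub>j\<close> the \<open>j\<close>-th functional exceeds \<open>2 \<kappa>\<close> with a known sign, all others are below \<open>2 \<kappa>\<close>. The two
  translates of each pair together have at least \<open>2 exp (- V)\<close> times the measure of \<open>S\<close>. This replaces
  a covariance computation and a comparison theorem for the maximum of a Gaussian vector.\<close>

lemma small_maximum_probability:
  fixes a :: "'j \<Rightarrow> nat \<Rightarrow> real"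
  assumes \<sigma>: "\<sigma> > 0" and J: "finite J" and "\<kappa> > 0"
    and diag: "\<And>j. j \<in> J \<Longrightarrow> lin n (a j) (\<mu> j) \<ge> 3 * \<kappa>"
    and off: "\<And>j k. j \<in> J \<Longrightarrow> k \<in> J \<Longrightarrow> j \<noteq> k \<Longrightarrow> \<bar>lin n (a k) (\<mu> j)\<bar> \<le> \<kappa> / 2"
    and V: "\<And>j. j \<in> J \<Longrightarrow> (\<Sum>i=1..n. (\<mu> j i)\<^sup>2) / (2 * \<sigma>\<^sup>2) \<le> V"
  shows "measure (noise_law n \<sigma>) {E \<in> space (noise_law n \<sigma>). \<forall>j\<in>J. \<bar>lin n (a j) E\<bar> < \<kappa>} * (2 * real (card J) * exp (- V)) \<le> 1"
proof -
  let ?\<nu> = "noise_law n \<sigma>"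
  interpret prob_space ?\<nu> by (rule prob_space_noise_law[OF \<sigma>])
  define S where "S = {E \<in> space ?\<nu>. \<forall>j\<in>J. \<bar>lin n (a j) E\<bar> < \<kappa>}"
  note lin_measurable[measurable]
  have S: "S \<in> sets ?\<nu>" unfolding S_def using J by measurable
  define T where "T j b = translate n (if b then \<lambda>i. - \<mu> j i else \<mu> j) -` S \<inter> space ?\<nu>" for j b
  have T: "T j b \<in> sets ?\<nu>" for j b unfolding T_def by (rule measurable_sets[OF translate_measurable S])
  have inT: "lin n (a j) E > 2 * \<kappa>" "k \<in> J \<Longrightarrow> k \<noteq> j \<Longrightarrow> \<bar>lin n (a k) E\<bar> < 2 * \<kappa>" if "E \<in> T j True" "j \<in> J" for E j k
  proof -
    have s: "\<bar>lin n (a k) E - lin n (a k) (\<mu> j)\<bar> < \<kappa>" if "k \<in> J" for k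
      using \<open>E \<in> T j True\<close> that by (auto simp: T_def S_def lin_translate lin_uminus)
    show "lin n (a j) E > 2 * \<kappa>" using s[OF that(2)] diag[OF that(2)] by linarith
    show "\<bar>lin n (a k) E\<bar> < 2 * \<kappa>" if "k \<in> J" "k \<noteq> j"
      using s[OF that(1)] off[OF \<open>j \<in> J\<close> that(1) that(2)[symmetric]] \<open>\<kappa> > 0\<close> by linarith
  qed
  have inF: "lin n (a j) E < - 2 * \<kappa>" "k \<in> J \<Longrightarrow> k \<noteq> j \<Longrightarrow> \<bar>lin n (a k) E\<bar> < 2 * \<kappa>" if "E \<in> T j False" "j \<in> J" for E j k
  proof -
    have s: "\<bar>lin n (a k) E + lin n (a k) (\<mu> j)\<bar> < \<kappa>" if "k \<in> J" for k
      using \<open>E \<in> T j False\<close> that by (auto simp: T_def S_def lin_translate)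
    show "lin n (a j) E < - 2 * \<kappa>" using s[OF that(2)] diag[OF that(2)] by linarith
    show "\<bar>lin n (a k) E\<bar> < 2 * \<kappa>" if "k \<in> J" "k \<noteq> j"
      using s[OF that(1)] off[OF \<open>j \<in> J\<close> that(1) that(2)[symmetric]] \<open>\<kappa> > 0\<close> by linarith
  qed
  have big: "\<bar>lin n (a j) E\<bar> > 2 * \<kappa>" if "E \<in> T j b" "j \<in> J" for E j b
    using inT(1)[of E j] inF(1)[of E j] that \<open>\<kappa> > 0\<close> by (cases b) auto
  have small: "\<bar>lin n (a k) E\<bar> < 2 * \<kappa>" if "E \<in> T j b" "j \<in> J" "k \<in> J" "k \<noteq> j" for E j b k
    using inT(2)[of E j k] inF(2)[of E j k] that by (cases b) auto
  have disj: "disjoint_family_on (\<lambda>(j, b). T j b) (J \<times> UNIV)"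
    unfolding disjoint_family_on_def
  proof (intro ballI impI)
    fix x y assume xy: "x \<in> J \<times> (UNIV :: bool set)" "y \<in> J \<times> (UNIV :: bool set)" "x \<noteq> y"
    obtain j b k c where [simp]: "x = (j, b)" "y = (k, c)" by (cases x, cases y)
    have "E \<notin> T j b \<or> E \<notin> T k c" for E
    proof (cases "j = k")
      case True
      have "E \<notin> T j True \<or> E \<notin> T j False"
      proof (rule ccontr)
        assume "\<not> (E \<notin> T j True \<or> E \<notin> T j False)"
        then have "E \<in> T j True" "E \<in> T j False" by blast+
        moreover have "j \<in> J" using xy(1) by simp
        ultimately have "lin n (a j) E > 2 * \<kappa>" "lin n (a j) E < - 2 * \<kappa>" using inT(1) inF(1) by blast+
        then show False using \<open>\<kappa> > 0\<close> by linarith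
      qed
      moreover have "b \<noteq> c" using xy(3) True by simp
      ultimately show ?thesis using True by (metis (full_types))
    next
      case False
      have "j \<in> J" "k \<in> J" using xy by simp_all
      then show ?thesis using big[of E j b] small[of E k c j] False by (meson less_asym)
    qed
    then show "(\<lambda>(j, b). T j b) x \<inter> (\<lambda>(j, b). T j b) y = {}" by auto
  qed
  have each: "ennreal (2 * exp (- V)) * emeasure ?\<nu> S \<le> (\<Sum>b\<in>UNIV. emeasure ?\<nu> (T j b))" if "j \<in> J" for j
    using translates_lower_bound[OF \<sigma> S V[OF that]] by (simp add: UNIV_bool T_def add.commute)
  have "of_nat (card J) * (ennreal (2 * exp (- V)) * emeasure ?\<nu> S) = (\<Sum>j\<in>J. ennreal (2 * exp (- V)) * emeasure ?\<nu> S)" by simp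
  also have "\<dots> \<le> (\<Sum>j\<in>J. \<Sum>b\<in>UNIV. emeasure ?\<nu> (T j b))" by (intro sum_mono each)
  also have "\<dots> = (\<Sum>(j, b)\<in>J \<times> UNIV. emeasure ?\<nu> (T j b))" by (rule sum.cartesian_product)
  also have "\<dots> = (\<Sum>x\<in>J \<times> UNIV. emeasure ?\<nu> ((\<lambda>(j, b). T j b) x))" by (intro sum.cong) auto
  also have "\<dots> = emeasure ?\<nu> (\<Union>x\<in>J \<times> UNIV. (\<lambda>(j, b). T j b) x)"
    using T J by (intro sum_emeasure disj) auto
  also have "\<dots> \<le> 1" by (rule emeasure_le_1)
  finally have "ennreal (real (card J)) * (ennreal (2 * exp (- V)) * ennreal (prob S)) \<le> 1"
    by (simp add: emeasure_eq_measure ennreal_of_nat_eq_real_of_nat)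
  then have "ennreal (real (card J) * (2 * exp (- V) * prob S)) \<le> ennreal 1"
    by (simp add: ennreal_mult)
  then have "real (card J) * (2 * exp (- V) * prob S) \<le> 1" by (subst (asm) ennreal_le_iff) auto
  then show ?thesis unfolding S_def[symmetric] by (simp add: mult_ac)
qed

subsection \<open>Conditioning on the design\<close>

lemma (in prob_space) gaussian_errors_law:
  assumes "gaussian_errors M \<sigma> e" "n \<ge> 1"
  shows "(\<lambda>w. \<lambda>i\<in>{1..n}. e i w) \<in> M \<rightarrow>\<^sub>M noise_law n \<sigma>"
    and "distr M (noise_law n \<sigma>) (\<lambda>w. \<lambda>i\<in>{1..n}. e i w) = noise_law n \<sigma>"
proof -
  have ind: "indep_vars (\<lambda>_. borel) e {1..n}" and d: "\<And>i. i \<in> {1..n} \<Longrightarrow> distributed M lborel (e i) (normal_density 0 \<sigma>)"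
    using assms by (auto simp: gaussian_errors_def intro: indep_vars_subset)
  have rv: "\<And>i. i \<in> {1..n} \<Longrightarrow> e i \<in> borel_measurable M"
    using d by (auto simp: distributed_def)
  then have m: "(\<lambda>w. \<lambda>i\<in>{1..n}. e i w) \<in> M \<rightarrow>\<^sub>M (\<Pi>\<^sub>M i\<in>{1..n}. borel)" by (intro measurable_restrict)
  then show "(\<lambda>w. \<lambda>i\<in>{1..n}. e i w) \<in> M \<rightarrow>\<^sub>M noise_law n \<sigma>"
    using measurable_cong_sets[OF refl sets_noise_law[of n \<sigma>], of M] by simp
  have "distr M (noise_law n \<sigma>) (\<lambda>w. \<lambda>i\<in>{1..n}. e i w) = distr M (\<Pi>\<^sub>M i\<in>{1..n}. borel) (\<lambda>w. \<lambda>i\<in>{1..n}. e i w)"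
    by (rule distr_cong) (simp_all add: sets_noise_law)
  also have "\<dots> = (\<Pi>\<^sub>M i\<in>{1..n}. distr M borel (e i))"
    using indep_vars_iff_distr_eq_PiM'[where I = "{1..n}" and M' = "\<lambda>_. borel" and X = e] rv ind assms(2) by auto
  also have "\<dots> = noise_law n \<sigma>"
    unfolding noise_law_def
  proof (rule PiM_cong[OF refl])
    fix i assume "i \<in> {1..n}"
    from d[OF this] have "distr M lborel (e i) = density lborel (normal_density 0 \<sigma>)" by (simp add: distributed_def)
    moreover have "distr M lborel (e i) = distr M borel (e i)" by (rule distr_cong) auto
    ultimately show "distr M borel (e i) = normal_law 0 \<sigma>" by (simp add: normal_law_def)
  qed
  finally show "distr M (noise_law n \<sigma>) (\<lambda>w. \<lambda>i\<in>{1..n}. e i w) = noise_law n \<sigma>" .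
qed

text \<open>The pair of design and noise has a product law, so bounds that hold for each good design integrate
  up. The design enters through the \<open>\<sigma>\<close>-algebra \<open>F\<close> that it generates on the sample space, which avoids a
  separate space of designs.\<close>

lemma (in prob_space) probability_from_conditional_bound:
  fixes F :: "'a measure"
  assumes F: "space F = space M" "sets F \<subseteq> sets M"
    and E: "E \<in> M \<rightarrow>\<^sub>M \<nu>" "distr M \<nu> E = \<nu>" and "prob_space \<nu>"
    and ind: "\<And>A B. A \<in> sets F \<Longrightarrow> B \<in> sets \<nu> \<Longrightarrow> prob (A \<inter> (E -` B \<inter> space M)) = prob A * prob (E -` B \<inter> space M)"
    and A: "A \<in> sets (F \<Otimes>\<^sub>M \<nu>)" and G: "G \<in> sets M" "p \<le> prob G" "0 \<le> p" "0 \<le> q"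
    and cond: "\<And>w. w \<in> G \<Longrightarrow> q \<le> measure \<nu> (Pair w -` A)"
  shows "q * p \<le> prob {w \<in> space M. (w, E w) \<in> A}"
proof -
  interpret \<nu>: prob_space \<nu> by fact
  have idF: "(\<lambda>w. w) \<in> M \<rightarrow>\<^sub>M F"
  proof (rule measurableI)
    fix X assume X: "X \<in> sets F"
    then have "X \<subseteq> space M" using sets.sets_into_space[OF X] F(1) by simp
    then have "(\<lambda>w. w) -` X \<inter> space M = X" by blast
    then show "(\<lambda>w. w) -` X \<inter> space M \<in> sets M" using X F(2) by auto
  qed (simp add: F(1))
  define MF where "MF = distr M F (\<lambda>w. w)"
  interpret MF: prob_space MF unfolding MF_def by (rule prob_space_distr[OF idF])
  interpret P: pair_sigma_finite MF \<nu> ..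
  have sMF[measurable_cong]: "sets MF = sets F" by (simp add: MF_def)
  have emMF: "emeasure MF X = emeasure M X" if "X \<in> sets F" for X
  proof -
    have "X \<subseteq> space M" using sets.sets_into_space[OF that] F(1) by simp
    then have "(\<lambda>w. w) -` X \<inter> space M = X" by auto
    then show ?thesis unfolding MF_def by (subst emeasure_distr[OF idF that]) simp
  qed
  have pm: "(\<lambda>w. (w, E w)) \<in> M \<rightarrow>\<^sub>M (F \<Otimes>\<^sub>M \<nu>)" by (rule measurable_Pair[OF idF E(1)])
  have "MF \<Otimes>\<^sub>M \<nu> = distr M (F \<Otimes>\<^sub>M \<nu>) (\<lambda>w. (w, E w))"
  proof (rule pair_measure_eqI)
    show "sigma_finite_measure MF" "sigma_finite_measure \<nu>" by unfold_locales
    show "sets (MF \<Otimes>\<^sub>M \<nu>) = sets (distr M (F \<Otimes>\<^sub>M \<nu>) (\<lambda>w. (w, E w)))"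
      by (simp add: sMF cong: sets_pair_measure_cong)
    fix X B assume X: "X \<in> sets MF" and B: "B \<in> sets \<nu>"
    have X': "X \<in> sets F" using X by (simp add: sMF)
    then have XM: "X \<in> sets M" "X \<subseteq> space M" using F sets.sets_into_space[OF X'] by auto
    have EB: "E -` B \<inter> space M \<in> sets M" by (rule measurable_sets[OF E(1) B])
    have "emeasure MF X * emeasure \<nu> B = ennreal (prob X * prob (E -` B \<inter> space M))"
      unfolding emMF[OF X'] by (subst E(2)[symmetric], subst emeasure_distr[OF E(1) B])
        (simp add: emeasure_eq_measure ennreal_mult)
    also have "\<dots> = ennreal (prob (X \<inter> (E -` B \<inter> space M)))" by (simp only: ind[OF X' B])
    also have "X \<inter> (E -` B \<inter> space M) = (\<lambda>w. (w, E w)) -` (X \<times> B) \<inter> space M" using XM by auto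
    also have "ennreal (prob \<dots>) = emeasure (distr M (F \<Otimes>\<^sub>M \<nu>) (\<lambda>w. (w, E w))) (X \<times> B)"
      using X' B by (subst emeasure_distr[OF pm]) (auto simp: emeasure_eq_measure)
    finally show "emeasure MF X * emeasure \<nu> B = emeasure (distr M (F \<Otimes>\<^sub>M \<nu>) (\<lambda>w. (w, E w))) (X \<times> B)" .
  qed
  have A': "A \<in> sets (MF \<Otimes>\<^sub>M \<nu>)" using A by (simp add: sMF cong: sets_pair_measure_cong)
  have "ennreal (prob {w \<in> space M. (w, E w) \<in> A}) = emeasure (distr M (F \<Otimes>\<^sub>M \<nu>) (\<lambda>w. (w, E w))) A"
    by (subst emeasure_distr[OF pm A]) (auto simp: emeasure_eq_measure vimage_def Int_def conj_commute intro!: arg_cong[where f = prob])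
  also have "\<dots> = emeasure (MF \<Otimes>\<^sub>M \<nu>) A" by (simp only: \<open>MF \<Otimes>\<^sub>M \<nu> = _\<close>)
  also have "\<dots> = (\<integral>\<^sup>+w. emeasure \<nu> (Pair w -` A) \<partial>MF)" by (rule \<nu>.emeasure_pair_measure_alt[OF A'])
  also have "\<dots> = (\<integral>\<^sup>+w. emeasure \<nu> (Pair w -` A) \<partial>M)"
    unfolding MF_def
    by (rule nn_integral_distr[OF idF]) (use \<nu>.measurable_emeasure_Pair[OF A] in simp)
  also have "\<dots> \<ge> (\<integral>\<^sup>+w. ennreal q * indicator G w \<partial>M)"
    using cond by (intro nn_integral_mono) (auto simp: indicator_def \<nu>.emeasure_eq_measure ennreal_leI)
  also have "(\<integral>\<^sup>+w. ennreal q * indicator G w \<partial>M) = ennreal (q * prob G)"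
    using G by (simp add: nn_integral_cmult_indicator emeasure_eq_measure ennreal_mult)
  finally have "q * prob G \<le> prob {w \<in> space M. (w, E w) \<in> A}" by (subst (asm) ennreal_le_iff) auto
  moreover have "q * p \<le> q * prob G" using G by (intro mult_left_mono) auto
  ultimately show ?thesis by linarith
qed

lemma (in prob_space) gaussian_errors_mean_zero:
  assumes "gaussian_errors M \<sigma> e" "i \<ge> 1" "\<sigma> > 0"
  shows "integrable M (e i)" "expectation (e i) = 0"
proof -
  have d: "distributed M lborel (e i) (normal_density 0 \<sigma>)" using assms by (auto simp: gaussian_errors_def)
  have h: "has_bochner_integral lborel (\<lambda>x. normal_density 0 \<sigma> x * x) 0"
    using normal_moment_odd[OF assms(3), of 0 0] by simp
  show "integrable M (e i)"
    by (rule distributed_integrable_var[OF d]) (use h in \<open>auto simp: has_bochner_integral_iff\<close>)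
  have "expectation (e i) = (\<integral>x. normal_density 0 \<sigma> x * x \<partial>lborel)"
    by (rule distributed_integral[OF d, of "\<lambda>x. x", symmetric]) auto
  then show "expectation (e i) = 0" using h by (simp add: has_bochner_integral_iff)
qed

section \<open>The derivative operator on the Sobolev space\<close>

lemma partials_sum:
  assumes "open U" and v: "\<And>j. j \<in> S \<Longrightarrow> partials_upto U k (v j)" and "length I \<le> k"
  shows "\<forall>t\<in>U. partials I (\<lambda>x. \<Sum>j\<in>S. c j * v j x) t = (\<Sum>j\<in>S. c j * partials I (v j) t)"
  using assms(3)
proof (induction I)
  case (Cons i I)
  show ?case
  proof
    fix t assume t: "t \<in> U"
    have d: "((\<lambda>s. partials I (v j) (t + s *\<^sub>R axis i 1)) has_real_derivative partials (i # I) (v j) t) (at 0)" if "j \<in> S" for j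
      using v[OF that] Cons.prems t by (simp add: partials_upto_def)
    have "((\<lambda>s. \<Sum>j\<in>S. c j * partials I (v j) (t + s *\<^sub>R axis i 1)) has_real_derivative (\<Sum>j\<in>S. c j * partials (i # I) (v j) t)) (at 0)"
      by (intro DERIV_sum DERIV_cmult d)
    moreover have ev: "eventually (\<lambda>s. partials I (\<lambda>x. \<Sum>j\<in>S. c j * v j x) (t + s *\<^sub>R axis i 1) = (\<Sum>j\<in>S. c j * partials I (v j) (t + s *\<^sub>R axis i 1))) (nhds 0)"
      using eventually_on_line[OF assms(1) t, of i] by eventually_elim (use Cons in auto)
    ultimately have "((\<lambda>s. partials I (\<lambda>x. \<Sum>j\<in>S. c j * v j x) (t + s *\<^sub>R axis i 1)) has_real_derivative (\<Sum>j\<in>S. c j * partials (i # I) (v j) t)) (at 0)"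
      by (subst DERIV_cong_ev[OF refl ev refl])
    then show "partials (i # I) (\<lambda>x. \<Sum>j\<in>S. c j * v j x) t = (\<Sum>j\<in>S. c j * partials (i # I) (v j) t)"
      by (simp add: partials_Cons[of _ _ "\<lambda>x. \<Sum>j\<in>S. c j * v j x"] partial_def DERIV_imp_deriv)
  qed
qed simp

locale smooth_sobolev =
  fixes \<Omega> :: "(real^'d) set" and m :: real and \<alpha> :: "nat^'d"
  assumes convex: "convex \<Omega>" and compact: "compact \<Omega>" and interior: "interior \<Omega> \<noteq> {}"
    and order: "m > real CARD('d) / 2 + real (mi_order \<alpha>)"
begin

lemma m_pos: "m > 0"
proof -
  have "0 \<le> real CARD('d) / 2 + real (mi_order \<alpha>)" by simp
  then show ?thesis using order by linarith
qed

lemma partials_upto_sobolev: "v \<in> sobolev_space \<Omega> m \<Longrightarrow> partials_upto (interior \<Omega>) (mi_order \<alpha>) v"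
  by (rule sobolev_embedding(1)[OF convex compact interior _ order])

lemma mderiv_continuous: "v \<in> sobolev_space \<Omega> m \<Longrightarrow> continuous_on (interior \<Omega>) (mderiv \<alpha> v)"
  using partials_upto_sobolev unfolding partials_upto_def mderiv_eq[abs_def] by (simp add: length_mi_list)

lemma interior_limit_point:
  assumes "t \<in> \<Omega>" "t \<notin> interior \<Omega>"
  shows "at t within interior \<Omega> \<noteq> bot"
proof -
  have "closure (interior \<Omega>) = closure \<Omega>" by (rule convex_closure_interior[OF convex interior])
  then have "t \<in> closure (interior \<Omega>)" using assms(1) closure_subset by blast
  then have "t islimpt interior \<Omega>" using assms(2) by (simp add: closure_def)
  then show ?thesis by (simp add: trivial_limit_within)
qed

lemma mderiv_on_boundary:
  assumes "v \<in> sobolev_space \<Omega> m" "t \<in> \<Omega>" "t \<notin> interior \<Omega>"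
  shows "(mderiv \<alpha> v \<longlongrightarrow> mderiv_on \<Omega> \<alpha> v t) (at t within interior \<Omega>)"
proof -
  obtain L where L: "(mderiv \<alpha> v \<longlongrightarrow> L) (at t within interior \<Omega>)"
    using sobolev_embedding(2)[OF convex compact interior assms(1) order _ assms(2), of "mi_list \<alpha>"]
    unfolding mderiv_eq[abs_def] by (auto simp: length_mi_list)
  have "Lim (at t within interior \<Omega>) (mderiv \<alpha> v) = L"
    by (rule tendsto_Lim[OF interior_limit_point[OF assms(2,3)] L])
  then show ?thesis using L assms(3) by (simp add: mderiv_on_def)
qed

lemma mderiv_on_interior: "t \<in> interior \<Omega> \<Longrightarrow> mderiv_on \<Omega> \<alpha> v t = mderiv \<alpha> v t"
  by (simp add: mderiv_on_def)

lemma mderiv_sum: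
  assumes "\<And>j. j \<in> S \<Longrightarrow> v j \<in> sobolev_space \<Omega> m" "t \<in> interior \<Omega>"
  shows "mderiv \<alpha> (\<lambda>x. \<Sum>j\<in>S. c j * v j x) t = (\<Sum>j\<in>S. c j * mderiv \<alpha> (v j) t)"
proof -
  have "\<forall>t\<in>interior \<Omega>. partials (mi_list \<alpha>) (\<lambda>x. \<Sum>j\<in>S. c j * v j x) t = (\<Sum>j\<in>S. c j * partials (mi_list \<alpha>) (v j) t)"
    by (rule partials_sum[OF open_interior partials_upto_sobolev[OF assms(1)]]) (simp_all add: length_mi_list)
  then show ?thesis using assms(2) by (simp add: mderiv_eq)
qed

lemma mderiv_on_sum:
  assumes v: "\<And>j. j \<in> S \<Longrightarrow> v j \<in> sobolev_space \<Omega> m" and t: "t \<in> \<Omega>"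
    and sum: "(\<lambda>x. \<Sum>j\<in>S. c j * v j x) \<in> sobolev_space \<Omega> m"
  shows "mderiv_on \<Omega> \<alpha> (\<lambda>x. \<Sum>j\<in>S. c j * v j x) t = (\<Sum>j\<in>S. c j * mderiv_on \<Omega> \<alpha> (v j) t)"
proof (cases "t \<in> interior \<Omega>")
  case True
  then show ?thesis by (simp add: mderiv_on_interior mderiv_sum[OF v])
next
  case False
  have "((\<lambda>s. \<Sum>j\<in>S. c j * mderiv \<alpha> (v j) s) \<longlongrightarrow> (\<Sum>j\<in>S. c j * mderiv_on \<Omega> \<alpha> (v j) t)) (at t within interior \<Omega>)"
    by (intro tendsto_sum tendsto_mult_left mderiv_on_boundary v t False)
  moreover have "eventually (\<lambda>s. (\<Sum>j\<in>S. c j * mderiv \<alpha> (v j) s) = mderiv \<alpha> (\<lambda>x. \<Sum>j\<in>S. c j * v j x) s) (at t within interior \<Omega>)"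
    unfolding eventually_at_filter by (rule always_eventually) (simp add: mderiv_sum[OF v])
  ultimately have "(mderiv \<alpha> (\<lambda>x. \<Sum>j\<in>S. c j * v j x) \<longlongrightarrow> (\<Sum>j\<in>S. c j * mderiv_on \<Omega> \<alpha> (v j) t)) (at t within interior \<Omega>)"
    by (rule Lim_transform_eventually)
  from tendsto_unique[OF interior_limit_point[OF t False] mderiv_on_boundary[OF sum t False] this] show ?thesis .
qed

lemma bounded_on_dense_imp:
  assumes v: "v \<in> sobolev_space \<Omega> m" and D: "D \<subseteq> interior \<Omega>" "interior \<Omega> \<subseteq> closure D"
    and bd: "\<And>t. t \<in> D \<Longrightarrow> \<bar>mderiv \<alpha> v t\<bar> \<le> b" and t: "t \<in> \<Omega>"
  shows "\<bar>mderiv_on \<Omega> \<alpha> v t\<bar> \<le> b"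
proof -
  have int: "\<bar>mderiv \<alpha> v t\<bar> \<le> b" if t: "t \<in> interior \<Omega>" for t
  proof -
    have "t \<in> closure D" using t D by blast
    then obtain x where x: "\<And>n. x n \<in> D" "x \<longlonglongrightarrow> t" unfolding closure_sequential by blast
    have "isCont (mderiv \<alpha> v) t"
      using t by (intro continuous_on_interior[OF mderiv_continuous[OF v]]) simp
    then have "(\<lambda>n. mderiv \<alpha> v (x n)) \<longlonglongrightarrow> mderiv \<alpha> v t" by (rule isCont_tendsto_compose) (rule x(2))
    then have "(\<lambda>n. \<bar>mderiv \<alpha> v (x n)\<bar>) \<longlonglongrightarrow> \<bar>mderiv \<alpha> v t\<bar>" by (rule tendsto_rabs)
    then show ?thesis by (rule LIMSEQ_le_const2) (use bd x in auto)
  qed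
  show ?thesis
  proof (cases "t \<in> interior \<Omega>")
    case True
    then show ?thesis using int by (simp add: mderiv_on_interior)
  next
    case False
    have "((\<lambda>s. \<bar>mderiv \<alpha> v s\<bar>) \<longlongrightarrow> \<bar>mderiv_on \<Omega> \<alpha> v t\<bar>) (at t within interior \<Omega>)"
      by (intro tendsto_rabs mderiv_on_boundary v t False)
    then show ?thesis
      by (rule tendsto_upperbound[OF _ _ interior_limit_point[OF t False]])
        (simp add: eventually_at_filter int)
  qed
qed

text \<open>The derivative is continuous in the interior and has limits at the boundary, so a dense set determines
  the supremum. A countable one makes it measurable.\<close>

lemma SUP_mderiv_on_eq:
  assumes v: "v \<in> sobolev_space \<Omega> m" and D: "D \<subseteq> interior \<Omega>" "interior \<Omega> \<subseteq> closure D"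
  shows "(SUP t\<in>\<Omega>. ereal \<bar>mderiv_on \<Omega> \<alpha> v t\<bar>) = (SUP t\<in>D. ereal \<bar>mderiv \<alpha> v t\<bar>)"
proof (rule antisym)
  show "(SUP t\<in>D. ereal \<bar>mderiv \<alpha> v t\<bar>) \<le> (SUP t\<in>\<Omega>. ereal \<bar>mderiv_on \<Omega> \<alpha> v t\<bar>)"
  proof (rule SUP_least)
    fix t assume "t \<in> D"
    then have t: "t \<in> interior \<Omega>" "t \<in> \<Omega>" using D(1) interior_subset by blast+
    have "ereal \<bar>mderiv \<alpha> v t\<bar> = ereal \<bar>mderiv_on \<Omega> \<alpha> v t\<bar>" by (simp add: mderiv_on_interior[OF t(1)])
    also have "\<dots> \<le> (SUP t\<in>\<Omega>. ereal \<bar>mderiv_on \<Omega> \<alpha> v t\<bar>)" by (rule SUP_upper[OF t(2)])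
    finally show "ereal \<bar>mderiv \<alpha> v t\<bar> \<le> (SUP t\<in>\<Omega>. ereal \<bar>mderiv_on \<Omega> \<alpha> v t\<bar>)" .
  qed
  let ?B = "SUP t\<in>D. ereal \<bar>mderiv \<alpha> v t\<bar>"
  have "D \<noteq> {}" using D(2) interior by auto
  then obtain t0 where "t0 \<in> D" by blast
  then have B0: "ereal \<bar>mderiv \<alpha> v t0\<bar> \<le> ?B" by (rule SUP_upper)
  show "(SUP t\<in>\<Omega>. ereal \<bar>mderiv_on \<Omega> \<alpha> v t\<bar>) \<le> ?B"
  proof (cases ?B)
    case (real b)
    have "\<bar>mderiv \<alpha> v t\<bar> \<le> b" if "t \<in> D" for t
      using SUP_upper[OF that, of "\<lambda>t. ereal \<bar>mderiv \<alpha> v t\<bar>"] real by simp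
    then have "\<bar>mderiv_on \<Omega> \<alpha> v t\<bar> \<le> b" if "t \<in> \<Omega>" for t by (rule bounded_on_dense_imp[OF v D _ that])
    then show ?thesis unfolding real by (intro SUP_least) simp
  qed (use B0 in auto)
qed

text \<open>Derivatives are sequential limits of difference quotients.\<close>

lemma mderiv_measurable:
  assumes mem: "\<And>z. z \<in> space N \<Longrightarrow> g z \<in> sobolev_space \<Omega> m"
    and meas: "\<And>t. t \<in> interior \<Omega> \<Longrightarrow> (\<lambda>z. g z t) \<in> borel_measurable N"
    and t: "t \<in> interior \<Omega>"
  shows "(\<lambda>z. mderiv \<alpha> (g z) t) \<in> borel_measurable N"
proof -
  have "length I \<le> mi_order \<alpha> \<Longrightarrow> \<forall>t\<in>interior \<Omega>. (\<lambda>z. partials I (g z) t) \<in> borel_measurable N" for I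
  proof (induction I)
    case (Cons i I)
    show ?case
    proof
      fix t assume t: "t \<in> interior \<Omega>"
      obtain \<delta> where \<delta>: "\<delta> > 0" "ball t \<delta> \<subseteq> interior \<Omega>" using open_contains_ball[of "interior \<Omega>"] t by auto
      define r where "r n = \<delta> / 2 * inverse (real (Suc n))" for n
      have r0: "r n > 0" "r n < \<delta>" for n
      proof -
        have "inverse (real (Suc n)) \<le> 1" by (simp add: inverse_le_1_iff)
        then have "\<delta> / 2 * inverse (real (Suc n)) \<le> \<delta> / 2 * 1" using \<delta>(1) by (intro mult_left_mono) auto
        then show "r n < \<delta>" using \<delta>(1) unfolding r_def by linarith
      qed (use \<delta>(1) in \<open>simp add: r_def\<close>)
      have "r \<longlonglongrightarrow> \<delta> / 2 * 0" unfolding r_def by (intro tendsto_mult_left LIMSEQ_inverse_real_of_nat)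
      then have r: "filterlim r (at 0) sequentially" using r0(1) by (simp add: filterlim_at less_imp_neq[symmetric])
      have tr: "t + r n *\<^sub>R axis i 1 \<in> interior \<Omega>" for n
        using \<delta>(2) r0[of n] by (intro subsetD[OF \<delta>(2)]) (simp add: dist_norm)
      show "(\<lambda>z. partials (i # I) (g z) t) \<in> borel_measurable N"
      proof (rule borel_measurable_LIMSEQ_real)
        show "(\<lambda>z. (partials I (g z) (t + r n *\<^sub>R axis i 1) - partials I (g z) t) / r n) \<in> borel_measurable N" for n
          using Cons tr t by (intro borel_measurable_divide borel_measurable_diff) auto
        fix z assume "z \<in> space N"
        from partials_upto_sobolev[OF mem[OF this]]
        have "((\<lambda>s. partials I (g z) (t + s *\<^sub>R axis i 1)) has_real_derivative partials (i # I) (g z) t) (at 0)"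
          using Cons.prems t by (simp add: partials_upto_def)
        then have "((\<lambda>h. (partials I (g z) (t + h *\<^sub>R axis i 1) - partials I (g z) t) / h) \<longlongrightarrow> partials (i # I) (g z) t) (at 0)"
          by (simp add: DERIV_def)
        from filterlim_compose[OF this r]
        show "(\<lambda>n. (partials I (g z) (t + r n *\<^sub>R axis i 1) - partials I (g z) t) / r n) \<longlonglongrightarrow> partials (i # I) (g z) t" .
      qed
    qed
  qed (simp add: meas)
  from this[of "mi_list \<alpha>"] t show ?thesis by (simp add: mderiv_eq length_mi_list)
qed

text \<open>Integration by parts turns the integral into one of \<open>D\<^sup>\<alpha> v\<close> against the rescaled bump itself. The
  factor in front is \<open>\<rho> ^ d\<close> for the volume and \<open>\<rho> ^ |\<alpha>|\<close> for the derivatives.\<close>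

lemma integral_against_derived_bump_le:
  assumes v: "v \<in> sobolev_space \<Omega> m" and b: "bumpfam l u \<eta>" and pos: "\<And>x. prodfun \<eta> x \<ge> 0" and "\<rho> > 0"
    and sub: "cbox (t + \<rho> *\<^sub>R l) (t + \<rho> *\<^sub>R u) \<subseteq> interior \<Omega>"
    and bd: "\<And>x. x \<in> interior \<Omega> \<Longrightarrow> \<bar>mderiv \<alpha> v x\<bar> \<le> B"
  shows "\<bar>\<integral>x. v x * prodfun (rescale t \<rho> (der (mi_list \<alpha>) \<eta>)) x \<partial>lborel\<bar>
    \<le> \<rho> ^ (CARD('d) + mi_order \<alpha>) * B * (\<integral>z. prodfun \<eta> z \<partial>lborel)"
proof -
  let ?U = "interior \<Omega>" and ?k = "mi_order \<alpha>" and ?\<psi> = "prodfun (rescale t \<rho> \<eta>)"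
  have sm: "\<And>i. smooth (\<eta> i)" by (rule bumpfam_smooth[OF b])
  have bR: "bumpfam (t + \<rho> *\<^sub>R l) (t + \<rho> *\<^sub>R u) (rescale t \<rho> \<eta>)" by (rule bumpfam_rescale[OF b assms(4)])
  have smR: "\<And>i. smooth (rescale t \<rho> \<eta> i)" by (rule bumpfam_smooth[OF bR])
  have bT: "bumpfam (t + \<rho> *\<^sub>R l) (t + \<rho> *\<^sub>R u) (rescale t \<rho> (der (mi_list \<alpha>) \<eta>))"
    by (rule bumpfam_rescale[OF bumpfam_der[OF b] assms(4)])
  have out: "?\<psi> x = 0" if "x \<notin> ?U" for x using prodfun_zero_outside[OF bR, of x] sub that by blast
  have out': "prodfun (rescale t \<rho> (der (mi_list \<alpha>) \<eta>)) x = 0" if "x \<notin> ?U" for x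
    using prodfun_zero_outside[OF bT, of x] sub that by blast
  have eq: "partials (rev (mi_list \<alpha>)) ?\<psi> = (\<lambda>x. (1 / \<rho>) ^ ?k * prodfun (rescale t \<rho> (der (mi_list \<alpha>) \<eta>)) x)"
  proof -
    have "partials (rev (mi_list \<alpha>)) ?\<psi> = prodfun (der (rev (mi_list \<alpha>)) (rescale t \<rho> \<eta>))"
      by (rule partials_prodfun[of "rescale t \<rho> \<eta>", OF smR])
    also have "der (rev (mi_list \<alpha>)) (rescale t \<rho> \<eta>) = der (mi_list \<alpha>) (rescale t \<rho> \<eta>)"
      by (rule der_cong_count) (simp add: count_list_rev)
    finally show ?thesis by (simp add: fun_eq_iff prodfun_der_rescale[of \<eta>, OF sm] length_mi_list)
  qed
  have pu: "partials_upto ?U (length (rev (mi_list \<alpha>))) v" using partials_upto_sobolev[OF v] by (simp add: length_mi_list)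
  have "(LINT x:?U|lborel. v x * partials (rev (mi_list \<alpha>)) ?\<psi> x) = (- 1) ^ ?k * (LINT x:?U|lborel. mderiv \<alpha> v x * ?\<psi> x)"
    using integral_by_parts_partials[OF open_interior prodfun_test_fun[OF bR sub] pu] by (simp add: mderiv_eq length_mi_list)
  moreover have "(LINT x:?U|lborel. v x * partials (rev (mi_list \<alpha>)) ?\<psi> x) = (\<integral>x. v x * partials (rev (mi_list \<alpha>)) ?\<psi> x \<partial>lborel)"
    by (rule set_lebesgue_integral_zero_outside) (simp add: eq out')
  moreover have "\<dots> = (1 / \<rho>) ^ ?k * (\<integral>x. v x * prodfun (rescale t \<rho> (der (mi_list \<alpha>) \<eta>)) x \<partial>lborel)"
    unfolding eq by (subst integral_mult_right_zero[symmetric]) (simp only: mult_ac)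
  ultimately have ibp: "(1 / \<rho>) ^ ?k * (\<integral>x. v x * prodfun (rescale t \<rho> (der (mi_list \<alpha>) \<eta>)) x \<partial>lborel)
    = (- 1) ^ ?k * (LINT x:?U|lborel. mderiv \<alpha> v x * ?\<psi> x)" by simp
  have "(1 / \<rho>) ^ ?k * \<bar>\<integral>x. v x * prodfun (rescale t \<rho> (der (mi_list \<alpha>) \<eta>)) x \<partial>lborel\<bar>
    = \<bar>LINT x:?U|lborel. mderiv \<alpha> v x * ?\<psi> x\<bar>"
    using assms(4) arg_cong[OF ibp, of abs] by (simp add: abs_mult power_abs)
  also have "\<dots> \<le> B * (\<integral>x. ?\<psi> x \<partial>lborel)"
  proof -
    have loc: "locally_integrable ?U (mderiv \<alpha> v)" by (rule locally_integrable_continuous[OF mderiv_continuous[OF v]])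
    have "\<bar>LINT x:?U|lborel. mderiv \<alpha> v x * ?\<psi> x\<bar> = \<bar>\<integral>x. mderiv \<alpha> v x * ?\<psi> x \<partial>lborel\<bar>"
      by (simp only: locally_integrable_mult_prodfun(2)[OF loc bR sub])
    also have "\<dots> \<le> (\<integral>x. \<bar>mderiv \<alpha> v x * ?\<psi> x\<bar> \<partial>lborel)" by (rule integral_abs_bound)
    also have "\<dots> \<le> (\<integral>x. B * ?\<psi> x \<partial>lborel)"
    proof (rule integral_mono)
      show "integrable lborel (\<lambda>x. \<bar>mderiv \<alpha> v x * ?\<psi> x\<bar>)"
        by (rule integrable_abs[OF locally_integrable_mult_prodfun(1)[OF loc bR sub]])
      show "integrable lborel (\<lambda>x. B * ?\<psi> x)" using prodfun_integrable[OF bR] by simp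
      fix x
      show "\<bar>mderiv \<alpha> v x * ?\<psi> x\<bar> \<le> B * ?\<psi> x"
      proof (cases "x \<in> ?U")
        case True
        have "?\<psi> x \<ge> 0" unfolding prodfun_rescale by (rule pos)
        then show ?thesis using bd[OF True] by (simp add: abs_mult mult_right_mono)
      qed (simp add: out)
    qed
    also have "\<dots> = B * (\<integral>x. ?\<psi> x \<partial>lborel)" by simp
    finally show ?thesis .
  qed
  also have "(\<integral>x. ?\<psi> x \<partial>lborel) = \<rho> ^ CARD('d) * (\<integral>z. prodfun \<eta> z \<partial>lborel)"
    using prodfun_measurable[of "rescale t \<rho> \<eta>", OF smR] assms(4)
    by (subst integral_affine_vec[OF _ assms(4), where t = t]) (auto simp: prodfun_rescale)
  finally have "(1 / \<rho>) ^ ?k * \<bar>\<integral>x. v x * prodfun (rescale t \<rho> (der (mi_list \<alpha>) \<eta>)) x \<partial>lborel\<bar>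
    \<le> B * (\<rho> ^ CARD('d) * (\<integral>z. prodfun \<eta> z \<partial>lborel))" .
  then have "\<rho> ^ ?k * ((1 / \<rho>) ^ ?k * \<bar>\<integral>x. v x * prodfun (rescale t \<rho> (der (mi_list \<alpha>) \<eta>)) x \<partial>lborel\<bar>)
    \<le> \<rho> ^ ?k * (B * (\<rho> ^ CARD('d) * (\<integral>z. prodfun \<eta> z \<partial>lborel)))"
    using assms(4) by (intro mult_left_mono) auto
  then show ?thesis using assms(4) by (simp add: power_one_over power_add mult_ac)
qed

end

section \<open>The lower bound for a fixed design\<close>

subsection \<open>Disjoint cells\<close>

definition cube :: "real^'d \<Rightarrow> real \<Rightarrow> (real^'d) set" where
  "cube t r = cbox t (t + (\<chi> i. r))"

lemma disjoint_cells:
  fixes l :: "real^'d"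
  assumes "0 < \<rho>" "\<rho> \<le> a / 2"
  obtains J and s :: "('d \<Rightarrow> nat) \<Rightarrow> real^'d" where "finite J" "(a / (2 * \<rho>)) ^ CARD('d) \<le> real (card J)"
    "\<forall>j\<in>J. cube (s j) \<rho> \<subseteq> cube l a"
    "\<forall>j\<in>J. \<forall>k\<in>J. j \<noteq> k \<longrightarrow> cube (s j) (\<rho> / 2) \<inter> cube (s k) (\<rho> / 2) = {}"
proof -
  define L where "L = nat \<lfloor>a / \<rho>\<rfloor>"
  have "a / \<rho> \<ge> 2" using assms by (simp add: field_simps)
  then have L: "real L \<le> a / \<rho>" "a / \<rho> - 1 < real L" unfolding L_def by linarith+
  then have L2: "a / (2 * \<rho>) \<le> real L" using \<open>a / \<rho> \<ge> 2\<close> by (simp add: field_simps)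
  define J where "J = PiE (UNIV :: 'd set) (\<lambda>_. {..<L})"
  define s where "s j = (\<chi> i. l $ i + \<rho> * real (j i))" for j :: "'d \<Rightarrow> nat"
  have "finite J" unfolding J_def by (intro finite_PiE) auto
  moreover have "(a / (2 * \<rho>)) ^ CARD('d) \<le> real (card J)"
  proof -
    have "real (card J) = real L ^ CARD('d)" by (simp add: J_def card_PiE)
    moreover have "0 \<le> a / (2 * \<rho>)" using assms by simp
    ultimately show ?thesis using L2 by (simp add: power_mono)
  qed
  moreover have "cube (s j) \<rho> \<subseteq> cube l a" if "j \<in> J" for j
  proof
    fix y assume y: "y \<in> cube (s j) \<rho>"
    show "y \<in> cube l a"
      unfolding cube_def mem_box_cart
    proof
      fix i
      have "j i < L" using that by (auto simp: J_def)
      then have "real (j i) + 1 \<le> real L" by linarith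
      then have "\<rho> * (real (j i) + 1) \<le> \<rho> * (a / \<rho>)" using L(1) assms(1) by (intro mult_left_mono) auto
      then have "\<rho> * real (j i) + \<rho> \<le> a" using assms(1) by (simp add: distrib_left)
      moreover have "l $ i + \<rho> * real (j i) \<le> y $ i" "y $ i \<le> l $ i + \<rho> * real (j i) + \<rho>"
        using y by (auto simp: cube_def mem_box_cart s_def)
      moreover have "0 \<le> \<rho> * real (j i)" using assms(1) by simp
      ultimately have "l $ i \<le> y $ i" "y $ i \<le> l $ i + a" by linarith+
      then show "l $ i \<le> y $ i \<and> y $ i \<le> (l + (\<chi> i. a)) $ i" by simp
    qed
  qed
  moreover have "y \<notin> cube (s k) (\<rho> / 2)" if "j \<in> J" "k \<in> J" and jk: "j \<noteq> k" and y: "y \<in> cube (s j) (\<rho> / 2)" for j k y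
  proof
    assume k: "y \<in> cube (s k) (\<rho> / 2)"
    obtain i where i: "j i \<noteq> k i" using jk by auto
    have "l $ i + \<rho> * real (j i) \<le> y $ i" "y $ i \<le> l $ i + \<rho> * real (j i) + \<rho> / 2"
      "l $ i + \<rho> * real (k i) \<le> y $ i" "y $ i \<le> l $ i + \<rho> * real (k i) + \<rho> / 2"
      using y k by (auto simp: cube_def mem_box_cart s_def)
    then have "\<rho> * (real (j i) - real (k i)) \<le> \<rho> * (1 / 2)" "\<rho> * (real (k i) - real (j i)) \<le> \<rho> * (1 / 2)"
      by (simp_all add: algebra_simps)
    then have "real (j i) - real (k i) \<le> 1 / 2" "real (k i) - real (j i) \<le> 1 / 2" using assms(1) by simp_all
    with i show False by linarith
  qed
  ultimately show thesis by (intro that[of J s]) (blast intro: ballI)+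
qed

subsection \<open>Fitting a noiseless function\<close>

text \<open>The residuals are small in the empirical norm and bounded in the norm of \<open>H\<close>; together with a norm
  comparison this bounds them in \<open>L\<^sub>2\<close>.\<close>

lemma (in rkhs) noiseless_fit:
  fixes n :: nat and xs :: "nat \<Rightarrow> 'a"
  assumes xs: "\<And>i. i \<in> {1..n} \<Longrightarrow> xs i \<in> \<Omega>" and lam: "lam > 0" and h: "h \<in> H"
  defines "g \<equiv> krr H ip lam n xs (\<lambda>i. h (xs i))"
  shows "g \<in> H" "(\<Sum>i=1..n. (h (xs i) - g (xs i))\<^sup>2) / real n \<le> lam * (ip_norm ip h)\<^sup>2"
    "emp_norm n xs (\<lambda>x. h x - g x) \<le> sqrt lam * ip_norm ip h"
    "ip_norm ip (\<lambda>x. h x - g x) \<le> 2 * ip_norm ip h"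
proof -
  show gH: "g \<in> H" unfolding g_def by (rule krr_mem[OF xs lam])
  have bias: "(\<Sum>i=1..n. (h (xs i) - g (xs i))\<^sup>2) / real n + lam * (ip_norm ip g)\<^sup>2 \<le> lam * (ip_norm ip h)\<^sup>2"
    unfolding g_def by (rule krr_bias_bound[OF xs lam h])
  moreover have "lam * (ip_norm ip g)\<^sup>2 \<ge> 0" using lam by simp
  ultimately show res: "(\<Sum>i=1..n. (h (xs i) - g (xs i))\<^sup>2) / real n \<le> lam * (ip_norm ip h)\<^sup>2" by linarith
  have hn: "ip_norm ip h \<ge> 0" by (rule ip_norm_nonneg[OF h])
  have "emp_norm n xs (\<lambda>x. h x - g x) \<le> sqrt (lam * (ip_norm ip h)\<^sup>2)"
    unfolding emp_norm_def by (rule real_sqrt_le_mono[OF res])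
  then show "emp_norm n xs (\<lambda>x. h x - g x) \<le> sqrt lam * ip_norm ip h" using hn by (simp add: real_sqrt_mult)
  have "(\<Sum>i=1..n. (h (xs i) - g (xs i))\<^sup>2) / real n \<ge> 0" by (intro divide_nonneg_nonneg sum_nonneg) auto
  with bias have "lam * (ip_norm ip g)\<^sup>2 \<le> lam * (ip_norm ip h)\<^sup>2" by linarith
  then have "(ip_norm ip g)\<^sup>2 \<le> (ip_norm ip h)\<^sup>2" using lam by simp
  then have gh: "ip_norm ip g \<le> ip_norm ip h" using hn by (rule power2_le_imp_le)
  have "ip_norm ip (\<lambda>x. h x - g x) = ip_norm ip (\<lambda>x. h x + (- 1) * g x)" by simp
  also have "\<dots> \<le> ip_norm ip h + ip_norm ip (\<lambda>x. (- 1) * g x)" by (rule ip_norm_triangle[OF h scale_mem[OF gH]])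
  also have "ip_norm ip (\<lambda>x. (- 1) * g x) = ip_norm ip g"
    unfolding ip_norm_def by (subst ip_scale[OF gH scale_mem[OF gH]], subst ip_scale_right[OF gH gH]) simp
  finally show "ip_norm ip (\<lambda>x. h x - g x) \<le> 2 * ip_norm ip h" using gh by linarith
qed

lemma L2_norm_on_nonneg: "0 \<le> L2_norm_on \<Omega> v"
  unfolding L2_norm_on_def set_lebesgue_integral_def
  by (intro real_sqrt_ge_zero Bochner_Integration.integral_nonneg) (simp add: indicator_def)

lemma (in smooth_sobolev) L2_norm_square:
  assumes "v \<in> sobolev_space \<Omega> m"
  shows "(L2_norm_on \<Omega> v)\<^sup>2 = (\<integral>x. (v x)\<^sup>2 \<partial>lborel)" "integrable lborel (\<lambda>x. (v x)\<^sup>2)"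
proof -
  note vD = sobolev_spaceD[OF assms]
  have eq: "indicator \<Omega> x *\<^sub>R (v x)\<^sup>2 = (v x)\<^sup>2" for x using vD(1)[of x] by (auto simp: indicator_def)
  have "set_integrable lborel \<Omega> (\<lambda>x. (v x)\<^sup>2)"
    unfolding set_integrable_def by (intro borel_integrable_compact compact continuous_on_power vD(2))
  then show "integrable lborel (\<lambda>x. (v x)\<^sup>2)" unfolding set_integrable_def eq .
  show "(L2_norm_on \<Omega> v)\<^sup>2 = (\<integral>x. (v x)\<^sup>2 \<partial>lborel)"
    unfolding L2_norm_on_def set_lebesgue_integral_def eq by simp
qed

subsection \<open>The bound\<close>

text \<open>The heart of the proof. Let \<open>\<theta>\<close> be \<open>D\<^sup>\<alpha>\<close> of a bump and \<open>\<beta>\<^sub>j\<close> its copies, rescaled to the scale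
  \<open>\<rho> = R lam' powr (1 / (2 m))\<close>, in disjoint cells of a cube inside \<open>\<Omega>\<close>. Their number is of order
  \<open>\<rho> powr (- d)\<close>. If \<open>\<bar>D\<^sup>\<alpha>\<bar>\<close> of the fit to the noise \<open>E\<close> is at most \<open>b\<close>, then all functionals
  \<open>l\<^sub>k E = \<integral> krr E \<beta>\<^sub>k\<close> are at most a multiple of \<open>\<rho> ^ (d + |\<alpha>|) b\<close>; it remains to see that they are rarely
  all small.

  The fit to the values of \<open>\<beta>\<^sub>j\<close> differs from \<open>\<beta>\<^sub>j\<close> by at most a multiple of \<open>R powr (- m)\<close> relative to
  the \<open>L\<^sub>2\<close> norm of \<open>\<beta>\<^sub>j\<close>: the norm of \<open>\<beta>\<^sub>j\<close> in \<open>H\<close> is of order \<open>\<rho> powr (d / 2 - m)\<close>, and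
  \<open>sqrt lam' = R powr (- m) \<rho> powr m\<close>. Hence, for a large \<open>R\<close>, each functional is much
  larger at its own data vector than at the others, and multiples of these vectors serve as translations
  of the noise.

  The cells must be small compared with the cube, which fails for \<open>lam\<close> close to 1. There the fit with
  \<open>lam' = min lam lam0\<close> is used, realised as the fit with \<open>lam\<close> to a data vector of comparable size. Since
  \<open>lam0\<close> is a constant, this affects constants only.\<close>

lemma (in smooth_sobolev) lower_bound_fixed_design:
  fixes K :: "real^'d \<Rightarrow> real^'d \<Rightarrow> real" and H :: "(real^'d \<Rightarrow> real) set"
    and ip :: "(real^'d \<Rightarrow> real) \<Rightarrow> (real^'d \<Rightarrow> real) \<Rightarrow> real"
  assumes rk: "rkhs \<Omega> K H ip" and H: "H = sobolev_space \<Omega> m"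
    and a: "a > 0" "\<And>v. v \<in> H \<Longrightarrow> a * ip_norm ip v \<le> sobolev_norm \<Omega> m v"
    and C: "C1 > 0" "C > 0" "c > 0"
  obtains B1 lam0 where "B1 > 0" "0 < lam0" "lam0 \<le> 1"
    "\<And>n xs lam \<sigma>. n \<ge> 1 \<Longrightarrow> (\<And>i. i \<in> {1..n} \<Longrightarrow> xs i \<in> \<Omega>) \<Longrightarrow>
      (\<And>v. v \<in> H \<Longrightarrow> L2_norm_on \<Omega> v \<le> max (C1 * emp_norm n xs v) (C * real n powr (- m / real CARD('d)) * ip_norm ip v)) \<Longrightarrow>
      (\<And>v. v \<in> H \<Longrightarrow> emp_norm n xs v \<le> max (C1 * L2_norm_on \<Omega> v) (C * real n powr (- m / real CARD('d)) * ip_norm ip v)) \<Longrightarrow>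
      0 < lam \<Longrightarrow> lam \<le> 1 \<Longrightarrow> real n powr (- 2 * m / real CARD('d)) \<le> c * min lam lam0 \<Longrightarrow> \<sigma> > 0 \<Longrightarrow>
      \<exists>S\<in>sets (noise_law n \<sigma>). measure (noise_law n \<sigma>) S \<le> 1 / 4 \<and>
        (\<forall>E\<in>space (noise_law n \<sigma>) - S. \<forall>b. (\<forall>t\<in>interior \<Omega>. \<bar>mderiv \<alpha> (krr H ip lam n xs E) t\<bar> \<le> b) \<longrightarrow>
          B1 * \<sigma> * real n powr (- 1 / 2) * lam powr (- (real CARD('d) + 2 * real (mi_order \<alpha>)) / (4 * m)) * sqrt (ln (2 / lam)) \<le> b)"
proof -
  interpret rkhs \<Omega> K H ip by (rule rk)
  let ?d = "real CARD('d)" and ?k = "mi_order \<alpha>" and ?U = "interior \<Omega>"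
  have d: "?d > 0" by simp
  note mp = m_pos
  \<comment> \<open>bumps in the lower half of the unit cube leave gaps, so that the closed cells are disjoint\<close>
  define l0 u0 :: "real^'d" where "l0 = 0" and "u0 = (\<chi> i. 1 / 2)"
  have lu0: "l0 $ i < u0 $ i" for i by (simp add: l0_def u0_def)
  define \<eta> where "\<eta> = boxbump l0 u0"
  have b: "bumpfam l0 u0 \<eta>" and p0: "(\<integral>z. prodfun \<eta> z \<partial>lborel) > 0" unfolding \<eta>_def by (rule boxbump[OF lu0])+
  define p where "p = (\<integral>z. prodfun \<eta> z \<partial>lborel)"
  have p: "p > 0" using p0 by (simp add: p_def)
  have \<eta>pos: "prodfun \<eta> x \<ge> 0" for x
    unfolding prodfun_def \<eta>_def boxbump_def by (intro prod_nonneg) (auto intro: bump_range)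
  define \<theta> where "\<theta> = der (mi_list \<alpha>) \<eta>"
  have b\<theta>: "bumpfam l0 u0 \<theta>" unfolding \<theta>_def by (rule bumpfam_der[OF b])
  define q where "q = (\<integral>z. (prodfun \<theta> z)\<^sup>2 \<partial>lborel)"
  have i\<theta>: "integrable lborel (\<lambda>z. (prodfun \<theta> z)\<^sup>2)" by (rule integral_rescaled_bump_squared(2)[OF b\<theta> zero_less_one])
  have q: "q > 0"
  proof -
    have "\<exists>x. \<theta> i x \<noteq> 0" for i
    proof -
      obtain x where x: "(deriv ^^ (\<alpha> $ i)) bump x \<noteq> 0" using funpow_deriv_bump_nonzero by blast
      have "\<eta> i = (\<lambda>x. bump ((x - 0) / (1 / 2)))" by (simp add: \<eta>_def boxbump_def l0_def u0_def fun_eq_iff)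
      then have "\<theta> i (x / 2) = (1 / (1 / 2)) ^ (\<alpha> $ i) * (deriv ^^ (\<alpha> $ i)) bump ((x / 2 - 0) / (1 / 2))"
        unfolding \<theta>_def der_def count_mi_list by (simp only: funpow_deriv_rescale[OF smooth_bump])
      then have "\<theta> i (x / 2) \<noteq> 0" using x by simp
      then show ?thesis by blast
    qed
    then obtain x where x: "\<And>i. \<theta> i (x i) \<noteq> 0" by metis
    have "prodfun \<theta> (\<chi> i. x i) \<noteq> 0" unfolding prodfun_def using x by (simp add: prod_zero_iff)
    then show ?thesis unfolding q_def
      by (intro integral_pos_of_continuous[of _ "\<chi> i. x i"] continuous_on_power prodfun_continuous bumpfam_smooth[OF b\<theta>] i\<theta>) auto
  qed
  obtain x0 where "x0 \<in> ?U" using interior by blast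
  then obtain r0 where r0: "r0 > 0" "ball x0 r0 \<subseteq> ?U" using open_contains_ball[of ?U] by auto
  obtain lc uc where luc: "\<And>i. lc $ i < uc $ i" "cbox lc uc \<subseteq> ball x0 r0" using cube_in_ball[OF r0(1)] by metis
  define side where "side = Min (range (\<lambda>i. uc $ i - lc $ i))"
  have side: "side > 0" unfolding side_def using luc(1) by (subst Min_gr_iff) auto
  have sideU: "cube lc side \<subseteq> ?U"
  proof -
    have "side \<le> uc $ i - lc $ i" for i unfolding side_def by (intro Min_le) auto
    then have "cube lc side \<subseteq> cbox lc uc" by (auto simp: cube_def mem_box_cart) (smt (verit))
    then show ?thesis using luc(2) r0(2) by blast
  qed
  \<comment> \<open>\<open>C2\<close> bounds the norms of the bumps, \<open>C3\<close> the residuals of their fits, \<open>C4\<close> and \<open>C5\<close> the data vectors;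
     \<open>R\<close> makes the residuals small, \<open>x1\<close> and \<open>y1\<close> make the bumps small enough and numerous enough\<close>
  obtain Cb where Cb: "Cb > 0" "\<And>t \<rho>. 0 < \<rho> \<Longrightarrow> \<rho> \<le> 1 \<Longrightarrow> cbox (t + \<rho> *\<^sub>R l0) (t + \<rho> *\<^sub>R u0) \<subseteq> ?U \<Longrightarrow>
       prodfun (rescale t \<rho> \<theta>) \<in> sobolev_space \<Omega> m \<and>
       sobolev_norm \<Omega> m (prodfun (rescale t \<rho> \<theta>)) \<le> Cb * \<rho> powr (?d / 2 - m)"
    using bump_in_sobolev_space[OF mp b\<theta>, of \<Omega>] by blast
  define C2 where "C2 = Cb / a"
  have C2: "C2 > 0" using Cb a by (simp add: C2_def)
  define C3 where "C3 = (C1 + 2 * C * sqrt c) * C2"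
  have C3: "C3 > 0" using C C2 by (auto simp: C3_def intro!: mult_pos_pos add_pos_pos)
  define R where "R = max 1 ((8 * C3 / sqrt q) powr (1 / m))"
  have R: "R \<ge> 1" by (simp add: R_def)
  have Rm: "8 * C3 / sqrt q \<le> R powr m"
  proof -
    have "8 * C3 / sqrt q = ((8 * C3 / sqrt q) powr (1 / m)) powr m" using mp C3 q by (simp add: powr_powr)
    also have "\<dots> \<le> R powr m" using mp by (intro powr_mono2) (auto simp: R_def)
    finally show ?thesis .
  qed
  define x1 where "x1 = min 1 (side / 2) / R"
  define y1 where "y1 = 4 * (2 * R / side) ^ CARD('d)"
  have x1: "x1 > 0" using side R by (simp add: x1_def)
  have y1: "y1 > 0" using side R by (simp add: y1_def)
  define lam0 where "lam0 = min 1 (min (x1 powr (2 * m)) (y1 powr (- (4 * m / ?d))))"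
  have lam0: "0 < lam0" "lam0 \<le> 1" using x1 y1 by (auto simp: lam0_def)
  define C4 where "C4 = C1 * sqrt q + C * sqrt c * C2"
  have C4: "C4 > 0" using C C2 q by (auto simp: C4_def intro!: mult_pos_pos add_pos_pos)
  define C5 where "C5 = 2 * C4\<^sup>2 + 2 * C2\<^sup>2 / lam0\<^sup>2"
  have C5: "C5 > 0" using C4 C2 lam0 by (auto simp: C5_def intro!: add_pos_pos)
  define B1 where "B1 = q / (p * sqrt (8 * C5)) * sqrt (?d / (4 * m)) * R powr (- (?d / 2 + real ?k))"
  have B1: "B1 > 0" using q p C5 mp R by (simp add: B1_def)
  show thesis
  proof (rule that[OF B1 lam0])
    fix n xs lam \<sigma>
    assume n: "n \<ge> (1::nat)" and xs: "\<And>i. i \<in> {1..n} \<Longrightarrow> xs i \<in> \<Omega>"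
      and L2e: "\<And>v. v \<in> H \<Longrightarrow> L2_norm_on \<Omega> v \<le> max (C1 * emp_norm n xs v) (C * real n powr (- m / ?d) * ip_norm ip v)"
      and eL2: "\<And>v. v \<in> H \<Longrightarrow> emp_norm n xs v \<le> max (C1 * L2_norm_on \<Omega> v) (C * real n powr (- m / ?d) * ip_norm ip v)"
      and lam: "0 < lam" "lam \<le> 1" and nl: "real n powr (- 2 * m / ?d) \<le> c * min lam lam0" and \<sigma>: "\<sigma> > (0::real)"
    define lam' where "lam' = min lam lam0"
    have lam': "0 < lam'" "lam' \<le> lam" "lam' \<le> lam0" "lam0 * lam \<le> lam'"
      using lam lam0 by (auto simp: lam'_def min_def mult_left_le mult_right_le_one_le)
    define \<rho> where "\<rho> = R * lam' powr (1 / (2 * m))"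
    have \<rho>0: "\<rho> > 0" using R lam'(1) by (simp add: \<rho>_def)
    have "lam' powr (1 / (2 * m)) \<le> (x1 powr (2 * m)) powr (1 / (2 * m))"
      using lam' mp by (intro powr_mono2) (auto simp: lam0_def)
    also have "\<dots> = x1" using x1 mp by (simp add: powr_powr)
    finally have "\<rho> \<le> min 1 (side / 2)" using R by (simp add: \<rho>_def x1_def field_simps)
    then have \<rho>1: "\<rho> \<le> 1" "\<rho> \<le> side / 2" by auto
    have sl: "sqrt lam' = \<rho> powr m * R powr (- m)"
    proof -
      have "\<rho> powr m = R powr m * (lam' powr (1 / (2 * m))) powr m"
        unfolding \<rho>_def using R by (subst powr_mult) auto
      also have "(lam' powr (1 / (2 * m))) powr m = sqrt lam'"
        using mp lam'(1) by (simp add: powr_powr powr_half_sqrt)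
      finally show ?thesis using R by (simp add: powr_minus)
    qed
    have sn: "real n powr (- m / ?d) \<le> sqrt c * sqrt lam'"
    proof -
      have "real n powr (- m / ?d) = sqrt (real n powr (- 2 * m / ?d))"
        using n by (simp add: powr_half_sqrt[symmetric] powr_powr)
      also have "\<dots> \<le> sqrt (c * lam')" using nl by (simp add: lam'_def)
      finally show ?thesis by (simp add: real_sqrt_mult)
    qed
    obtain J and s :: "('d \<Rightarrow> nat) \<Rightarrow> real^'d" where J: "finite J" "(side / (2 * \<rho>)) ^ CARD('d) \<le> real (card J)"
      "\<forall>j\<in>J. cube (s j) \<rho> \<subseteq> cube lc side"
      "\<forall>j\<in>J. \<forall>k\<in>J. j \<noteq> k \<longrightarrow> cube (s j) (\<rho> / 2) \<inter> cube (s k) (\<rho> / 2) = {}"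
      by (rule disjoint_cells[OF \<rho>0 \<rho>1(2), of lc])
    define \<beta> where "\<beta> j = prodfun (rescale (s j) \<rho> \<theta>)" for j
    have cell: "cbox (s j + \<rho> *\<^sub>R l0) (s j + \<rho> *\<^sub>R u0) = cube (s j) (\<rho> / 2)" for j
    proof -
      have "\<rho> *\<^sub>R u0 = (\<chi> i. \<rho> / 2)" by (simp add: u0_def vec_eq_iff)
      then show ?thesis by (simp add: cube_def l0_def)
    qed
    have cellU: "cbox (s j + \<rho> *\<^sub>R l0) (s j + \<rho> *\<^sub>R u0) \<subseteq> ?U" if "j \<in> J" for j
    proof -
      have "cube (s j) (\<rho> / 2) \<subseteq> cube (s j) \<rho>" using \<rho>0 by (auto simp: cube_def mem_box_cart) (smt (verit) field_sum_of_halves)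
      then show ?thesis unfolding cell using bspec[OF J(3) that] sideU by blast
    qed
    have bR: "bumpfam (s j + \<rho> *\<^sub>R l0) (s j + \<rho> *\<^sub>R u0) (rescale (s j) \<rho> \<theta>)" for j by (rule bumpfam_rescale[OF b\<theta> \<rho>0])
    have \<beta>H: "\<beta> j \<in> H" and \<beta>norm: "ip_norm ip (\<beta> j) \<le> C2 * \<rho> powr (?d / 2 - m)" if "j \<in> J" for j
    proof -
      have *: "\<beta> j \<in> sobolev_space \<Omega> m" "sobolev_norm \<Omega> m (\<beta> j) \<le> Cb * \<rho> powr (?d / 2 - m)"
        using Cb(2)[OF \<rho>0 \<rho>1(1) cellU[OF that]] by (auto simp: \<beta>_def)
      show "\<beta> j \<in> H" using * H by simp
      with a(2) * have "a * ip_norm ip (\<beta> j) \<le> Cb * \<rho> powr (?d / 2 - m)" by force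
      then show "ip_norm ip (\<beta> j) \<le> C2 * \<rho> powr (?d / 2 - m)" using a(1) by (simp add: C2_def field_simps)
    qed
    have \<beta>bd: "\<exists>B. \<forall>x. \<bar>\<beta> j x\<bar> \<le> B" for j unfolding \<beta>_def using prodfun_bounded[OF bR] by metis
    have \<beta>meas[measurable]: "\<beta> j \<in> borel_measurable borel" for j
      unfolding \<beta>_def by (rule prodfun_measurable[OF bumpfam_smooth[OF bR]])
    have \<rho>d: "\<rho> ^ CARD('d) = \<rho> powr ?d" "\<rho> powr ?d > 0" using \<rho>0 by (simp_all add: powr_realpow)
    have \<rho>half: "(\<rho> powr (?d / 2))\<^sup>2 = \<rho> powr ?d" by (simp add: power2_eq_square flip: powr_add)
    have \<beta>sq: "(\<integral>x. (\<beta> j x)\<^sup>2 \<partial>lborel) = q * \<rho> powr ?d" for j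
    proof -
      have "(\<integral>x. (\<beta> j x)\<^sup>2 \<partial>lborel) = \<rho> ^ CARD('d) * (\<integral>z. (\<beta> j (s j + \<rho> *\<^sub>R z))\<^sup>2 \<partial>lborel)"
        using \<rho>0 by (intro integral_affine_vec) measurable
      also have "(\<integral>z. (\<beta> j (s j + \<rho> *\<^sub>R z))\<^sup>2 \<partial>lborel) = q"
        unfolding \<beta>_def q_def using \<rho>0 by (simp add: prodfun_rescale)
      finally show ?thesis using \<rho>d(1) by simp
    qed
    have \<beta>disj: "\<beta> j x * \<beta> k x = 0" if "j \<in> J" "k \<in> J" "j \<noteq> k" for j k x
      unfolding \<beta>_def
      using that J(4) prodfun_zero_outside[OF bR, of x j] prodfun_zero_outside[OF bR, of x k] unfolding cell by auto
    \<comment> \<open>the noiseless fits to the bumps\<close>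
    define g where "g j = krr H ip lam' n xs (\<lambda>i. \<beta> j (xs i))" for j
    have fit: "g j \<in> H" "(\<Sum>i=1..n. (\<beta> j (xs i) - g j (xs i))\<^sup>2) / real n \<le> lam' * (ip_norm ip (\<beta> j))\<^sup>2"
      "emp_norm n xs (\<lambda>x. \<beta> j x - g j x) \<le> sqrt lam' * ip_norm ip (\<beta> j)"
      "ip_norm ip (\<lambda>x. \<beta> j x - g j x) \<le> 2 * ip_norm ip (\<beta> j)" if "j \<in> J" for j
      using noiseless_fit[where xs = xs, OF xs lam'(1) \<beta>H[OF that]] by (auto simp: g_def)
    have sb: "sqrt lam' * ip_norm ip (\<beta> j) \<le> C2 * R powr (- m) * \<rho> powr (?d / 2)" if "j \<in> J" for j
    proof -
      have "sqrt lam' * ip_norm ip (\<beta> j) \<le> sqrt lam' * (C2 * \<rho> powr (?d / 2 - m))"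
        using lam'(1) by (intro mult_left_mono \<beta>norm that) auto
      also have "\<dots> = C2 * R powr (- m) * (\<rho> powr m * \<rho> powr (?d / 2 - m))" by (simp only: sl mult_ac)
      also have "\<rho> powr m * \<rho> powr (?d / 2 - m) = \<rho> powr (?d / 2)" by (simp flip: powr_add)
      finally show ?thesis .
    qed
    have Rle: "R powr (- m) \<le> 1"
    proof -
      have "R powr (- m) \<le> 1 powr (- m)" using R mp by (intro powr_mono2') auto
      then show ?thesis by simp
    qed
    have resid: "(\<integral>x. (\<beta> j x - g j x)\<^sup>2 \<partial>lborel) \<le> q / 64 * \<rho> powr ?d"
      and iresid: "integrable lborel (\<lambda>x. (\<beta> j x - g j x)\<^sup>2)" if j: "j \<in> J" for j
    proof -
      have dH: "(\<lambda>x. \<beta> j x - g j x) \<in> H" by (rule diff_mem[OF \<beta>H[OF j] fit(1)[OF j]])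
      then have dS: "(\<lambda>x. \<beta> j x - g j x) \<in> sobolev_space \<Omega> m" using H by simp
      show "integrable lborel (\<lambda>x. (\<beta> j x - g j x)\<^sup>2)" by (rule L2_norm_square(2)[OF dS])
      let ?hN = "ip_norm ip (\<beta> j)"
      have hN: "?hN \<ge> 0" by (rule ip_norm_nonneg[OF \<beta>H[OF j]])
      have "L2_norm_on \<Omega> (\<lambda>x. \<beta> j x - g j x) \<le> max (C1 * (sqrt lam' * ?hN)) (C * (sqrt c * sqrt lam') * (2 * ?hN))"
      proof (rule order_trans[OF L2e[OF dH]], rule max.mono)
        show "C1 * emp_norm n xs (\<lambda>x. \<beta> j x - g j x) \<le> C1 * (sqrt lam' * ?hN)" using C(1) fit(3)[OF j] by simp
        show "C * real n powr (- m / ?d) * ip_norm ip (\<lambda>x. \<beta> j x - g j x) \<le> C * (sqrt c * sqrt lam') * (2 * ?hN)"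
          using C sn fit(4)[OF j] lam'(1) ip_norm_nonneg[OF dH] by (intro mult_mono) auto
      qed
      also have "\<dots> \<le> C1 * (sqrt lam' * ?hN) + C * (sqrt c * sqrt lam') * (2 * ?hN)"
        using C lam'(1) hN by (intro max.boundedI) auto
      also have "\<dots> = (C1 + 2 * C * sqrt c) * (sqrt lam' * ?hN)" by (simp add: algebra_simps)
      also have "\<dots> \<le> (C1 + 2 * C * sqrt c) * (C2 * R powr (- m) * \<rho> powr (?d / 2))"
        using C by (intro mult_left_mono sb j) auto
      also have "\<dots> = C3 / R powr m * \<rho> powr (?d / 2)" by (simp add: C3_def powr_minus field_simps)
      also have "\<dots> \<le> sqrt q / 8 * \<rho> powr (?d / 2)"
      proof (rule mult_right_mono)
        have "R powr m > 0" using R by simp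
        then show "C3 / R powr m \<le> sqrt q / 8" using Rm q by (simp add: field_simps)
      qed simp
      finally have le: "L2_norm_on \<Omega> (\<lambda>x. \<beta> j x - g j x) \<le> sqrt q / 8 * \<rho> powr (?d / 2)" .
      from L2_norm_on_nonneg have "(L2_norm_on \<Omega> (\<lambda>x. \<beta> j x - g j x))\<^sup>2 \<le> (sqrt q / 8 * \<rho> powr (?d / 2))\<^sup>2" by (intro power_mono le)
      also have "\<dots> = q / 64 * \<rho> powr ?d"
        using q by (simp add: power_mult_distrib power_divide \<rho>half)
      finally show "(\<integral>x. (\<beta> j x - g j x)\<^sup>2 \<partial>lborel) \<le> q / 64 * \<rho> powr ?d" by (simp only: L2_norm_square(1)[OF dS])
    qed
    have Hint: "integrable lborel (\<lambda>x. v x * \<beta> k x)" if "v \<in> H" for v k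
    proof -
      obtain B where "\<forall>x. \<bar>\<beta> k x\<bar> \<le> B" using \<beta>bd by blast
      moreover have "integrable lborel v" using that sobolev_space_integrable(1)[OF compact] H by blast
      ultimately show ?thesis by (intro integrable_mult_bounded_fun[of _ v _ B]) auto
    qed
    have cross: "\<bar>\<integral>x. (\<beta> j x - g j x) * \<beta> k x \<partial>lborel\<bar> \<le> q / 8 * \<rho> powr ?d" if j: "j \<in> J" and k: "k \<in> J" for j k
    proof -
      have dH: "(\<lambda>x. \<beta> j x - g j x) \<in> H" by (rule diff_mem[OF \<beta>H[OF j] fit(1)[OF j]])
      have i2: "integrable lborel (\<lambda>x. (\<beta> k x)\<^sup>2)" using L2_norm_square(2)[of "\<beta> k"] \<beta>H[OF k] H by simp
      have "\<bar>\<integral>x. (\<beta> j x - g j x) * \<beta> k x \<partial>lborel\<bar> \<le> (\<integral>x. \<bar>(\<beta> j x - g j x) * \<beta> k x\<bar> \<partial>lborel)" by (rule integral_abs_bound)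
      also have "\<dots> \<le> (\<integral>x. 4 * (\<beta> j x - g j x)\<^sup>2 + (\<beta> k x)\<^sup>2 / 16 \<partial>lborel)"
      proof (rule integral_mono)
        show "integrable lborel (\<lambda>x. \<bar>(\<beta> j x - g j x) * \<beta> k x\<bar>)" by (rule integrable_abs[OF Hint[OF dH]])
        show "integrable lborel (\<lambda>x. 4 * (\<beta> j x - g j x)\<^sup>2 + (\<beta> k x)\<^sup>2 / 16)" using iresid[OF j] i2 by simp
        fix x
        show "\<bar>(\<beta> j x - g j x) * \<beta> k x\<bar> \<le> 4 * (\<beta> j x - g j x)\<^sup>2 + (\<beta> k x)\<^sup>2 / 16"
          using weighted_AM_GM[of 8 "\<beta> j x - g j x" "\<beta> k x"] by simp
      qed
      also have "\<dots> = 4 * (\<integral>x. (\<beta> j x - g j x)\<^sup>2 \<partial>lborel) + (\<integral>x. (\<beta> k x)\<^sup>2 \<partial>lborel) / 16"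
        using iresid[OF j] i2 by (subst Bochner_Integration.integral_add) auto
      also have "\<dots> \<le> 4 * (q / 64 * \<rho> powr ?d) + q * \<rho> powr ?d / 16"
        unfolding \<beta>sq using resid[OF j] by linarith
      also have "\<dots> = q / 8 * \<rho> powr ?d" by (simp add: field_simps)
      finally show ?thesis .
    qed
    \<comment> \<open>noise vectors that \<open>lam\<close> fits by \<open>g j\<close> as \<open>lam'\<close> does with \<open>\<beta> j\<close>, and the coefficients of the functionals\<close>
    define e where "e j i = \<beta> j (xs i) + (lam - lam') / lam' * (\<beta> j (xs i) - g j (xs i))" for j i
    have fite: "krr H ip lam n xs (e j) = g j" for j
      unfolding e_def[abs_def] g_def by (rule krr_change_parameter[OF xs lam'(1) lam(1)])
    define A where "A k i = (\<integral>x. krr H ip lam n xs (\<lambda>i'. if i' = i then 1 else 0) x * \<beta> k x \<partial>lborel)" for k i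
    have lin: "lin n (A k) E = (\<integral>x. krr H ip lam n xs E x * \<beta> k x \<partial>lborel)" for k E
    proof -
      let ?u = "\<lambda>i. krr H ip lam n xs (\<lambda>i'. if i' = i then 1 else 0)"
      have "(\<integral>x. krr H ip lam n xs E x * \<beta> k x \<partial>lborel) = (\<integral>x. (\<Sum>i=1..n. E i * (?u i x * \<beta> k x)) \<partial>lborel)"
        by (subst krr_linear_combination[OF xs lam(1)]) (simp_all add: sum_distrib_right mult.assoc)
      also have "\<dots> = (\<Sum>i=1..n. \<integral>x. E i * (?u i x * \<beta> k x) \<partial>lborel)"
        by (intro Bochner_Integration.integral_sum integrable_mult_right Hint krr_mem[OF xs lam(1)])
      also have "\<dots> = lin n (A k) E" by (simp add: lin_def A_def)
      finally show ?thesis by simp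
    qed
    have lin_e: "lin n (A k) (e j) = (\<integral>x. \<beta> j x * \<beta> k x \<partial>lborel) - (\<integral>x. (\<beta> j x - g j x) * \<beta> k x \<partial>lborel)" if j: "j \<in> J" for j k
    proof -
      have "(\<integral>x. (\<beta> j x - g j x) * \<beta> k x \<partial>lborel) = (\<integral>x. \<beta> j x * \<beta> k x - g j x * \<beta> k x \<partial>lborel)" by (simp add: left_diff_distrib)
      also have "\<dots> = (\<integral>x. \<beta> j x * \<beta> k x \<partial>lborel) - (\<integral>x. g j x * \<beta> k x \<partial>lborel)"
        by (intro Bochner_Integration.integral_diff Hint \<beta>H fit(1) j)
      finally show ?thesis unfolding lin fite by simp
    qed
    have diag: "lin n (A j) (e j) \<ge> 7 / 8 * q * \<rho> powr ?d" if j: "j \<in> J" for j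
    proof -
      have "(\<integral>x. \<beta> j x * \<beta> j x \<partial>lborel) = q * \<rho> powr ?d" using \<beta>sq[of j] by (simp add: power2_eq_square)
      then show ?thesis using lin_e[OF j, of j] cross[OF j j] by (simp add: abs_le_iff)
    qed
    have off: "\<bar>lin n (A k) (e j)\<bar> \<le> q / 8 * \<rho> powr ?d" if "j \<in> J" "k \<in> J" "j \<noteq> k" for j k
      using lin_e[OF that(1), of k] cross[OF that(1,2)] by (simp add: \<beta>disj[OF that])
    have esq: "(\<Sum>i=1..n. (e j i)\<^sup>2) \<le> real n * C5 * \<rho> powr ?d" if j: "j \<in> J" for j
    proof -
      let ?r = "(lam - lam') / lam'"
      have r: "0 \<le> ?r" "?r \<le> 1 / lam0"
      proof -
        show "0 \<le> ?r" using lam' by simp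
        have "lam - lam' \<le> lam" using lam' by simp
        also have "lam \<le> lam' / lam0" using lam'(4) lam0(1) by (simp add: field_simps)
        finally show "?r \<le> 1 / lam0" using lam'(1) lam0 by (simp add: field_simps)
      qed
      have emp: "(\<Sum>i=1..n. (\<beta> j (xs i))\<^sup>2) / real n \<le> C4\<^sup>2 * \<rho> powr ?d"
      proof -
        have "L2_norm_on \<Omega> (\<beta> j) = sqrt (q * \<rho> powr ?d)"
          using L2_norm_square(1)[of "\<beta> j"] \<beta>H[OF j] H \<beta>sq[of j] L2_norm_on_nonneg[of \<Omega> "\<beta> j"]
          by (intro real_sqrt_unique[symmetric]) auto
        also have "\<dots> = sqrt q * \<rho> powr (?d / 2)" by (simp add: real_sqrt_mult powr_half_sqrt[symmetric] powr_powr)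
        finally have L2b: "L2_norm_on \<Omega> (\<beta> j) = sqrt q * \<rho> powr (?d / 2)" .
        have "emp_norm n xs (\<beta> j) \<le> max (C1 * (sqrt q * \<rho> powr (?d / 2))) (C * (sqrt c * sqrt lam') * ip_norm ip (\<beta> j))"
          using eL2[OF \<beta>H[OF j]] C sn ip_norm_nonneg[OF \<beta>H[OF j]] unfolding L2b
          by (elim order_trans) (intro max.mono mult_right_mono mult_left_mono; simp)
        also have "\<dots> \<le> C1 * (sqrt q * \<rho> powr (?d / 2)) + C * sqrt c * (sqrt lam' * ip_norm ip (\<beta> j))"
          using C q lam'(1) ip_norm_nonneg[OF \<beta>H[OF j]] by (intro max.boundedI) (auto simp: mult.assoc)
        also have "C * sqrt c * (sqrt lam' * ip_norm ip (\<beta> j)) \<le> C * sqrt c * (C2 * 1 * \<rho> powr (?d / 2))"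
        proof (rule mult_left_mono)
          have "C2 * R powr (- m) * \<rho> powr (?d / 2) \<le> C2 * 1 * \<rho> powr (?d / 2)"
            using C2 Rle by (intro mult_right_mono mult_left_mono) auto
          then show "sqrt lam' * ip_norm ip (\<beta> j) \<le> C2 * 1 * \<rho> powr (?d / 2)" using sb[OF j] by linarith
        qed (use C in simp)
        finally have "emp_norm n xs (\<beta> j) \<le> C4 * \<rho> powr (?d / 2)" by (simp add: C4_def algebra_simps)
        moreover have "emp_norm n xs (\<beta> j) \<ge> 0" unfolding emp_norm_def by (intro real_sqrt_ge_zero divide_nonneg_nonneg sum_nonneg) auto
        ultimately have "(emp_norm n xs (\<beta> j))\<^sup>2 \<le> (C4 * \<rho> powr (?d / 2))\<^sup>2" by (intro power_mono)
        moreover have "(emp_norm n xs (\<beta> j))\<^sup>2 = (\<Sum>i=1..n. (\<beta> j (xs i))\<^sup>2) / real n"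
          unfolding emp_norm_def by (intro real_sqrt_pow2 divide_nonneg_nonneg sum_nonneg) auto
        moreover have "(C4 * \<rho> powr (?d / 2))\<^sup>2 = C4\<^sup>2 * \<rho> powr ?d"
          by (simp add: power_mult_distrib \<rho>half)
        ultimately show ?thesis by simp
      qed
      have res: "(\<Sum>i=1..n. (\<beta> j (xs i) - g j (xs i))\<^sup>2) / real n \<le> C2\<^sup>2 * \<rho> powr ?d"
      proof -
        have "lam' * (ip_norm ip (\<beta> j))\<^sup>2 = (sqrt lam' * ip_norm ip (\<beta> j))\<^sup>2" using lam'(1) by (simp add: power_mult_distrib)
        also have "\<dots> \<le> (C2 * R powr (- m) * \<rho> powr (?d / 2))\<^sup>2"
          using lam'(1) ip_norm_nonneg[OF \<beta>H[OF j]] by (intro power_mono sb j) auto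
        also have "\<dots> \<le> (C2 * 1 * \<rho> powr (?d / 2))\<^sup>2"
          using C2 Rle by (intro power_mono mult_right_mono mult_left_mono) auto
        also have "\<dots> = C2\<^sup>2 * \<rho> powr ?d" by (simp add: power_mult_distrib \<rho>half)
        finally show ?thesis using fit(2)[OF j] by linarith
      qed
      have "(\<Sum>i=1..n. (e j i)\<^sup>2) \<le> (\<Sum>i=1..n. 2 * (\<beta> j (xs i))\<^sup>2 + 2 * ?r\<^sup>2 * (\<beta> j (xs i) - g j (xs i))\<^sup>2)"
      proof (rule sum_mono)
        fix i
        have "(x + y)\<^sup>2 \<le> 2 * x\<^sup>2 + 2 * y\<^sup>2" for x y :: real
          using zero_le_power2[of "x - y"] by (simp add: power2_sum power2_diff)
        from this[of "\<beta> j (xs i)" "?r * (\<beta> j (xs i) - g j (xs i))"]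
        show "(e j i)\<^sup>2 \<le> 2 * (\<beta> j (xs i))\<^sup>2 + 2 * ?r\<^sup>2 * (\<beta> j (xs i) - g j (xs i))\<^sup>2"
          unfolding e_def power_mult_distrib by (simp only: mult.assoc)
      qed
      also have "\<dots> = 2 * (\<Sum>i=1..n. (\<beta> j (xs i))\<^sup>2) + 2 * ?r\<^sup>2 * (\<Sum>i=1..n. (\<beta> j (xs i) - g j (xs i))\<^sup>2)"
        by (simp only: sum.distrib sum_distrib_left)
      also have "\<dots> \<le> 2 * (real n * (C4\<^sup>2 * \<rho> powr ?d)) + 2 * (1 / lam0)\<^sup>2 * (real n * (C2\<^sup>2 * \<rho> powr ?d))"
      proof (rule add_mono)
        show "2 * (\<Sum>i=1..n. (\<beta> j (xs i))\<^sup>2) \<le> 2 * (real n * (C4\<^sup>2 * \<rho> powr ?d))"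
          using emp n by (simp add: divide_le_eq mult.commute)
        have "(\<Sum>i=1..n. (\<beta> j (xs i) - g j (xs i))\<^sup>2) \<le> real n * (C2\<^sup>2 * \<rho> powr ?d)"
          using res n by (simp add: divide_le_eq mult.commute)
        then show "2 * ?r\<^sup>2 * (\<Sum>i=1..n. (\<beta> j (xs i) - g j (xs i))\<^sup>2) \<le> 2 * (1 / lam0)\<^sup>2 * (real n * (C2\<^sup>2 * \<rho> powr ?d))"
          using r by (intro mult_mono power_mono sum_nonneg) auto
      qed
      also have "\<dots> = real n * C5 * \<rho> powr ?d" by (simp add: C5_def power_divide algebra_simps)
      finally show ?thesis .
    qed
    \<comment> \<open>half of the exponent in \<open>lam' powr (- d / (2 m))\<close>, the order of the number of bumps, is spent on
       absorbing the constant \<open>y1\<close>; this leads to the constant 2 in the logarithm\<close>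
    define N where "N = real (card J)"
    have N2: "N / 2 \<ge> 2 * lam' powr (- (?d / (4 * m)))"
    proof -
      have y: "y1 \<le> lam' powr (- (?d / (4 * m)))"
      proof -
        have "y1 = (y1 powr (- (4 * m / ?d))) powr (- (?d / (4 * m)))" using y1 mp by (simp add: powr_powr)
        also have "\<dots> \<le> lam' powr (- (?d / (4 * m)))"
          using lam' mp by (intro powr_mono2') (auto simp: lam0_def)
        finally show ?thesis .
      qed
      have "lam' powr (- (?d / (2 * m))) = lam' powr (- (?d / (4 * m))) * lam' powr (- (?d / (4 * m)))"
        using mp by (simp add: field_simps flip: powr_add)
      then have "y1 * lam' powr (- (?d / (4 * m))) \<le> lam' powr (- (?d / (2 * m)))"
        using y by (simp add: mult_right_mono)
      then have "(side / (2 * R)) ^ CARD('d) * (y1 * lam' powr (- (?d / (4 * m)))) \<le> (side / (2 * R)) ^ CARD('d) * lam' powr (- (?d / (2 * m)))"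
        using side R by (intro mult_left_mono) auto
      moreover have "(side / (2 * R)) ^ CARD('d) * y1 = 4"
      proof -
        have "(side / (2 * R)) ^ CARD('d) * (2 * R / side) ^ CARD('d) = 1"
          using side R by (simp flip: power_mult_distrib)
        then show ?thesis unfolding y1_def by (metis mult.commute mult.left_commute mult_1_right)
      qed
      moreover have "(side / (2 * R)) ^ CARD('d) * lam' powr (- (?d / (2 * m))) = (side / (2 * \<rho>)) ^ CARD('d)"
      proof -
        have "lam' powr (- (?d / (2 * m))) = (lam' powr (- (1 / (2 * m)))) powr ?d" using mp by (simp add: powr_powr)
        also have "\<dots> = (lam' powr (- (1 / (2 * m)))) ^ CARD('d)" using lam'(1) by (simp add: powr_realpow)
        also have "lam' powr (- (1 / (2 * m))) = 1 / lam' powr (1 / (2 * m))" by (rule powr_minus_divide)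
        finally show ?thesis by (simp add: \<rho>_def mult.assoc flip: power_mult_distrib)
      qed
      ultimately have "4 * lam' powr (- (?d / (4 * m))) \<le> (side / (2 * \<rho>)) ^ CARD('d)" by (metis mult.assoc)
      then show ?thesis using J(2) by (simp add: N_def)
    qed
    have "1 powr (- (?d / (4 * m))) \<le> lam' powr (- (?d / (4 * m)))" using lam' lam mp by (intro powr_mono2') auto
    then have N1: "N / 2 \<ge> 2" using N2 by simp
    define V where "V = ln (N / 2)"
    have V: "V \<ge> ?d / (4 * m) * ln (2 / lam)" "V > 0" "exp V = N / 2"
    proof -
      show "V > 0" "exp V = N / 2" unfolding V_def using N1 by auto
      have dm: "?d / (4 * m) \<le> 1" "0 \<le> ?d / (4 * m)" using order mp by (auto simp: divide_le_eq)
      have "?d / (4 * m) * ln (2 / lam) = ?d / (4 * m) * ln 2 + ?d / (4 * m) * (- ln lam)"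
      proof -
        have "ln (2 / lam) = ln 2 + (- ln lam)" using lam by (simp add: ln_div)
        then show ?thesis by (simp only: distrib_left)
      qed
      also have "\<dots> \<le> ln 2 + ?d / (4 * m) * (- ln lam')"
      proof (rule add_mono)
        show "?d / (4 * m) * ln 2 \<le> ln 2" using dm(1) mult_right_mono[of "?d / (4 * m)" 1 "ln 2"] by simp
        show "?d / (4 * m) * (- ln lam) \<le> ?d / (4 * m) * (- ln lam')" using dm(2) lam lam' by (intro mult_left_mono) auto
      qed
      also have "\<dots> = ln (2 * lam' powr (- (?d / (4 * m))))" using lam'(1) by (simp add: ln_mult ln_powr)
      also have "\<dots> \<le> V" unfolding V_def using N1 N2 lam'(1) by (subst ln_le_cancel_iff) auto
      finally show "V \<ge> ?d / (4 * m) * ln (2 / lam)" .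
    qed
    \<comment> \<open>the level, calibrated so that a translation costs \<open>V\<close>, the logarithm of half the number of bumps\<close>
    define \<kappa> where "\<kappa> = \<sigma> * q * sqrt (\<rho> powr ?d * V / (8 * C5 * real n))"
    have \<kappa>: "\<kappa> > 0" using \<sigma> q \<rho>d V C5 n by (simp add: \<kappa>_def)
    define S where "S = {E \<in> space (noise_law n \<sigma>). \<forall>j\<in>J. \<bar>lin n (A j) E\<bar> < \<kappa>}"
    define sc where "sc = 4 * \<kappa> / (q * \<rho> powr ?d)"
    have sc: "sc > 0" "sc * (q * \<rho> powr ?d) = 4 * \<kappa>" using \<kappa> q \<rho>d by (simp_all add: sc_def)
    have lsc: "lin n a (\<lambda>i. sc * E i) = sc * lin n a E" for a E by (simp add: lin_def sum_distrib_left mult_ac)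
    have "measure (noise_law n \<sigma>) S * (2 * real (card J) * exp (- V)) \<le> 1"
      unfolding S_def
    proof (rule small_maximum_probability[OF \<sigma> J(1) \<kappa>, of n A "\<lambda>j i. sc * e j i"])
      fix j assume j: "j \<in> J"
      have "sc * (7 / 8 * q * \<rho> powr ?d) \<le> sc * lin n (A j) (e j)" using sc(1) by (intro mult_left_mono diag j) auto
      moreover have "sc * (7 / 8 * q * \<rho> powr ?d) = 7 / 8 * (sc * (q * \<rho> powr ?d))" by simp
      ultimately show "3 * \<kappa> \<le> lin n (A j) (\<lambda>i. sc * e j i)" unfolding lsc sc(2) using \<kappa> by linarith
      have "(\<Sum>i=1..n. (sc * e j i)\<^sup>2) / (2 * \<sigma>\<^sup>2) = sc\<^sup>2 * (\<Sum>i=1..n. (e j i)\<^sup>2) / (2 * \<sigma>\<^sup>2)"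
        by (simp add: power_mult_distrib sum_distrib_left)
      also have "\<dots> \<le> sc\<^sup>2 * (real n * C5 * \<rho> powr ?d) / (2 * \<sigma>\<^sup>2)"
        by (intro divide_right_mono mult_left_mono esq j) auto
      also have "\<dots> = V"
      proof -
        have "\<kappa>\<^sup>2 = \<sigma>\<^sup>2 * q\<^sup>2 * (\<rho> powr ?d * V / (8 * C5 * real n))"
          using \<rho>d V C5 n by (simp add: \<kappa>_def power_mult_distrib)
        moreover have "sc\<^sup>2 = 16 * \<kappa>\<^sup>2 / (q\<^sup>2 * (\<rho> powr ?d)\<^sup>2)" by (simp add: sc_def power_divide power_mult_distrib)
        ultimately have "sc\<^sup>2 = 2 * \<sigma>\<^sup>2 * V / (C5 * real n * \<rho> powr ?d)"
          using \<sigma> q \<rho>d(2) C5 n by (simp only:) (simp add: field_simps power2_eq_square)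
        then show ?thesis using \<sigma> q \<rho>d(2) C5 n by (simp add: field_simps)
      qed
      finally show "(\<Sum>i=1..n. (sc * e j i)\<^sup>2) / (2 * \<sigma>\<^sup>2) \<le> V" .
    next
      fix j k assume jk: "j \<in> J" "k \<in> J" "j \<noteq> k"
      have "\<bar>lin n (A k) (\<lambda>i. sc * e j i)\<bar> = sc * \<bar>lin n (A k) (e j)\<bar>" unfolding lsc using sc(1) by (simp add: abs_mult)
      also have "\<dots> \<le> sc * (q / 8 * \<rho> powr ?d)" using sc(1) by (intro mult_left_mono off jk) auto
      also have "\<dots> = \<kappa> / 2" using sc(2) by (simp add: field_simps)
      finally show "\<bar>lin n (A k) (\<lambda>i. sc * e j i)\<bar> \<le> \<kappa> / 2" .
    qed
    moreover have "2 * real (card J) * exp (- V) = 4" using V(3) N1 by (simp add: exp_minus N_def field_simps)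
    ultimately have S4: "measure (noise_law n \<sigma>) S \<le> 1 / 4" by simp
    have Ssets: "S \<in> sets (noise_law n \<sigma>)"
      unfolding S_def using J(1) lin_measurable[of n _ \<sigma>] by measurable
    have "B1 * \<sigma> * real n powr (- 1 / 2) * lam powr (- (?d + 2 * real ?k) / (4 * m)) * sqrt (ln (2 / lam)) \<le> bb"
      if E: "E \<in> space (noise_law n \<sigma>) - S" and bb: "\<forall>t\<in>?U. \<bar>mderiv \<alpha> (krr H ip lam n xs E) t\<bar> \<le> bb" for E bb
    proof -
      obtain j where j: "j \<in> J" "\<kappa> \<le> \<bar>lin n (A j) E\<bar>" using E by (auto simp: S_def not_less)
      have "\<bar>lin n (A j) E\<bar> \<le> \<rho> ^ (CARD('d) + ?k) * bb * p"
        unfolding lin \<beta>_def \<theta>_def p_def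
      proof (rule integral_against_derived_bump_le[OF _ b \<eta>pos \<rho>0 cellU[OF j(1)]])
        show "krr H ip lam n xs E \<in> sobolev_space \<Omega> m" using krr_mem[where xs = xs, OF xs lam(1)] H by simp
      qed (use bb in blast)
      then have "\<kappa> \<le> \<rho> powr (?d + real ?k) * p * bb" using j(2) \<rho>0 by (simp add: powr_add powr_realpow power_add mult_ac)
      then have kb: "\<kappa> / (\<rho> powr (?d + real ?k) * p) \<le> bb" using \<rho>0 p by (simp add: divide_le_eq mult.commute)
      have "B1 * \<sigma> * real n powr (- 1 / 2) * lam powr (- (?d + 2 * real ?k) / (4 * m)) * sqrt (ln (2 / lam))
         = \<sigma> * (q / (p * sqrt (8 * C5))) * real n powr (- 1 / 2) * (R powr (- (?d / 2 + real ?k)) * lam powr (- (?d + 2 * real ?k) / (4 * m)))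
            * sqrt (?d / (4 * m) * ln (2 / lam))"
        unfolding real_sqrt_mult[of "?d / (4 * m)"] B1_def by (simp only: mult_ac)
      also have "\<dots> \<le> \<sigma> * (q / (p * sqrt (8 * C5))) * real n powr (- 1 / 2) * \<rho> powr (- (?d / 2 + real ?k)) * sqrt V"
      proof (intro mult_mono order_refl)
        have "R powr (- (?d / 2 + real ?k)) * lam powr (- (?d + 2 * real ?k) / (4 * m)) = (R * lam powr (1 / (2 * m))) powr (- (?d / 2 + real ?k))"
        proof -
          have "(R * lam powr (1 / (2 * m))) powr (- (?d / 2 + real ?k)) = R powr (- (?d / 2 + real ?k)) * (lam powr (1 / (2 * m))) powr (- (?d / 2 + real ?k))"
            using R by (subst powr_mult) auto
          also have "(lam powr (1 / (2 * m))) powr (- (?d / 2 + real ?k)) = lam powr (- (?d + 2 * real ?k) / (4 * m))"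
          proof -
            have "1 / (2 * m) * (- (?d / 2 + real ?k)) = - (?d + 2 * real ?k) / (4 * m)" using mp by (simp add: field_simps)
            then show ?thesis by (simp only: powr_powr)
          qed
          finally show ?thesis by simp
        qed
        also have "\<dots> \<le> \<rho> powr (- (?d / 2 + real ?k))"
        proof (rule powr_mono2')
          show "- (?d / 2 + real ?k) \<le> 0" by (simp add: add_nonneg_nonneg)
          show "\<rho> \<le> R * lam powr (1 / (2 * m))"
            unfolding \<rho>_def using R lam' mp by (intro mult_left_mono powr_mono2) auto
        qed (rule \<rho>0)
        finally show "R powr (- (?d / 2 + real ?k)) * lam powr (- (?d + 2 * real ?k) / (4 * m)) \<le> \<rho> powr (- (?d / 2 + real ?k))" .
        show "sqrt (?d / (4 * m) * ln (2 / lam)) \<le> sqrt V" using V(1) by simp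
        have "ln (2 / lam) \<ge> 0" using lam by simp
        then show "0 \<le> sqrt (?d / (4 * m) * ln (2 / lam))" using mp by simp
      qed (use \<sigma> q p C5 R in auto)
      also have "\<dots> = \<kappa> / (\<rho> powr (?d + real ?k) * p)"
      proof -
        have s: "sqrt (\<rho> powr ?d * V / (8 * C5 * real n)) = \<rho> powr (?d / 2) * sqrt V / sqrt (8 * C5) * real n powr (- 1 / 2)"
        proof -
          have "sqrt (\<rho> powr ?d) = \<rho> powr (?d / 2)" by (simp add: powr_half_sqrt[symmetric] powr_powr)
          moreover have "real n powr (- 1 / 2) = 1 / sqrt (real n)"
            by (simp add: powr_minus_divide powr_half_sqrt)
          ultimately show ?thesis by (simp add: real_sqrt_mult real_sqrt_divide)
        qed
        have e: "\<rho> powr (- (?d / 2 + real ?k)) = \<rho> powr (?d / 2) / \<rho> powr (?d + real ?k)"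
        proof -
          have "- (?d / 2 + real ?k) = ?d / 2 - (?d + real ?k)" by simp
          then show ?thesis by (simp only: powr_diff)
        qed
        show ?thesis unfolding \<kappa>_def s e by (simp add: mult_ac)
      qed
      also note kb
      finally show ?thesis .
    qed
    with Ssets S4 show "\<exists>S\<in>sets (noise_law n \<sigma>). measure (noise_law n \<sigma>) S \<le> 1 / 4 \<and>
        (\<forall>E\<in>space (noise_law n \<sigma>) - S. \<forall>b. (\<forall>t\<in>interior \<Omega>. \<bar>mderiv \<alpha> (krr H ip lam n xs E) t\<bar> \<le> b) \<longrightarrow>
          B1 * \<sigma> * real n powr (- 1 / 2) * lam powr (- (?d + 2 * real ?k) / (4 * m)) * sqrt (ln (2 / lam)) \<le> b)"
      by blast
  qed
qed

section \<open>Random designs\<close>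

context smooth_sobolev
begin

text \<open>The estimator is linear in the data and the errors have mean zero: the regression function \<open>f\<close> cancels
  and the centred estimator is the fit to the pure noise.\<close>

lemma krr_deriv_centred:
  assumes rk: "rkhs \<Omega> K H ip" and H: "H = sobolev_space \<Omega> m"
    and M: "prob_space M" and e: "gaussian_errors M \<sigma> e" "\<sigma> > 0" and lam: "lam > 0"
    and xs: "\<And>i. i \<in> {1..n} \<Longrightarrow> x n i w \<in> \<Omega>" and t: "t \<in> \<Omega>"
  shows "krr_deriv \<Omega> H ip \<alpha> f x e lam n w w t - (\<integral>w'. krr_deriv \<Omega> H ip \<alpha> f x e lam n w w' t \<partial>M)
    = mderiv_on \<Omega> \<alpha> (krr H ip lam n (\<lambda>i. x n i w) (\<lambda>i. e i w)) t"
proof -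
  interpret rkhs \<Omega> K H ip by fact
  interpret prob_space M by fact
  let ?X = "\<lambda>i. x n i w"
  define c where "c j = mderiv_on \<Omega> \<alpha> (krr H ip lam n ?X (\<lambda>i. if i = j then 1 else 0)) t" for j
  have lin: "mderiv_on \<Omega> \<alpha> (krr H ip lam n ?X ys) t = (\<Sum>j=1..n. ys j * c j)" for ys
  proof -
    have eq: "krr H ip lam n ?X ys = (\<lambda>t. \<Sum>j=1..n. ys j * krr H ip lam n ?X (\<lambda>i. if i = j then 1 else 0) t)"
      by (rule krr_linear_combination[where xs = ?X, OF xs lam])
    have mem: "krr H ip lam n ?X zs \<in> sobolev_space \<Omega> m" for zs
      using krr_mem[where xs = ?X, OF xs lam] H by simp
    show ?thesis
      unfolding c_def by (subst eq, rule mderiv_on_sum[OF mem t]) (simp only: eq[symmetric] mem)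
  qed
  have int: "integrable M (e j)" "expectation (e j) = 0" if "j \<in> {1..n}" for j
    using gaussian_errors_mean_zero[OF e(1) _ e(2), of j] that by auto
  have "(\<integral>w'. krr_deriv \<Omega> H ip \<alpha> f x e lam n w w' t \<partial>M) = (\<integral>w'. (\<Sum>j=1..n. f (x n j w) * c j + e j w' * c j) \<partial>M)"
    unfolding krr_deriv_def lin by (simp add: distrib_right)
  also have "\<dots> = (\<Sum>j=1..n. \<integral>w'. f (x n j w) * c j + e j w' * c j \<partial>M)"
    by (intro Bochner_Integration.integral_sum Bochner_Integration.integrable_add integrable_mult_left int) auto
  also have "\<dots> = (\<Sum>j=1..n. f (x n j w) * c j)"
  proof (intro sum.cong refl)
    fix j assume j: "j \<in> {1..n}"
    have "(\<integral>w'. f (x n j w) * c j + e j w' * c j \<partial>M) = (\<integral>w'. f (x n j w) * c j \<partial>M) + (\<integral>w'. e j w' * c j \<partial>M)"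
      by (intro Bochner_Integration.integral_add integrable_mult_left int j) auto
    then show "(\<integral>w'. f (x n j w) * c j + e j w' * c j \<partial>M) = f (x n j w) * c j"
      using int[OF j] by (simp add: prob_space)
  qed
  finally show ?thesis
    unfolding krr_deriv_def lin by (simp add: distrib_right sum.distrib)
qed

text \<open>A good design has probability at least \<open>3/4\<close>, and given a good design the bound holds with probability
  at least \<open>3/4\<close>; the product exceeds \<open>1/2\<close>.\<close>

lemma probability_for_random_design:
  assumes rk: "rkhs \<Omega> K H ip" and H: "H = sobolev_space \<Omega> m" and M: "prob_space M"
    and x: "\<And>i. i \<in> {1..n} \<Longrightarrow> x n i \<in> borel_measurable M"
      "\<And>i w. i \<in> {1..n} \<Longrightarrow> w \<in> space M \<Longrightarrow> x n i w \<in> \<Omega>"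
    and e: "gaussian_errors M \<sigma> e" "\<sigma> > 0" and ind: "indep_of_design M x e"
    and n: "n \<ge> 1" and lam: "lam > 0"
    and G: "G \<in> sets M" "3 / 4 \<le> measure M G"
    and bound: "\<And>w. w \<in> G \<Longrightarrow> \<exists>S\<in>sets (noise_law n \<sigma>). measure (noise_law n \<sigma>) S \<le> 1 / 4 \<and>
        (\<forall>E\<in>space (noise_law n \<sigma>) - S. \<forall>b. (\<forall>t\<in>interior \<Omega>. \<bar>mderiv \<alpha> (krr H ip lam n (\<lambda>i. x n i w) E) t\<bar> \<le> b) \<longrightarrow> T \<le> b)"
  shows "1 / 2 \<le> measure M {w \<in> space M. (SUP t\<in>\<Omega>. ereal \<bar>mderiv_on \<Omega> \<alpha> (krr H ip lam n (\<lambda>i. x n i w) (\<lambda>i. e i w)) t\<bar>) \<ge> ereal T}"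
proof -
  interpret rkhs \<Omega> K H ip by fact
  interpret prob_space M by fact
  let ?\<nu> = "noise_law n \<sigma>"
  let ?X = "\<lambda>w. \<lambda>i\<in>{1..n}. x n i w" and ?E = "\<lambda>w. \<lambda>i\<in>{1..n}. e i w"
  let ?B = "\<Pi>\<^sub>M i\<in>{1..n}. borel :: (real^'d) measure"
  let ?R = "\<Pi>\<^sub>M i\<in>{1..n}. borel :: real measure"
  interpret \<nu>: prob_space ?\<nu> by (rule prob_space_noise_law[OF e(2)])
  define F where "F = vimage_algebra (space M) ?X ?B"
  have spF: "space F = space M" by (simp add: F_def)
  have Xsp: "?X \<in> space M \<rightarrow> space ?B" by (auto simp: space_PiM)
  have ind': "indep_set (sets F) (sets (vimage_algebra (space M) ?E ?R))"
    using ind unfolding indep_of_design_def F_def by blast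
  have setsF: "sets F \<subseteq> sets M" by (rule indep_setD_ev1[OF ind'])
  note Elaw = gaussian_errors_law[OF e(1) n]
  obtain D where D: "countable D" "D \<subseteq> interior \<Omega>" "interior \<Omega> \<subseteq> closure D" using separable[of "interior \<Omega>"] by metis
  define N where "N = F \<Otimes>\<^sub>M ?\<nu>"
  define g where "g z = krr H ip lam n (\<lambda>i. x n i (fst z)) (\<lambda>i. snd z i)" for z :: "_ \<times> (nat \<Rightarrow> real)"
  define A where "A = {z \<in> space N. ereal T \<le> (SUP t\<in>D. ereal \<bar>mderiv \<alpha> (g z) t\<bar>)}"
  have spN: "space N = space M \<times> space ?\<nu>" by (simp add: N_def space_pair_measure spF)
  have gH: "g z \<in> sobolev_space \<Omega> m" if "z \<in> space N" for z
    unfolding g_def H[symmetric]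
    by (rule krr_mem[where xs = "\<lambda>i. x n i (fst z)", OF x(2) lam]) (use that spN in auto)
  have Xm: "(\<lambda>z. x n i (fst z)) \<in> borel_measurable N" if "i \<in> {1..n}" for i
  proof -
    have "(\<lambda>w. ?X w i) \<in> borel_measurable F"
      unfolding F_def by (rule measurable_compose[OF measurable_vimage_algebra1[OF Xsp] measurable_component_singleton[OF that]])
    then have "x n i \<in> borel_measurable F" using that by simp
    then show ?thesis unfolding N_def by (rule measurable_compose[OF measurable_fst])
  qed
  have Ym: "(\<lambda>z. snd z i) \<in> borel_measurable N" if "i \<in> {1..n}" for i
  proof -
    have "(\<lambda>E. E i) \<in> borel_measurable ?\<nu>"
      using measurable_component_singleton[OF that, of "\<lambda>_. borel :: real measure"]
      by (simp cong: measurable_cong_sets add: sets_noise_law)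
    then show ?thesis unfolding N_def by (rule measurable_compose[OF measurable_snd])
  qed
  have gt: "(\<lambda>z. g z t) \<in> borel_measurable N" if "t \<in> interior \<Omega>" for t
    unfolding g_def
  proof (rule krr_measurable[OF rk compact_imp_closed[OF compact] _ Xm _ Ym lam])
    show "continuous_on \<Omega> v" if "v \<in> H" for v using sobolev_spaceD(2)[of v] that H by blast
    show "x n i (fst w) \<in> \<Omega>" if "i \<in> {1..n}" "w \<in> space N" for i w using that x(2) spN by auto
    show "t \<in> \<Omega>" using that interior_subset by blast
  qed
  have sup: "(\<lambda>z. SUP t\<in>D. ereal \<bar>mderiv \<alpha> (g z) t\<bar>) \<in> borel_measurable N"
  proof (rule borel_measurable_SUP[OF D(1)])
    fix t assume "t \<in> D"
    then have "(\<lambda>z. mderiv \<alpha> (g z) t) \<in> borel_measurable N" using D(2) by (intro mderiv_measurable gH gt) auto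
    then show "(\<lambda>z. ereal \<bar>mderiv \<alpha> (g z) t\<bar>) \<in> borel_measurable N" by measurable
  qed
  then have A: "A \<in> sets (F \<Otimes>\<^sub>M ?\<nu>)" unfolding A_def N_def[symmetric] by measurable
  have "3 / 4 * (3 / 4) \<le> prob {w \<in> space M. (w, ?E w) \<in> A}"
  proof (rule probability_from_conditional_bound[OF spF setsF Elaw \<nu>.prob_space_axioms _ A G])
    fix P Q assume P: "P \<in> sets F" and Q: "Q \<in> sets ?\<nu>"
    have "?E -` Q \<inter> space M \<in> sets (vimage_algebra (space M) ?E ?R)"
      using Q sets_noise_law by (intro in_vimage_algebra) auto
    then show "prob (P \<inter> (?E -` Q \<inter> space M)) = prob P * prob (?E -` Q \<inter> space M)"
      by (rule indep_setD[OF ind' P])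
  next
    fix w assume w: "w \<in> G"
    then have wM: "w \<in> space M" using sets.sets_into_space[OF G(1)] by blast
    obtain S where S: "S \<in> sets ?\<nu>" "measure ?\<nu> S \<le> 1 / 4"
      "\<forall>E\<in>space ?\<nu> - S. \<forall>b. (\<forall>t\<in>interior \<Omega>. \<bar>mderiv \<alpha> (krr H ip lam n (\<lambda>i. x n i w) E) t\<bar> \<le> b) \<longrightarrow> T \<le> b"
      using bound[OF w] by blast
    have "space ?\<nu> - S \<subseteq> Pair w -` A"
    proof
      fix E assume E: "E \<in> space ?\<nu> - S"
      then have zN: "(w, E) \<in> space N" using wM spN by auto
      have "ereal T \<le> (SUP t\<in>D. ereal \<bar>mderiv \<alpha> (g (w, E)) t\<bar>)"
      proof (rule ccontr)
        assume "\<not> ?thesis"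
        then have "(SUP t\<in>D. ereal \<bar>mderiv \<alpha> (g (w, E)) t\<bar>) < ereal T" by (simp only: not_le)
        then obtain b where b: "(SUP t\<in>D. ereal \<bar>mderiv \<alpha> (g (w, E)) t\<bar>) < ereal b" "ereal b < ereal T"
          using ereal_dense2 by blast
        have "\<bar>mderiv \<alpha> (g (w, E)) t\<bar> \<le> b" if "t \<in> D" for t
        proof -
          have "ereal \<bar>mderiv \<alpha> (g (w, E)) t\<bar> \<le> ereal b" by (rule order_trans[OF SUP_upper[OF that] less_imp_le[OF b(1)]])
          then show ?thesis by simp
        qed
        then have "\<bar>mderiv_on \<Omega> \<alpha> (g (w, E)) t\<bar> \<le> b" if "t \<in> \<Omega>" for t
          using bounded_on_dense_imp[OF gH[OF zN] D(2,3) _ that] by blast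
        then have "\<forall>t\<in>interior \<Omega>. \<bar>mderiv \<alpha> (krr H ip lam n (\<lambda>i. x n i w) E) t\<bar> \<le> b"
          using interior_subset[of \<Omega>] by (auto simp: g_def simp flip: mderiv_on_interior)
        then have "T \<le> b" using S(3) E by blast
        then show False using b(2) by simp
      qed
      then show "E \<in> Pair w -` A" using zN by (simp add: A_def)
    qed
    moreover have "Pair w -` A \<in> sets ?\<nu>" by (rule sets_Pair1[OF A])
    ultimately have "measure ?\<nu> (space ?\<nu> - S) \<le> measure ?\<nu> (Pair w -` A)" by (rule \<nu>.finite_measure_mono)
    then show "3 / 4 \<le> measure ?\<nu> (Pair w -` A)" using S(2) \<nu>.prob_compl[OF S(1)] by simp
  qed simp_all
  moreover have "{w \<in> space M. (w, ?E w) \<in> A} =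
    {w \<in> space M. ereal T \<le> (SUP t\<in>\<Omega>. ereal \<bar>mderiv_on \<Omega> \<alpha> (krr H ip lam n (\<lambda>i. x n i w) (\<lambda>i. e i w)) t\<bar>)}"
  proof (intro Collect_cong conj_cong refl)
    fix w assume w: "w \<in> space M"
    have zN: "(w, ?E w) \<in> space N" using w measurable_space[OF Elaw(1)] spN by auto
    have "g (w, ?E w) = krr H ip lam n (\<lambda>i. x n i w) (\<lambda>i. e i w)"
      unfolding g_def fst_conv snd_conv using x(2)[OF _ w] by (intro krr_cong[where xs = "\<lambda>i. x n i w"]) simp_all
    then show "((w, ?E w) \<in> A) = (ereal T \<le> (SUP t\<in>\<Omega>. ereal \<bar>mderiv_on \<Omega> \<alpha> (krr H ip lam n (\<lambda>i. x n i w) (\<lambda>i. e i w)) t\<bar>))"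
      using SUP_mderiv_on_eq[OF gH[OF zN] D(2,3)] zN by (simp add: A_def)
  qed
  ultimately show ?thesis by simp
qed

end

section \<open>The lower bound in probability\<close>

theorem theorem13:
  fixes \<Omega> :: "(real^'d) set" and K :: "real^'d \<Rightarrow> real^'d \<Rightarrow> real"
    and H :: "(real^'d \<Rightarrow> real) set" and ip :: "(real^'d \<Rightarrow> real) \<Rightarrow> (real^'d \<Rightarrow> real) \<Rightarrow> real"
    and m c :: real and \<alpha> :: "nat^'d"
    and M :: "'w measure" and x :: "nat \<Rightarrow> nat \<Rightarrow> 'w \<Rightarrow> real^'d" and f :: "real^'d \<Rightarrow> real"
  assumes "convex \<Omega>" and "compact \<Omega>" and "interior \<Omega> \<noteq> {}"
    and "rkhs \<Omega> K H ip"
    and "m > real CARD('d) / 2 + real (mi_order \<alpha>)"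
    and "H = sobolev_space \<Omega> m"
    and "\<exists>a>0. \<exists>b>0. \<forall>v\<in>H. a * ip_norm ip v \<le> sobolev_norm \<Omega> m v \<and>
           sobolev_norm \<Omega> m v \<le> b * ip_norm ip v"
    and "f \<in> H"
    and "prob_space M"
    and "\<And>n i. i \<in> {1..n} \<Longrightarrow> x n i \<in> borel_measurable M"
    and "\<And>n i w. i \<in> {1..n} \<Longrightarrow> w \<in> space M \<Longrightarrow> x n i w \<in> \<Omega>"
    and "norm_comparison M \<Omega> H ip m x"
    and "c > 0"
  shows "\<exists>B1>0. \<exists>B2>1. \<forall>\<sigma>>0. \<forall>lam :: nat \<Rightarrow> real. \<forall>e :: nat \<Rightarrow> 'w \<Rightarrow> real.
    gaussian_errors M \<sigma> e \<longrightarrow> indep_of_design M x e \<longrightarrow>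
    (\<forall>n\<ge>1. 0 < lam n \<and> lam n \<le> 1 \<and> real n powr (- 2 * m / real CARD('d)) \<le> c * lam n) \<longrightarrow>
    (\<forall>\<^sub>F n in sequentially.
      \<P>(w in M.
        (SUP t\<in>\<Omega>. ereal \<bar>krr_deriv \<Omega> H ip \<alpha> f x e (lam n) n w w t -
            (\<integral>w'. krr_deriv \<Omega> H ip \<alpha> f x e (lam n) n w w' t \<partial>M)\<bar>)
        \<ge> ereal (B1 * \<sigma> * real n powr (- 1 / 2) *
            lam n powr (- (real CARD('d) + 2 * real (mi_order \<alpha>)) / (4 * m)) *
            sqrt (ln (B2 / lam n))))
      \<ge> 1 / 2)"
proof -
  interpret smooth_sobolev \<Omega> m \<alpha> by unfold_locales (use assms in auto)
  interpret prob_space M by fact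
  let ?d = "real CARD('d)"
  obtain a where a: "a > 0" "\<And>v. v \<in> H \<Longrightarrow> a * ip_norm ip v \<le> sobolev_norm \<Omega> m v" using assms(7) by blast
  obtain C1 where C1: "C1 > 0" "\<forall>\<epsilon>>0. \<exists>C>0. \<forall>n\<ge>1.
        \<P>(w in M. \<forall>v\<in>H.
          L2_norm_on \<Omega> v \<le> max (C1 * emp_norm n (\<lambda>i. x n i w) v) (C * real n powr (- m / ?d) * ip_norm ip v) \<and>
          emp_norm n (\<lambda>i. x n i w) v \<le> max (C1 * L2_norm_on \<Omega> v) (C * real n powr (- m / ?d) * ip_norm ip v))
        \<ge> 1 - \<epsilon>"
    using assms(12) unfolding norm_comparison_def by blast
  obtain C where C: "C > 0" and G: "\<forall>n\<ge>1.
        \<P>(w in M. \<forall>v\<in>H.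
          L2_norm_on \<Omega> v \<le> max (C1 * emp_norm n (\<lambda>i. x n i w) v) (C * real n powr (- m / ?d) * ip_norm ip v) \<and>
          emp_norm n (\<lambda>i. x n i w) v \<le> max (C1 * L2_norm_on \<Omega> v) (C * real n powr (- m / ?d) * ip_norm ip v))
        \<ge> 1 - 1 / 4"
    using C1(2)[rule_format, of "1 / 4"] by auto
  obtain B1 lam0 where B1: "B1 > 0" "0 < lam0" "lam0 \<le> 1" and
    bound: "\<And>n xs lam \<sigma>. n \<ge> 1 \<Longrightarrow> (\<And>i. i \<in> {1..n} \<Longrightarrow> xs i \<in> \<Omega>) \<Longrightarrow>
      (\<And>v. v \<in> H \<Longrightarrow> L2_norm_on \<Omega> v \<le> max (C1 * emp_norm n xs v) (C * real n powr (- m / ?d) * ip_norm ip v)) \<Longrightarrow>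
      (\<And>v. v \<in> H \<Longrightarrow> emp_norm n xs v \<le> max (C1 * L2_norm_on \<Omega> v) (C * real n powr (- m / ?d) * ip_norm ip v)) \<Longrightarrow>
      0 < lam \<Longrightarrow> lam \<le> 1 \<Longrightarrow> real n powr (- 2 * m / ?d) \<le> c * min lam lam0 \<Longrightarrow> \<sigma> > 0 \<Longrightarrow>
      \<exists>S\<in>sets (noise_law n \<sigma>). measure (noise_law n \<sigma>) S \<le> 1 / 4 \<and>
        (\<forall>E\<in>space (noise_law n \<sigma>) - S. \<forall>b. (\<forall>t\<in>interior \<Omega>. \<bar>mderiv \<alpha> (krr H ip lam n xs E) t\<bar> \<le> b) \<longrightarrow>
          B1 * \<sigma> * real n powr (- 1 / 2) * lam powr (- (?d + 2 * real (mi_order \<alpha>)) / (4 * m)) * sqrt (ln (2 / lam)) \<le> b)"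
    using lower_bound_fixed_design[OF assms(4,6) a C1(1) C assms(13)] by metis
  have "\<forall>\<^sub>F n in sequentially.
      \<P>(w in M.
        (SUP t\<in>\<Omega>. ereal \<bar>krr_deriv \<Omega> H ip \<alpha> f x e (lam n) n w w t -
            (\<integral>w'. krr_deriv \<Omega> H ip \<alpha> f x e (lam n) n w w' t \<partial>M)\<bar>)
        \<ge> ereal (B1 * \<sigma> * real n powr (- 1 / 2) *
            lam n powr (- (?d + 2 * real (mi_order \<alpha>)) / (4 * m)) * sqrt (ln (2 / lam n))))
      \<ge> 1 / 2"
    if \<sigma>: "\<sigma> > 0" and e: "gaussian_errors M \<sigma> e" "indep_of_design M x e"
      and lam: "\<forall>n\<ge>1. 0 < lam n \<and> lam n \<le> 1 \<and> real n powr (- 2 * m / ?d) \<le> c * lam n" for \<sigma> lam e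
  proof -
    have "((\<lambda>n. real n powr (- 2 * m / ?d)) \<longlongrightarrow> 0) sequentially"
      using m_pos by (intro tendsto_neg_powr filterlim_real_sequentially) (simp add: divide_neg_pos)
    then have "\<forall>\<^sub>F n in sequentially. real n powr (- 2 * m / ?d) < c * lam0"
      using assms(13) B1(2) by (intro order_tendstoD) auto
    then show ?thesis using eventually_ge_at_top[of 1]
    proof eventually_elim
      case (elim n)
      let ?T = "B1 * \<sigma> * real n powr (- 1 / 2) * lam n powr (- (?d + 2 * real (mi_order \<alpha>)) / (4 * m)) * sqrt (ln (2 / lam n))"
      define G' where "G' = {w \<in> space M. \<forall>v\<in>H.
          L2_norm_on \<Omega> v \<le> max (C1 * emp_norm n (\<lambda>i. x n i w) v) (C * real n powr (- m / ?d) * ip_norm ip v) \<and>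
          emp_norm n (\<lambda>i. x n i w) v \<le> max (C1 * L2_norm_on \<Omega> v) (C * real n powr (- m / ?d) * ip_norm ip v)}"
      have pG: "3 / 4 \<le> prob G'" using G elim(2) by (simp add: G'_def)
      have ln: "0 < lam n" "lam n \<le> 1" "real n powr (- 2 * m / ?d) \<le> c * lam n" using lam elim(2) by blast+
      then have nl: "real n powr (- 2 * m / ?d) \<le> c * min (lam n) lam0" using elim(1) by (simp add: min_def)
      \<comment> \<open>non-measurable sets have measure 0, so the event of norm comparison is measurable\<close>
      have sG: "G' \<in> sets M" using pG measure_notin_sets[of G' M] by fastforce
      have "1 / 2 \<le> prob {w \<in> space M. (SUP t\<in>\<Omega>. ereal \<bar>mderiv_on \<Omega> \<alpha> (krr H ip (lam n) n (\<lambda>i. x n i w) (\<lambda>i. e i w)) t\<bar>) \<ge> ereal ?T}"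
      proof (rule probability_for_random_design[where x = x, OF assms(4,6,9) assms(10,11) e(1) \<sigma> e(2) elim(2) ln(1) sG pG])
        fix w assume "w \<in> G'"
        then have w: "w \<in> space M" and
          nc: "\<And>v. v \<in> H \<Longrightarrow> L2_norm_on \<Omega> v \<le> max (C1 * emp_norm n (\<lambda>i. x n i w) v) (C * real n powr (- m / ?d) * ip_norm ip v)"
            "\<And>v. v \<in> H \<Longrightarrow> emp_norm n (\<lambda>i. x n i w) v \<le> max (C1 * L2_norm_on \<Omega> v) (C * real n powr (- m / ?d) * ip_norm ip v)"
          unfolding G'_def by blast+
        show "\<exists>S\<in>sets (noise_law n \<sigma>). measure (noise_law n \<sigma>) S \<le> 1 / 4 \<and>
          (\<forall>E\<in>space (noise_law n \<sigma>) - S. \<forall>b. (\<forall>t\<in>interior \<Omega>. \<bar>mderiv \<alpha> (krr H ip (lam n) n (\<lambda>i. x n i w) E) t\<bar> \<le> b) \<longrightarrow> ?T \<le> b)"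
          by (rule bound[of n "\<lambda>i. x n i w", OF elim(2) assms(11)[OF _ w] nc ln(1,2) nl \<sigma>])
      qed
      also have "{w \<in> space M. (SUP t\<in>\<Omega>. ereal \<bar>mderiv_on \<Omega> \<alpha> (krr H ip (lam n) n (\<lambda>i. x n i w) (\<lambda>i. e i w)) t\<bar>) \<ge> ereal ?T}
        = {w \<in> space M. (SUP t\<in>\<Omega>. ereal \<bar>krr_deriv \<Omega> H ip \<alpha> f x e (lam n) n w w t -
            (\<integral>w'. krr_deriv \<Omega> H ip \<alpha> f x e (lam n) n w w' t \<partial>M)\<bar>) \<ge> ereal ?T}"
      proof (intro Collect_cong conj_cong refl)
        fix w assume w: "w \<in> space M"
        have "(SUP t\<in>\<Omega>. ereal \<bar>krr_deriv \<Omega> H ip \<alpha> f x e (lam n) n w w t -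
            (\<integral>w'. krr_deriv \<Omega> H ip \<alpha> f x e (lam n) n w w' t \<partial>M)\<bar>)
          = (SUP t\<in>\<Omega>. ereal \<bar>mderiv_on \<Omega> \<alpha> (krr H ip (lam n) n (\<lambda>i. x n i w) (\<lambda>i. e i w)) t\<bar>)"
          by (intro SUP_cong refl arg_cong[where f = "\<lambda>r. ereal \<bar>r\<bar>"]
              krr_deriv_centred[where x = x and n = n and w = w, OF assms(4,6,9) e(1) \<sigma> ln(1) assms(11)[OF _ w]])
        then show "(ereal ?T \<le> (SUP t\<in>\<Omega>. ereal \<bar>mderiv_on \<Omega> \<alpha> (krr H ip (lam n) n (\<lambda>i. x n i w) (\<lambda>i. e i w)) t\<bar>))
          = (ereal ?T \<le> (SUP t\<in>\<Omega>. ereal \<bar>krr_deriv \<Omega> H ip \<alpha> f x e (lam n) n w w t -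
            (\<integral>w'. krr_deriv \<Omega> H ip \<alpha> f x e (lam n) n w w' t \<partial>M)\<bar>))" by simp
      qed
      finally show ?case .
    qed
  qed
  then show ?thesis using B1(1) by (intro exI[of _ B1] conjI exI[of _ "2 :: real"]) auto
qed

end
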